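(* There exists an unbounded domain $V\subset\mathbb{R}^2$ with non-compact $C^\infty$ boundary such that $E(R_V^\alpha)$ is well-defined for all $\alpha\in\mathbb{R}$ (i.e. the form $r^\alpha_V$ is well-defined on $H^1(V)$, closed and lower semibounded), but the limit of the ratio $E(R_V^\alpha)/\alpha^2$ as $\alpha\to-\infty$ does not exist.
   Context: For a domain $V\subset\mathbb{R}^2$ with sufficiently regular boundary and $\alpha\in\mathbb{R}$, $R^\alpha_V$ denotes the Robin Laplacian $u\mapsto-\Delta u$ in $V$ with boundary condition $\partial_\nu u+\alpha u=0$ on $\partial V$ ($\nu$ the outer unit normal), i.e. the self-adjoint operator in $L^2(V)$ generated by the hermitian sesquilinear form $$r^\alpha_V(u,u)=\iint_V|\nabla u|^2\,dx\,dy+\alpha\int_{\partial V}|u|^2\,d\sigma,\qquad \mathcal{D}(r^\alpha_V)=H^1(V),$$ where $d\sigma$ is the arc-length measure on $\partial V$ and the restriction of $u$ to $\partial V$ is understood in the sense of Sobolev traces. Moreover, $$E(R^\alpha_V):=\inf\operatorname{spec}R^\alpha_V=\inf_{u\in H^1(V),\,u\ne0}\frac{r^\alpha_V(u,u)}{\|u\|^2_{L^2(V)}}.$$ *)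

theory Defs
  imports "HOL-Analysis.Analysis"
begin

section \<open>Smooth functions and domains with smooth boundary\<close>

primrec Ck_map :: "nat \<Rightarrow> ('a::real_normed_vector \<Rightarrow> 'b::real_normed_vector) \<Rightarrow> bool" where
  "Ck_map 0 f \<longleftrightarrow> continuous_on UNIV f"
| "Ck_map (Suc k) f \<longleftrightarrow> (\<forall>x. f differentiable (at x)) \<and>
     (\<forall>v. Ck_map k (\<lambda>x. frechet_derivative f (at x) v))"

definition smooth_map :: "('a::real_normed_vector \<Rightarrow> 'b::real_normed_vector) \<Rightarrow> bool" where
  "smooth_map f \<longleftrightarrow> (\<forall>k. Ck_map k f)"

text \<open>The plane is \<^typ>\<open>real \<times> real\<close>, whose library norm is the Euclidean one. Near each boundary
  point, and up to a rigid motion, the set has to be the region strictly above the graph of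
  a smooth function; in particular it lies locally on one side of its boundary.\<close>

definition smooth_boundary :: "(real \<times> real) set \<Rightarrow> bool" where
  "smooth_boundary V \<longleftrightarrow> (\<forall>p\<in>frontier V. \<exists>(A :: real \<times> real \<Rightarrow> real \<times> real) (h :: real \<Rightarrow> real) r.
     orthogonal_transformation A \<and> smooth_map h \<and> r > 0 \<and>
     (\<forall>q\<in>ball p r. q \<in> V \<longleftrightarrow> h (fst (A (q - p))) < snd (A (q - p))))"

text \<open>The arc-length measure on the boundary, as a Borel measure on the plane which is carried by
  the boundary and assigns to every regular arc in the boundary its length. If the boundary is
  smooth, exactly one measure has these properties.\<close>

definition is_arc_length_measure :: "(real \<times> real) set \<Rightarrow> (real \<times> real) measure \<Rightarrow> bool" where
  "is_arc_length_measure V \<sigma> \<longleftrightarrow>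
     sets \<sigma> = sets borel \<and> emeasure \<sigma> (- frontier V) = 0 \<and>
     (\<forall>\<gamma>. arc \<gamma> \<and> \<gamma> C1_differentiable_on {0..1} \<and>
          (\<forall>t\<in>{0..1}. vector_derivative \<gamma> (at t) \<noteq> 0) \<and> path_image \<gamma> \<subseteq> frontier V \<longrightarrow>
        emeasure \<sigma> (path_image \<gamma>) =
          ennreal (integral {0..1} (\<lambda>t. norm (vector_derivative \<gamma> (at t)))))"

definition arc_length_measure :: "(real \<times> real) set \<Rightarrow> (real \<times> real) measure" where
  "arc_length_measure V = (THE \<sigma>. is_arc_length_measure V \<sigma>)"


section \<open>Square-integrable functions, closed forms and their operators\<close>

text \<open>Elements of $L^2$ are represented by functions rather than by classes modulo null sets.
  Inner products and sesquilinear forms are linear in the first argument.\<close>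

definition sq_integrable :: "'a measure \<Rightarrow> ('a \<Rightarrow> complex) \<Rightarrow> bool" where
  "sq_integrable M u \<longleftrightarrow> u \<in> borel_measurable M \<and> integrable M (\<lambda>x. (cmod (u x))\<^sup>2)"

definition l2_inner :: "'a measure \<Rightarrow> ('a \<Rightarrow> complex) \<Rightarrow> ('a \<Rightarrow> complex) \<Rightarrow> complex" where
  "l2_inner M u v = (\<integral>x. u x * cnj (v x) \<partial>M)"

definition l2_norm :: "'a measure \<Rightarrow> ('a \<Rightarrow> complex) \<Rightarrow> real" where
  "l2_norm M u = sqrt (\<integral>x. (cmod (u x))\<^sup>2 \<partial>M)"

type_synonym 'a form = "('a \<Rightarrow> complex) \<Rightarrow> ('a \<Rightarrow> complex) \<Rightarrow> complex"

definition lower_semibounded_form :: "'a measure \<Rightarrow> ('a \<Rightarrow> complex) set \<Rightarrow> 'a form \<Rightarrow> bool" where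
  "lower_semibounded_form M D t \<longleftrightarrow>
     (\<exists>c::real. \<forall>u\<in>D. Im (t u u) = 0 \<and> Re (t u u) \<ge> c * (l2_norm M u)\<^sup>2)"

definition closed_form :: "'a measure \<Rightarrow> ('a \<Rightarrow> complex) set \<Rightarrow> 'a form \<Rightarrow> bool" where
  "closed_form M D t \<longleftrightarrow>
     (\<forall>(w :: nat \<Rightarrow> 'a \<Rightarrow> complex) u.
        (\<forall>n. w n \<in> D) \<and> sq_integrable M u \<and>
        (\<lambda>n. l2_norm M (\<lambda>x. w n x - u x)) \<longlonglongrightarrow> 0 \<and>
        (\<forall>e>0. \<exists>N. \<forall>m\<ge>N. \<forall>n\<ge>N.
           cmod (t (\<lambda>x. w m x - w n x) (\<lambda>x. w m x - w n x)) < e)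
      \<longrightarrow> u \<in> D \<and> (\<lambda>n. t (\<lambda>x. w n x - u x) (\<lambda>x. w n x - u x)) \<longlonglongrightarrow> 0)"

text \<open>The graph of the operator generated by a form (Kato's first representation theorem):
  \<open>u\<close> belongs to the operator domain and is mapped to \<open>f\<close>.\<close>

definition form_operator ::
    "'a measure \<Rightarrow> ('a \<Rightarrow> complex) set \<Rightarrow> 'a form \<Rightarrow> ('a \<Rightarrow> complex) \<Rightarrow> ('a \<Rightarrow> complex) \<Rightarrow> bool" where
  "form_operator M D t u f \<longleftrightarrow>
     u \<in> D \<and> sq_integrable M f \<and> (\<forall>v\<in>D. t u v = l2_inner M f v)"

text \<open>For an operator in $L^2$ given by its graph, \<open>z\<close> is in the resolvent set if
  the operator minus \<open>z\<close> maps its domain onto $L^2$ and is bounded from below,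
  i.e. is bijective with bounded inverse.\<close>

definition resolvent_set ::
    "'a measure \<Rightarrow> (('a \<Rightarrow> complex) \<Rightarrow> ('a \<Rightarrow> complex) \<Rightarrow> bool) \<Rightarrow> complex set" where
  "resolvent_set M T = {z.
     (\<forall>f. sq_integrable M f \<longrightarrow> (\<exists>u g. T u g \<and> (AE x in M. g x - z * u x = f x))) \<and>
     (\<exists>C::real. \<forall>u g. T u g \<longrightarrow> l2_norm M u \<le> C * l2_norm M (\<lambda>x. g x - z * u x))}"

definition spectrum ::
    "'a measure \<Rightarrow> (('a \<Rightarrow> complex) \<Rightarrow> ('a \<Rightarrow> complex) \<Rightarrow> bool) \<Rightarrow> complex set" where
  "spectrum M T = - resolvent_set M T"


section \<open>The Sobolev space $H^1$ and traces\<close>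

abbreviation leb :: "(real \<times> real) set \<Rightarrow> (real \<times> real) measure" where
  "leb V \<equiv> restrict_space lborel V"

definition test_function :: "(real \<times> real) set \<Rightarrow> (real \<times> real \<Rightarrow> complex) \<Rightarrow> bool" where
  "test_function V \<phi> \<longleftrightarrow> smooth_map \<phi> \<and>
     compact (closure {x. \<phi> x \<noteq> 0}) \<and> closure {x. \<phi> x \<noteq> 0} \<subseteq> V"

definition is_weak_partial :: "(real \<times> real) set \<Rightarrow> real \<times> real \<Rightarrow>
    (real \<times> real \<Rightarrow> complex) \<Rightarrow> (real \<times> real \<Rightarrow> complex) \<Rightarrow> bool" where
  "is_weak_partial V e u g \<longleftrightarrow> sq_integrable (leb V) g \<and>
     (\<forall>\<phi>. test_function V \<phi> \<longrightarrow>
        (\<integral>x. u x * frechet_derivative \<phi> (at x) e \<partial>leb V) = - (\<integral>x. g x * \<phi> x \<partial>leb V))"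

definition H1 :: "(real \<times> real) set \<Rightarrow> (real \<times> real \<Rightarrow> complex) set" where
  "H1 V = {u. sq_integrable (leb V) u \<and> (\<forall>e\<in>Basis. \<exists>g. is_weak_partial V e u g)}"

definition weak_partial :: "(real \<times> real) set \<Rightarrow> real \<times> real \<Rightarrow>
    (real \<times> real \<Rightarrow> complex) \<Rightarrow> (real \<times> real \<Rightarrow> complex)" where
  "weak_partial V e u = (SOME g. is_weak_partial V e u g)"

definition H1_norm :: "(real \<times> real) set \<Rightarrow> (real \<times> real \<Rightarrow> complex) \<Rightarrow> real" where
  "H1_norm V u =
     sqrt ((l2_norm (leb V) u)\<^sup>2 + (\<Sum>e\<in>Basis. (l2_norm (leb V) (weak_partial V e u))\<^sup>2))"

text \<open>The trace is the extension by continuity, from $H^1(V)$ to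
  $L^2_{\mathrm{loc}}(\partial V)$, of the restriction map defined on the functions in
  $C_c^\infty(\mathbb{R}^2)$. It is unique up to null sets of the arc-length measure.\<close>

definition is_trace :: "(real \<times> real) set \<Rightarrow>
    (real \<times> real \<Rightarrow> complex) \<Rightarrow> (real \<times> real \<Rightarrow> complex) \<Rightarrow> bool" where
  "is_trace V u g \<longleftrightarrow> g \<in> borel_measurable (arc_length_measure V) \<and>
     (\<exists>\<phi> :: nat \<Rightarrow> real \<times> real \<Rightarrow> complex.
        (\<forall>n. test_function UNIV (\<phi> n)) \<and>
        (\<lambda>n. H1_norm V (\<lambda>x. \<phi> n x - u x)) \<longlonglongrightarrow> 0 \<and>
        (\<forall>K. compact K \<longrightarrow>
           (\<lambda>n. \<integral>\<^sup>+x\<in>K. ennreal ((cmod (\<phi> n x - g x))\<^sup>2) \<partial>arc_length_measure V)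
             \<longlonglongrightarrow> 0))"

definition sobolev_trace :: "(real \<times> real) set \<Rightarrow> (real \<times> real \<Rightarrow> complex) \<Rightarrow> (real \<times> real \<Rightarrow> complex)" where
  "sobolev_trace V u = (SOME g. is_trace V u g)"


section \<open>The Robin Laplacian\<close>

definition robin_form :: "(real \<times> real) set \<Rightarrow> real \<Rightarrow> (real \<times> real) form" where
  "robin_form V \<alpha> u v =
     (\<Sum>e\<in>Basis. l2_inner (leb V) (weak_partial V e u) (weak_partial V e v)) +
     of_real \<alpha> * l2_inner (arc_length_measure V) (sobolev_trace V u) (sobolev_trace V v)"

text \<open>The boundary term of the form makes sense on all of $H^1(V)$: every function has
  a trace, and the trace is globally square-integrable.\<close>

definition robin_form_well_defined :: "(real \<times> real) set \<Rightarrow> bool" where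
  "robin_form_well_defined V \<longleftrightarrow>
     (\<forall>u\<in>H1 V. \<exists>g. is_trace V u g \<and> sq_integrable (arc_length_measure V) g)"

definition robin_laplacian ::
    "(real \<times> real) set \<Rightarrow> real \<Rightarrow> (real \<times> real \<Rightarrow> complex) \<Rightarrow> (real \<times> real \<Rightarrow> complex) \<Rightarrow> bool" where
  "robin_laplacian V \<alpha> = form_operator (leb V) (H1 V) (robin_form V \<alpha>)"

definition robin_E :: "(real \<times> real) set \<Rightarrow> real \<Rightarrow> real" where
  "robin_E V \<alpha> = Inf {x::real. complex_of_real x \<in> spectrum (leb V) (robin_laplacian V \<alpha>)}"

end

theory Submission
  imports Defs
begin

text \<open>
  \<open>V\<close> is the region above a flat line carrying one copy of a fixed smooth bump, rescaled by
  \<open>e\<^sub>n = 1 / (8 n!\<^sup>2)\<close>, near every integer \<open>n\<close> (negative \<open>n\<close> use \<open>e\<^sub>0\<close>). With \<open>a = -\<alpha>\<close>, a bump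
  of scale \<open>e\<close> sees the parameter \<open>a e\<close>. For \<open>a = 1/e\<^sub>n\<close> the excess length of the \<open>n\<close>-th
  bump pushes \<open>E/a\<^sup>2\<close> below \<open>-1\<close> by a fixed amount. For \<open>a = (n + 1)/e\<^sub>n\<close> all bumps are
  either very large (the boundary is almost straight at the scale \<open>1/a\<close>) or very small
  (almost invisible), and \<open>E/a\<^sup>2\<close> is close to \<open>-1\<close>.

  Lower bounds for \<open>E\<close> come from vector fields \<open>F\<close> with \<open>F \<bullet> \<nu> = a\<close> on the boundary: the divergence
  theorem for \<open>F |u|\<^sup>2\<close> gives \<open>E \<ge> - sup (|F|\<^sup>2 + div F)\<close>. Fields depending only on the horizontal
  coordinate suffice.
\<close>

section \<open>Smooth functions\<close>

text \<open>The definitions give no direct hold on the energy: \<open>robin_E\<close> is an infimum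
  over a spectrum, the boundary measure is a definite description, weak derivatives and traces are
  choices. The variational principle, density of test functions, and uniqueness of arc length and of
  traces must come before any estimate. They are uniform over infinitely many bumps because height
  and width shrink together: the graph has one Lipschitz constant although its curvature is
  unbounded. Unbounded curvature is the obstacle to a lower bound. The field \<open>a\<close> times
  the unit normal has divergence of order \<open>a / e\<close> on a bump of scale \<open>e\<close>,
  which swamps \<open>a^2\<close> when \<open>a e\<close> is small. Fine bumps therefore need
  another field, whose horizontal part is a small multiple of \<open>a\<close>. No bump may be
  intermediate, hence the factorials: \<open>(n + 1) / e\<^sub>n\<close> is the geometric mean of
  the critical parameters \<open>1 / e\<^sub>n\<close> and
  \<open>1 / e\<^sub>n\<^sub>+\<^sub>1\<close>, at a factor n + 1 from both.\<close>

lemma Ck_map_SucD: "Ck_map (Suc k) f \<Longrightarrow> Ck_map k f"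
proof (induction k arbitrary: f)
  case 0
  then show ?case
    by (auto intro!: continuous_at_imp_continuous_on differentiable_imp_continuous_within)
next
  case (Suc k)
  then show ?case by (metis Ck_map.simps(2))
qed

lemma Ck_map_SucI:
  assumes "\<And>x. (f has_derivative D x) (at x)" "\<And>v. Ck_map k (\<lambda>x. D x v)"
  shows "Ck_map (Suc k) f"
proof -
  have "frechet_derivative f (at x) = D x" for x
    using frechet_derivative_at[OF assms(1)] by metis
  then show ?thesis using assms by (auto simp: differentiable_def)
qed

lemma Ck_map_SucE:
  assumes "Ck_map (Suc k) f"
  shows "(f has_derivative frechet_derivative f (at x)) (at x)"
    and "Ck_map k (\<lambda>x. frechet_derivative f (at x) v)"
  using assms by (auto simp: frechet_derivative_works)

lemma Ck_map_0D: "Ck_map k f \<Longrightarrow> continuous_on UNIV f"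
  by (induction k) (auto intro!: continuous_at_imp_continuous_on differentiable_imp_continuous_within)

lemma Ck_map_const: "Ck_map k (\<lambda>x. c)"
proof (induction k arbitrary: c)
  case (Suc k)
  show ?case by (rule Ck_map_SucI[where D = "\<lambda>x v. 0"]) (auto simp: Suc)
qed simp

lemma Ck_map_add: "Ck_map k f \<Longrightarrow> Ck_map k g \<Longrightarrow> Ck_map k (\<lambda>x. f x + g x)"
proof (induction k arbitrary: f g)
  case (Suc k)
  show ?case
    by (rule Ck_map_SucI[OF has_derivative_add[OF Ck_map_SucE(1)[OF Suc.prems(1)] Ck_map_SucE(1)[OF Suc.prems(2)]]])
       (rule Suc.IH[OF Ck_map_SucE(2)[OF Suc.prems(1)] Ck_map_SucE(2)[OF Suc.prems(2)]])
qed (simp add: continuous_on_add)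

lemma Ck_map_linear: "bounded_linear L \<Longrightarrow> Ck_map k f \<Longrightarrow> Ck_map k (\<lambda>x. L (f x))"
proof (induction k arbitrary: f)
  case (Suc k)
  show ?case
    by (rule Ck_map_SucI[OF bounded_linear.has_derivative[OF Suc.prems(1) Ck_map_SucE(1)[OF Suc.prems(2)]]])
       (rule Suc.IH[OF Suc.prems(1) Ck_map_SucE(2)[OF Suc.prems(2)]])
qed (simp add: bounded_linear.continuous_on)

lemma Ck_map_bilinear:
  assumes B: "bounded_bilinear B"
  shows "Ck_map k f \<Longrightarrow> Ck_map k g \<Longrightarrow> Ck_map k (\<lambda>x. B (f x) (g x))"
proof (induction k arbitrary: f g)
  case (Suc k)
  have "Ck_map k f" "Ck_map k g" using Suc.prems Ck_map_SucD by blast+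
  then show ?case
    by (intro Ck_map_SucI[OF bounded_bilinear.FDERIV[OF B Ck_map_SucE(1)[OF Suc.prems(1)] Ck_map_SucE(1)[OF Suc.prems(2)]]]
        Ck_map_add Suc.IH Ck_map_SucE(2)[OF Suc.prems(1)] Ck_map_SucE(2)[OF Suc.prems(2)])
qed (simp add: bounded_bilinear.continuous_on[OF B])

text \<open>For an affine inner map the derivative in direction v is the derivative of
  \<open>f\<close> in the fixed direction \<open>L v\<close>, composed with the same map, so the
  induction closes. Translations, scalings and coordinate projections are of this kind, which spares
  a general chain rule.\<close>

lemma Ck_map_affine:
  "bounded_linear L \<Longrightarrow> Ck_map k f \<Longrightarrow> Ck_map k (\<lambda>x. f (c + L x))"
proof (induction k arbitrary: f)
  case 0
  then have "continuous_on UNIV (\<lambda>x. c + L x)"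
    by (intro continuous_on_add continuous_on_const linear_continuous_on)
  with 0 show ?case by (auto intro: continuous_on_compose2)
next
  case (Suc k)
  have "((\<lambda>x. f (c + L x)) has_derivative (\<lambda>v. frechet_derivative f (at (c + L x)) (L v))) (at x)" for x
  proof (rule has_derivative_compose[of "\<lambda>x. c + L x" L x UNIV f, simplified])
    show "((\<lambda>x. c + L x) has_derivative L) (at x)"
      using Suc.prems(1) by (auto intro!: derivative_eq_intros bounded_linear_imp_has_derivative)
    show "(f has_derivative frechet_derivative f (at (c + L x))) (at (c + L x))"
      by (rule Ck_map_SucE(1)[OF Suc.prems(2)])
  qed
  then show ?case
    by (rule Ck_map_SucI) (rule Suc.IH[OF Suc.prems(1) Ck_map_SucE(2)[OF Suc.prems(2)]])
qed

text \<open>The local models may change from point to point; on the open set where \<open>f\<close>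
  agrees with \<open>g\<close> the derivatives agree too, and this carries the induction. Used for
  the profile, which is glued from infinitely many bumps.\<close>

lemma Ck_map_local:
  "(\<And>x. \<exists>g S. open S \<and> x \<in> S \<and> Ck_map k g \<and> (\<forall>y\<in>S. f y = g y)) \<Longrightarrow> Ck_map k f"
proof (induction k arbitrary: f)
  case 0
  have "isCont f x" for x
  proof -
    obtain g S where gS: "open S" "x \<in> S" "continuous_on UNIV g" "\<forall>y\<in>S. f y = g y"
      using 0[of x] by auto
    then have "isCont g x" by (simp add: continuous_on_eq_continuous_at)
    moreover have "eventually (\<lambda>y. f y = g y) (nhds x)"
      using gS by (auto simp: eventually_nhds)
    ultimately show ?thesis using isCont_cong by blast
  qed
  then show ?case by (simp add: continuous_at_imp_continuous_on)
next
  case (Suc k)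
  have *: "\<exists>g S. open S \<and> x \<in> S \<and> Ck_map (Suc k) g \<and> (\<forall>y\<in>S. f y = g y \<and>
       (f has_derivative frechet_derivative g (at y)) (at y))" for x
  proof -
    obtain g S where gS: "open S" "x \<in> S" "Ck_map (Suc k) g" "\<forall>y\<in>S. f y = g y"
      using Suc.prems by blast
    have "(f has_derivative frechet_derivative g (at y)) (at y)" if "y \<in> S" for y
      by (rule has_derivative_transform_within_open[OF Ck_map_SucE(1)[OF gS(3)] gS(1) that]) (use gS in auto)
    then show ?thesis using gS by blast
  qed
  have d: "f differentiable (at x)" for x
    using *[of x] by (auto simp: differentiable_def)
  have "Ck_map k (\<lambda>x. frechet_derivative f (at x) v)" for v
  proof (rule Suc.IH)
    fix x
    obtain g S where gS: "open S" "x \<in> S" "Ck_map (Suc k) g"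
      "\<forall>y\<in>S. (f has_derivative frechet_derivative g (at y)) (at y)" using *[of x] by blast
    then have "\<forall>y\<in>S. frechet_derivative f (at y) v = frechet_derivative g (at y) v"
      using frechet_derivative_at by metis
    then show "\<exists>g S. open S \<and> x \<in> S \<and> Ck_map k g \<and> (\<forall>y\<in>S. frechet_derivative f (at y) v = g y)"
      using gS Ck_map_SucE(2)[OF gS(3)] by (intro exI[of _ "\<lambda>x. frechet_derivative g (at x) v"] exI[of _ S]) auto
  qed
  with d show ?case by simp
qed

lemma smooth_map_const [simp]: "smooth_map (\<lambda>x. c)"
  unfolding smooth_map_def by (blast intro: Ck_map_const)

lemma smooth_map_add: "smooth_map f \<Longrightarrow> smooth_map g \<Longrightarrow> smooth_map (\<lambda>x. f x + g x)"
  unfolding smooth_map_def by (blast intro: Ck_map_add)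

lemma smooth_map_linear: "bounded_linear L \<Longrightarrow> smooth_map f \<Longrightarrow> smooth_map (\<lambda>x. L (f x))"
  unfolding smooth_map_def by (blast intro: Ck_map_linear)

lemma smooth_map_affine: "bounded_linear L \<Longrightarrow> smooth_map f \<Longrightarrow> smooth_map (\<lambda>x. f (c + L x))"
  unfolding smooth_map_def by (blast intro: Ck_map_affine)

lemma smooth_map_mult:
  fixes f g :: "'a::real_normed_vector \<Rightarrow> 'b::real_normed_algebra"
  shows "smooth_map f \<Longrightarrow> smooth_map g \<Longrightarrow> smooth_map (\<lambda>x. f x * g x)"
  unfolding smooth_map_def by (auto intro: Ck_map_bilinear[OF bounded_bilinear_mult])

lemma smooth_map_diff:
  assumes "smooth_map f" "smooth_map g" shows "smooth_map (\<lambda>x. f x - g x)"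
  using smooth_map_add[OF assms(1) smooth_map_linear[OF bounded_linear_minus[OF bounded_linear_ident] assms(2)]]
  by simp

lemma smooth_map_local:
  "(\<And>x. \<exists>g S. open S \<and> x \<in> S \<and> smooth_map g \<and> (\<forall>y\<in>S. f y = g y)) \<Longrightarrow> smooth_map f"
  unfolding smooth_map_def by (intro allI Ck_map_local) metis

lemma smooth_map_has_derivative:
  "smooth_map f \<Longrightarrow> (f has_derivative frechet_derivative f (at x)) (at x)"
  using Ck_map_SucE(1) unfolding smooth_map_def by blast

lemma smooth_map_frechet_derivative:
  "smooth_map f \<Longrightarrow> smooth_map (\<lambda>x. frechet_derivative f (at x) v)"
  using Ck_map_SucE(2) unfolding smooth_map_def by blast

lemma smooth_map_continuous: "smooth_map f \<Longrightarrow> continuous_on S f"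
  using Ck_map_0D continuous_on_subset unfolding smooth_map_def by (metis UNIV_I subsetI)

lemma smooth_map_real_deriv:
  fixes f :: "real \<Rightarrow> real"
  assumes "smooth_map f"
  shows "(f has_real_derivative deriv f x) (at x)" "smooth_map (deriv f)"
proof -
  have d: "(f has_real_derivative frechet_derivative f (at x) 1) (at x)" for x
  proof -
    have "linear (frechet_derivative f (at x))"
      using smooth_map_has_derivative[OF assms] has_derivative_linear by blast
    then have "frechet_derivative f (at x) = (*) (frechet_derivative f (at x) 1)"
      by (metis (no_types, opaque_lifting) linear_times_of_real mult.commute mult.right_neutral ext
          linear.scaleR real_scaleR_def linear_scale)
    then show ?thesis
      using smooth_map_has_derivative[OF assms] has_field_derivative_def by metis
  qed
  then show "(f has_real_derivative deriv f x) (at x)" using DERIV_imp_deriv by metis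
  have "deriv f = (\<lambda>x. frechet_derivative f (at x) 1)" using d DERIV_imp_deriv by blast
  then show "smooth_map (deriv f)" using smooth_map_frechet_derivative[OF assms] by metis
qed

lemma Ck_map_real_derivI:
  fixes f :: "real \<Rightarrow> real"
  assumes "\<And>x. (f has_real_derivative f' x) (at x)" "Ck_map k f'"
  shows "Ck_map (Suc k) f"
  by (rule Ck_map_SucI[OF assms(1)[unfolded has_field_derivative_def]])
     (use Ck_map_linear[OF bounded_linear_mult_left assms(2)] in auto)

lemma smooth_map_exp: "smooth_map (exp :: real \<Rightarrow> real)"
proof -
  have "Ck_map k (exp :: real \<Rightarrow> real)" for k
    by (induction k) (auto intro!: Ck_map_real_derivI[of exp exp] continuous_intros simp del: Ck_map.simps(2))
  then show ?thesis by (simp add: smooth_map_def)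
qed

subsection \<open>A bump function\<close>

text \<open>The index makes the family closed under differentiation: derivatives of exp(-1/t) are
  linear combinations of members, so one induction on the order proves all of them smooth.\<close>

definition flat_exp :: "nat \<Rightarrow> real \<Rightarrow> real" where
  "flat_exp n t = (if t > 0 then exp (- 1 / t) / t ^ n else 0)"

lemma flat_exp_tendsto_0: "(flat_exp n \<longlongrightarrow> 0) (at 0)"
proof -
  have "((\<lambda>x::real. x ^ n / exp x) \<longlongrightarrow> 0) at_top" by (rule tendsto_power_div_exp_0)
  then have "((\<lambda>t::real. inverse t ^ n / exp (inverse t)) \<longlongrightarrow> 0) (at_right 0)"
    by (rule filterlim_compose[OF _ filterlim_inverse_at_top_right])
  moreover have "eventually (\<lambda>t. inverse t ^ n / exp (inverse t) = flat_exp n t) (at_right 0)"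
    by (auto simp: eventually_at_right_less flat_exp_def exp_minus field_simps intro!: eventually_at_right_less[THEN eventually_mono])
  ultimately have r: "(flat_exp n \<longlongrightarrow> 0) (at_right 0)" by (rule Lim_transform_eventually)
  have "eventually (\<lambda>t. 0 = flat_exp n t) (at_left 0)"
    by (auto simp: eventually_at_filter flat_exp_def)
  then have "(flat_exp n \<longlongrightarrow> 0) (at_left 0)" by (rule Lim_transform_eventually[OF tendsto_const])
  with r show ?thesis by (simp add: filterlim_split_at)
qed

lemma flat_exp_deriv:
  "(flat_exp n has_real_derivative flat_exp (n + 2) t - real n * flat_exp (n + 1) t) (at t)"
proof -
  consider "t > 0" | "t < 0" | "t = 0" by linarith
  then show ?thesis
  proof cases
    case 1
    have "((\<lambda>t. exp (- 1 / t) / t ^ n) has_real_derivative flat_exp (n + 2) t - real n * flat_exp (n + 1) t) (at t)"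
    proof -
      have 1: "((\<lambda>t. exp (- 1 / t)) has_real_derivative exp (- 1 / t) * (1 / t ^ 2)) (at t)"
        using \<open>t > 0\<close> by (auto intro!: derivative_eq_intros simp: power2_eq_square)
      have 2: "((\<lambda>t. t ^ n) has_real_derivative real n * t ^ (n - 1)) (at t)"
        by (auto intro!: derivative_eq_intros)
      have "((\<lambda>t. exp (- 1 / t) / t ^ n) has_real_derivative
          (exp (- 1 / t) * (1 / t ^ 2) * t ^ n - exp (- 1 / t) * (real n * t ^ (n - 1))) / (t ^ n * t ^ n)) (at t)"
        by (rule DERIV_divide[OF 1 2]) (use \<open>t > 0\<close> in simp)
      moreover have "(exp (- 1 / t) * (1 / t ^ 2) * t ^ n - exp (- 1 / t) * (real n * t ^ (n - 1))) / (t ^ n * t ^ n)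
          = flat_exp (n + 2) t - real n * flat_exp (n + 1) t"
        using \<open>t > 0\<close> by (cases n) (simp_all add: flat_exp_def field_simps power2_eq_square)
      ultimately show ?thesis by simp
    qed
    then show ?thesis
      by (rule has_field_derivative_transform_within_open[of _ _ _ "{0<..}"]) (use 1 in \<open>auto simp: flat_exp_def\<close>)
  next
    case 2
    have "((\<lambda>t. 0) has_real_derivative flat_exp (n + 2) t - real n * flat_exp (n + 1) t) (at t)"
      using 2 by (simp add: flat_exp_def)
    then show ?thesis
      by (rule has_field_derivative_transform_within_open[of _ _ _ "{..<0}"]) (use 2 in \<open>auto simp: flat_exp_def\<close>)
  next
    case 3
    \<comment> \<open>At 0 the difference quotient of member n is member n + 1, which tends to
      0.\<close>
    have "((\<lambda>y. (flat_exp n y - flat_exp n 0) / (y - 0)) \<longlongrightarrow> 0) (at 0)"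
    proof (rule Lim_transform_eventually[OF flat_exp_tendsto_0[of "n + 1"]])
      show "eventually (\<lambda>y. flat_exp (n + 1) y = (flat_exp n y - flat_exp n 0) / (y - 0)) (at 0)"
        by (auto simp: eventually_at_filter flat_exp_def field_simps)
    qed
    then show ?thesis using 3 by (simp add: has_field_derivative_iff flat_exp_def)
  qed
qed

lemma smooth_map_flat_exp: "smooth_map (flat_exp n)"
proof -
  have "\<forall>n. Ck_map k (flat_exp n)" for k
  proof (induction k)
    case 0
    then show ?case
      using flat_exp_deriv by (auto intro!: continuous_at_imp_continuous_on DERIV_isCont)
  next
    case (Suc k)
    show ?case
    proof
      fix n
      have "Ck_map k (\<lambda>t. flat_exp (n + 2) t + (- real n) * flat_exp (n + 1) t)"
        using Suc by (intro Ck_map_add Ck_map_linear[OF bounded_linear_mult_right]) auto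
      then show "Ck_map (Suc k) (flat_exp n)"
        by (intro Ck_map_real_derivI[OF flat_exp_deriv]) simp
    qed
  qed
  then show ?thesis by (simp add: smooth_map_def)
qed

definition bump :: "real \<Rightarrow> real" where
  "bump x = flat_exp 0 (1 + x) * flat_exp 0 (1 - x)"

lemma smooth_map_bump: "smooth_map bump"
proof -
  have "smooth_map (\<lambda>x. flat_exp 0 (1 + x))" "smooth_map (\<lambda>x. flat_exp 0 (1 + - x))"
    by (intro smooth_map_affine[OF bounded_linear_ident] smooth_map_affine[OF bounded_linear_minus[OF bounded_linear_ident]]
        smooth_map_flat_exp)+
  from smooth_map_mult[OF this] show ?thesis by (simp add: bump_def[abs_def])
qed

lemma bump_nonneg: "0 \<le> bump x"
  and bump_pos: "\<bar>x\<bar> < 1 \<Longrightarrow> 0 < bump x"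
  and bump_outside: "1 \<le> \<bar>x\<bar> \<Longrightarrow> bump x = 0"
  by (auto simp: bump_def flat_exp_def zero_less_mult_iff)

lemma bump_le_1: "bump x \<le> 1"
proof -
  have "flat_exp 0 t \<le> 1" for t by (simp add: flat_exp_def)
  moreover have "0 \<le> flat_exp 0 t" for t by (simp add: flat_exp_def)
  ultimately show ?thesis unfolding bump_def by (simp add: mult_le_one)
qed

lemma continuous_bounded_outside:
  fixes f :: "real \<Rightarrow> real"
  assumes "continuous_on UNIV f" "\<And>x. 1 \<le> \<bar>x\<bar> \<Longrightarrow> f x = 0"
  obtains C where "C > 0" "\<And>x. \<bar>f x\<bar> \<le> C"
proof -
  have "bounded (f ` {-1..1})"
    using assms(1) by (intro compact_imp_bounded compact_continuous_image) (auto intro: continuous_on_subset)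
  then obtain C where C: "C > 0" "\<And>x. x \<in> {-1..1} \<Longrightarrow> \<bar>f x\<bar> \<le> C"
    unfolding bounded_pos by auto
  have "\<bar>f x\<bar> \<le> C" for x using C assms(2)[of x] by (cases "x \<in> {-1..1}") auto
  then show thesis using that C(1) by blast
qed

lemma deriv_zero_outside:
  fixes f :: "real \<Rightarrow> real"
  assumes "smooth_map f" "\<And>x. 1 \<le> \<bar>x\<bar> \<Longrightarrow> f x = 0" "1 \<le> \<bar>x\<bar>"
  shows "deriv f x = 0"
proof -
  have c: "continuous_on UNIV (deriv f)" using smooth_map_real_deriv(2)[OF assms(1)] smooth_map_continuous by blast
  have z: "deriv f y = 0" if "1 < \<bar>y\<bar>" for y
  proof -
    have o: "open {y::real. 1 < \<bar>y\<bar>}"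
      by (intro open_Collect_less continuous_on_const continuous_on_rabs continuous_on_id)
    have "(f has_real_derivative 0) (at y)"
    proof (rule has_field_derivative_transform_within_open[OF _ o])
      show "((\<lambda>x. 0) has_real_derivative 0) (at y)" by simp
      show "y \<in> {y. 1 < \<bar>y\<bar>}" using that by simp
    qed (simp add: assms(2))
    then show ?thesis by (rule DERIV_imp_deriv)
  qed
  \<comment> \<open>For |x| = 1 no neighbourhood of x avoids the open interval, so the value is
    obtained as a limit along points pushed strictly outwards.\<close>
  have "(\<lambda>n. x * (1 + 1 / real (Suc n))) \<longlonglongrightarrow> x * (1 + 0)"
    by (rule tendsto_mult[OF tendsto_const tendsto_add[OF tendsto_const LIMSEQ_Suc[OF lim_1_over_n]]])
  moreover have "isCont (deriv f) (x * (1 + 0))" using c by (simp add: continuous_on_eq_continuous_at)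
  ultimately have "(\<lambda>n. deriv f (x * (1 + 1 / real (Suc n)))) \<longlonglongrightarrow> deriv f (x * (1 + 0))"
    using isCont_tendsto_compose by blast
  moreover have "deriv f (x * (1 + 1 / real (Suc n))) = 0" for n
  proof (rule z)
    have "1 < (1 + 1 / real (Suc n))" by simp
    also have "\<dots> \<le> \<bar>x\<bar> * (1 + 1 / real (Suc n))" using mult_right_mono[OF assms(3), of "1 + 1 / real (Suc n)"] by simp
    finally show "1 < \<bar>x * (1 + 1 / real (Suc n))\<bar>" by (simp add: abs_mult)
  qed
  ultimately have "(\<lambda>n::nat. 0) \<longlonglongrightarrow> deriv f (x * (1 + 0))" by simp
  then show ?thesis by (simp add: LIMSEQ_const_iff)
qed

section \<open>Hermitian forms\<close>

text \<open>The carrier consists of functions with pointwise operations; the forms are only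
  semidefinite in general, because functions represent their classes modulo null sets.\<close>

locale hermitian_form =
  fixes D :: "('a \<Rightarrow> complex) set" and t :: "'a form"
  assumes D_add: "u \<in> D \<Longrightarrow> v \<in> D \<Longrightarrow> (\<lambda>x. u x + v x) \<in> D"
    and D_scale: "u \<in> D \<Longrightarrow> (\<lambda>x. c * u x) \<in> D"
    and D_nonempty: "(\<lambda>x. 0) \<in> D"
    and add_left: "u \<in> D \<Longrightarrow> v \<in> D \<Longrightarrow> w \<in> D \<Longrightarrow> t (\<lambda>x. u x + v x) w = t u w + t v w"
    and scale_left: "u \<in> D \<Longrightarrow> w \<in> D \<Longrightarrow> t (\<lambda>x. c * u x) w = c * t u w"
    and herm: "u \<in> D \<Longrightarrow> v \<in> D \<Longrightarrow> t v u = cnj (t u v)"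
begin

lemma D_diff: "u \<in> D \<Longrightarrow> v \<in> D \<Longrightarrow> (\<lambda>x. u x - v x) \<in> D"
  using D_add[of u "\<lambda>x. (-1) * v x"] D_scale[of v "-1"] by simp

lemma add_right: "u \<in> D \<Longrightarrow> v \<in> D \<Longrightarrow> w \<in> D \<Longrightarrow> t w (\<lambda>x. u x + v x) = t w u + t w v"
  using herm[of "\<lambda>x. u x + v x" w] herm[of u w] herm[of v w] by (simp add: add_left D_add)

lemma scale_right: "u \<in> D \<Longrightarrow> w \<in> D \<Longrightarrow> t w (\<lambda>x. c * u x) = cnj c * t w u"
  using herm[of "\<lambda>x. c * u x" w] herm[of u w] by (simp add: scale_left D_scale)

lemma diff_left: "u \<in> D \<Longrightarrow> v \<in> D \<Longrightarrow> w \<in> D \<Longrightarrow> t (\<lambda>x. u x - v x) w = t u w - t v w"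
  using add_left[of u "\<lambda>x. (-1) * v x" w] D_scale[of v "-1"] scale_left[of v w "-1"] by simp

lemma diff_right: "u \<in> D \<Longrightarrow> v \<in> D \<Longrightarrow> w \<in> D \<Longrightarrow> t w (\<lambda>x. u x - v x) = t w u - t w v"
  using herm[of "\<lambda>x. u x - v x" w] herm[of u w] herm[of v w] by (simp add: diff_left D_diff)

lemma diag_real: "u \<in> D \<Longrightarrow> t u u = of_real (Re (t u u))"
  using herm[of u u] by (metis Reals_cnj_iff of_real_Re)

lemma diag_add:
  assumes "u \<in> D" "v \<in> D"
  shows "Re (t (\<lambda>x. u x + v x) (\<lambda>x. u x + v x)) = Re (t u u) + 2 * Re (t u v) + Re (t v v)"
  using assms herm[OF assms] by (simp add: add_left add_right D_add)

lemma diag_scale: "u \<in> D \<Longrightarrow> Re (t (\<lambda>x. c * u x) (\<lambda>x. c * u x)) = (cmod c)\<^sup>2 * Re (t u u)"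
  using diag_real[of u]
  by (simp add: scale_left scale_right D_scale mult.assoc[symmetric] complex_norm_square[symmetric] del: of_real_power)

lemma diag_diff:
  assumes "u \<in> D" "v \<in> D"
  shows "Re (t (\<lambda>x. u x - v x) (\<lambda>x. u x - v x)) = Re (t u u) - 2 * Re (t u v) + Re (t v v)"
  using assms herm[OF assms] by (simp add: diff_left diff_right D_diff)

lemma parallelogram:
  assumes "u \<in> D" "v \<in> D"
  shows "Re (t (\<lambda>x. u x - v x) (\<lambda>x. u x - v x)) =
    2 * Re (t u u) + 2 * Re (t v v) - Re (t (\<lambda>x. u x + v x) (\<lambda>x. u x + v x))"
  using assms by (simp add: diag_diff diag_add)

end

locale nonneg_form = hermitian_form +
  assumes nonneg: "u \<in> D \<Longrightarrow> 0 \<le> Re (t u u)"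
begin

lemma cauchy_schwarz:
  assumes "u \<in> D" "v \<in> D"
  shows "(cmod (t u v))\<^sup>2 \<le> Re (t u u) * Re (t v v)"
proof -
  \<comment> \<open>Expansion of t at u - c v with c = r t(u, v): the factor t(u, v) fixes the phase
    and leaves a real quadratic in r.\<close>
  have *: "0 \<le> Re (t u u) - 2 * r * (cmod (t u v))\<^sup>2 + r\<^sup>2 * (cmod (t u v))\<^sup>2 * Re (t v v)" for r :: real
  proof -
    define c where "c = of_real r * t u v"
    have "t u (\<lambda>x. c * v x) = cnj c * t u v" by (rule scale_right[OF assms(2,1)])
    then have 1: "Re (t u (\<lambda>x. c * v x)) = r * (cmod (t u v))\<^sup>2"
      unfolding c_def cmod_power2 by (simp add: algebra_simps power2_eq_square)
    have 2: "Re (t (\<lambda>x. c * v x) (\<lambda>x. c * v x)) = r\<^sup>2 * (cmod (t u v))\<^sup>2 * Re (t v v)"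
      using diag_scale[OF assms(2), of c] by (simp add: c_def norm_mult power_mult_distrib)
    show ?thesis
      using nonneg[OF D_diff[OF assms(1) D_scale[OF assms(2), of c]]] diag_diff[OF assms(1) D_scale[OF assms(2), of c]]
      unfolding 1 2 by simp
  qed
  show ?thesis
  proof (cases "Re (t v v) = 0")
    \<comment> \<open>In the degenerate case the quadratic is affine in r, and r = (t(u, u) + 1) /
      |t(u, v)|^2 would make it negative.\<close>
    case True
    show ?thesis
    proof (rule ccontr)
      assume "\<not> ?thesis"
      then have p: "(cmod (t u v))\<^sup>2 > 0" using True by simp
      have "0 \<le> Re (t u u) - 2 * ((Re (t u u) + 1) / (cmod (t u v))\<^sup>2) * (cmod (t u v))\<^sup>2"
        using *[of "(Re (t u u) + 1) / (cmod (t u v))\<^sup>2"] True by simp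
      then have "0 \<le> Re (t u u) - 2 * (Re (t u u) + 1)" using p by simp
      then show False using nonneg[OF assms(1)] by simp
    qed
  next
    case False
    then have p: "Re (t v v) > 0" using nonneg[OF assms(2)] by simp
    have "0 \<le> Re (t u u) - (cmod (t u v))\<^sup>2 / Re (t v v)"
      using *[of "1 / Re (t v v)"] p by (simp add: power2_eq_square field_simps)
    then show ?thesis using p by (simp add: field_simps)
  qed
qed

lemma sqrt_triangle:
  assumes "u \<in> D" "v \<in> D"
  shows "sqrt (Re (t (\<lambda>x. u x + v x) (\<lambda>x. u x + v x))) \<le> sqrt (Re (t u u)) + sqrt (Re (t v v))"
proof (rule real_le_lsqrt)
  have "Re (t u v) \<le> cmod (t u v)" by (rule complex_Re_le_cmod)
  also have "\<dots> \<le> sqrt (Re (t u u) * Re (t v v))"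
    using cauchy_schwarz[OF assms] real_le_rsqrt by blast
  finally show "Re (t (\<lambda>x. u x + v x) (\<lambda>x. u x + v x)) \<le> (sqrt (Re (t u u)) + sqrt (Re (t v v)))\<^sup>2"
    using assms nonneg by (simp add: diag_add power2_sum real_sqrt_mult)
qed (use assms nonneg in simp)

end

section \<open>Square-integrable functions\<close>

lemma borel_measurable_cnj [measurable (raw)]:
  "f \<in> borel_measurable M \<Longrightarrow> (\<lambda>x. cnj (f x)) \<in> borel_measurable M"
  by (rule measurable_compose[OF _ borel_measurable_continuous_onI[OF continuous_on_cnj[OF continuous_on_id]]])

lemma sq_integrableD:
  "sq_integrable M u \<Longrightarrow> u \<in> borel_measurable M" "sq_integrable M u \<Longrightarrow> integrable M (\<lambda>x. (cmod (u x))\<^sup>2)"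
  by (auto simp: sq_integrable_def)

lemma sq_integrable_bound:
  assumes "u \<in> borel_measurable M" "integrable M f" "AE x in M. (cmod (u x))\<^sup>2 \<le> f x"
  shows "sq_integrable M u"
  unfolding sq_integrable_def using assms
  by (auto intro!: Bochner_Integration.integrable_bound[OF assms(2)] elim!: eventually_mono)

lemma sq_integrable_add:
  assumes "sq_integrable M u" "sq_integrable M v"
  shows "sq_integrable M (\<lambda>x. u x + v x)"
proof (rule sq_integrable_bound)
  show "integrable M (\<lambda>x. 2 * (cmod (u x))\<^sup>2 + 2 * (cmod (v x))\<^sup>2)"
    using assms by (auto simp: sq_integrable_def)
  have "(cmod (u x + v x))\<^sup>2 \<le> 2 * (cmod (u x))\<^sup>2 + 2 * (cmod (v x))\<^sup>2" for x
  proof -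
    have "(cmod (u x + v x))\<^sup>2 \<le> (cmod (u x) + cmod (v x))\<^sup>2" by (intro power_mono norm_triangle_ineq) auto
    also have "\<dots> \<le> 2 * (cmod (u x))\<^sup>2 + 2 * (cmod (v x))\<^sup>2"
      using sum_squares_bound[of "cmod (u x)" "cmod (v x)"] by (simp add: power2_sum)
    finally show ?thesis .
  qed
  then show "AE x in M. (cmod (u x + v x))\<^sup>2 \<le> 2 * (cmod (u x))\<^sup>2 + 2 * (cmod (v x))\<^sup>2" by simp
qed (use assms in \<open>auto simp: sq_integrable_def\<close>)

lemma sq_integrable_scale: "sq_integrable M u \<Longrightarrow> sq_integrable M (\<lambda>x. c * u x)"
  by (auto simp: sq_integrable_def norm_mult power_mult_distrib)

lemma sq_integrable_0: "sq_integrable M (\<lambda>x. 0)"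
  by (auto simp: sq_integrable_def)

lemma sq_integrable_diff:
  "sq_integrable M u \<Longrightarrow> sq_integrable M v \<Longrightarrow> sq_integrable M (\<lambda>x. u x - v x)"
  using sq_integrable_add[of M u "\<lambda>x. (-1) * v x"] sq_integrable_scale[of M v "-1"] by simp

lemma sq_integrable_mult_integrable:
  assumes "sq_integrable M u" "sq_integrable M v"
  shows "integrable M (\<lambda>x. u x * v x)"
proof (rule Bochner_Integration.integrable_bound)
  show "integrable M (\<lambda>x. (cmod (u x))\<^sup>2 + (cmod (v x))\<^sup>2)"
    using assms by (auto simp: sq_integrable_def)
  have "cmod (u x) * cmod (v x) \<le> (cmod (u x))\<^sup>2 + (cmod (v x))\<^sup>2" for x
    using sum_squares_bound[of "cmod (u x)" "cmod (v x)"]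
      mult_nonneg_nonneg[OF norm_ge_zero[of "u x"] norm_ge_zero[of "v x"]] by linarith
  then show "AE x in M. norm (u x * v x) \<le> norm ((cmod (u x))\<^sup>2 + (cmod (v x))\<^sup>2)"
    by (simp add: norm_mult)
qed (use sq_integrableD(1)[OF assms(1)] sq_integrableD(1)[OF assms(2)] in measurable)

lemma sq_integrable_cnj: "sq_integrable M u \<Longrightarrow> sq_integrable M (\<lambda>x. cnj (u x))"
  by (auto simp: sq_integrable_def)

lemma sq_integrable_AE_cong:
  assumes "sq_integrable M u" "v \<in> borel_measurable M" "AE x in M. u x = v x"
  shows "sq_integrable M v"
  by (rule sq_integrable_bound[OF assms(2) sq_integrableD(2)[OF assms(1)]]) (use assms(3) in auto)

lemma l2_norm_nonneg: "0 \<le> l2_norm M u"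
  by (auto simp: l2_norm_def)

lemma l2_norm_square: "(l2_norm M u)\<^sup>2 = (\<integral>x. (cmod (u x))\<^sup>2 \<partial>M)"
  by (auto simp: l2_norm_def)

lemma l2_inner_self: "l2_inner M u u = of_real ((l2_norm M u)\<^sup>2)"
  unfolding l2_inner_def l2_norm_square
  by (simp add: complex_norm_square[symmetric] del: of_real_power)

lemma l2_norm_AE_cong:
  assumes "u \<in> borel_measurable M" "v \<in> borel_measurable M" "AE x in M. u x = v x"
  shows "l2_norm M u = l2_norm M v"
  unfolding l2_norm_def using assms by (intro arg_cong[where f = sqrt] integral_cong_AE) auto

lemma l2_inner_AE_cong:
  assumes "u \<in> borel_measurable M" "v \<in> borel_measurable M" "AE x in M. u x = v x"
    "u' \<in> borel_measurable M" "v' \<in> borel_measurable M" "AE x in M. u' x = v' x"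
  shows "l2_inner M u u' = l2_inner M v v'"
  unfolding l2_inner_def using assms by (intro integral_cong_AE) auto

interpretation l2: nonneg_form "{u. sq_integrable M u}" "l2_inner M" for M
proof unfold_locales
  fix u v w assume "u \<in> {u. sq_integrable M u}" "v \<in> {u. sq_integrable M u}" "w \<in> {u. sq_integrable M u}"
  then have "integrable M (\<lambda>x. u x * cnj (w x))" "integrable M (\<lambda>x. v x * cnj (w x))"
    by (auto intro: sq_integrable_mult_integrable sq_integrable_cnj)
  then show "l2_inner M (\<lambda>x. u x + v x) w = l2_inner M u w + l2_inner M v w"
    by (simp add: l2_inner_def distrib_right)
next
  fix u v assume "u \<in> {u. sq_integrable M u}" "v \<in> {u. sq_integrable M u}"
  show "l2_inner M v u = cnj (l2_inner M u v)"
  proof -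
    have "cnj (l2_inner M u v) = (\<integral>x. cnj (u x * cnj (v x)) \<partial>M)"
      unfolding l2_inner_def by (rule Bochner_Integration.integral_cnj[symmetric])
    also have "\<dots> = l2_inner M v u"
      unfolding l2_inner_def by (intro Bochner_Integration.integral_cong) auto
    finally show ?thesis by simp
  qed
qed (auto simp: sq_integrable_add sq_integrable_scale sq_integrable_0 l2_inner_self,
    simp add: l2_inner_def mult.assoc)

lemma l2_norm_sqrt: "l2_norm M u = sqrt (Re (l2_inner M u u))"
  unfolding l2_inner_self Re_complex_of_real using l2_norm_nonneg[of M u] by (simp only: real_sqrt_abs abs_of_nonneg)

lemma l2_cauchy_schwarz:
  assumes "sq_integrable M u" "sq_integrable M v"
  shows "cmod (l2_inner M u v) \<le> l2_norm M u * l2_norm M v"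
proof (rule power2_le_imp_le)
  have "(cmod (l2_inner M u v))\<^sup>2 \<le> Re (l2_inner M u u) * Re (l2_inner M v v)"
    by (rule l2.cauchy_schwarz) (simp_all only: mem_Collect_eq assms)
  then show "(cmod (l2_inner M u v))\<^sup>2 \<le> (l2_norm M u * l2_norm M v)\<^sup>2"
    unfolding l2_inner_self Re_complex_of_real power_mult_distrib .
qed (simp add: l2_norm_nonneg)

lemma l2_triangle:
  assumes "sq_integrable M u" "sq_integrable M v"
  shows "l2_norm M (\<lambda>x. u x + v x) \<le> l2_norm M u + l2_norm M v"
  using l2.sqrt_triangle[of u M v] assms by (simp only: l2_norm_sqrt mem_Collect_eq)

lemma l2_norm_scale: "l2_norm M (\<lambda>x. c * u x) = cmod c * l2_norm M u"
  by (simp add: l2_norm_def norm_mult power_mult_distrib real_sqrt_mult)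

lemma l2_norm_minus_commute: "l2_norm M (\<lambda>x. u x - v x) = l2_norm M (\<lambda>x. v x - u x)"
  by (simp add: l2_norm_def norm_minus_commute)

lemma l2_triangle_diff:
  assumes "sq_integrable M u" "sq_integrable M v" "sq_integrable M w"
  shows "l2_norm M (\<lambda>x. u x - w x) \<le> l2_norm M (\<lambda>x. u x - v x) + l2_norm M (\<lambda>x. v x - w x)"
  using l2_triangle[of M "\<lambda>x. u x - v x" "\<lambda>x. v x - w x"] assms by (simp add: sq_integrable_diff)

lemma l2_norm_tendsto:
  assumes "\<And>n. sq_integrable M (f n)" "sq_integrable M g" "(\<lambda>n. l2_norm M (\<lambda>x. f n x - g x)) \<longlonglongrightarrow> 0"
  shows "(\<lambda>n. l2_norm M (f n)) \<longlonglongrightarrow> l2_norm M g"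
proof (rule Lim_transform[OF tendsto_const])
  have "\<bar>l2_norm M (f n) - l2_norm M g\<bar> \<le> l2_norm M (\<lambda>x. f n x - g x)" for n
  proof -
    have "l2_norm M (f n) \<le> l2_norm M (\<lambda>x. f n x - g x) + l2_norm M g"
      using l2_triangle[of M "\<lambda>x. f n x - g x" g] assms by (simp add: sq_integrable_diff)
    moreover have "l2_norm M g \<le> l2_norm M (\<lambda>x. g x - f n x) + l2_norm M (f n)"
      using l2_triangle[of M "\<lambda>x. g x - f n x" "f n"] assms by (simp add: sq_integrable_diff)
    ultimately show ?thesis by (simp add: l2_norm_minus_commute[of M g])
  qed
  then show "(\<lambda>n. l2_norm M (f n) - l2_norm M g) \<longlonglongrightarrow> 0"
    by (intro tendsto_rabs_zero_cancel[OF tendsto_sandwich[OF _ _ tendsto_const assms(3)]])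
       auto
qed

lemma l2_inner_tendsto:
  assumes "\<And>n. sq_integrable M (f n)" "sq_integrable M g" "sq_integrable M h"
    "(\<lambda>n. l2_norm M (\<lambda>x. f n x - g x)) \<longlonglongrightarrow> 0"
  shows "(\<lambda>n. l2_inner M (f n) h) \<longlonglongrightarrow> l2_inner M g h"
proof -
  have "(\<lambda>n. l2_inner M (f n) h - l2_inner M g h) \<longlonglongrightarrow> 0"
  proof (rule tendsto_norm_zero_cancel[OF tendsto_sandwich[OF _ _ tendsto_const tendsto_mult_left_zero[OF assms(4), of "l2_norm M h"]]])
    show "eventually (\<lambda>n. norm (l2_inner M (f n) h - l2_inner M g h) \<le> l2_norm M (\<lambda>x. f n x - g x) * l2_norm M h) sequentially"
      using assms l2_cauchy_schwarz[OF sq_integrable_diff[OF assms(1,2)] assms(3)]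
      by (simp add: l2.diff_left)
  qed auto
  then show ?thesis using LIM_zero_iff by blast
qed

text \<open>Along a rapidly convergent subsequence, \<open>\<Sum>k. 2^k |f\<^sub>k\<^sub>+\<^sub>1 - f\<^sub>k|\<^sup>2\<close> is integrable, which
  forces pointwise geometric convergence almost everywhere; Fatou's lemma does the rest.\<close>

lemma l2_complete:
  assumes f: "\<And>n. sq_integrable M (f n)"
    and cauchy: "\<And>e. e > 0 \<Longrightarrow> \<exists>N. \<forall>m\<ge>N. \<forall>n\<ge>N. l2_norm M (\<lambda>x. f m x - f n x) < e"
  obtains g where "sq_integrable M g" "(\<lambda>n. l2_norm M (\<lambda>x. f n x - g x)) \<longlonglongrightarrow> 0"
proof -
  have [measurable]: "f n \<in> borel_measurable M" for n using f by (auto simp: sq_integrable_def)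
  \<comment> \<open>\<open>r k\<close> is a stage after which all differences are below 2^-k; in
    particular it bounds the successive differences along the subsequence.\<close>
  have "\<exists>r::nat\<Rightarrow>nat. \<forall>k. (\<forall>m\<ge>r k. \<forall>n\<ge>r k. l2_norm M (\<lambda>x. f m x - f n x) < (1/2)^k) \<and> r k < r (Suc k)"
  proof (rule dependent_nat_choice)
    show "\<exists>x. \<forall>m\<ge>x. \<forall>n\<ge>x. l2_norm M (\<lambda>x. f m x - f n x) < (1/2)^0" using cauchy[of 1] by auto
    show "\<exists>y. (\<forall>m\<ge>y. \<forall>n\<ge>y. l2_norm M (\<lambda>x. f m x - f n x) < (1/2) ^ Suc k) \<and> x < y" for x k
    proof -
      obtain N where "\<forall>m\<ge>N. \<forall>n\<ge>N. l2_norm M (\<lambda>x. f m x - f n x) < (1/2) ^ Suc k"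
        using cauchy[of "(1/2) ^ Suc k"] by auto
      then show ?thesis by (intro exI[of _ "max N (Suc x)"]) auto
    qed
  qed
  then obtain r :: "nat \<Rightarrow> nat" where r: "\<And>k m n. m \<ge> r k \<Longrightarrow> n \<ge> r k \<Longrightarrow> l2_norm M (\<lambda>x. f m x - f n x) < (1/2)^k"
    and rs: "\<And>k. r k < r (Suc k)" by blast
  have sm: "strict_mono r" using rs by (simp add: strict_mono_Suc_iff)
  define d where "d k x = (cmod (f (r (Suc k)) x - f (r k) x))\<^sup>2" for k x
  have [measurable]: "d k \<in> borel_measurable M" for k unfolding d_def[abs_def] by measurable
  have di: "integrable M (d k)" for k
    unfolding d_def[abs_def] using sq_integrable_diff[OF f f] by (auto simp: sq_integrable_def)
  have d_nn: "0 \<le> d k x" for k x by (simp add: d_def)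
  have dn: "(\<integral>x. d k x \<partial>M) \<le> (1/4)^k" for k
  proof -
    have "(l2_norm M (\<lambda>x. f (r (Suc k)) x - f (r k) x))\<^sup>2 \<le> ((1/2)^k)\<^sup>2"
      using r[of k "r (Suc k)" "r k"] rs[of k] by (intro power_mono) (simp_all add: l2_norm_nonneg)
    also have "((1/2)^k)\<^sup>2 = ((1/2::real)\<^sup>2)^k" by (simp only: power_mult[symmetric] mult.commute)
    also have "\<dots> = (1/4)^k" by (simp add: power2_eq_square)
    finally show ?thesis by (simp add: l2_norm_square d_def)
  qed
  have ae: "AE x in M. convergent (\<lambda>k. f (r k) x)"
  proof -
    \<comment> \<open>The weights 2^k lose against the squared norms 4^-k, but a finite weighted sum
      still forces \<open>d k x\<close> <= C 2^-k pointwise, which is summable after taking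
      roots.\<close>
    have "(\<integral>\<^sup>+x. (\<Sum>k. ennreal (2^k * d k x)) \<partial>M) = (\<Sum>k. \<integral>\<^sup>+x. ennreal (2^k * d k x) \<partial>M)"
      by (intro nn_integral_suminf) measurable
    also have "\<dots> = (\<Sum>k. ennreal (2^k * (\<integral>x. d k x \<partial>M)))"
      using di d_nn by (simp add: nn_integral_eq_integral)
    also have "\<dots> \<le> (\<Sum>k. ennreal ((1/2)^k))"
    proof (intro suminf_le ennreal_leI)
      fix k
      have "2^k * (\<integral>x. d k x \<partial>M) \<le> 2^k * (1/4)^k" using dn by (intro mult_left_mono) auto
      also have "\<dots> = (1/2)^k" by (subst power_mult_distrib[symmetric]) simp
      finally show "2^k * (\<integral>x. d k x \<partial>M) \<le> (1/2)^k" .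
    qed auto
    also have "\<dots> < \<infinity>"
      by (subst suminf_ennreal2) (simp_all add: summable_geometric)
    finally have "AE x in M. (\<Sum>k. ennreal (2^k * d k x)) \<noteq> \<infinity>"
      by (intro nn_integral_PInf_AE) auto
    then show ?thesis
    proof eventually_elim
      fix x assume fin: "(\<Sum>k. ennreal (2^k * d k x)) \<noteq> \<infinity>"
      then obtain C where C: "C \<ge> 0" "(\<Sum>k. ennreal (2^k * d k x)) = ennreal C"
        by (metis ennreal_cases infinity_ennreal_def)
      have b: "cmod (f (r (Suc k)) x - f (r k) x) \<le> sqrt C * (sqrt (1/2))^k" for k
      proof -
        have "ennreal (2^k * d k x) \<le> ennreal C"
          using C(2) sum_le_suminf[of "\<lambda>k. ennreal (2^k * d k x)" "{k}"] by simp
        then have "2^k * d k x \<le> C" using C(1) by (simp add: ennreal_le_iff)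
        then have "d k x \<le> C * (1/2)^k" by (simp add: field_simps power_divide)
        then have "sqrt (d k x) \<le> sqrt (C * (1/2)^k)" by simp
        then show ?thesis by (simp add: d_def real_sqrt_mult real_sqrt_power)
      qed
      have "summable (\<lambda>k. sqrt C * (sqrt (1/2))^k)"
        by (intro summable_mult summable_geometric) (simp add: real_sqrt_divide)
      then have "summable (\<lambda>k. f (r (Suc k)) x - f (r k) x)"
        using b by (rule summable_comparison_test')
      then have "convergent (\<lambda>n. f (r n) x - f (r 0) x)"
        unfolding summable_iff_convergent sum_lessThan_telescope[of "\<lambda>n. f (r n) x"] .
      then have "convergent (\<lambda>n. (f (r n) x - f (r 0) x) + f (r 0) x)"
        by (intro convergent_add convergent_const)
      then show "convergent (\<lambda>k. f (r k) x)" by simp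
    qed
  qed
  define g where "g x = lim (\<lambda>k. f (r k) x)" for x
  have [measurable]: "g \<in> borel_measurable M" unfolding g_def by measurable
  have lim: "AE x in M. (\<lambda>k. f (r k) x) \<longlonglongrightarrow> g x"
    using ae by eventually_elim (auto simp: g_def convergent_LIMSEQ_iff)
  \<comment> \<open>Fatou is applied in the second index j with n fixed, so the bound holds on the
    whole tail n >= \<open>r k\<close> and not just along the subsequence.\<close>
  have fatou: "(\<integral>\<^sup>+x. ennreal ((cmod (f n x - g x))\<^sup>2) \<partial>M) \<le> ennreal (((1/2)^k)\<^sup>2)" if "n \<ge> r k" for n k
  proof -
    have "(\<integral>\<^sup>+x. ennreal ((cmod (f n x - g x))\<^sup>2) \<partial>M) = (\<integral>\<^sup>+x. liminf (\<lambda>j. ennreal ((cmod (f n x - f (r j) x))\<^sup>2)) \<partial>M)"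
    proof (rule nn_integral_cong_AE)
      show "AE x in M. ennreal ((cmod (f n x - g x))\<^sup>2) = liminf (\<lambda>j. ennreal ((cmod (f n x - f (r j) x))\<^sup>2))"
        using lim
      proof eventually_elim
        fix x assume "(\<lambda>k. f (r k) x) \<longlonglongrightarrow> g x"
        then have "(\<lambda>j. ennreal ((cmod (f n x - f (r j) x))\<^sup>2)) \<longlonglongrightarrow> ennreal ((cmod (f n x - g x))\<^sup>2)"
          by (intro tendsto_intros tendsto_ennrealI)
        then show "ennreal ((cmod (f n x - g x))\<^sup>2) = liminf (\<lambda>j. ennreal ((cmod (f n x - f (r j) x))\<^sup>2))"
          by (metis lim_imp_Liminf sequentially_bot)
      qed
    qed
    also have "\<dots> \<le> liminf (\<lambda>j. \<integral>\<^sup>+x. ennreal ((cmod (f n x - f (r j) x))\<^sup>2) \<partial>M)"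
      by (intro nn_integral_liminf) measurable
    also have "\<dots> \<le> ennreal (((1/2)^k)\<^sup>2)"
    proof (rule Liminf_le, simp)
      have "eventually (\<lambda>j. j \<ge> k) sequentially" by (rule eventually_ge_at_top)
      then show "eventually (\<lambda>j. (\<integral>\<^sup>+x. ennreal ((cmod (f n x - f (r j) x))\<^sup>2) \<partial>M) \<le> ennreal (((1/2)^k)\<^sup>2)) sequentially"
      proof eventually_elim
        fix j assume "j \<ge> k"
        then have "r k \<le> r j" using sm by (simp add: strict_mono_less_eq)
        then have "(l2_norm M (\<lambda>x. f n x - f (r j) x))\<^sup>2 \<le> ((1/2)^k)\<^sup>2"
          using r[OF that, of "r j"] by (intro power_mono) (simp_all add: l2_norm_nonneg)
        then show "(\<integral>\<^sup>+x. ennreal ((cmod (f n x - f (r j) x))\<^sup>2) \<partial>M) \<le> ennreal (((1/2)^k)\<^sup>2)"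
          using sq_integrable_diff[OF f f, of n "r j"]
          by (subst nn_integral_eq_integral) (auto simp: sq_integrable_def l2_norm_square intro: ennreal_leI)
      qed
    qed
    finally show ?thesis .
  qed
  have sqd: "sq_integrable M (\<lambda>x. f n x - g x)" if "n \<ge> r k" for n k
    unfolding sq_integrable_def
  proof
    show "integrable M (\<lambda>x. (cmod (f n x - g x))\<^sup>2)"
    proof (rule integrableI_bounded)
      show "(\<integral>\<^sup>+x. ennreal (norm ((cmod (f n x - g x))\<^sup>2)) \<partial>M) < \<infinity>"
        using le_less_trans[OF fatou[OF that] ennreal_less_top] by simp
    qed measurable
  qed measurable
  have sqg: "sq_integrable M g"
    using sq_integrable_diff[OF f sqd[of 0 "r 0"], of "r 0"] by simp
  have "(\<lambda>n. l2_norm M (\<lambda>x. f n x - g x)) \<longlonglongrightarrow> 0"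
  proof (rule LIMSEQ_I)
    fix e :: real assume "e > 0"
    then obtain k where k: "(1/2::real)^k < e" using real_arch_pow_inv[of e "1/2"] by auto
    have "norm (l2_norm M (\<lambda>x. f n x - g x) - 0) < e" if "n \<ge> r k" for n
    proof -
      have "ennreal ((l2_norm M (\<lambda>x. f n x - g x))\<^sup>2) \<le> ennreal (((1/2)^k)\<^sup>2)"
        using fatou[OF that] sqd[OF that]
        by (subst (asm) nn_integral_eq_integral) (auto simp: sq_integrable_def l2_norm_square)
      then have "(l2_norm M (\<lambda>x. f n x - g x))\<^sup>2 \<le> ((1/2)^k)\<^sup>2" by (subst (asm) ennreal_le_iff) auto
      then have "l2_norm M (\<lambda>x. f n x - g x) \<le> (1/2)^k" by (rule power2_le_imp_le) simp
      then show ?thesis using k l2_norm_nonneg[of M "\<lambda>x. f n x - g x"] by simp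
    qed
    then show "\<exists>no. \<forall>n\<ge>no. norm (l2_norm M (\<lambda>x. f n x - g x) - 0) < e" by blast
  qed
  with sqg show thesis by (rule that)
qed

section \<open>The bottom of the spectrum of a form operator\<close>

text \<open>A lower bound is handed to each result as the hypothesis \<open>low\<close> instead of
  being fixed here, so that the optimal bound \<open>rayleigh_inf\<close> can be inserted once a
  crude one has shown it to be finite.\<close>

locale semibounded_closed_form = hermitian_form D t for D :: "('a \<Rightarrow> complex) set" and t +
  fixes M :: "'a measure"
  assumes D_sq: "u \<in> D \<Longrightarrow> sq_integrable M u"
    and closed: "closed_form M D t"
begin

text \<open>The same shift serves c strictly below the spectrum, for solving the equation, and the
  borderline c = \<open>rayleigh_inf\<close>, where the shifted form is merely semidefinite.\<close>

lemma nonneg_form_shift: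
  assumes "\<And>u. u \<in> D \<Longrightarrow> c * (l2_norm M u)\<^sup>2 \<le> Re (t u u)"
  shows "nonneg_form D (\<lambda>u v. t u v - of_real c * l2_inner M u v)"
proof unfold_locales
  fix u v w assume *: "u \<in> D" "v \<in> D" "w \<in> D"
  show "t (\<lambda>x. u x + v x) w - of_real c * l2_inner M (\<lambda>x. u x + v x) w =
      t u w - of_real c * l2_inner M u w + (t v w - of_real c * l2_inner M v w)"
    using * l2.add_left[of u M v w] by (simp add: add_left D_sq algebra_simps)
next
  fix u v assume *: "u \<in> D" "v \<in> D"
  show "t v u - of_real c * l2_inner M v u = cnj (t u v - of_real c * l2_inner M u v)"
    using * herm[of u v] l2.herm[of u M v] by (simp add: D_sq)
next
  fix u w a assume *: "u \<in> D" "w \<in> D"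
  show "t (\<lambda>x. a * u x) w - of_real c * l2_inner M (\<lambda>x. a * u x) w = a * (t u w - of_real c * l2_inner M u w)"
    using * l2.scale_left[of u M w a] by (simp add: scale_left D_sq algebra_simps)
next
  fix u assume "u \<in> D"
  then show "0 \<le> Re (t u u - of_real c * l2_inner M u u)"
    using assms[of u] by (simp add: l2_inner_self)
qed (auto intro: D_add D_scale D_nonempty)

text \<open>Riesz' theorem for the scalar product \<open>t - c\<close>, proved by minimising
  \<open>(t - c)(u, u) - 2 Re \<langle>f, u\<rangle>\<close>: the parallelogram identity makes minimising sequences Cauchy.\<close>

lemma form_equation_solvable:
  assumes low: "\<And>u. u \<in> D \<Longrightarrow> l * (l2_norm M u)\<^sup>2 \<le> Re (t u u)"
    and c: "c < l" and f: "sq_integrable M f"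
  obtains u where "u \<in> D" "\<And>v. v \<in> D \<Longrightarrow> t u v - of_real c * l2_inner M u v = l2_inner M f v"
proof -
  define s where "s u v = t u v - of_real c * l2_inner M u v" for u v
  have lowc: "c * (l2_norm M u)\<^sup>2 \<le> Re (t u u)" if "u \<in> D" for u
    using low[OF that] mult_right_mono[of c l "(l2_norm M u)\<^sup>2"] c by simp
  interpret s: nonneg_form D s
    unfolding s_def[abs_def] by (rule nonneg_form_shift[OF lowc])
  have s_low: "(l - c) * (l2_norm M u)\<^sup>2 \<le> Re (s u u)" if "u \<in> D" for u
    using low[OF that] by (simp add: s_def l2_inner_self algebra_simps)
  define J where "J u = Re (s u u) - 2 * Re (l2_inner M f u)" for u
  have J_low: "- (l2_norm M f)\<^sup>2 / (l - c) \<le> J u" if "u \<in> D" for u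
  proof -
    have "Re (l2_inner M f u) \<le> l2_norm M f * l2_norm M u"
      using l2_cauchy_schwarz[OF f D_sq[OF that]] complex_Re_le_cmod order_trans by blast
    moreover have "0 \<le> ((l - c) * l2_norm M u - l2_norm M f)\<^sup>2 / (l - c)" using c by simp
    then have "0 \<le> (l - c) * (l2_norm M u)\<^sup>2 - 2 * (l2_norm M f * l2_norm M u) + (l2_norm M f)\<^sup>2 / (l - c)"
      using c by (simp add: power2_eq_square field_simps)
    ultimately show ?thesis unfolding J_def using s_low[OF that] by linarith
  qed
  define m where "m = Inf (J ` D)"
  have bdd: "bdd_below (J ` D)" using J_low by (auto intro!: bdd_belowI)
  have m_le: "m \<le> J u" if "u \<in> D" for u unfolding m_def using bdd that by (auto intro: cInf_lower)
  have "\<exists>u\<in>D. J u < m + 1 / real (Suc n)" for n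
  proof -
    have "Inf (J ` D) < m + 1 / real (Suc n)" by (simp add: m_def)
    then show ?thesis using cInf_lessD[of "J ` D"] D_nonempty by blast
  qed
  then obtain w where wD: "\<And>n. w n \<in> D" and wJ: "\<And>n. J (w n) < m + 1 / real (Suc n)" by metis
  have f_add: "l2_inner M f (\<lambda>x. u x + v x) = l2_inner M f u + l2_inner M f v" if "u \<in> D" "v \<in> D" for u v
    using l2.add_right[of u M v f] that f by (simp add: D_sq)
  have f_scale: "l2_inner M f (\<lambda>x. a * u x) = cnj a * l2_inner M f u" if "u \<in> D" for u a
    using l2.scale_right[of u M f a] that f by (simp add: D_sq)
  have par: "Re (s (\<lambda>x. w p x - w q x) (\<lambda>x. w p x - w q x)) \<le> 2 / real (Suc p) + 2 / real (Suc q)" for p q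
  proof -
    \<comment> \<open>The midpoint is a competitor, so \<open>J h\<close> >= m; inserted into the
      parallelogram identity it leaves only the excesses of J over m at \<open>w p\<close> and
      \<open>w q\<close>.\<close>
    define h where "h = (\<lambda>x. (1/2) * (w p x + w q x))"
    have sumD: "(\<lambda>x. w p x + w q x) \<in> D" by (intro D_add wD)
    have hD: "h \<in> D" unfolding h_def by (intro D_scale sumD)
    have 1: "Re (s h h) = (1/4) * Re (s (\<lambda>x. w p x + w q x) (\<lambda>x. w p x + w q x))"
      unfolding h_def using s.diag_scale[OF sumD, of "1/2"] by (simp add: power2_eq_square norm_divide)
    have eq: "l2_inner M f h = (1/2) * (l2_inner M f (w p) + l2_inner M f (w q))"
      unfolding h_def using f_scale[OF sumD, of "1/2"] by (simp add: f_add wD)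
    have 2: "2 * Re (l2_inner M f h) = Re (l2_inner M f (w p)) + Re (l2_inner M f (w q))"
      unfolding eq by simp
    show ?thesis
      unfolding s.parallelogram[OF wD wD] using 1 2 m_le[OF hD] wJ[of p] wJ[of q] unfolding J_def by linarith
  qed
  have small: "\<exists>N. \<forall>p\<ge>N. \<forall>q\<ge>N. Re (s (\<lambda>x. w p x - w q x) (\<lambda>x. w p x - w q x)) < e" if "e > 0" for e
  proof -
    obtain N where N: "4 / e < real N" using reals_Archimedean2 by blast
    have tail: "2 / real (Suc p) < e / 2" if "p \<ge> N" for p
    proof -
      have "4 / e < real (Suc p)" using N that by linarith
      then show ?thesis using \<open>e > 0\<close> by (simp add: field_simps)
    qed
    have "Re (s (\<lambda>x. w p x - w q x) (\<lambda>x. w p x - w q x)) < e" if "p \<ge> N" "q \<ge> N" for p q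
      using par[of p q] tail[OF that(1)] tail[OF that(2)] by linarith
    then show ?thesis by blast
  qed
  have l2small: "\<exists>N. \<forall>p\<ge>N. \<forall>q\<ge>N. l2_norm M (\<lambda>x. w p x - w q x) < e" if "e > 0" for e
  proof -
    obtain N where N: "\<forall>p\<ge>N. \<forall>q\<ge>N. Re (s (\<lambda>x. w p x - w q x) (\<lambda>x. w p x - w q x)) < (l - c) * e\<^sup>2"
      using small[of "(l - c) * e\<^sup>2"] c \<open>e > 0\<close> by auto
    have "l2_norm M (\<lambda>x. w p x - w q x) < e" if "p \<ge> N" "q \<ge> N" for p q
    proof -
      have "(l - c) * (l2_norm M (\<lambda>x. w p x - w q x))\<^sup>2 < (l - c) * e\<^sup>2"
        using s_low[OF D_diff[OF wD wD], of p q] N that by fastforce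
      then have "(l2_norm M (\<lambda>x. w p x - w q x))\<^sup>2 < e\<^sup>2" using c by simp
      then show ?thesis using \<open>e > 0\<close> power2_less_imp_less by fastforce
    qed
    then show ?thesis by blast
  qed
  obtain u where u: "sq_integrable M u" "(\<lambda>n. l2_norm M (\<lambda>x. w n x - u x)) \<longlonglongrightarrow> 0"
    using l2_complete[OF D_sq[OF wD] l2small] by blast
  \<comment> \<open>\<open>closed_form\<close> speaks about t itself, so the estimates for s = t - c
    are converted back with the L^2 bound; c may have either sign and may be 0, hence |c| +
    1.\<close>
  have tcauchy: "\<exists>N. \<forall>p\<ge>N. \<forall>q\<ge>N. cmod (t (\<lambda>x. w p x - w q x) (\<lambda>x. w p x - w q x)) < e" if "e > 0" for e
  proof -
    obtain N1 where N1: "\<forall>p\<ge>N1. \<forall>q\<ge>N1. Re (s (\<lambda>x. w p x - w q x) (\<lambda>x. w p x - w q x)) < e / 2"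
      using small[of "e / 2"] \<open>e > 0\<close> by auto
    obtain N2 where N2: "\<forall>p\<ge>N2. \<forall>q\<ge>N2. l2_norm M (\<lambda>x. w p x - w q x) < sqrt (e / (2 * (\<bar>c\<bar> + 1)))"
      using l2small[of "sqrt (e / (2 * (\<bar>c\<bar> + 1)))"] \<open>e > 0\<close> by auto
    have "cmod (t (\<lambda>x. w p x - w q x) (\<lambda>x. w p x - w q x)) < e" if pq: "p \<ge> max N1 N2" "q \<ge> max N1 N2" for p q
    proof -
      define z where "z = (\<lambda>x. w p x - w q x)"
      have zD: "z \<in> D" unfolding z_def by (intro D_diff wD)
      have "(l2_norm M z)\<^sup>2 < (sqrt (e / (2 * (\<bar>c\<bar> + 1))))\<^sup>2"
        unfolding z_def using N2 pq by (intro power_strict_mono) (auto simp: l2_norm_nonneg)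
      then have "(l2_norm M z)\<^sup>2 * (2 * (\<bar>c\<bar> + 1)) < e"
        using \<open>e > 0\<close> by (simp add: field_simps)
      then have 1: "\<bar>c\<bar> * (l2_norm M z)\<^sup>2 \<le> e / 2" 
        using zero_le_power2[of "l2_norm M z"] by (simp only: distrib_left distrib_right mult_1_right mult_1 mult.assoc mult.commute mult.left_commute)
      have 2: "Re (s z z) < e / 2" unfolding z_def using N1 pq by auto
      have 3: "Re (t z z) = Re (s z z) + c * (l2_norm M z)\<^sup>2" by (simp add: s_def l2_inner_self)
      have "\<bar>c * (l2_norm M z)\<^sup>2\<bar> \<le> e / 2" using 1 by (simp add: abs_mult)
      then have "\<bar>Re (t z z)\<bar> < e" using 2 3 s.nonneg[OF zD] by linarith
      moreover have "cmod (t z z) = \<bar>Re (t z z)\<bar>" using diag_real[OF zD] by (metis norm_of_real)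
      ultimately show ?thesis unfolding z_def by simp
    qed
    then show ?thesis by blast
  qed
  have uD: "u \<in> D" and tu: "(\<lambda>n. t (\<lambda>x. w n x - u x) (\<lambda>x. w n x - u x)) \<longlonglongrightarrow> 0"
    using closed[unfolded closed_form_def, rule_format, of w u] wD u tcauchy by blast+
  have su: "(\<lambda>n. Re (s (\<lambda>x. w n x - u x) (\<lambda>x. w n x - u x))) \<longlonglongrightarrow> 0"
  proof -
    have "(\<lambda>n. Re (t (\<lambda>x. w n x - u x) (\<lambda>x. w n x - u x)) - c * (l2_norm M (\<lambda>x. w n x - u x))\<^sup>2) \<longlonglongrightarrow> Re 0 - c * 0\<^sup>2"
      by (rule tendsto_diff[OF tendsto_Re[OF tu] tendsto_mult[OF tendsto_const tendsto_power[OF u(2)]]])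
    then show ?thesis by (simp add: s_def l2_inner_self)
  qed
  have "s u v = l2_inner M f v" if v: "v \<in> D" for v
  proof -
    \<comment> \<open>A quantitative Euler equation: moving the near-minimiser \<open>w n\<close> in
      the direction v can lower J by at most 1 / (n + 1), which bounds the residual before any limit
      is taken.\<close>
    have approx: "(cmod (s (w n) v - l2_inner M f v))\<^sup>2 \<le> (1 / real (Suc n)) * Re (s v v)" for n
    proof -
      define z where "z = s (w n) v - l2_inner M f v"
      have *: "0 \<le> 1 / real (Suc n) - 2 * r * (cmod z)\<^sup>2 + r\<^sup>2 * (cmod z)\<^sup>2 * Re (s v v)" for r :: real
      proof -
        define a where "a = - of_real r * z"
        have avD: "(\<lambda>x. a * v x) \<in> D" by (intro D_scale v)
        have "J (\<lambda>x. w n x + a * v x) = J (w n) + 2 * Re (cnj a * z) + (cmod a)\<^sup>2 * Re (s v v)"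
          unfolding J_def z_def s.diag_add[OF wD avD] f_add[OF wD avD] f_scale[OF v] s.diag_scale[OF v]
            s.scale_right[OF v wD] by (simp add: algebra_simps)
        moreover have "Re (cnj a * z) = - r * (cmod z)\<^sup>2"
          unfolding a_def cmod_power2 by (simp add: algebra_simps power2_eq_square)
        moreover have "(cmod a)\<^sup>2 = r\<^sup>2 * (cmod z)\<^sup>2" by (simp add: a_def norm_mult power_mult_distrib)
        ultimately show ?thesis using m_le[OF D_add[OF wD avD], of n] wJ[of n] by simp
      qed
      show ?thesis
      proof (cases "Re (s v v) = 0")
        case True
        have "(cmod z)\<^sup>2 = 0"
        proof (rule ccontr)
          assume "(cmod z)\<^sup>2 \<noteq> 0"
          define d where "d = 1 / real (Suc n)"
          have "0 \<le> d - 2 * (d / (cmod z)\<^sup>2) * (cmod z)\<^sup>2"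
            using *[of "d / (cmod z)\<^sup>2"] unfolding d_def[symmetric] True by simp
          then have "0 \<le> d - 2 * d" using \<open>(cmod z)\<^sup>2 \<noteq> 0\<close> by simp
          moreover have "d > 0" by (simp add: d_def)
          ultimately show False by simp
        qed
        then show ?thesis using True by (simp add: z_def)
      next
        case False
        then have p: "Re (s v v) > 0" using s.nonneg[OF v] by simp
        have "0 \<le> 1 / real (Suc n) - (cmod z)\<^sup>2 / Re (s v v)"
          using *[of "1 / Re (s v v)"] p by (simp add: power2_eq_square)
        then have "(cmod z)\<^sup>2 / Re (s v v) \<le> 1 / real (Suc n)" by simp
        then show ?thesis using p unfolding z_def[symmetric] by (simp only: pos_divide_le_eq)
      qed
    qed
    have "(\<lambda>n. (cmod (s (w n) v - l2_inner M f v))\<^sup>2) \<longlonglongrightarrow> 0"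
    proof (rule tendsto_sandwich[OF _ _ tendsto_const])
      show "(\<lambda>n. 1 / real (Suc n) * Re (s v v)) \<longlonglongrightarrow> 0"
        using tendsto_mult[OF LIMSEQ_Suc[OF lim_1_over_n] tendsto_const, of "Re (s v v)"] by simp
    qed (use approx in auto)
    then have 1: "(\<lambda>n. s (w n) v) \<longlonglongrightarrow> l2_inner M f v"
      by (simp add: LIM_zero_iff tendsto_norm_zero_iff)
    have "(\<lambda>n. (cmod (s (w n) v - s u v))\<^sup>2) \<longlonglongrightarrow> 0"
    proof (rule tendsto_sandwich[OF _ _ tendsto_const])
      show "(\<lambda>n. Re (s (\<lambda>x. w n x - u x) (\<lambda>x. w n x - u x)) * Re (s v v)) \<longlonglongrightarrow> 0"
        using tendsto_mult[OF su tendsto_const, of "Re (s v v)"] by simp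
      show "eventually (\<lambda>n. (cmod (s (w n) v - s u v))\<^sup>2 \<le> Re (s (\<lambda>x. w n x - u x) (\<lambda>x. w n x - u x)) * Re (s v v)) sequentially"
        using s.cauchy_schwarz[OF D_diff[OF wD uD] v] by (simp add: s.diff_left wD uD v)
    qed auto
    then have 2: "(\<lambda>n. s (w n) v) \<longlonglongrightarrow> s u v"
      by (simp add: LIM_zero_iff tendsto_norm_zero_iff)
    show ?thesis by (rule LIMSEQ_unique[OF 2 1])
  qed
  then show thesis using that uD by (simp add: s_def)
qed

text \<open>Surjectivity is \<open>form_equation_solvable\<close>, with g = f + c u as the image of
  u. Testing the equation with u bounds (l - c) times the squared norm of u by the product of the
  norms of g - c u and u, hence a bounded inverse.\<close>

lemma below_bound_in_resolvent_set:
  assumes low: "\<And>u. u \<in> D \<Longrightarrow> l * (l2_norm M u)\<^sup>2 \<le> Re (t u u)" and c: "c < l"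
  shows "complex_of_real c \<in> resolvent_set M (form_operator M D t)"
  unfolding resolvent_set_def
proof (intro CollectI conjI allI impI)
  fix f assume f: "sq_integrable M f"
  obtain u where u: "u \<in> D" "\<And>v. v \<in> D \<Longrightarrow> t u v - of_real c * l2_inner M u v = l2_inner M f v"
    using form_equation_solvable[OF low c f] by blast
  define g where "g x = f x + of_real c * u x" for x
  have "sq_integrable M g" unfolding g_def[abs_def] by (intro sq_integrable_add sq_integrable_scale f D_sq u)
  moreover have "t u v = l2_inner M g v" if "v \<in> D" for v
    using u(2)[OF that] l2.add_left[of f M "\<lambda>x. of_real c * u x" v] l2.scale_left[of u M v "of_real c"]
      D_sq[OF that] D_sq[OF u(1)] f unfolding g_def[abs_def]
    by (simp add: sq_integrable_scale algebra_simps)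
  ultimately have "form_operator M D t u g" using u(1) by (simp add: form_operator_def)
  then show "\<exists>u g. form_operator M D t u g \<and> (AE x in M. g x - of_real c * u x = f x)"
    by (intro exI[of _ u] exI[of _ g]) (simp add: g_def)
next
  show "\<exists>C. \<forall>u g. form_operator M D t u g \<longrightarrow> l2_norm M u \<le> C * l2_norm M (\<lambda>x. g x - of_real c * u x)"
  proof (intro exI allI impI)
    fix u g assume "form_operator M D t u g"
    then have u: "u \<in> D" and g: "sq_integrable M g" and e: "t u u = l2_inner M g u"
      by (auto simp: form_operator_def)
    let ?h = "\<lambda>x. g x - of_real c * u x"
    have us: "sq_integrable M u" by (rule D_sq[OF u])
    have hs: "sq_integrable M ?h" by (intro sq_integrable_diff sq_integrable_scale g us)
    have "l2_inner M ?h u = t u u - of_real c * l2_inner M u u"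
      using l2.diff_left[of g M "\<lambda>x. of_real c * u x" u] l2.scale_left[of u M u "of_real c"] e g us
      by (simp add: sq_integrable_scale)
    then have "Re (l2_inner M ?h u) = Re (t u u) - c * (l2_norm M u)\<^sup>2" by (simp add: l2_inner_self)
    then have "(l - c) * (l2_norm M u)\<^sup>2 \<le> Re (l2_inner M ?h u)" using low[OF u] by (simp add: algebra_simps)
    also have "\<dots> \<le> l2_norm M ?h * l2_norm M u"
      using l2_cauchy_schwarz[OF hs us] complex_Re_le_cmod order_trans by blast
    finally have *: "((l - c) * l2_norm M u) * l2_norm M u \<le> l2_norm M ?h * l2_norm M u"
      by (simp add: power2_eq_square)
    show "l2_norm M u \<le> (1 / (l - c)) * l2_norm M ?h"
    proof (cases "l2_norm M u = 0")
      case True then show ?thesis using c by (simp add: l2_norm_nonneg)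
    next
      case False
      then have "l2_norm M u > 0" using l2_norm_nonneg[of M u] by simp
      then have "(l - c) * l2_norm M u \<le> l2_norm M ?h" using * by simp
      then show ?thesis using c by (simp add: field_simps)
    qed
  qed
qed

text \<open>Nonzero vectors are expressed by a positive norm, since a function that vanishes almost
  everywhere represents 0.\<close>

definition rayleigh_inf :: real where
  "rayleigh_inf = Inf {Re (t u u) / (l2_norm M u)\<^sup>2 | u. u \<in> D \<and> l2_norm M u > 0}"

lemma rayleigh_inf:
  assumes low: "\<And>u. u \<in> D \<Longrightarrow> l * (l2_norm M u)\<^sup>2 \<le> Re (t u u)"
    and ex: "\<exists>u\<in>D. l2_norm M u > 0"
  shows "l \<le> rayleigh_inf" "u \<in> D \<Longrightarrow> rayleigh_inf * (l2_norm M u)\<^sup>2 \<le> Re (t u u)"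
    "e > 0 \<Longrightarrow> \<exists>u\<in>D. l2_norm M u > 0 \<and> Re (t u u) < (rayleigh_inf + e) * (l2_norm M u)\<^sup>2"
proof -
  let ?S = "{Re (t u u) / (l2_norm M u)\<^sup>2 | u. u \<in> D \<and> l2_norm M u > 0}"
  have ne: "?S \<noteq> {}" using ex by auto
  have lb: "l \<le> x" if "x \<in> ?S" for x using that low by (auto simp: field_simps)
  then show "l \<le> rayleigh_inf" unfolding rayleigh_inf_def using ne by (intro cInf_greatest) auto
  show "rayleigh_inf * (l2_norm M u)\<^sup>2 \<le> Re (t u u)" if "u \<in> D"
  proof (cases "l2_norm M u = 0")
    case True then show ?thesis using low[OF that] by simp
  next
    case False
    then have p: "l2_norm M u > 0" using l2_norm_nonneg[of M u] by simp
    then have "rayleigh_inf \<le> Re (t u u) / (l2_norm M u)\<^sup>2"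
      unfolding rayleigh_inf_def using that lb by (intro cInf_lower bdd_belowI[of _ l]) auto
    then show ?thesis using p by (simp add: pos_le_divide_eq)
  qed
  assume "e > 0"
  then have "Inf ?S < rayleigh_inf + e" by (simp add: rayleigh_inf_def)
  then obtain u where "u \<in> D" "l2_norm M u > 0" "Re (t u u) / (l2_norm M u)\<^sup>2 < rayleigh_inf + e"
    using cInf_lessD[OF ne] by blast
  then show "\<exists>u\<in>D. l2_norm M u > 0 \<and> Re (t u u) < (rayleigh_inf + e) * (l2_norm M u)\<^sup>2"
    by (auto simp: pos_divide_less_eq)
qed

text \<open>If the infimum of the Rayleigh quotient were in the resolvent set, then solving
  \<open>(T - rayleigh_inf) u = v\<close> for an almost minimising \<open>v\<close> would contradict the Cauchy-Schwarz
  inequality for the shifted form.\<close>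

lemma rayleigh_inf_in_spectrum:
  assumes low: "\<And>u. u \<in> D \<Longrightarrow> l * (l2_norm M u)\<^sup>2 \<le> Re (t u u)"
    and ex: "\<exists>u\<in>D. l2_norm M u > 0"
  shows "complex_of_real rayleigh_inf \<in> spectrum M (form_operator M D t)"
proof (rule ccontr)
  note R = rayleigh_inf[OF low ex]
  define r where "r = rayleigh_inf"
  define s where "s u v = t u v - of_real r * l2_inner M u v" for u v
  interpret s: nonneg_form D s
    unfolding s_def[abs_def] r_def by (rule nonneg_form_shift[OF R(2)])
  assume "\<not> ?thesis"
  then have "complex_of_real r \<in> resolvent_set M (form_operator M D t)" by (simp add: spectrum_def r_def)
  then obtain C0 where surj: "\<And>f. sq_integrable M f \<Longrightarrow> \<exists>u g. form_operator M D t u g \<and> (AE x in M. g x - of_real r * u x = f x)"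
    and C0: "\<And>u g. form_operator M D t u g \<Longrightarrow> l2_norm M u \<le> C0 * l2_norm M (\<lambda>x. g x - of_real r * u x)"
    unfolding resolvent_set_def by blast
  \<comment> \<open>The constant taken from \<open>resolvent_set\<close> may be zero or negative;
    the enlarged one can be divided by, and 1 / C is the accuracy demanded of the almost
    minimiser.\<close>
  define C where "C = \<bar>C0\<bar> + 1"
  have C: "C > 0" "C0 \<le> C" by (auto simp: C_def)
  obtain v where v: "v \<in> D" "l2_norm M v > 0" "Re (t v v) < (r + 1 / C) * (l2_norm M v)\<^sup>2"
    using R(3)[of "1 / C"] C by (auto simp: r_def)
  have vs: "sq_integrable M v" by (rule D_sq[OF v(1)])
  obtain u g where ug: "form_operator M D t u g" "AE x in M. g x - of_real r * u x = v x"
    using surj[OF vs] by blast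
  then have u: "u \<in> D" and g: "sq_integrable M g" and e: "\<And>w. w \<in> D \<Longrightarrow> t u w = l2_inner M g w"
    by (auto simp: form_operator_def)
  have us: "sq_integrable M u" by (rule D_sq[OF u])
  let ?h = "\<lambda>x. g x - of_real r * u x"
  have hs: "sq_integrable M ?h" by (intro sq_integrable_diff sq_integrable_scale g us)
  have nh: "l2_norm M ?h = l2_norm M v"
    by (rule l2_norm_AE_cong[OF sq_integrableD(1)[OF hs] sq_integrableD(1)[OF vs] ug(2)])
  have sw: "s u w = l2_inner M v w" if w: "w \<in> D" for w
  proof -
    have "s u w = l2_inner M ?h w"
      unfolding s_def e[OF w]
      using l2.diff_left[of g M "\<lambda>x. of_real r * u x" w] l2.scale_left[of u M w "of_real r"] g us D_sq[OF w]
      by (simp add: sq_integrable_scale)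
    also have "\<dots> = l2_inner M v w"
      by (rule l2_inner_AE_cong[OF sq_integrableD(1)[OF hs] sq_integrableD(1)[OF vs] ug(2)
          sq_integrableD(1)[OF D_sq[OF w]] sq_integrableD(1)[OF D_sq[OF w]]]) simp
    finally show ?thesis .
  qed
  define n where "n = l2_norm M v"
  have n: "n > 0" using v(2) by (simp add: n_def)
  have "cmod (s u v) = n\<^sup>2" unfolding sw[OF v(1)] l2_inner_self n_def by (simp add: norm_power)
  then have 1: "(n\<^sup>2)\<^sup>2 \<le> Re (s u u) * Re (s v v)" using s.cauchy_schwarz[OF u v(1)] by simp
  have un: "l2_norm M u \<le> C * n"
    using C0[OF ug(1)] mult_right_mono[OF C(2) l2_norm_nonneg[of M v]] unfolding nh n_def by linarith
  have "Re (s u u) \<le> n * l2_norm M u"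
    unfolding sw[OF u] n_def using l2_cauchy_schwarz[OF vs us] complex_Re_le_cmod order_trans by blast
  also have "\<dots> \<le> n * (C * n)" using un n by (intro mult_left_mono) auto
  finally have 2: "Re (s u u) \<le> C * n\<^sup>2" by (simp add: power2_eq_square algebra_simps)
  have 3: "Re (s v v) < n\<^sup>2 / C" using v(3) by (simp add: s_def l2_inner_self n_def algebra_simps)
  \<comment> \<open>Cauchy-Schwarz demands at least n^4, whereas the resolvent bound and the choice
    of v give strictly less.\<close>
  have "Re (s u u) * Re (s v v) \<le> (C * n\<^sup>2) * Re (s v v)"
    using 2 s.nonneg[OF v(1)] by (intro mult_right_mono) auto
  also have "\<dots> < (C * n\<^sup>2) * (n\<^sup>2 / C)" using 3 C n by (intro mult_strict_left_mono) auto
  also have "\<dots> = (n\<^sup>2)\<^sup>2" using C by (simp add: power2_eq_square)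
  finally show False using 1 by simp
qed

text \<open>Every real point below \<open>rayleigh_inf\<close> is in the resolvent set, by inserting
  \<open>rayleigh_inf\<close> itself as the form bound, and \<open>rayleigh_inf\<close> is in the
  spectrum; so the infimum is a minimum.\<close>

theorem Inf_spectrum:
  assumes low: "\<And>u. u \<in> D \<Longrightarrow> l * (l2_norm M u)\<^sup>2 \<le> Re (t u u)"
    and ex: "\<exists>u\<in>D. l2_norm M u > 0"
  shows "Inf {x::real. complex_of_real x \<in> spectrum M (form_operator M D t)} = rayleigh_inf"
proof (rule cInf_eq_minimum)
  show "rayleigh_inf \<in> {x. complex_of_real x \<in> spectrum M (form_operator M D t)}"
    using rayleigh_inf_in_spectrum[OF low ex] by simp
  fix x assume "x \<in> {x. complex_of_real x \<in> spectrum M (form_operator M D t)}"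
  then show "rayleigh_inf \<le> x"
    using below_bound_in_resolvent_set[OF rayleigh_inf(2)[OF low ex], of x] by (force simp: spectrum_def)
qed

end

section \<open>Translations and mollification in \<open>L\<^sup>2\<close>\<close>

lemma lborel_distr_translation: "distr lborel borel (\<lambda>x. x + c) = (lborel :: 'a::euclidean_space measure)"
proof -
  have "(\<lambda>x. x + c) = (+) c" by (intro ext add.commute)
  then show ?thesis by (simp only: lborel_distr_plus)
qed

lemma lborel_distr_reflection: "distr lborel borel (\<lambda>x. c - x) = (lborel :: 'a::euclidean_space measure)"
  using lborel_affine[of "-1" c] by (simp add: density_1)

lemma lborel_translation:
  fixes f :: "'a::euclidean_space \<Rightarrow> 'b::{banach, second_countable_topology}"
  shows "integrable lborel f \<Longrightarrow> integrable lborel (\<lambda>x. f (x + c))"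
    and "f \<in> borel_measurable borel \<Longrightarrow> (\<integral>x. f (x + c) \<partial>lborel) = (\<integral>x. f x \<partial>lborel)"
proof -
  show "integrable lborel (\<lambda>x. f (x + c))" if "integrable lborel f"
  proof (subst integrable_distr_eq[symmetric, of "\<lambda>x. x + c" lborel borel f])
    show "integrable (distr lborel borel (\<lambda>x. x + c)) f" unfolding lborel_distr_translation by (rule that)
  qed (use that in auto)
  show "(\<integral>x. f (x + c) \<partial>lborel) = (\<integral>x. f x \<partial>lborel)" if "f \<in> borel_measurable borel"
  proof (subst integral_distr[symmetric, of "\<lambda>x. x + c" lborel borel f])
    show "integral\<^sup>L (distr lborel borel (\<lambda>x. x + c)) f = integral\<^sup>L lborel f"
      unfolding lborel_distr_translation ..
  qed (use that in auto)
qed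

lemma lborel_reflection:
  fixes f :: "'a::euclidean_space \<Rightarrow> 'b::{banach, second_countable_topology}"
  assumes "f \<in> borel_measurable borel"
  shows "(\<integral>x. f (c - x) \<partial>lborel) = (\<integral>x. f x \<partial>lborel)"
proof (subst integral_distr[symmetric, of "\<lambda>x. c - x" lborel borel f])
  show "integral\<^sup>L (distr lborel borel (\<lambda>x. c - x)) f = integral\<^sup>L lborel f"
    unfolding lborel_distr_reflection ..
qed (use assms in auto)

text \<open>Continuity of translations at 0 in the L^1 norm. It comes first because
  \<open>integrable_induct\<close> applies to it; the L^2 version is deduced by truncation.\<close>

definition translation_cont :: "('a::euclidean_space \<Rightarrow> 'b::{banach, second_countable_topology}) \<Rightarrow> bool" where
  "translation_cont f \<longleftrightarrow> (\<forall>e>0. \<exists>d>0. \<forall>s. norm s < d \<longrightarrow> (\<integral>x. norm (f (x + s) - f x) \<partial>lborel) < e)"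

text \<open>Translation preserves the L^1 norm, so the error f - g is paid twice and the rest is the
  modulus of g: the property survives L^1 limits.\<close>

lemma translation_cont_approx:
  fixes f :: "'a::euclidean_space \<Rightarrow> 'b::{banach, second_countable_topology}"
  assumes f: "integrable lborel f"
    and ap: "\<And>e. e > 0 \<Longrightarrow> \<exists>g. integrable lborel g \<and> translation_cont g \<and> (\<integral>x. norm (f x - g x) \<partial>lborel) < e"
  shows "translation_cont f"
  unfolding translation_cont_def
proof (intro allI impI)
  fix e :: real assume "e > 0"
  obtain g where g: "integrable lborel g" "translation_cont g" "(\<integral>x. norm (f x - g x) \<partial>lborel) < e / 3"
    using ap[of "e / 3"] \<open>e > 0\<close> by auto
  obtain d where d: "d > 0" "\<And>s. norm s < d \<Longrightarrow> (\<integral>x. norm (g (x + s) - g x) \<partial>lborel) < e / 3"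
    using g(2)[unfolded translation_cont_def, rule_format, of "e / 3"] \<open>e > 0\<close> by auto
  have "(\<integral>x. norm (f (x + s) - f x) \<partial>lborel) < e" if s: "norm s < d" for s
  proof -
    have fg: "integrable lborel (\<lambda>x. norm (f x - g x))" by (intro integrable_norm Bochner_Integration.integrable_diff f g)
    have fgs: "integrable lborel (\<lambda>x. norm (f (x + s) - g (x + s)))" by (rule lborel_translation(1)[OF fg])
    have gs: "integrable lborel (\<lambda>x. norm (g (x + s) - g x))"
      by (intro integrable_norm Bochner_Integration.integrable_diff lborel_translation(1) g)
    have "(\<integral>x. norm (f (x + s) - f x) \<partial>lborel)
      \<le> (\<integral>x. norm (f (x + s) - g (x + s)) + norm (g (x + s) - g x) + norm (f x - g x) \<partial>lborel)"
    proof (rule integral_mono)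
      show "integrable lborel (\<lambda>x. norm (f (x + s) - f x))"
        by (intro integrable_norm Bochner_Integration.integrable_diff lborel_translation(1) f)
      show "norm (f (x + s) - f x) \<le> norm (f (x + s) - g (x + s)) + norm (g (x + s) - g x) + norm (f x - g x)" for x
      proof -
        have "norm (f (x + s) - f x) = norm ((f (x + s) - g (x + s)) + (g (x + s) - g x) - (f x - g x))" by simp
        then show ?thesis
          using norm_triangle_ineq4[of "(f (x + s) - g (x + s)) + (g (x + s) - g x)" "f x - g x"]
            norm_triangle_ineq[of "f (x + s) - g (x + s)" "g (x + s) - g x"] by linarith
      qed
    qed (intro Bochner_Integration.integrable_add fg fgs gs)
    also have "\<dots> = (\<integral>x. norm (f (x + s) - g (x + s)) \<partial>lborel) + (\<integral>x. norm (g (x + s) - g x) \<partial>lborel)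
        + (\<integral>x. norm (f x - g x) \<partial>lborel)"
      using fg fgs gs by simp
    also have "(\<integral>x. norm (f (x + s) - g (x + s)) \<partial>lborel) = (\<integral>x. norm (f x - g x) \<partial>lborel)"
      using borel_measurable_integrable[OF fg] by (intro lborel_translation(2)) simp
    finally show ?thesis using g(3) d(2)[OF s] by linarith
  qed
  then show "\<exists>d>0. \<forall>s. norm s < d \<longrightarrow> (\<integral>x. norm (f (x + s) - f x) \<partial>lborel) < e"
    using d(1) by blast
qed

text \<open>Openness suits dominated convergence: a point of U stays in U under small shifts, so the
  overlap of U with its shifts tends to the measure of U.\<close>

lemma translation_cont_open:
  fixes U :: "'a::euclidean_space set" and c :: "'b::{banach, second_countable_topology}"
  assumes U: "open U" "emeasure lborel U < \<infinity>"
  shows "translation_cont (\<lambda>x. indicator U x *\<^sub>R c)"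
proof -
  have Ub [measurable]: "U \<in> sets borel" using U(1) by simp
  have fi: "integrable lborel (\<lambda>x. indicator U x :: real)"
    using U by (intro integrable_real_indicator) auto
  define I where "I s = (\<integral>x. norm (indicator U (x + s) *\<^sub>R c - indicator U x *\<^sub>R c) \<partial>lborel)" for s
  define J where "J s = (\<integral>x. indicator U x * indicator U (x + s) \<partial>lborel :: real)" for s
  \<comment> \<open>The distance of two indicators is the sum of the two measures minus twice the
    overlap, and the measures agree by translation invariance.\<close>
  have IJ: "I s = norm c * (2 * measure lborel U - 2 * J s)" for s
  proof -
    have 1: "integrable lborel (\<lambda>x. indicator U (x + s) :: real)" by (rule lborel_translation(1)[OF fi])
    have 2: "integrable lborel (\<lambda>x. indicator U x * indicator U (x + s) :: real)"
      by (rule Bochner_Integration.integrable_bound[OF fi]) (auto simp: indicator_def)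
    have "I s = (\<integral>x. norm c * (indicator U (x + s) + indicator U x - 2 * (indicator U x * indicator U (x + s))) \<partial>lborel)"
      unfolding I_def by (intro Bochner_Integration.integral_cong) (auto simp: indicator_def)
    also have "\<dots> = norm c * ((\<integral>x. indicator U (x + s) \<partial>lborel) + (\<integral>x. indicator U x \<partial>lborel) - 2 * J s)"
      using 1 2 fi unfolding J_def by simp
    also have "(\<integral>x. indicator U (x + s) \<partial>lborel :: real) = (\<integral>x. indicator U x \<partial>lborel)"
      by (intro lborel_translation(2)) measurable
    also have "(\<integral>x. indicator U x \<partial>lborel :: real) = measure lborel U" by simp
    finally show ?thesis by (simp add: algebra_simps)
  qed
  have "(I \<longlongrightarrow> 0) (at 0)"
  proof (rule iffD2[OF tendsto_at_iff_sequentially], intro allI impI)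
    fix X :: "nat \<Rightarrow> 'a" assume "X \<longlonglongrightarrow> 0"
    have "(\<lambda>n. J (X n)) \<longlonglongrightarrow> (\<integral>x. indicator U x \<partial>lborel)"
      unfolding J_def
    proof (rule integral_dominated_convergence[where w = "\<lambda>x. indicator U x"])
      show "AE x in lborel. (\<lambda>n. indicator U x * indicator U (x + X n) :: real) \<longlonglongrightarrow> indicator U x"
      proof (rule AE_I2)
        fix x show "(\<lambda>n. indicator U x * indicator U (x + X n) :: real) \<longlonglongrightarrow> indicator U x"
        proof (cases "x \<in> U")
          case True
          have "(\<lambda>n. x + X n) \<longlonglongrightarrow> x + 0" by (intro tendsto_add tendsto_const \<open>X \<longlonglongrightarrow> 0\<close>)
          then have "eventually (\<lambda>n. x + X n \<in> U) sequentially"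
            using topological_tendstoD[OF _ U(1)] True by fastforce
          then have "eventually (\<lambda>n. (1::real) = indicator U x * indicator U (x + X n)) sequentially"
            by eventually_elim (simp add: True)
          then show ?thesis using True by (intro Lim_transform_eventually[OF tendsto_const]) simp_all
        qed simp
      qed
    qed (use fi in \<open>auto simp: indicator_def\<close>)
    then have "(\<lambda>n. norm c * (2 * measure lborel U - 2 * J (X n))) \<longlonglongrightarrow> norm c * (2 * measure lborel U - 2 * measure lborel U)"
      by (intro tendsto_intros) simp
    then show "((I \<circ> X) \<longlongrightarrow> 0) sequentially" by (simp add: IJ comp_def)
  qed
  then have "\<exists>d>0. \<forall>s. norm s < d \<longrightarrow> I s < e" if "e > 0" for e
  proof -
    have "I 0 = 0" by (simp add: I_def)
    have "eventually (\<lambda>s. dist (I s) 0 < e) (at 0)" using \<open>(I \<longlongrightarrow> 0) (at 0)\<close> that by (rule tendstoD)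
    then obtain d where d: "d > 0" "\<And>s. s \<noteq> 0 \<Longrightarrow> dist s 0 < d \<Longrightarrow> dist (I s) 0 < e"
      unfolding eventually_at by blast
    have "I s < e" if "norm s < d" for s
      using d(2)[of s] that \<open>I 0 = 0\<close> \<open>e > 0\<close> by (cases "s = 0") auto
    then show ?thesis using d(1) by blast
  qed
  then show ?thesis by (simp add: translation_cont_def I_def)
qed

text \<open>Indicators are approximated from outside by open sets of finite measure, sums are
  immediate, and limits dominated by 2 |f| go through
  \<open>translation_cont_approx\<close>.\<close>

lemma translation_cont_integrable:
  fixes f :: "'a::euclidean_space \<Rightarrow> 'b::{banach, second_countable_topology}"
  assumes "integrable lborel f"
  shows "translation_cont f"
  using assms
proof (induction rule: integrable_induct)
  case (base A c)
  have Ab: "A \<in> sets borel" using base by simp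
  have fin: "emeasure lborel A < \<infinity>" by (rule base(2))
  show ?case
  proof (rule translation_cont_approx)
    show "integrable lborel (\<lambda>x. indicator A x *\<^sub>R c)" using base by simp
    fix e :: real assume "e > 0"
    \<comment> \<open>The 1 in the denominator covers the value c = 0.\<close>
    define e' where "e' = e / (norm c + 1)"
    have e': "e' > 0" "norm c * e' < e"
      using \<open>e > 0\<close> by (auto simp: e'_def field_simps add_pos_nonneg intro!: divide_pos_pos)
    have "A \<in> sets lebesgue" using Ab by simp
    then obtain U where U: "open U" "A \<subseteq> U" "emeasure lebesgue (U - A) < ennreal e'"
      using sets_lebesgue_outer_open[OF _ e'(1)] by metis
    have Ub: "U \<in> sets borel" using U(1) by simp
    have UA: "emeasure lborel (U - A) < ennreal e'"
      using U(3) Ub Ab by (simp add: emeasure_completion)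
    have "emeasure lborel U \<le> emeasure lborel (U - A) + emeasure lborel A"
      using U(2) Ub Ab by (intro order_trans[OF _ emeasure_subadditive] emeasure_mono) auto
    also have "\<dots> < \<infinity>"
      using less_trans[OF UA ennreal_less_top] fin by (simp add: ennreal_add_less_top)
    finally have Ufin: "emeasure lborel U < \<infinity>" .
    have "(\<integral>x. norm (indicator A x *\<^sub>R c - indicator U x *\<^sub>R c) \<partial>lborel) = (\<integral>x. norm c * indicator (U - A) x \<partial>lborel)"
      using U(2) by (intro Bochner_Integration.integral_cong) (auto simp: indicator_def)
    also have "\<dots> = norm c * measure lborel (U - A)" using Ub Ab by simp
    also have "\<dots> \<le> norm c * e'"
    proof (intro mult_left_mono)
      show "measure lborel (U - A) \<le> e'"
        unfolding measure_def using UA e'(1) by (intro enn2real_leI) auto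
    qed simp
    also have "\<dots> < e" by (rule e'(2))
    finally show "\<exists>g. integrable lborel g \<and> translation_cont g \<and> (\<integral>x. norm (indicator A x *\<^sub>R c - g x) \<partial>lborel) < e"
      using translation_cont_open[OF U(1) Ufin, of c] Ub Ufin
      by (intro exI[of _ "\<lambda>x. indicator U x *\<^sub>R c"]) auto
  qed
next
  case (add f g)
  show ?case
    unfolding translation_cont_def
  proof (intro allI impI)
    fix e :: real assume "e > 0"
    obtain d1 where d1: "d1 > 0" "\<And>s. norm s < d1 \<Longrightarrow> (\<integral>x. norm (f (x + s) - f x) \<partial>lborel) < e / 2"
      using add.IH(1)[unfolded translation_cont_def, rule_format, of "e / 2"] \<open>e > 0\<close> by auto
    obtain d2 where d2: "d2 > 0" "\<And>s. norm s < d2 \<Longrightarrow> (\<integral>x. norm (g (x + s) - g x) \<partial>lborel) < e / 2"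
      using add.IH(2)[unfolded translation_cont_def, rule_format, of "e / 2"] \<open>e > 0\<close> by auto
    have "(\<integral>x. norm (f (x + s) + g (x + s) - (f x + g x)) \<partial>lborel) < e" if "norm s < min d1 d2" for s
    proof -
      have i: "integrable lborel (\<lambda>x. norm (f (x + s) - f x))" "integrable lborel (\<lambda>x. norm (g (x + s) - g x))"
        by (intro integrable_norm Bochner_Integration.integrable_diff lborel_translation(1) add.hyps)+
      have "(\<integral>x. norm (f (x + s) + g (x + s) - (f x + g x)) \<partial>lborel)
          \<le> (\<integral>x. norm (f (x + s) - f x) + norm (g (x + s) - g x) \<partial>lborel)"
      proof (rule integral_mono)
        show "integrable lborel (\<lambda>x. norm (f (x + s) + g (x + s) - (f x + g x)))"
          by (intro integrable_norm Bochner_Integration.integrable_diff Bochner_Integration.integrable_add lborel_translation(1) add.hyps)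
        show "norm (f (x + s) + g (x + s) - (f x + g x)) \<le> norm (f (x + s) - f x) + norm (g (x + s) - g x)" for x
          by (rule norm_diff_triangle_ineq)
      qed (intro Bochner_Integration.integrable_add i)
      then show ?thesis using d1(2)[of s] d2(2)[of s] that i by simp
    qed
    then show "\<exists>d>0. \<forall>s. norm s < d \<longrightarrow> (\<integral>x. norm (f (x + s) + g (x + s) - (f x + g x)) \<partial>lborel) < e"
      using d1(1) d2(1) by (intro exI[of _ "min d1 d2"]) simp
  qed
next
  case (lim f s)
  show ?case
  proof (rule translation_cont_approx[OF lim.hyps(4)])
    fix e :: real assume "e > 0"
    have sb: "\<And>i. s i \<in> borel_measurable lborel" "f \<in> borel_measurable lborel"
      using lim.hyps(1,4) by (auto intro: borel_measurable_integrable)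
    have "(\<lambda>i. \<integral>x. norm (f x - s i x) \<partial>lborel) \<longlonglongrightarrow> (\<integral>x. 0 \<partial>(lborel::'a measure))"
    proof (rule integral_dominated_convergence[where w = "\<lambda>x. 3 * norm (f x)"])
      show "AE x in lborel. (\<lambda>i. norm (f x - s i x)) \<longlonglongrightarrow> 0"
      proof (rule AE_I2)
        fix x :: 'a
        have "(\<lambda>i. norm (f x - s i x)) \<longlonglongrightarrow> norm (f x - f x)"
          using lim.hyps(2)[of x] by (intro tendsto_norm tendsto_diff tendsto_const) simp
        then show "(\<lambda>i. norm (f x - s i x)) \<longlonglongrightarrow> 0" by simp
      qed
      show "AE x in lborel. norm (norm (f x - s i x)) \<le> 3 * norm (f x)" for i
      proof (rule AE_I2)
        fix x :: 'a
        have "norm (f x - s i x) \<le> norm (f x) + norm (s i x)" by (rule norm_triangle_ineq4)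
        then show "norm (norm (f x - s i x)) \<le> 3 * norm (f x)" using lim.hyps(3)[of x i] by simp
      qed
    qed (use sb lim.hyps(4) in auto)
    then have "eventually (\<lambda>i. (\<integral>x. norm (f x - s i x) \<partial>lborel) < e) sequentially"
      using \<open>e > 0\<close> by (intro order_tendstoD(2)) simp_all
    then obtain i where "(\<integral>x. norm (f x - s i x) \<partial>lborel) < e"
      using eventually_happens sequentially_bot by blast
    then show "\<exists>g. integrable lborel g \<and> translation_cont g \<and> (\<integral>x. norm (f x - g x) \<partial>lborel) < e"
      using lim.hyps(1) lim.IH by blast
  qed
qed

lemma sq_integrable_translation:
  fixes f :: "'a::euclidean_space \<Rightarrow> complex"
  assumes "sq_integrable lborel f"
  shows "sq_integrable lborel (\<lambda>x. f (x + s))" "l2_norm lborel (\<lambda>x. f (x + s)) = l2_norm lborel f"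
proof -
  have [measurable]: "f \<in> borel_measurable borel" using sq_integrableD(1)[OF assms] by simp
  show "sq_integrable lborel (\<lambda>x. f (x + s))"
    unfolding sq_integrable_def using lborel_translation(1)[OF sq_integrableD(2)[OF assms]] by simp
  show "l2_norm lborel (\<lambda>x. f (x + s)) = l2_norm lborel f"
    unfolding l2_norm_def by (subst lborel_translation(2)[of "\<lambda>x. (cmod (f x))\<^sup>2"]) auto
qed

lemma translation_cont_l2:
  fixes f :: "'a::euclidean_space \<Rightarrow> complex"
  assumes f: "sq_integrable lborel f" and "e > 0"
  shows "\<exists>d>0. \<forall>s. norm s < d \<longrightarrow> l2_norm lborel (\<lambda>x. f (x + s) - f x) < e"
proof -
  have fb [measurable]: "f \<in> borel_measurable borel" using sq_integrableD(1)[OF f] by simp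
  have f2: "integrable lborel (\<lambda>x. (cmod (f x))\<^sup>2)" by (rule sq_integrableD(2)[OF f])
  \<comment> \<open>The lower cut makes \<open>g n\<close> integrable, since |g| <= (n + 1) |f|^2;
    the upper cut makes it bounded, so that squares of its differences are controlled by the
    differences themselves.\<close>
  define g where "g n x = (if 1 / real (Suc n) \<le> cmod (f x) \<and> cmod (f x) \<le> real (Suc n) then f x else 0)" for n x
  have gb [measurable]: "g n \<in> borel_measurable borel" for n unfolding g_def[abs_def] by measurable
  have g_le: "cmod (g n x) \<le> cmod (f x)" and g_bd: "cmod (g n x) \<le> real (Suc n)" for n x by (auto simp: g_def)
  have fg_le: "cmod (f x - g n x) \<le> cmod (f x)" for n x by (auto simp: g_def)
  have gs: "sq_integrable lborel (g n)" for n
    by (rule sq_integrable_bound[OF _ f2]) (auto intro!: power_mono g_le)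
  have fgs: "sq_integrable lborel (\<lambda>x. f x - g n x)" for n by (rule sq_integrable_diff[OF f gs])
  have gi: "integrable lborel (g n)" for n
  proof (rule Bochner_Integration.integrable_bound)
    show "integrable lborel (\<lambda>x. real (Suc n) * (cmod (f x))\<^sup>2)" using f2 by simp
    have "cmod (g n x) \<le> real (Suc n) * (cmod (f x))\<^sup>2" for x
    proof (cases "1 / real (Suc n) \<le> cmod (f x) \<and> cmod (f x) \<le> real (Suc n)")
      case True
      then have "1 \<le> cmod (f x) * real (Suc n)" by (simp add: pos_divide_le_eq)
      then have "1 * cmod (f x) \<le> (cmod (f x) * real (Suc n)) * cmod (f x)" by (intro mult_right_mono) auto
      moreover have "g n x = f x" using True by (simp add: g_def)
      ultimately show ?thesis by (simp add: power2_eq_square algebra_simps)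
    next
      case False
      then have "g n x = 0" by (simp only: g_def if_False)
      then show ?thesis by simp
    qed
    then show "AE x in lborel. norm (g n x) \<le> norm (real (Suc n) * (cmod (f x))\<^sup>2)" by (intro AE_I2) simp
  qed simp
  have "(\<lambda>n. \<integral>x. (cmod (f x - g n x))\<^sup>2 \<partial>lborel) \<longlonglongrightarrow> (\<integral>x. 0 \<partial>(lborel::'a measure))"
  proof (rule integral_dominated_convergence[where w = "\<lambda>x. (cmod (f x))\<^sup>2"])
    show "AE x in lborel. norm ((cmod (f x - g n x))\<^sup>2) \<le> (cmod (f x))\<^sup>2" for n
      by (intro AE_I2) (simp add: power_mono fg_le)
    show "AE x in lborel. (\<lambda>n. (cmod (f x - g n x))\<^sup>2) \<longlonglongrightarrow> 0"
    proof (rule AE_I2)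
      fix x
      obtain N1 :: nat where N1: "cmod (f x) \<le> real N1" using real_arch_simple by blast
      have "\<exists>N2::nat. f x \<noteq> 0 \<longrightarrow> 1 / cmod (f x) \<le> real N2" using real_arch_simple by blast
      then obtain N2 :: nat where N2: "f x \<noteq> 0 \<Longrightarrow> 1 / cmod (f x) \<le> real N2" by blast
      have "f x - g n x = 0" if "n \<ge> max N1 N2" for n
      proof (cases "f x = 0")
        case False
        have "cmod (f x) \<le> real (Suc n)" using N1 that by simp
        moreover have "1 / cmod (f x) \<le> real (Suc n)" using N2[OF False] that by simp
        then have "1 / real (Suc n) \<le> cmod (f x)" using False by (simp add: field_simps)
        ultimately show ?thesis by (simp add: g_def)
      qed (simp add: g_def)
      then have "eventually (\<lambda>n. 0 = (cmod (f x - g n x))\<^sup>2) sequentially"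
        unfolding eventually_sequentially by (intro exI[of _ "max N1 N2"]) simp
      then show "(\<lambda>n. (cmod (f x - g n x))\<^sup>2) \<longlonglongrightarrow> 0" by (rule Lim_transform_eventually[OF tendsto_const])
    qed
  qed (use f2 in auto)
  then have "eventually (\<lambda>n. (\<integral>x. (cmod (f x - g n x))\<^sup>2 \<partial>lborel) < (e / 3)\<^sup>2) sequentially"
    using \<open>e > 0\<close> by (intro order_tendstoD(2)[OF _ zero_less_power]) simp_all
  then obtain n where n: "(\<integral>x. (cmod (f x - g n x))\<^sup>2 \<partial>lborel) < (e / 3)\<^sup>2"
    using eventually_happens sequentially_bot by blast
  have fgn: "l2_norm lborel (\<lambda>x. f x - g n x) < e / 3"
    using n \<open>e > 0\<close> unfolding l2_norm_square[symmetric] by (intro power2_less_imp_less[of _ "e / 3"]) auto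
  define B where "B = 2 * real (Suc n)"
  have B: "B > 0" by (simp add: B_def)
  obtain d where d: "d > 0" "\<And>s. norm s < d \<Longrightarrow> (\<integral>x. norm (g n (x + s) - g n x) \<partial>lborel) < (e / 3)\<^sup>2 / B"
    using translation_cont_integrable[OF gi, unfolded translation_cont_def, rule_format, of "(e / 3)\<^sup>2 / B" n] \<open>e > 0\<close> B by auto
  have "l2_norm lborel (\<lambda>x. f (x + s) - f x) < e" if s: "norm s < d" for s
  proof -
    have gd: "sq_integrable lborel (\<lambda>x. g n (x + s) - g n x)"
      by (intro sq_integrable_diff sq_integrable_translation(1) gs)
    have "(l2_norm lborel (\<lambda>x. g n (x + s) - g n x))\<^sup>2 \<le> (\<integral>x. B * norm (g n (x + s) - g n x) \<partial>lborel)"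
      unfolding l2_norm_square
    proof (rule integral_mono)
      show "integrable lborel (\<lambda>x. B * norm (g n (x + s) - g n x))"
        by (intro integrable_mult_right integrable_norm Bochner_Integration.integrable_diff lborel_translation(1) gi)
      have "norm (g n (x + s) - g n x) \<le> B" for x
        using norm_triangle_ineq4[of "g n (x + s)" "g n x"] g_bd[of n x] g_bd[of n "x + s"] by (simp add: B_def)
      then show "(cmod (g n (x + s) - g n x))\<^sup>2 \<le> B * norm (g n (x + s) - g n x)" for x
        unfolding power2_eq_square by (intro mult_right_mono) auto
    qed (rule sq_integrableD(2)[OF gd])
    also have "\<dots> < (e / 3)\<^sup>2" using d(2)[OF s] B by (simp add: pos_less_divide_eq mult.commute)
    finally have 1: "l2_norm lborel (\<lambda>x. g n (x + s) - g n x) < e / 3"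
      using \<open>e > 0\<close> by (intro power2_less_imp_less[of _ "e / 3"]) auto
    have fs: "sq_integrable lborel (\<lambda>x. f (x + s))" and gss: "sq_integrable lborel (\<lambda>x. g n (x + s))"
      by (intro sq_integrable_translation(1) f gs)+
    have 2: "l2_norm lborel (\<lambda>x. f (x + s) - g n (x + s)) = l2_norm lborel (\<lambda>x. f x - g n x)"
      by (rule sq_integrable_translation(2)[OF fgs])
    have "l2_norm lborel (\<lambda>x. f (x + s) - f x) \<le> l2_norm lborel (\<lambda>x. f (x + s) - g n (x + s)) + l2_norm lborel (\<lambda>x. g n (x + s) - f x)"
      by (rule l2_triangle_diff[OF fs gss f])
    also have "l2_norm lborel (\<lambda>x. g n (x + s) - f x) \<le> l2_norm lborel (\<lambda>x. g n (x + s) - g n x) + l2_norm lborel (\<lambda>x. g n x - f x)"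
      by (rule l2_triangle_diff[OF gss gs f])
    finally show ?thesis using 1 2 fgn l2_norm_minus_commute[of lborel f "g n"] by linarith
  qed
  then show ?thesis using d(1) by blast
qed

subsection \<open>Mollification\<close>

definition conv :: "('a::euclidean_space \<Rightarrow> complex) \<Rightarrow> ('a \<Rightarrow> complex) \<Rightarrow> 'a \<Rightarrow> complex" where
  "conv f k x = (\<integral>z. f z * k (x - z) \<partial>lborel)"

lemma conv_alt:
  assumes [measurable]: "f \<in> borel_measurable borel" "k \<in> borel_measurable borel"
  shows "conv f k x = (\<integral>s. f (x - s) * k s \<partial>lborel)"
  using lborel_reflection[of "\<lambda>z. f z * k (x - z)" x] by (simp add: conv_def)

lemma conv_measurable [measurable]:
  assumes [measurable]: "f \<in> borel_measurable borel" "k \<in> borel_measurable borel"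
  shows "conv f k \<in> borel_measurable borel"
proof -
  have "(\<lambda>x. \<integral>z. f z * k (x - z) \<partial>lborel) \<in> borel_measurable borel"
    by (rule lborel.borel_measurable_lebesgue_integral) measurable
  then show ?thesis by (simp add: conv_def[abs_def])
qed

text \<open>Jensen's inequality (as Cauchy-Schwarz for the kernel) and Tonelli.\<close>

lemma conv_l2_close:
  fixes f :: "'a::euclidean_space \<Rightarrow> complex" and k :: "'a \<Rightarrow> real"
  assumes f: "sq_integrable lborel f"
    and k: "continuous_on UNIV k" "\<And>s. 0 \<le> k s" "\<And>s. k s \<le> B" "integrable lborel k" "(\<integral>s. k s \<partial>lborel) = 1"
    and close: "\<And>s. k s \<noteq> 0 \<Longrightarrow> l2_norm lborel (\<lambda>x. f (x + - s) - f x) \<le> e" and "0 \<le> e"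
  shows "sq_integrable lborel (conv f (\<lambda>s. of_real (k s)))"
    "l2_norm lborel (\<lambda>x. conv f (\<lambda>s. of_real (k s)) x - f x) \<le> e"
proof -
  have fb [measurable]: "f \<in> borel_measurable borel" using sq_integrableD(1)[OF f] by simp
  have kb [measurable]: "k \<in> borel_measurable borel" using k(1) by (rule borel_measurable_continuous_onI)
  let ?k = "\<lambda>s. complex_of_real (k s)"
  have kc [measurable]: "?k \<in> borel_measurable borel" by measurable
  have B: "0 \<le> B" using k(2,3) order_trans by blast
  have refl: "sq_integrable lborel (\<lambda>s. f (x - s))" for x
  proof -
    have "integrable lborel (\<lambda>s. (cmod (f (x - s)))\<^sup>2)"
      using sq_integrableD(2)[OF f]
      by (subst integrable_distr_eq[symmetric, of "\<lambda>s. x - s" lborel borel "\<lambda>s. (cmod (f s))\<^sup>2"])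
         (auto simp: lborel_distr_reflection)
    then show ?thesis unfolding sq_integrable_def by simp
  qed
  \<comment> \<open>Splitting k = sqrt k sqrt k turns \<open>conv f k x - f x\<close> into an inner
    product with sqrt k, whose L^2 norm is 1 because k has integral 1.\<close>
  have sk: "sq_integrable lborel (\<lambda>s. of_real (sqrt (k s)))"
    unfolding sq_integrable_def using k(2,4) by simp
  have cs: "ennreal ((cmod (conv f ?k x - f x))\<^sup>2) \<le> (\<integral>\<^sup>+s. ennreal ((cmod (f (x - s) - f x))\<^sup>2 * k s) \<partial>lborel)" for x
  proof -
    have fk: "sq_integrable lborel (\<lambda>s. f (x - s) * of_real (sqrt (k s)))"
    proof (rule sq_integrable_bound)
      show "integrable lborel (\<lambda>s. B * (cmod (f (x - s)))\<^sup>2)"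
        using sq_integrableD(2)[OF refl[of x]] by simp
      show "AE s in lborel. (cmod (f (x - s) * of_real (sqrt (k s))))\<^sup>2 \<le> B * (cmod (f (x - s)))\<^sup>2"
        using k(2,3) by (intro AE_I2) (simp add: norm_mult power_mult_distrib mult.commute mult_right_mono)
    qed measurable
    have fk2: "sq_integrable lborel (\<lambda>s. f x * of_real (sqrt (k s)))" by (rule sq_integrable_scale[OF sk])
    have d: "sq_integrable lborel (\<lambda>s. f (x - s) * of_real (sqrt (k s)) - f x * of_real (sqrt (k s)))"
      by (rule sq_integrable_diff[OF fk fk2])
    have sq: "of_real (sqrt (k s)) * of_real (sqrt (k s)) = ?k s" for s
      using k(2)[of s] by (simp flip: of_real_mult)
    have i1: "integrable lborel (\<lambda>s. f (x - s) * ?k s)"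
      using sq_integrable_mult_integrable[OF fk sk] by (simp add: mult.assoc sq)
    have i2: "integrable lborel (\<lambda>s. f x * ?k s)" using k(4) by (intro integrable_mult_right integrable_of_real)
    have kint: "(\<integral>s. ?k s \<partial>lborel) = 1" using k(5) by simp
    have "conv f ?k x - f x = (\<integral>s. f (x - s) * ?k s \<partial>lborel) - (\<integral>s. f x * ?k s \<partial>lborel)"
      using kint by (simp add: conv_alt)
    also have "\<dots> = (\<integral>s. f (x - s) * ?k s - f x * ?k s \<partial>lborel)"
      by (rule Bochner_Integration.integral_diff[OF i1 i2, symmetric])
    also have "\<dots> = l2_inner lborel (\<lambda>s. f (x - s) * of_real (sqrt (k s)) - f x * of_real (sqrt (k s))) (\<lambda>s. of_real (sqrt (k s)))"
      unfolding l2_inner_def by (intro Bochner_Integration.integral_cong) (simp_all add: left_diff_distrib mult.assoc sq)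
    finally have "cmod (conv f ?k x - f x) \<le> l2_norm lborel (\<lambda>s. f (x - s) * of_real (sqrt (k s)) - f x * of_real (sqrt (k s)))
        * l2_norm lborel (\<lambda>s. of_real (sqrt (k s)))"
      using l2_cauchy_schwarz[OF d sk] by simp
    moreover have "l2_norm lborel (\<lambda>s. of_real (sqrt (k s))) = 1"
      using k(2,5) by (simp add: l2_norm_def)
    ultimately have "(cmod (conv f ?k x - f x))\<^sup>2 \<le> (l2_norm lborel (\<lambda>s. f (x - s) * of_real (sqrt (k s)) - f x * of_real (sqrt (k s))))\<^sup>2"
      by (intro power_mono) simp_all
    also have "\<dots> = (\<integral>s. (cmod (f (x - s) - f x))\<^sup>2 * k s \<partial>lborel)"
      unfolding l2_norm_square using k(2)
      by (intro Bochner_Integration.integral_cong) (simp_all flip: left_diff_distrib add: norm_mult power_mult_distrib)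
    also have "ennreal \<dots> = (\<integral>\<^sup>+s. ennreal ((cmod (f (x - s) - f x))\<^sup>2 * k s) \<partial>lborel)"
    proof (rule nn_integral_eq_integral[symmetric])
      have "(\<lambda>s. (cmod (f (x - s) * of_real (sqrt (k s)) - f x * of_real (sqrt (k s))))\<^sup>2) = (\<lambda>s. (cmod (f (x - s) - f x))\<^sup>2 * k s)"
        using k(2) by (intro ext) (simp flip: left_diff_distrib add: norm_mult power_mult_distrib)
      then show "integrable lborel (\<lambda>s. (cmod (f (x - s) - f x))\<^sup>2 * k s)" using sq_integrableD(2)[OF d] by simp
    qed (use k(2) in simp)
    finally show ?thesis by (simp add: ennreal_leI)
  qed
  have "(\<integral>\<^sup>+x. ennreal ((cmod (conv f ?k x - f x))\<^sup>2) \<partial>lborel)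
      \<le> (\<integral>\<^sup>+x. \<integral>\<^sup>+s. ennreal ((cmod (f (x - s) - f x))\<^sup>2 * k s) \<partial>lborel \<partial>lborel)"
    by (intro nn_integral_mono cs)
  also have "\<dots> = (\<integral>\<^sup>+s. \<integral>\<^sup>+x. ennreal ((cmod (f (x - s) - f x))\<^sup>2 * k s) \<partial>lborel \<partial>lborel)"
    by (rule lborel_pair.Fubini') measurable
  \<comment> \<open>Only shifts s with k s nonzero contribute, and for these \<open>close\<close>
    applies.\<close>
  also have "\<dots> \<le> (\<integral>\<^sup>+s. ennreal (e\<^sup>2 * k s) \<partial>lborel)"
  proof (intro nn_integral_mono)
    fix s
    show "(\<integral>\<^sup>+x. ennreal ((cmod (f (x - s) - f x))\<^sup>2 * k s) \<partial>lborel) \<le> ennreal (e\<^sup>2 * k s)"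
    proof (cases "k s = 0")
      case False
      have d: "sq_integrable lborel (\<lambda>x. f (x + - s) - f x)"
        by (intro sq_integrable_diff sq_integrable_translation(1) f)
      have "(\<integral>\<^sup>+x. ennreal ((cmod (f (x - s) - f x))\<^sup>2 * k s) \<partial>lborel) = ennreal (\<integral>x. (cmod (f (x - s) - f x))\<^sup>2 * k s \<partial>lborel)"
        using sq_integrableD(2)[OF d] k(2) by (intro nn_integral_eq_integral) auto
      also have "(\<integral>x. (cmod (f (x - s) - f x))\<^sup>2 * k s \<partial>lborel) = (l2_norm lborel (\<lambda>x. f (x + - s) - f x))\<^sup>2 * k s"
        unfolding l2_norm_square by simp
      also have "\<dots> \<le> e\<^sup>2 * k s"
        using k(2) by (intro mult_right_mono power_mono close False) (auto simp: l2_norm_nonneg)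
      finally show ?thesis by (simp add: ennreal_leI)
    qed simp
  qed
  also have "\<dots> = ennreal (e\<^sup>2)"
    using k(2,4,5) by (subst nn_integral_eq_integral) auto
  finally have le: "(\<integral>\<^sup>+x. ennreal ((cmod (conv f ?k x - f x))\<^sup>2) \<partial>lborel) \<le> ennreal (e\<^sup>2)" .
  have i: "integrable lborel (\<lambda>x. (cmod (conv f ?k x - f x))\<^sup>2)"
    by (rule integrableI_bounded) (use le_less_trans[OF le ennreal_less_top] in auto)
  then have sqd: "sq_integrable lborel (\<lambda>x. conv f ?k x - f x)" by (simp add: sq_integrable_def)
  show "sq_integrable lborel (conv f ?k)"
    using sq_integrable_add[OF sqd f] by simp
  have "ennreal ((l2_norm lborel (\<lambda>x. conv f ?k x - f x))\<^sup>2) \<le> ennreal (e\<^sup>2)"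
    using le i by (simp add: nn_integral_eq_integral l2_norm_square)
  then have "(l2_norm lborel (\<lambda>x. conv f ?k x - f x))\<^sup>2 \<le> e\<^sup>2" by (simp add: ennreal_le_iff)
  then show "l2_norm lborel (\<lambda>x. conv f ?k x - f x) \<le> e" using \<open>0 \<le> e\<close> by (rule power2_le_imp_le)
qed

section \<open>Test functions\<close>

lemma test_functionI:
  assumes "smooth_map \<phi>" "compact C" "C \<subseteq> V" "\<And>x. \<phi> x \<noteq> 0 \<Longrightarrow> x \<in> C"
  shows "test_function V \<phi>"
proof -
  have 1: "closure {x. \<phi> x \<noteq> 0} \<subseteq> C"
    by (rule closure_minimal) (use compact_imp_closed[OF assms(2)] assms(4) in blast)+
  have "compact (C \<inter> closure {x. \<phi> x \<noteq> 0})"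
    by (rule compact_Int_closed[OF assms(2) closed_closure])
  moreover have "C \<inter> closure {x. \<phi> x \<noteq> 0} = closure {x. \<phi> x \<noteq> 0}" using 1 by blast
  ultimately have "compact (closure {x. \<phi> x \<noteq> 0})" by simp
  then show ?thesis
    unfolding test_function_def using assms(1) order_trans[OF 1 assms(3)] by blast
qed

lemma test_functionD:
  assumes "test_function V \<phi>"
  shows "smooth_map \<phi>" "compact (closure {x. \<phi> x \<noteq> 0})" "closure {x. \<phi> x \<noteq> 0} \<subseteq> V"
  using assms by (auto simp: test_function_def)

lemma test_function_mono: "test_function V \<phi> \<Longrightarrow> V \<subseteq> W \<Longrightarrow> test_function W \<phi>"
  by (auto simp: test_function_def)

lemma test_function_zero_outside:
  assumes "test_function V \<phi>"
  obtains R where "R > 0" "\<And>x. norm x > R \<Longrightarrow> \<phi> x = 0"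
proof -
  obtain R where R: "R > 0" "\<And>x. x \<in> closure {x. \<phi> x \<noteq> 0} \<Longrightarrow> norm x \<le> R"
    using compact_imp_bounded[OF test_functionD(2)[OF assms]] unfolding bounded_pos by blast
  have "\<phi> x = 0" if "norm x > R" for x
    using R(2)[of x] closure_subset[of "{x. \<phi> x \<noteq> 0}"] that by (meson mem_Collect_eq not_le subsetD)
  then show thesis using R(1) that by blast
qed

lemma frechet_derivative_zero_outside:
  assumes "smooth_map \<phi>" "x \<notin> closure {x. \<phi> x \<noteq> 0}"
  shows "frechet_derivative \<phi> (at x) v = 0"
proof -
  have "(\<phi> has_derivative (\<lambda>v. 0)) (at x)"
  proof (rule has_derivative_transform_within_open[of "\<lambda>x. 0" "\<lambda>v. 0" x UNIV "- closure {x. \<phi> x \<noteq> 0}"])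
    show "0 = \<phi> y" if "y \<in> - closure {x. \<phi> x \<noteq> 0}" for y
      using that closure_subset[of "{x. \<phi> x \<noteq> 0}"] by auto
  qed (use assms(2) in auto)
  then have "frechet_derivative \<phi> (at x) = (\<lambda>v. 0)" by (metis frechet_derivative_at)
  then show ?thesis by simp
qed

lemma test_function_frechet_derivative:
  assumes "test_function V \<phi>"
  shows "test_function V (\<lambda>x. frechet_derivative \<phi> (at x) v)"
proof (rule test_functionI)
  show "x \<in> closure {x. \<phi> x \<noteq> 0}" if "frechet_derivative \<phi> (at x) v \<noteq> 0" for x
    using frechet_derivative_zero_outside[OF test_functionD(1)[OF assms]] that by blast
qed (use test_functionD[OF assms] smooth_map_frechet_derivative[OF test_functionD(1)[OF assms]] in auto)

lemma test_function_mult: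
  assumes "test_function V \<phi>" "smooth_map \<psi>"
  shows "test_function V (\<lambda>x. \<psi> x * \<phi> x)"
proof (rule test_functionI)
  show "x \<in> closure {x. \<phi> x \<noteq> 0}" if "\<psi> x * \<phi> x \<noteq> 0" for x
    using that closure_subset[of "{x. \<phi> x \<noteq> 0}"] by auto
qed (use test_functionD[OF assms(1)] smooth_map_mult[OF assms(2) test_functionD(1)[OF assms(1)]] in auto)

lemma test_function_diff:
  assumes "test_function V \<phi>" "test_function V \<psi>"
  shows "test_function V (\<lambda>x. \<phi> x - \<psi> x)"
proof (rule test_functionI)
  show "x \<in> closure {x. \<phi> x \<noteq> 0} \<union> closure {x. \<psi> x \<noteq> 0}" if "\<phi> x - \<psi> x \<noteq> 0" for x
    using that closure_subset[of "{x. \<phi> x \<noteq> 0}"] closure_subset[of "{x. \<psi> x \<noteq> 0}"]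
    by (cases "\<phi> x = 0") auto
qed (use test_functionD[OF assms(1)] test_functionD[OF assms(2)]
    smooth_map_diff[OF test_functionD(1)[OF assms(1)] test_functionD(1)[OF assms(2)]] in auto)

lemma test_function_0: "test_function V (\<lambda>x. 0)"
  by (rule test_functionI[of _ "{}"]) auto

lemma integrable_continuous_compact_support:
  fixes f :: "real \<times> real \<Rightarrow> 'b::{banach, second_countable_topology}"
  assumes "continuous_on UNIV f" "\<And>x. norm x > R \<Longrightarrow> f x = 0"
  shows "integrable lborel f"
proof -
  have "integrable lborel (\<lambda>x. indicator (cball 0 R) x *\<^sub>R f x)"
    by (rule borel_integrable_compact) (auto intro: continuous_on_subset[OF assms(1)])
  moreover have "(\<lambda>x. indicator (cball 0 R) x *\<^sub>R f x) = f"
    using assms(2) by (auto simp: indicator_def fun_eq_iff)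
  ultimately show ?thesis by simp
qed

lemma test_function_integrable: "test_function V \<phi> \<Longrightarrow> integrable lborel \<phi>"
  by (metis integrable_continuous_compact_support smooth_map_continuous test_functionD(1) test_function_zero_outside)

lemma test_function_measurable: "test_function V \<phi> \<Longrightarrow> \<phi> \<in> borel_measurable borel"
  by (simp add: borel_measurable_continuous_onI smooth_map_continuous test_functionD(1))

lemma test_function_sq_integrable:
  assumes "test_function V \<phi>" shows "sq_integrable lborel \<phi>"
proof -
  obtain R where "\<And>x. norm x > R \<Longrightarrow> \<phi> x = 0" using test_function_zero_outside[OF assms] by blast
  then have "integrable lborel (\<lambda>x. (cmod (\<phi> x))\<^sup>2)"
    by (intro integrable_continuous_compact_support[of _ R] continuous_intros smooth_map_continuous test_functionD(1)[OF assms]) auto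
  then show ?thesis using test_function_measurable[OF assms] by (simp add: sq_integrable_def)
qed

lemma test_function_bounded:
  assumes "test_function V \<phi>"
  obtains B where "B > 0" "\<And>x. cmod (\<phi> x) \<le> B"
proof -
  obtain R where R: "\<And>x. norm x > R \<Longrightarrow> \<phi> x = 0" using test_function_zero_outside[OF assms] by blast
  have "compact (\<phi> ` cball 0 R)"
    by (intro compact_continuous_image compact_cball smooth_map_continuous test_functionD(1)[OF assms])
  then obtain B where B: "B > 0" "\<forall>y\<in>\<phi> ` cball 0 R. cmod y \<le> B"
    using compact_imp_bounded[of "\<phi> ` cball 0 R"] unfolding bounded_pos by blast
  have "cmod (\<phi> x) \<le> B" for x using B R[of x] by (cases "norm x > R") auto
  then show thesis using B(1) that by blast
qed

lemma test_function_uniformly_continuous: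
  assumes "test_function V \<phi>" "e > 0"
  shows "\<exists>d>0. \<forall>x y. norm (y - x) < d \<longrightarrow> cmod (\<phi> y - \<phi> x) < e"
proof -
  obtain R where R: "\<And>x. norm x > R \<Longrightarrow> \<phi> x = 0" using test_function_zero_outside[OF assms(1)] by blast
  have "uniformly_continuous_on (cball 0 (R + 1)) \<phi>"
    by (intro compact_uniformly_continuous smooth_map_continuous test_functionD(1)[OF assms(1)] compact_cball)
  then obtain d where d: "d > 0" "\<And>x y. x \<in> cball 0 (R + 1) \<Longrightarrow> y \<in> cball 0 (R + 1) \<Longrightarrow> dist y x < d \<Longrightarrow> dist (\<phi> y) (\<phi> x) < e"
    unfolding uniformly_continuous_on_def using \<open>e > 0\<close> by blast
  have "cmod (\<phi> y - \<phi> x) < e" if xy: "norm (y - x) < min d 1" for x y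
  proof (cases "norm x \<le> R + 1 \<and> norm y \<le> R + 1")
    case True then show ?thesis using d(2)[of x y] xy by (simp add: dist_norm)
  next
    case False
    have "norm y \<le> norm x + norm (y - x)" "norm x \<le> norm y + norm (y - x)"
      by (metis add_diff_cancel_left' diff_add_cancel norm_triangle_ineq add.commute)
        (metis norm_minus_commute norm_triangle_sub)
    then have "norm x > R" "norm y > R" using False xy by auto
    then show ?thesis using R \<open>e > 0\<close> by simp
  qed
  then show ?thesis using d(1) by (intro exI[of _ "min d 1"]) simp
qed

lemma frechet_derivative_basis:
  fixes \<phi> :: "real \<times> real \<Rightarrow> complex"
  assumes "smooth_map \<phi>"
  shows "frechet_derivative \<phi> (at x) v = (\<Sum>b\<in>Basis. (v \<bullet> b) *\<^sub>R frechet_derivative \<phi> (at x) b)"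
proof -
  interpret L: linear "frechet_derivative \<phi> (at x)"
    by (rule has_derivative_linear[OF smooth_map_has_derivative[OF assms]])
  have "frechet_derivative \<phi> (at x) v = frechet_derivative \<phi> (at x) (\<Sum>b\<in>Basis. (v \<bullet> b) *\<^sub>R b)"
    by (simp only: euclidean_representation)
  also have "\<dots> = (\<Sum>b\<in>Basis. (v \<bullet> b) *\<^sub>R frechet_derivative \<phi> (at x) b)"
    by (simp only: L.sum L.scale)
  finally show ?thesis .
qed

text \<open>The partial derivatives are uniformly continuous, so the mean value inequality gives a
  first-order error that is uniform in the base point. This is what lets a derivative pass under an
  integral against a merely integrable density.\<close>

lemma test_function_uniformly_linear:
  assumes \<phi>: "test_function V \<phi>" and "e > 0"
  shows "\<exists>d>0. \<forall>x y. norm (y - x) < d \<longrightarrow>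
    cmod (\<phi> y - \<phi> x - frechet_derivative \<phi> (at x) (y - x)) \<le> e * norm (y - x)"
proof -
  let ?D = "\<lambda>x v. frechet_derivative \<phi> (at x) v"
  note sm = test_functionD(1)[OF \<phi>]
  let ?n = "real (card (Basis :: (real \<times> real) set)) + 1"
  have en: "e / ?n > 0" using \<open>e > 0\<close> by simp
  have "\<forall>b. \<exists>d>0. \<forall>x y. norm (y - x) < d \<longrightarrow> cmod (?D y b - ?D x b) < e / ?n"
    using test_function_uniformly_continuous[OF test_function_frechet_derivative[OF \<phi>] en] by blast
  then obtain d where d: "\<And>b. d b > 0" "\<And>b x y. norm (y - x) < d b \<Longrightarrow> cmod (?D y b - ?D x b) < e / ?n"
    by metis
  define d' where "d' = Min (d ` Basis)"
  have d': "d' > 0" "\<And>b. b \<in> Basis \<Longrightarrow> d' \<le> d b" unfolding d'_def using d(1) by auto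
  have "cmod (\<phi> y - \<phi> x - ?D x (y - x)) \<le> norm (y - x) * e" if xy: "norm (y - x) < d'" for x y
  proof (rule differentiable_bound_linearization[where S = "ball x d'" and f' = "\<lambda>x. frechet_derivative \<phi> (at x)"])
    show "x + t *\<^sub>R (y - x) \<in> ball x d'" if "t \<in> {0..1}" for t
    proof -
      have "t * norm (y - x) \<le> 1 * norm (y - x)" using that by (intro mult_right_mono) auto
      then show ?thesis using that xy by (simp add: dist_norm)
    qed
    show "(\<phi> has_derivative frechet_derivative \<phi> (at z)) (at z within ball x d')" for z
      by (rule has_derivative_at_withinI[OF smooth_map_has_derivative[OF sm]])
    show "x \<in> ball x d'" using d'(1) by simp
    fix z assume "z \<in> ball x d'"
    then have z: "norm (z - x) < d'" by (simp add: dist_norm norm_minus_commute)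
    show "onorm (frechet_derivative \<phi> (at z) - frechet_derivative \<phi> (at x)) \<le> e"
    proof (rule onorm_le)
      fix v
      have "(frechet_derivative \<phi> (at z) - frechet_derivative \<phi> (at x)) v = (\<Sum>b\<in>Basis. (v \<bullet> b) *\<^sub>R (?D z b - ?D x b))"
        unfolding fun_diff_def frechet_derivative_basis[OF sm, of _ v]
        by (simp only: sum_subtractf[symmetric] scaleR_diff_right)
      also have "cmod \<dots> \<le> (\<Sum>b\<in>(Basis::(real\<times>real) set). norm v * (e / ?n))"
      proof (rule sum_norm_le)
        fix b :: "real \<times> real" assume b: "b \<in> Basis"
        show "cmod ((v \<bullet> b) *\<^sub>R (?D z b - ?D x b)) \<le> norm v * (e / ?n)"
          unfolding norm_scaleR using b Basis_le_norm[OF b, of v] d'(2)[OF b] z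
          by (intro mult_mono less_imp_le[OF d(2)]) auto
      qed
      also have "\<dots> = (real (card (Basis :: (real \<times> real) set)) / ?n) * (norm v * e)" by simp
      also have "\<dots> \<le> 1 * (norm v * e)" using \<open>e > 0\<close> by (intro mult_right_mono) auto
      finally show "cmod ((frechet_derivative \<phi> (at z) - frechet_derivative \<phi> (at x)) v) \<le> e * norm v"
        by (simp add: mult.commute)
    qed
  qed
  then show ?thesis using d'(1) by (intro exI[of _ d']) (simp add: mult.commute)
qed

lemma conv_integrable:
  assumes f: "integrable lborel f" and k: "test_function V k"
  shows "integrable lborel (\<lambda>z. f z * k (x - z))"
proof -
  obtain B where B: "B > 0" "\<And>x. cmod (k x) \<le> B" using test_function_bounded[OF k] by blast
  have [measurable]: "k \<in> borel_measurable borel" by (rule test_function_measurable[OF k])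
  have [measurable]: "f \<in> borel_measurable borel" using borel_measurable_integrable[OF f] by simp
  show ?thesis
  proof (rule Bochner_Integration.integrable_bound)
    show "integrable lborel (\<lambda>z. B * cmod (f z))" using f by simp
    have "cmod (f z * k (x - z)) \<le> B * cmod (f z)" for z
      using mult_left_mono[OF B(2)[of "x - z"], of "cmod (f z)"] by (simp add: norm_mult mult.commute)
    then show "AE z in lborel. norm (f z * k (x - z)) \<le> norm (B * cmod (f z))" using B(1) by (intro AE_I2) simp
  qed simp
qed

text \<open>All regularity is taken from the kernel: its uniform linearisation error is integrated
  against |f|.\<close>

lemma conv_has_derivative:
  assumes f: "integrable lborel f" and k: "test_function V k"
  shows "(conv f k has_derivative (\<lambda>v. conv f (\<lambda>y. frechet_derivative k (at y) v) x)) (at x)"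
proof -
  let ?D = "\<lambda>x v. frechet_derivative k (at x) v"
  note sm = test_functionD(1)[OF k]
  have Di: "integrable lborel (\<lambda>z. f z * ?D (x - z) v)" for v
    by (rule conv_integrable[OF f test_function_frechet_derivative[OF k]])
  have lin: "linear (\<lambda>v. conv f (\<lambda>y. ?D y v) x)"
  proof
    have L: "linear (frechet_derivative k (at y))" for y
      by (rule has_derivative_linear[OF smooth_map_has_derivative[OF sm]])
    show "conv f (\<lambda>y. ?D y (a + b)) x = conv f (\<lambda>y. ?D y a) x + conv f (\<lambda>y. ?D y b) x" for a b
      unfolding conv_def linear_add[OF L] distrib_left by (rule Bochner_Integration.integral_add[OF Di Di])
    show "conv f (\<lambda>y. ?D y (c *\<^sub>R a)) x = c *\<^sub>R conv f (\<lambda>y. ?D y a) x" for c a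
      unfolding conv_def linear_cmul[OF L] mult_scaleR_right by (rule integral_scaleR_right)
  qed
  \<comment> \<open>The added 1 keeps N positive when f vanishes.\<close>
  define N where "N = (\<integral>z. cmod (f z) \<partial>lborel) + 1"
  have N: "N > 0" "(\<integral>z. cmod (f z) \<partial>lborel) \<le> N" unfolding N_def by (auto intro!: add_nonneg_pos)
  show ?thesis
    unfolding has_derivative_within_alt
  proof (intro conjI allI impI)
    show "bounded_linear (\<lambda>v. conv f (\<lambda>y. ?D y v) x)" using lin by (rule linear_conv_bounded_linear[THEN iffD1])
    fix e :: real assume "e > 0"
    then have "e / N > 0" using N(1) by simp
    then obtain d where d: "d > 0" "\<And>x y. norm (y - x) < d \<Longrightarrow> cmod (k y - k x - ?D x (y - x)) \<le> e / N * norm (y - x)"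
      using test_function_uniformly_linear[OF k] by meson
    have "norm (conv f k y - conv f k x - conv f (\<lambda>w. ?D w (y - x)) x) \<le> e * norm (y - x)" if "norm (y - x) < d" for y
    proof -
      have i1: "integrable lborel (\<lambda>z. f z * k (y - z))" and i2: "integrable lborel (\<lambda>z. f z * k (x - z))"
        by (rule conv_integrable[OF f k])+
      have "conv f k y - conv f k x - conv f (\<lambda>w. ?D w (y - x)) x
          = (\<integral>z. f z * k (y - z) - f z * k (x - z) - f z * ?D (x - z) (y - x) \<partial>lborel)"
        unfolding conv_def using i1 i2 Di by simp
      also have "norm \<dots> \<le> (\<integral>z. (e / N * norm (y - x)) * cmod (f z) \<partial>lborel)"
      proof (rule Bochner_Integration.integral_norm_bound_integral)
        fix z
        have eq: "f z * k (y - z) - f z * k (x - z) - f z * ?D (x - z) (y - x) = f z * (k (y - z) - k (x - z) - ?D (x - z) (y - x))"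
          by (simp only: right_diff_distrib)
        have "cmod (k (y - z) - k (x - z) - ?D (x - z) (y - x)) \<le> e / N * norm (y - x)"
          using d(2)[of "y - z" "x - z"] that by simp
        then show "norm (f z * k (y - z) - f z * k (x - z) - f z * ?D (x - z) (y - x)) \<le> (e / N * norm (y - x)) * cmod (f z)"
          unfolding eq norm_mult by (subst mult.commute) (rule mult_right_mono, simp_all)
      qed (use i1 i2 Di f in auto)
      also have "\<dots> = (e / N * norm (y - x)) * (\<integral>z. cmod (f z) \<partial>lborel)" using f by simp
      also have "\<dots> \<le> (e / N * norm (y - x)) * N" using N \<open>e > 0\<close> by (intro mult_left_mono) auto
      also have "\<dots> = e * norm (y - x)" using N(1) by simp
      finally show ?thesis .
    qed
    then show "\<exists>d>0. \<forall>y\<in>UNIV. norm (y - x) < d \<longrightarrow> norm (conv f k y - conv f k x - conv f (\<lambda>w. ?D w (y - x)) x) \<le> e * norm (y - x)"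
      using d(1) by blast
  qed
qed

lemma smooth_map_conv:
  assumes f: "integrable lborel f" and k: "test_function V k"
  shows "smooth_map (conv f k)"
proof -
  have "\<forall>k. test_function V k \<longrightarrow> Ck_map n (conv f k)" for n
  proof (induction n)
    case 0
    show ?case
    proof (intro allI impI)
      fix k assume "test_function V k"
      then have "isCont (conv f k) x" for x
        by (rule has_derivative_continuous[OF conv_has_derivative[OF f]])
      then show "Ck_map 0 (conv f k)" by (simp add: continuous_at_imp_continuous_on)
    qed
  next
    case (Suc n)
    show ?case
      using Suc test_function_frechet_derivative
      by (intro allI impI Ck_map_SucI[OF conv_has_derivative[OF f]]) auto
  qed
  then show ?thesis using k by (simp add: smooth_map_def)
qed

lemma test_function_conv:
  assumes f: "integrable lborel f" "\<And>x. norm x > R \<Longrightarrow> f x = 0" and k: "test_function V k"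
  shows "test_function UNIV (conv f k)"
proof -
  obtain S where S: "\<And>x. norm x > S \<Longrightarrow> k x = 0" using test_function_zero_outside[OF k] by blast
  have z: "conv f k x = 0" if "norm x > R + S" for x
  proof -
    have 0: "f z * k (x - z) = 0" for z
    proof (cases "norm z > R")
      case False
      have "norm x \<le> norm (x - z) + norm z" by (metis diff_add_cancel norm_triangle_ineq)
      then have "norm (x - z) > S" using that False by simp
      then show ?thesis using S by simp
    qed (simp add: f(2))
    show ?thesis unfolding conv_def 0 by simp
  qed
  show ?thesis
    by (rule test_functionI[OF smooth_map_conv[OF f(1) k], of "cball 0 (R + S)"]) (use z in \<open>auto simp: not_less[symmetric]\<close>)
qed

text \<open>By translation invariance \<open>\<phi> (x + t v)\<close> and \<open>\<phi> x\<close>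
  have the same integral, so t times the integral of the derivative is, up to sign, the integral of
  a linearisation error, which is o(t) and lives on a fixed ball.\<close>

lemma test_function_integral_derivative:
  assumes \<phi>: "test_function V \<phi>"
  shows "(\<integral>x. frechet_derivative \<phi> (at x) v \<partial>lborel) = 0"
proof (rule ccontr)
  let ?D = "\<lambda>x. frechet_derivative \<phi> (at x) v"
  let ?I = "\<integral>x. ?D x \<partial>lborel"
  assume "?I \<noteq> 0"
  have L: "linear (frechet_derivative \<phi> (at y))" for y
    by (rule has_derivative_linear[OF smooth_map_has_derivative[OF test_functionD(1)[OF \<phi>]]])
  have "v \<noteq> 0"
  proof
    assume "v = 0"
    then have "?D x = 0" for x using linear_0[OF L] by simp
    then show False using \<open>?I \<noteq> 0\<close> by simp
  qed
  obtain R where R: "R > 0" "\<And>x. norm x > R \<Longrightarrow> \<phi> x = 0" using test_function_zero_outside[OF \<phi>] by blast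
  have DR: "?D x = 0" if "norm x > R" for x
  proof (rule frechet_derivative_zero_outside[OF test_functionD(1)[OF \<phi>]])
    have "closure {x. \<phi> x \<noteq> 0} \<subseteq> cball 0 R"
      by (rule closure_minimal) (use R(2) in \<open>auto simp: not_less[symmetric]\<close>)
    then show "x \<notin> closure {x. \<phi> x \<noteq> 0}" using that by auto
  qed
  \<comment> \<open>Radius R + 1 covers the support and all its shifts of length at most 1; outside
    this ball the whole integrand vanishes. The added 1 keeps A positive.\<close>
  define A where "A = measure lborel (cball 0 (R + 1) :: (real \<times> real) set) + 1"
  have A: "A > 0" by (simp add: A_def add_nonneg_pos)
  define e where "e = cmod ?I / (2 * A * norm v)"
  have e: "e > 0" using A \<open>v \<noteq> 0\<close> \<open>?I \<noteq> 0\<close> by (simp add: e_def)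
  obtain d where d: "d > 0" "\<And>x y. norm (y - x) < d \<Longrightarrow> cmod (\<phi> y - \<phi> x - frechet_derivative \<phi> (at x) (y - x)) \<le> e * norm (y - x)"
    using test_function_uniformly_linear[OF \<phi> e] by meson
  define t where "t = min (d / 2) 1 / norm v"
  have t: "t > 0" "norm (t *\<^sub>R v) < d" "norm (t *\<^sub>R v) \<le> 1"
    using d(1) \<open>v \<noteq> 0\<close> by (auto simp: t_def)
  have i: "integrable lborel \<phi>" "integrable lborel ?D"
    by (intro test_function_integrable[of V] \<phi> test_function_frechet_derivative)+
  have it: "integrable lborel (\<lambda>x. \<phi> (x + t *\<^sub>R v))" by (rule lborel_translation(1)[OF i(1)])
  have "(\<integral>x. \<phi> (x + t *\<^sub>R v) - \<phi> x - t *\<^sub>R ?D x \<partial>lborel) = (\<integral>x. \<phi> (x + t *\<^sub>R v) \<partial>lborel) - (\<integral>x. \<phi> x \<partial>lborel) - t *\<^sub>R ?I"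
    using i it by simp
  also have "(\<integral>x. \<phi> (x + t *\<^sub>R v) \<partial>lborel) = (\<integral>x. \<phi> x \<partial>lborel)"
    by (rule lborel_translation(2)[OF test_function_measurable[OF \<phi>]])
  finally have "cmod (t *\<^sub>R ?I) = cmod (\<integral>x. \<phi> (x + t *\<^sub>R v) - \<phi> x - t *\<^sub>R ?D x \<partial>lborel)" by simp
  also have "\<dots> \<le> (\<integral>x. (e * norm (t *\<^sub>R v)) * indicator (cball 0 (R + 1) :: (real \<times> real) set) x \<partial>lborel)"
  proof (rule Bochner_Integration.integral_norm_bound_integral)
    show "integrable lborel (\<lambda>x::real\<times>real. (e * norm (t *\<^sub>R v)) * indicator (cball 0 (R + 1)) x)"
      using emeasure_lborel_cball_finite by (intro integrable_mult_right integrable_real_indicator) auto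
    fix x
    show "norm (\<phi> (x + t *\<^sub>R v) - \<phi> x - t *\<^sub>R ?D x) \<le> (e * norm (t *\<^sub>R v)) * indicator (cball 0 (R + 1)) x"
    proof (cases "x \<in> cball 0 (R + 1)")
      case True
      then show ?thesis using d(2)[of "x + t *\<^sub>R v" x] t(2) linear_cmul[OF L, of x t v] by simp
    next
      case False
      have "norm x \<le> norm (x + t *\<^sub>R v) + norm (t *\<^sub>R v)" by (metis add_diff_cancel_right' norm_triangle_ineq4)
      then have "norm (x + t *\<^sub>R v) > R" "norm x > R" using False t(3) by auto
      then show ?thesis using False R(2) DR by simp
    qed
  qed (use i it in auto)
  also have "\<dots> = (e * norm (t *\<^sub>R v)) * measure lborel (cball 0 (R + 1) :: (real \<times> real) set)"
    using emeasure_lborel_cball_finite by simp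
  also have "\<dots> \<le> (e * norm (t *\<^sub>R v)) * A" using e by (intro mult_left_mono) (auto simp: A_def)
  also have "\<dots> = t * (cmod ?I / 2)" using t(1) A \<open>v \<noteq> 0\<close> by (simp add: e_def)
  finally have "t * cmod ?I \<le> t * (cmod ?I / 2)" using t(1) by simp
  then show False using t(1) \<open>?I \<noteq> 0\<close> by (simp add: mult_le_cancel_left_pos)
qed

lemma frechet_derivative_mult:
  fixes f g :: "'a::real_normed_vector \<Rightarrow> 'b::real_normed_algebra"
  assumes "smooth_map f" "smooth_map g"
  shows "frechet_derivative (\<lambda>x. f x * g x) (at x) v =
    f x * frechet_derivative g (at x) v + frechet_derivative f (at x) v * g x"
  using frechet_derivative_at[OF has_derivative_mult[OF smooth_map_has_derivative[OF assms(1)] smooth_map_has_derivative[OF assms(2)], of x], symmetric]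
  by simp

text \<open>The kernels are supported below the origin in a set so flat that, for \<open>V\<close> the epigraph of
  a function with Lipschitz constant \<open>m\<close>, subtracting them keeps points inside \<open>V\<close>.\<close>

lemma downward_kernel:
  fixes m d :: real
  assumes "m \<ge> 0" "d > 0"
  obtains k :: "real \<times> real \<Rightarrow> real" and B C where
    "smooth_map k" "\<And>s. 0 \<le> k s" "\<And>s. k s \<le> B" "integrable lborel k" "(\<integral>s. k s \<partial>lborel) = 1"
    "compact C" "\<And>s. k s \<noteq> 0 \<Longrightarrow> s \<in> C" "\<And>s. s \<in> C \<Longrightarrow> norm s < d \<and> m * \<bar>fst s\<bar> < - snd s"
proof -
  \<comment> \<open>The support is a square of half-side r around (0, -(m + 2) r). On it the depth
    is at least (m + 1) r > m |fst s|, and the norm is at most (m + 4) r < d.\<close>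
  define r where "r = d / (m + 5)"
  have r: "r > 0" "(m + 5) * r = d" using assms by (auto simp: r_def)
  define q where "q s = bump (fst s / r) * bump ((snd s + (m + 2) * r) / r)" for s :: "real \<times> real"
  define C where "C = cbox (- r, - r - (m + 2) * r) (r, r - (m + 2) * r)"
  have C: "norm s < d \<and> m * \<bar>fst s\<bar> < - snd s" if "s \<in> C" for s
  proof -
    obtain a b where s: "s = (a, b)" by (cases s)
    have ab: "\<bar>a\<bar> \<le> r" "- r - (m + 2) * r \<le> b" "b \<le> r - (m + 2) * r"
      using that by (auto simp: C_def s cbox_Pair_eq)
    have "norm s \<le> \<bar>a\<bar> + \<bar>b\<bar>" unfolding s using norm_Pair_le[of a b] by simp
    moreover have "0 \<le> m * r" using assms(1) r(1) by simp
    then have "\<bar>b\<bar> \<le> (m + 3) * r" using ab(2,3) r(1) unfolding abs_le_iff distrib_right by linarith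
    moreover have "r + (m + 3) * r < d" using r by (simp add: algebra_simps)
    ultimately have "norm s < d" using ab(1) by linarith
    moreover have "m * \<bar>a\<bar> \<le> m * r" using ab(1) assms(1) by (intro mult_left_mono)
    then have "m * \<bar>a\<bar> < - b" using ab(3) r(1) by (simp add: algebra_simps)
    ultimately show ?thesis by (simp add: s)
  qed
  have qC: "s \<in> C" if "q s \<noteq> 0" for s
  proof -
    have "\<bar>fst s / r\<bar> < 1" "\<bar>(snd s + (m + 2) * r) / r\<bar> < 1"
      using that bump_outside by (auto simp: q_def not_le[symmetric])
    then have "\<bar>fst s\<bar> < r" "\<bar>snd s + (m + 2) * r\<bar> < r" using r(1) by (simp_all add: abs_divide)
    then show ?thesis by (cases s) (auto simp: C_def cbox_Pair_eq)
  qed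
  have qsm: "smooth_map q"
  proof -
    have l1: "bounded_linear (\<lambda>s::real\<times>real. fst s / r)" and l2: "bounded_linear (\<lambda>s::real\<times>real. snd s / r)"
      by (intro bounded_linear_divide[THEN bounded_linear_compose] bounded_linear_fst bounded_linear_snd)+
    have "smooth_map (\<lambda>s::real\<times>real. bump (0 + fst s / r) * bump ((m + 2) * r / r + snd s / r))"
      by (intro smooth_map_mult smooth_map_affine[OF l1] smooth_map_affine[OF l2] smooth_map_bump)
    then show ?thesis by (simp add: q_def[abs_def] add_divide_distrib add.commute)
  qed
  have q0: "0 \<le> q s" and q1: "q s \<le> 1" for s
    unfolding q_def using bump_nonneg bump_le_1 by (auto intro: mult_le_one)
  have qc: "continuous_on UNIV q" by (rule smooth_map_continuous[OF qsm])
  have qi: "integrable lborel q"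
    by (rule integrable_continuous_compact_support[OF qc, of d]) (use qC C in fastforce)
  \<comment> \<open>The set where q is nonzero is open and contains the centre of the square, so it
    is not null, and q can be normalised.\<close>
  have "(\<integral>s. q s \<partial>lborel) \<noteq> 0"
  proof
    assume "(\<integral>s. q s \<partial>lborel) = 0"
    then have "AE s in lborel. q s = 0" using integral_nonneg_eq_0_iff_AE[OF qi] q0 by simp
    moreover have o: "open {s. q s \<noteq> 0}" by (rule open_Collect_neq[OF qc continuous_on_const])
    then have "{s. q s \<noteq> 0} \<in> sets lborel" by simp
    ultimately have "{s. q s \<noteq> 0} \<in> null_sets lborel" by (simp add: AE_iff_null_sets)
    with o have "{s. q s \<noteq> 0} = {}"
      using open_not_negligible negligible_iff_null_sets null_sets_completionI by blast
    moreover have "q (0, - ((m + 2) * r)) \<noteq> 0" using bump_pos[of 0] by (simp add: q_def)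
    ultimately show False by blast
  qed
  then have I: "(\<integral>s. q s \<partial>lborel) > 0" using q0 by (simp add: order.strict_iff_order Bochner_Integration.integral_nonneg)
  define I where "I = (\<integral>s. q s \<partial>lborel)"
  show thesis
  proof (rule that[of "\<lambda>s. q s / I" "1 / I" C])
    show "smooth_map (\<lambda>s. q s / I)" by (rule smooth_map_linear[OF bounded_linear_divide qsm])
    show "(\<integral>s. q s / I \<partial>lborel) = 1" using I by (simp add: I_def)
  qed (use q0 q1 I qi qC C in \<open>auto simp: I_def[symmetric] divide_right_mono C_def intro!: divide_nonneg_pos\<close>)
qed

section \<open>Restriction to an open set\<close>

text \<open>Here and below, the restricted measure is traded for extension by zero, so that
  translation, Fubini and convolution can be carried out on the whole plane.\<close>

lemma leb_integral:
  fixes f :: "real \<times> real \<Rightarrow> 'b::{banach, second_countable_topology}"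
  assumes "open V" shows "(\<integral>x. f x \<partial>leb V) = (\<integral>x. indicator V x *\<^sub>R f x \<partial>lborel)"
  using assms by (intro integral_restrict_space) simp

lemma leb_integrable:
  fixes f :: "real \<times> real \<Rightarrow> 'b::{banach, second_countable_topology}"
  assumes "open V" shows "integrable (leb V) f \<longleftrightarrow> integrable lborel (\<lambda>x. indicator V x *\<^sub>R f x)"
  using assms by (intro integrable_restrict_space) simp

lemma leb_measurable:
  fixes f :: "real \<times> real \<Rightarrow> 'b::real_normed_vector"
  assumes "open V" shows "f \<in> borel_measurable (leb V) \<longleftrightarrow> (\<lambda>x. indicator V x *\<^sub>R f x) \<in> borel_measurable borel"
proof -
  have "V \<inter> space lborel \<in> sets lborel" using assms by simp
  from borel_measurable_restrict_space_iff[OF this, of f] show ?thesis by simp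
qed

lemma leb_AE:
  assumes "open V" shows "(AE x in leb V. P x) \<longleftrightarrow> (AE x in lborel. x \<in> V \<longrightarrow> P x)"
  using assms by (intro AE_restrict_space_iff) simp

lemma leb_sq_integrable:
  assumes "open V" shows "sq_integrable (leb V) u \<longleftrightarrow> sq_integrable lborel (\<lambda>x. indicator V x *\<^sub>R u x)"
proof -
  have "(\<lambda>x. (cmod (indicator V x *\<^sub>R u x))\<^sup>2) = (\<lambda>x. indicator V x *\<^sub>R (cmod (u x))\<^sup>2)"
    by (auto simp: indicator_def)
  then show ?thesis unfolding sq_integrable_def leb_measurable[OF assms] leb_integrable[OF assms] by simp
qed

lemma leb_l2_norm:
  assumes "open V" shows "l2_norm (leb V) u = l2_norm lborel (\<lambda>x. indicator V x *\<^sub>R u x)"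
proof -
  have "(\<lambda>x. (cmod (indicator V x *\<^sub>R u x))\<^sup>2) = (\<lambda>x. indicator V x *\<^sub>R (cmod (u x))\<^sup>2)"
    by (auto simp: indicator_def)
  then show ?thesis unfolding l2_norm_def leb_integral[OF assms] by simp
qed

lemma leb_sq_integrable_restrict:
  assumes V: "open V" and u: "sq_integrable lborel u"
  shows "sq_integrable (leb V) u" "l2_norm (leb V) u \<le> l2_norm lborel u"
proof -
  have ub: "u \<in> borel_measurable borel" using sq_integrableD(1)[OF u] by simp
  have Vb: "V \<in> sets borel" using V by simp
  have vu: "(\<lambda>x. indicator V x *\<^sub>R u x) \<in> borel_measurable lborel" using ub Vb by simp
  have sq: "sq_integrable lborel (\<lambda>x. indicator V x *\<^sub>R u x)"
    by (rule sq_integrable_bound[OF vu sq_integrableD(2)[OF u]]) (simp add: indicator_def)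
  then show "sq_integrable (leb V) u" by (simp add: leb_sq_integrable[OF V])
  show "l2_norm (leb V) u \<le> l2_norm lborel u"
    unfolding leb_l2_norm[OF V] unfolding l2_norm_def
    by (intro real_sqrt_le_mono integral_mono sq_integrableD(2)[OF sq] sq_integrableD(2)[OF u]) (simp add: indicator_def)
qed

lemma l2_norm_zero_AE:
  assumes "sq_integrable M f" "l2_norm M f = 0"
  shows "AE x in M. f x = 0"
proof -
  have "(\<integral>x. (cmod (f x))\<^sup>2 \<partial>M) = 0" using assms(2) l2_norm_square[of M f] by simp
  then have "AE x in M. (cmod (f x))\<^sup>2 = 0"
    using integral_nonneg_eq_0_iff_AE[OF sq_integrableD(2)[OF assms(1)]] by simp
  then show ?thesis by simp
qed

lemma test_function_sq_integrable_leb: "open V \<Longrightarrow> test_function W \<phi> \<Longrightarrow> sq_integrable (leb V) \<phi>"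
  by (rule leb_sq_integrable_restrict(1)[OF _ test_function_sq_integrable])

section \<open>\<open>H\<^sup>1\<close> on the epigraph of a Lipschitz function\<close>

text \<open>The Lipschitz constant is a parameter because the trace constants and the shape of the
  mollifiers depend on h through it alone.\<close>

locale epigraph =
  fixes h :: "real \<Rightarrow> real" and m :: real
  assumes h_smooth: "smooth_map h" and h_deriv_le: "\<And>x. \<bar>deriv h x\<bar> \<le> m"
begin

definition V :: "(real \<times> real) set" where "V = {q. h (fst q) < snd q}"

lemma m_nonneg: "0 \<le> m"
  using h_deriv_le[of 0] by linarith

lemma h_continuous: "continuous_on S h"
  by (rule smooth_map_continuous[OF h_smooth])

lemma open_V: "open V"
  unfolding V_def by (intro open_Collect_less continuous_on_compose2[OF h_continuous] continuous_on_fst continuous_on_snd continuous_on_id) auto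

lemma h_lipschitz: "\<bar>h x - h y\<bar> \<le> m * \<bar>x - y\<bar>"
proof -
  have "norm (h x - h y) \<le> m * norm (x - y)"
    by (rule field_differentiable_bound[of UNIV h "deriv h" m x y])
       (use smooth_map_real_deriv(1)[OF h_smooth] h_deriv_le in \<open>auto simp: has_field_derivative_at_within\<close>)
  then show ?thesis by simp
qed

lemma V_downward:
  assumes "x \<in> V" "m * \<bar>fst s\<bar> < - snd s"
  shows "x - s \<in> V"
proof -
  have "h (fst x - fst s) \<le> h (fst x) + m * \<bar>fst s\<bar>"
    using h_lipschitz[of "fst x - fst s" "fst x"] by simp
  then show ?thesis using assms by (simp add: V_def)
qed

text \<open>The support of the reflected kernel is contained in x - C, and \<open>V_downward\<close>
  keeps x - C inside V. So for every x in V, however close to the boundary, the kernel may be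
  inserted into the definition of the weak derivative.\<close>

lemma test_kernel:
  fixes k :: "real \<times> real \<Rightarrow> real"
  assumes "smooth_map k" "compact C" "\<And>s. k s \<noteq> 0 \<Longrightarrow> s \<in> C" "\<And>s. s \<in> C \<Longrightarrow> m * \<bar>fst s\<bar> < - snd s" "x \<in> V"
  shows "test_function V (\<lambda>z. complex_of_real (k (x - z)))"
proof (rule test_functionI[of _ "(\<lambda>s. x - s) ` C"])
  have "smooth_map (\<lambda>z. k (x + - z))"
    by (rule smooth_map_affine[OF bounded_linear_minus[OF bounded_linear_ident] assms(1)])
  then show "smooth_map (\<lambda>z. complex_of_real (k (x - z)))"
    using smooth_map_linear[OF bounded_linear_of_real] by simp
  show "compact ((\<lambda>s. x - s) ` C)"
    by (intro compact_continuous_image assms(2) continuous_intros)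
  show "(\<lambda>s. x - s) ` C \<subseteq> V" using V_downward[OF assms(5)] assms(4) by blast
  show "z \<in> (\<lambda>s. x - s) ` C" if "complex_of_real (k (x - z)) \<noteq> 0" for z
    using assms(3)[of "x - z"] that by (intro image_eqI[of _ _ "x - z"]) auto
qed

lemma conv_extension: "conv (\<lambda>z. indicator V z *\<^sub>R f z) k x = (\<integral>z. f z * k (x - z) \<partial>leb V)"
  unfolding conv_def leb_integral[OF open_V] by simp

text \<open>One kernel has to serve a finite family, since a function and its weak derivatives must
  be smoothed by the same convolution. The extension by zero jumps across the boundary, yet its
  translates are continuous in L^2, which is all that closeness requires.\<close>

lemma mollifier:
  assumes "finite F" "\<And>f. f \<in> F \<Longrightarrow> sq_integrable (leb V) f" "e > 0"
  obtains k :: "real \<times> real \<Rightarrow> real" where "test_function UNIV (\<lambda>s. complex_of_real (k s))"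
    "\<And>x. x \<in> V \<Longrightarrow> test_function V (\<lambda>z. complex_of_real (k (x - z)))"
    "\<And>f. f \<in> F \<Longrightarrow> sq_integrable (leb V) (conv (\<lambda>z. indicator V z *\<^sub>R f z) (\<lambda>s. complex_of_real (k s)))"
    "\<And>f. f \<in> F \<Longrightarrow> l2_norm (leb V) (\<lambda>x. conv (\<lambda>z. indicator V z *\<^sub>R f z) (\<lambda>s. complex_of_real (k s)) x - f x) \<le> e"
proof -
  let ?z = "\<lambda>f z. indicator V z *\<^sub>R f z"
  have zf: "sq_integrable lborel (?z f)" if "f \<in> F" for f
    using assms(2)[OF that] by (simp add: leb_sq_integrable[OF open_V])
  have "\<forall>f\<in>F. \<exists>d>0. \<forall>s. norm s < d \<longrightarrow> l2_norm lborel (\<lambda>x. ?z f (x + s) - ?z f x) < e"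
    by (intro ballI translation_cont_l2[OF zf \<open>e > 0\<close>])
  from bchoice[OF this] obtain d where "\<forall>f\<in>F. d f > 0 \<and> (\<forall>s. norm s < d f \<longrightarrow> l2_norm lborel (\<lambda>x. ?z f (x + s) - ?z f x) < e)"
    by blast
  then have d: "\<And>f. f \<in> F \<Longrightarrow> d f > 0"
    "\<And>f s. f \<in> F \<Longrightarrow> norm s < d f \<Longrightarrow> l2_norm lborel (\<lambda>x. ?z f (x + s) - ?z f x) < e" by blast+
  define d' where "d' = Min (insert 1 (d ` F))"
  have d': "d' > 0" "\<And>f. f \<in> F \<Longrightarrow> d' \<le> d f" unfolding d'_def using assms(1) d(1) by auto
  obtain k :: "real \<times> real \<Rightarrow> real" and B C where k: "smooth_map k" "\<And>s. 0 \<le> k s" "\<And>s. k s \<le> B" "integrable lborel k" "(\<integral>s. k s \<partial>lborel) = 1"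
    "compact C" "\<And>s. k s \<noteq> 0 \<Longrightarrow> s \<in> C" "\<And>s. s \<in> C \<Longrightarrow> norm s < d' \<and> m * \<bar>fst s\<bar> < - snd s"
    by (rule downward_kernel[OF m_nonneg d'(1)]) (rule that)
  let ?k = "\<lambda>s. complex_of_real (k s)"
  have c: "sq_integrable lborel (conv (?z f) ?k)" "l2_norm lborel (\<lambda>x. conv (?z f) ?k x - ?z f x) \<le> e" if f: "f \<in> F" for f
  proof -
    have cl: "l2_norm lborel (\<lambda>x. ?z f (x + - s) - ?z f x) \<le> e" if "k s \<noteq> 0" for s
    proof -
      have "norm s < d'" using k(7)[OF that] k(8) by blast
      then have "norm (- s) < d f" using d'(2)[OF f] by simp
      from d(2)[OF f this] show ?thesis by simp
    qed
    show "sq_integrable lborel (conv (?z f) ?k)" "l2_norm lborel (\<lambda>x. conv (?z f) ?k x - ?z f x) \<le> e"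
      using conv_l2_close[OF zf[OF f] smooth_map_continuous[OF k(1)] k(2,3,4,5) cl] \<open>e > 0\<close> by simp_all
  qed
  show thesis
  proof (rule that)
    show "test_function UNIV ?k"
      by (rule test_functionI[OF smooth_map_linear[OF bounded_linear_of_real k(1)] k(6)]) (use k(7) in auto)
    show "test_function V (\<lambda>z. complex_of_real (k (x - z)))" if "x \<in> V" for x
      using k(8) by (intro test_kernel[OF k(1,6,7) _ that]) auto
    fix f assume f: "f \<in> F"
    show "sq_integrable (leb V) (conv (?z f) ?k)"
      by (rule leb_sq_integrable_restrict(1)[OF open_V c(1)[OF f]])
    have "l2_norm (leb V) (\<lambda>x. conv (?z f) ?k x - f x) = l2_norm (leb V) (\<lambda>x. conv (?z f) ?k x - ?z f x)"
      unfolding l2_norm_def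
      by (intro arg_cong[where f = sqrt] Bochner_Integration.integral_cong) (auto simp: space_restrict_space)
    also have "\<dots> \<le> e"
      using leb_sq_integrable_restrict(2)[OF open_V sq_integrable_diff[OF c(1)[OF f] zf[OF f]]] c(2)[OF f] by simp
    finally show "l2_norm (leb V) (\<lambda>x. conv (?z f) ?k x - f x) \<le> e" .
  qed
qed

text \<open>The smoothed extension of f vanishes on V, because each reflected kernel is a test
  function of V, and yet it is L^2-close to f.\<close>

lemma orthogonal_to_test_functions:
  assumes f: "sq_integrable (leb V) f" and o: "\<And>\<phi>. test_function V \<phi> \<Longrightarrow> (\<integral>x. f x * \<phi> x \<partial>leb V) = 0"
  shows "AE x in leb V. f x = 0"
proof (rule l2_norm_zero_AE[OF f], rule ccontr)
  assume "l2_norm (leb V) f \<noteq> 0"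
  \<comment> \<open>Half the norm as accuracy is contradictory, since the distance from f to 0 is
    the full norm.\<close>
  then have p: "l2_norm (leb V) f / 2 > 0" using l2_norm_nonneg[of "leb V" f] by simp
  have fs: "sq_integrable (leb V) g" if "g \<in> {f}" for g using that f by simp
  show False
  proof (rule mollifier[OF finite.insertI[OF finite.emptyI] fs p])
    fix k :: "real \<times> real \<Rightarrow> real"
    assume k: "\<And>x. x \<in> V \<Longrightarrow> test_function V (\<lambda>z. complex_of_real (k (x - z)))"
      and le: "\<And>g. g \<in> {f} \<Longrightarrow> l2_norm (leb V) (\<lambda>x. conv (\<lambda>z. indicator V z *\<^sub>R g z) (\<lambda>s. complex_of_real (k s)) x - g x) \<le> l2_norm (leb V) f / 2"
    have "conv (\<lambda>z. indicator V z *\<^sub>R f z) (\<lambda>s. complex_of_real (k s)) x = 0" if "x \<in> V" for x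
      unfolding conv_extension by (rule o[OF k[OF that]])
    then have "l2_norm (leb V) (\<lambda>x. conv (\<lambda>z. indicator V z *\<^sub>R f z) (\<lambda>s. complex_of_real (k s)) x - f x) = l2_norm (leb V) f"
      unfolding l2_norm_def
      by (intro arg_cong[where f = sqrt] Bochner_Integration.integral_cong) (simp_all add: space_restrict_space)
    then show False using le[of f] p by simp
  qed
qed

lemma is_weak_partialD:
  assumes "is_weak_partial V e u g"
  shows "sq_integrable (leb V) g"
    "test_function V \<phi> \<Longrightarrow> (\<integral>x. u x * frechet_derivative \<phi> (at x) e \<partial>leb V) = - (\<integral>x. g x * \<phi> x \<partial>leb V)"
  using assms by (auto simp: is_weak_partial_def)

lemma mult_test_integrable:
  "sq_integrable (leb V) u \<Longrightarrow> test_function W \<phi> \<Longrightarrow> integrable (leb V) (\<lambda>x. u x * \<phi> x)"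
  by (rule sq_integrable_mult_integrable[OF _ test_function_sq_integrable_leb[OF open_V]])

lemma is_weak_partial_unique:
  assumes "is_weak_partial V e u g" "is_weak_partial V e u g'"
  shows "AE x in leb V. g x = g' x"
proof -
  note g = is_weak_partialD[OF assms(1)] and g' = is_weak_partialD[OF assms(2)]
  have "AE x in leb V. g x - g' x = 0"
  proof (rule orthogonal_to_test_functions)
    show "sq_integrable (leb V) (\<lambda>x. g x - g' x)" by (rule sq_integrable_diff[OF g(1) g'(1)])
    fix \<phi> assume \<phi>: "test_function V \<phi>"
    show "(\<integral>x. (g x - g' x) * \<phi> x \<partial>leb V) = 0"
      unfolding left_diff_distrib
      using g(2)[OF \<phi>] g'(2)[OF \<phi>] mult_test_integrable[OF g(1) \<phi>] mult_test_integrable[OF g'(1) \<phi>] by simp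
  qed
  then show ?thesis by simp
qed

lemma is_weak_partial_add:
  assumes "is_weak_partial V e u g" "is_weak_partial V e u' g'" "sq_integrable (leb V) u" "sq_integrable (leb V) u'"
  shows "is_weak_partial V e (\<lambda>x. u x + u' x) (\<lambda>x. g x + g' x)"
  unfolding is_weak_partial_def
proof (intro conjI allI impI)
  note g = is_weak_partialD[OF assms(1)] and g' = is_weak_partialD[OF assms(2)]
  show "sq_integrable (leb V) (\<lambda>x. g x + g' x)" by (rule sq_integrable_add[OF g(1) g'(1)])
  fix \<phi> assume \<phi>: "test_function V \<phi>"
  note d\<phi> = test_function_frechet_derivative[OF \<phi>, of e]
  show "(\<integral>x. (u x + u' x) * frechet_derivative \<phi> (at x) e \<partial>leb V) = - (\<integral>x. (g x + g' x) * \<phi> x \<partial>leb V)"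
    unfolding distrib_right
    using g(2)[OF \<phi>] g'(2)[OF \<phi>] mult_test_integrable[OF g(1) \<phi>] mult_test_integrable[OF g'(1) \<phi>]
      mult_test_integrable[OF assms(3) d\<phi>] mult_test_integrable[OF assms(4) d\<phi>] by simp
qed

lemma is_weak_partial_scale:
  assumes "is_weak_partial V e u g"
  shows "is_weak_partial V e (\<lambda>x. c * u x) (\<lambda>x. c * g x)"
  using assms unfolding is_weak_partial_def by (simp add: mult.assoc sq_integrable_scale)

lemma H1D:
  assumes "u \<in> H1 V"
  shows "sq_integrable (leb V) u" "e \<in> Basis \<Longrightarrow> is_weak_partial V e u (weak_partial V e u)"
    "e \<in> Basis \<Longrightarrow> sq_integrable (leb V) (weak_partial V e u)"
proof -
  show "sq_integrable (leb V) u" using assms by (simp add: H1_def)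
  show w: "is_weak_partial V e u (weak_partial V e u)" if "e \<in> Basis" for e
  proof -
    have "\<exists>g. is_weak_partial V e u g" using assms that by (simp add: H1_def)
    then show ?thesis unfolding weak_partial_def by (rule someI_ex)
  qed
  then show "sq_integrable (leb V) (weak_partial V e u)" if "e \<in> Basis"
    using that is_weak_partialD(1) by blast
qed

lemma H1I: "sq_integrable (leb V) u \<Longrightarrow> (\<And>e. e \<in> Basis \<Longrightarrow> is_weak_partial V e u (g e)) \<Longrightarrow> u \<in> H1 V"
  by (auto simp: H1_def)

lemma weak_partial_eq:
  assumes "u \<in> H1 V" "e \<in> Basis" "is_weak_partial V e u g"
  shows "AE x in leb V. weak_partial V e u x = g x"
  by (rule is_weak_partial_unique[OF H1D(2)[OF assms(1,2)] assms(3)])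

lemma weak_partial_l2_norm:
  assumes "u \<in> H1 V" "e \<in> Basis" "is_weak_partial V e u g"
  shows "l2_norm (leb V) (weak_partial V e u) = l2_norm (leb V) g"
  by (rule l2_norm_AE_cong[OF sq_integrableD(1)[OF H1D(3)[OF assms(1,2)]]
      sq_integrableD(1)[OF is_weak_partialD(1)[OF assms(3)]] weak_partial_eq[OF assms]])

lemma H1_add: "u \<in> H1 V \<Longrightarrow> v \<in> H1 V \<Longrightarrow> (\<lambda>x. u x + v x) \<in> H1 V"
  by (rule H1I[OF sq_integrable_add[OF H1D(1) H1D(1)] is_weak_partial_add[OF H1D(2) H1D(2) H1D(1) H1D(1)]])

lemma H1_scale: "u \<in> H1 V \<Longrightarrow> (\<lambda>x. c * u x) \<in> H1 V"
  by (rule H1I[OF sq_integrable_scale[OF H1D(1)] is_weak_partial_scale[OF H1D(2)]])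

text \<open>Equality can hold almost everywhere only, since \<open>weak_partial\<close> selects each
  representative independently.\<close>

lemma weak_partial_add:
  assumes "u \<in> H1 V" "v \<in> H1 V" "e \<in> Basis"
  shows "AE x in leb V. weak_partial V e (\<lambda>x. u x + v x) x = weak_partial V e u x + weak_partial V e v x"
  by (rule weak_partial_eq[OF H1_add[OF assms(1,2)] assms(3)
      is_weak_partial_add[OF H1D(2)[OF assms(1,3)] H1D(2)[OF assms(2,3)] H1D(1)[OF assms(1)] H1D(1)[OF assms(2)]]])

lemma weak_partial_scale:
  assumes "u \<in> H1 V" "e \<in> Basis"
  shows "AE x in leb V. weak_partial V e (\<lambda>x. c * u x) x = c * weak_partial V e u x"
  by (rule weak_partial_eq[OF H1_scale[OF assms(1)] assms(2) is_weak_partial_scale[OF H1D(2)[OF assms]]])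

text \<open>The product with a test function of V is compactly supported in V, so its derivative
  integrates to zero over the plane. Thus no boundary term appears, although \<phi> itself may be
  nonzero on the boundary.\<close>

lemma test_weak_partial:
  assumes \<phi>: "test_function UNIV \<phi>"
  shows "is_weak_partial V e \<phi> (\<lambda>x. frechet_derivative \<phi> (at x) e)"
  unfolding is_weak_partial_def
proof (intro conjI allI impI)
  note d\<phi> = test_function_frechet_derivative[OF \<phi>, of e]
  show "sq_integrable (leb V) (\<lambda>x. frechet_derivative \<phi> (at x) e)"
    by (rule test_function_sq_integrable_leb[OF open_V d\<phi>])
  fix \<psi> assume \<psi>: "test_function V \<psi>"
  note d\<psi> = test_function_frechet_derivative[OF \<psi>, of e]
  have zero: "indicator V x *\<^sub>R (f x * g x) = f x * g x" if "test_function V g" for f g :: "real \<times> real \<Rightarrow> complex" and x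
  proof (cases "g x = 0")
    case False
    then have "x \<in> V" using test_functionD(3)[OF that] closure_subset[of "{x. g x \<noteq> 0}"] by blast
    then show ?thesis by simp
  qed simp
  have i: "integrable lborel (\<lambda>x. \<phi> x * frechet_derivative \<psi> (at x) e)"
    "integrable lborel (\<lambda>x. frechet_derivative \<phi> (at x) e * \<psi> x)"
    using test_function_sq_integrable[OF \<phi>] test_function_sq_integrable[OF d\<phi>]
      test_function_sq_integrable[OF \<psi>] test_function_sq_integrable[OF d\<psi>]
    by (auto intro: sq_integrable_mult_integrable)
  have "0 = (\<integral>x. frechet_derivative (\<lambda>x. \<phi> x * \<psi> x) (at x) e \<partial>lborel)"
    by (rule test_function_integral_derivative[OF test_function_mult[OF \<psi> test_functionD(1)[OF \<phi>]], symmetric])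
  also have "\<dots> = (\<integral>x. \<phi> x * frechet_derivative \<psi> (at x) e \<partial>lborel) + (\<integral>x. frechet_derivative \<phi> (at x) e * \<psi> x \<partial>lborel)"
    unfolding frechet_derivative_mult[OF test_functionD(1)[OF \<phi>] test_functionD(1)[OF \<psi>]]
    by (rule Bochner_Integration.integral_add[OF i])
  finally show "(\<integral>x. \<phi> x * frechet_derivative \<psi> (at x) e \<partial>leb V) = - (\<integral>x. frechet_derivative \<phi> (at x) e * \<psi> x \<partial>leb V)"
    using zero[OF \<psi>, where f = "\<lambda>x. frechet_derivative \<phi> (at x) e"] zero[OF d\<psi>, where f = \<phi>]
    unfolding leb_integral[OF open_V] by (simp add: eq_neg_iff_add_eq_0)
qed

lemma test_function_H1: "test_function UNIV \<phi> \<Longrightarrow> \<phi> \<in> H1 V"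
  by (rule H1I[OF test_function_sq_integrable_leb[OF open_V] test_weak_partial])

definition grad_form :: "(real \<times> real) form" where
  "grad_form u v = (\<Sum>e\<in>Basis. l2_inner (leb V) (weak_partial V e u) (weak_partial V e v))"

sublocale grad: nonneg_form "H1 V" grad_form
proof unfold_locales
  fix u v w assume H: "u \<in> H1 V" "v \<in> H1 V" "w \<in> H1 V"
  have "l2_inner (leb V) (weak_partial V e (\<lambda>x. u x + v x)) (weak_partial V e w) =
     l2_inner (leb V) (weak_partial V e u) (weak_partial V e w) + l2_inner (leb V) (weak_partial V e v) (weak_partial V e w)"
    if e: "e \<in> Basis" for e
  proof -
    note s = H1D(3)[OF H(1) e] H1D(3)[OF H(2) e] H1D(3)[OF H(3) e] H1D(3)[OF H1_add[OF H(1,2)] e]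
    have "l2_inner (leb V) (weak_partial V e (\<lambda>x. u x + v x)) (weak_partial V e w)
      = l2_inner (leb V) (\<lambda>x. weak_partial V e u x + weak_partial V e v x) (weak_partial V e w)"
      by (rule l2_inner_AE_cong[OF sq_integrableD(1)[OF s(4)] sq_integrableD(1)[OF sq_integrable_add[OF s(1,2)]]
          weak_partial_add[OF H(1,2) e] sq_integrableD(1)[OF s(3)] sq_integrableD(1)[OF s(3)]]) simp
    then show ?thesis using l2.add_left[of _ "leb V"] s by simp
  qed
  then show "grad_form (\<lambda>x. u x + v x) w = grad_form u w + grad_form v w"
    unfolding grad_form_def sum.distrib[symmetric] by (intro sum.cong) auto
next
  fix u w c assume H: "u \<in> H1 V" "w \<in> H1 V"
  have "l2_inner (leb V) (weak_partial V e (\<lambda>x. c * u x)) (weak_partial V e w) =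
     c * l2_inner (leb V) (weak_partial V e u) (weak_partial V e w)"
    if e: "e \<in> Basis" for e
  proof -
    note s = H1D(3)[OF H(1) e] H1D(3)[OF H(2) e] H1D(3)[OF H1_scale[OF H(1)] e]
    have "l2_inner (leb V) (weak_partial V e (\<lambda>x. c * u x)) (weak_partial V e w)
      = l2_inner (leb V) (\<lambda>x. c * weak_partial V e u x) (weak_partial V e w)"
      by (rule l2_inner_AE_cong[OF sq_integrableD(1)[OF s(3)] sq_integrableD(1)[OF sq_integrable_scale[OF s(1)]]
          weak_partial_scale[OF H(1) e] sq_integrableD(1)[OF s(2)] sq_integrableD(1)[OF s(2)]]) simp
    then show ?thesis using l2.scale_left[of _ "leb V"] s by simp
  qed
  then show "grad_form (\<lambda>x. c * u x) w = c * grad_form u w"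
    unfolding grad_form_def sum_distrib_left by (intro sum.cong) auto
next
  fix u v assume H: "u \<in> H1 V" "v \<in> H1 V"
  show "grad_form v u = cnj (grad_form u v)"
    unfolding grad_form_def cnj_sum using H1D(3)[OF H(1)] H1D(3)[OF H(2)] by (intro sum.cong l2.herm) auto
next
  show "(\<lambda>x. 0) \<in> H1 V" by (rule test_function_H1[OF test_function_0])
  show "0 \<le> Re (grad_form u u)" for u
    unfolding grad_form_def by (auto simp: l2_inner_self intro!: sum_nonneg)
qed (auto intro: H1_add H1_scale)

lemma grad_form_self: "Re (grad_form u u) = (\<Sum>e\<in>Basis. (l2_norm (leb V) (weak_partial V e u))\<^sup>2)"
  unfolding grad_form_def l2_inner_self by simp

lemma H1_norm_square: "(H1_norm V u)\<^sup>2 = (l2_norm (leb V) u)\<^sup>2 + Re (grad_form u u)"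
  unfolding H1_norm_def grad_form_self by (simp add: sum_nonneg)

lemma H1_norm_nonneg: "0 \<le> H1_norm V u"
  by (simp add: H1_norm_def sum_nonneg)

text \<open>The H^1 scalar product, written as the shift of \<open>grad_form\<close> by the constant
  -1.\<close>

definition H1_inner :: "(real \<times> real) form" where
  "H1_inner u v = grad_form u v - of_real (-1) * l2_inner (leb V) u v"

sublocale H1: nonneg_form "H1 V" H1_inner
proof unfold_locales
  fix u v w assume *: "u \<in> H1 V" "v \<in> H1 V" "w \<in> H1 V"
  show "H1_inner (\<lambda>x. u x + v x) w = H1_inner u w + H1_inner v w"
    using * l2.add_left[of u "leb V" v w] by (simp add: H1_inner_def grad.add_left H1D(1))
next
  fix u v assume *: "u \<in> H1 V" "v \<in> H1 V"
  show "H1_inner v u = cnj (H1_inner u v)"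
    using * grad.herm[of u v] l2.herm[of u "leb V" v] by (simp add: H1_inner_def H1D(1))
next
  fix u w a assume *: "u \<in> H1 V" "w \<in> H1 V"
  show "H1_inner (\<lambda>x. a * u x) w = a * H1_inner u w"
    using * l2.scale_left[of u "leb V" w a] by (simp add: H1_inner_def grad.scale_left H1D(1) algebra_simps)
next
  fix u assume "u \<in> H1 V"
  then show "0 \<le> Re (H1_inner u u)"
    using grad.nonneg[of u] by (simp add: H1_inner_def l2_inner_self)
qed (auto intro: H1_add H1_scale grad.D_nonempty)

lemma H1_norm_eq: "H1_norm V u = sqrt (Re (H1_inner u u))"
  using H1_norm_nonneg[of u] H1_norm_square[of u]
  by (simp add: H1_inner_def l2_inner_self real_sqrt_unique[symmetric])

lemma H1_triangle:
  "u \<in> H1 V \<Longrightarrow> v \<in> H1 V \<Longrightarrow> H1_norm V (\<lambda>x. u x + v x) \<le> H1_norm V u + H1_norm V v"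
  unfolding H1_norm_eq by (rule H1.sqrt_triangle)

lemma H1_norm_scale: "u \<in> H1 V \<Longrightarrow> H1_norm V (\<lambda>x. c * u x) = cmod c * H1_norm V u"
  unfolding H1_norm_eq by (simp add: H1.diag_scale real_sqrt_mult)

lemma H1_norm_minus_commute:
  assumes "u \<in> H1 V" "v \<in> H1 V" shows "H1_norm V (\<lambda>x. u x - v x) = H1_norm V (\<lambda>x. v x - u x)"
  using H1_norm_scale[OF H1.D_diff[OF assms], of "-1"] by simp

lemma H1_norm_ge_l2: "l2_norm (leb V) u \<le> H1_norm V u"
  unfolding H1_norm_def by (rule real_le_rsqrt) (simp add: sum_nonneg)

lemma H1_norm_ge_grad: "Re (grad_form u u) \<le> (H1_norm V u)\<^sup>2"
  unfolding H1_norm_square by simp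

end

lemma l2_norm_mono:
  assumes "sq_integrable M f" "sq_integrable M g" "\<And>x. cmod (f x) \<le> cmod (g x)"
  shows "l2_norm M f \<le> l2_norm M g"
  unfolding l2_norm_def
  by (intro real_sqrt_le_mono integral_mono sq_integrableD(2) assms power_mono) auto

lemma l2_norm_multiplier_tendsto:
  assumes f: "sq_integrable M f" and c: "\<And>n. c n \<in> borel_measurable M" "\<And>n x. cmod (c n x) \<le> B"
    and lim: "\<And>x. (\<lambda>n. c n x) \<longlonglongrightarrow> 1"
  shows "(\<lambda>n. l2_norm M (\<lambda>x. c n x * f x - f x)) \<longlonglongrightarrow> 0"
proof -
  have [measurable]: "f \<in> borel_measurable M" by (rule sq_integrableD(1)[OF f])
  note c(1) [measurable]
  have "(\<lambda>n. \<integral>x. (cmod (c n x * f x - f x))\<^sup>2 \<partial>M) \<longlonglongrightarrow> (\<integral>x. 0 \<partial>M)"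
  proof (rule integral_dominated_convergence[where w = "\<lambda>x. (B + 1)\<^sup>2 * (cmod (f x))\<^sup>2"])
    show "integrable M (\<lambda>x. (B + 1)\<^sup>2 * (cmod (f x))\<^sup>2)" using sq_integrableD(2)[OF f] by simp
    show "AE x in M. (\<lambda>n. (cmod (c n x * f x - f x))\<^sup>2) \<longlonglongrightarrow> 0"
    proof (rule AE_I2)
      fix x
      have "(\<lambda>n. (cmod (c n x * f x - f x))\<^sup>2) \<longlonglongrightarrow> (cmod (1 * f x - f x))\<^sup>2"
        by (intro tendsto_power tendsto_norm tendsto_diff tendsto_mult tendsto_const lim)
      then show "(\<lambda>n. (cmod (c n x * f x - f x))\<^sup>2) \<longlonglongrightarrow> 0" by simp
    qed
    show "AE x in M. norm ((cmod (c n x * f x - f x))\<^sup>2) \<le> (B + 1)\<^sup>2 * (cmod (f x))\<^sup>2" for n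
    proof (rule AE_I2)
      fix x
      have "cmod (c n x * f x - f x) \<le> cmod (c n x) * cmod (f x) + cmod (f x)"
        using norm_triangle_ineq4[of "c n x * f x" "f x"] by (simp add: norm_mult)
      also have "\<dots> \<le> (B + 1) * cmod (f x)" using mult_right_mono[OF c(2)[of n x], of "cmod (f x)"] by (simp add: algebra_simps)
      finally have "(cmod (c n x * f x - f x))\<^sup>2 \<le> ((B + 1) * cmod (f x))\<^sup>2" by (intro power_mono) auto
      then show "norm ((cmod (c n x * f x - f x))\<^sup>2) \<le> (B + 1)\<^sup>2 * (cmod (f x))\<^sup>2" by (simp add: power_mult_distrib)
    qed
  qed measurable
  then have "(\<lambda>n. sqrt (\<integral>x. (cmod (c n x * f x - f x))\<^sup>2 \<partial>M)) \<longlonglongrightarrow> sqrt 0"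
    by (intro tendsto_real_sqrt) simp
  then show ?thesis by (simp add: l2_norm_def)
qed

definition plane_bump :: "real \<times> real \<Rightarrow> complex" where
  "plane_bump x = complex_of_real (bump (fst x) * bump (snd x) / (bump 0)\<^sup>2)"

lemma plane_bump_test: "test_function UNIV plane_bump" and plane_bump_0: "plane_bump 0 = 1"
proof -
  have "smooth_map (\<lambda>s::real\<times>real. bump (0 + fst s) * bump (0 + snd s))"
    by (intro smooth_map_mult smooth_map_affine smooth_map_bump bounded_linear_fst bounded_linear_snd)
  then have "smooth_map (\<lambda>s::real\<times>real. complex_of_real (bump (0 + fst s) * bump (0 + snd s) / (bump 0)\<^sup>2))"
    by (intro smooth_map_linear[OF bounded_linear_of_real] smooth_map_linear[OF bounded_linear_divide])
  then have "smooth_map plane_bump" by (simp add: plane_bump_def[abs_def])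
  moreover have "x \<in> cbox (- 1, - 1) (1, 1)" if "plane_bump x \<noteq> 0" for x
  proof -
    have "\<bar>fst x\<bar> < 1" "\<bar>snd x\<bar> < 1"
      using that bump_outside[of "fst x"] bump_outside[of "snd x"] by (auto simp: plane_bump_def not_le[symmetric])
    then show ?thesis by (cases x) (auto simp: cbox_Pair_eq abs_less_iff)
  qed
  ultimately show "test_function UNIV plane_bump" by (intro test_functionI[of _ "cbox (- 1, - 1) (1, 1)"]) auto
  show "plane_bump 0 = 1" using bump_pos[of 0] by (simp add: plane_bump_def power2_eq_square)
qed

lemma test_function_rescale:
  assumes \<phi>: "test_function UNIV \<phi>" and c: "c > 0"
  shows "test_function UNIV (\<lambda>x. \<phi> (c *\<^sub>R x))"
    and "frechet_derivative (\<lambda>x. \<phi> (c *\<^sub>R x)) (at x) v = c *\<^sub>R frechet_derivative \<phi> (at (c *\<^sub>R x)) v"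
proof -
  have sm: "smooth_map (\<lambda>x. \<phi> (c *\<^sub>R x))"
    using smooth_map_affine[OF bounded_linear_scaleR_right[of c] test_functionD(1)[OF \<phi>], of 0] by simp
  obtain R where R: "R > 0" "\<And>x. norm x > R \<Longrightarrow> \<phi> x = 0" using test_function_zero_outside[OF \<phi>] by blast
  show "test_function UNIV (\<lambda>x. \<phi> (c *\<^sub>R x))"
  proof (rule test_functionI[OF sm, of "cball 0 (R / c)"])
    fix x assume "\<phi> (c *\<^sub>R x) \<noteq> 0"
    then have "\<not> norm (c *\<^sub>R x) > R" using R(2) by blast
    then show "x \<in> cball 0 (R / c)" using c by (simp add: field_simps)
  qed auto
  have "((\<lambda>x. \<phi> (c *\<^sub>R x)) has_derivative (\<lambda>v. frechet_derivative \<phi> (at (c *\<^sub>R x)) (c *\<^sub>R v))) (at x)"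
    by (rule has_derivative_compose[OF bounded_linear_imp_has_derivative[OF bounded_linear_scaleR_right]
        smooth_map_has_derivative[OF test_functionD(1)[OF \<phi>]]])
  then have "frechet_derivative (\<lambda>x. \<phi> (c *\<^sub>R x)) (at x) v = frechet_derivative \<phi> (at (c *\<^sub>R x)) (c *\<^sub>R v)"
    by (metis frechet_derivative_at)
  also have "\<dots> = c *\<^sub>R frechet_derivative \<phi> (at (c *\<^sub>R x)) v"
    by (rule linear_cmul[OF has_derivative_linear[OF smooth_map_has_derivative[OF test_functionD(1)[OF \<phi>]]]])
  finally show "frechet_derivative (\<lambda>x. \<phi> (c *\<^sub>R x)) (at x) v = c *\<^sub>R frechet_derivative \<phi> (at (c *\<^sub>R x)) v" .
qed

lemma sq_integrable_integrable_ball: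
  fixes f :: "real \<times> real \<Rightarrow> complex"
  assumes f: "sq_integrable lborel f" and z: "\<And>x. norm x > R \<Longrightarrow> f x = 0"
  shows "integrable lborel f"
proof (rule Bochner_Integration.integrable_bound)
  show "integrable lborel (\<lambda>x. (cmod (f x))\<^sup>2 + indicator (cball 0 R :: (real \<times> real) set) x)"
    using sq_integrableD(2)[OF f] emeasure_lborel_cball_finite
    by (intro Bochner_Integration.integrable_add integrable_real_indicator) auto
  have "cmod (f x) \<le> (cmod (f x))\<^sup>2 + indicator (cball 0 R) x" for x
  proof (cases "x \<in> cball 0 R")
    case True
    have "0 \<le> (cmod (f x) - 1/2)\<^sup>2" by simp
    then show ?thesis using True by (simp add: power2_eq_square algebra_simps)
  next
    case False
    then have "f x = 0" by (intro z) auto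
    then show ?thesis by simp
  qed
  then show "AE x in lborel. norm (f x) \<le> norm ((cmod (f x))\<^sup>2 + indicator (cball 0 R :: (real \<times> real) set) x)"
    by (intro AE_I2) (simp add: order_trans[OF _ abs_ge_self])
qed (rule sq_integrableD(1)[OF f])

section \<open>Density of test functions in H^1 and completeness of H^1\<close>

context epigraph
begin

lemma is_weak_partial_diff:
  assumes "is_weak_partial V e u g" "is_weak_partial V e u' g'" "sq_integrable (leb V) u" "sq_integrable (leb V) u'"
  shows "is_weak_partial V e (\<lambda>x. u x - u' x) (\<lambda>x. g x - g' x)"
  using is_weak_partial_add[OF assms(1) is_weak_partial_scale[OF assms(2), of "-1"] assms(3) sq_integrable_scale[OF assms(4), of "-1"]]
  by simp

lemma H1_norm_eqI:
  assumes "u \<in> H1 V" "\<And>e. e \<in> Basis \<Longrightarrow> is_weak_partial V e u (g e)"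
  shows "H1_norm V u = sqrt ((l2_norm (leb V) u)\<^sup>2 + (\<Sum>e\<in>Basis. (l2_norm (leb V) (g e))\<^sup>2))"
  unfolding H1_norm_def using weak_partial_l2_norm[OF assms(1) _ assms(2)] by simp

lemma H1_tendstoI:
  assumes "\<And>n. w n \<in> H1 V" "u \<in> H1 V" "\<And>n e. e \<in> Basis \<Longrightarrow> is_weak_partial V e (w n) (g n e)"
    "\<And>e. e \<in> Basis \<Longrightarrow> is_weak_partial V e u (g' e)"
    "(\<lambda>n. l2_norm (leb V) (\<lambda>x. w n x - u x)) \<longlonglongrightarrow> 0"
    "\<And>e. e \<in> Basis \<Longrightarrow> (\<lambda>n. l2_norm (leb V) (\<lambda>x. g n e x - g' e x)) \<longlonglongrightarrow> 0"
  shows "(\<lambda>n. H1_norm V (\<lambda>x. w n x - u x)) \<longlonglongrightarrow> 0"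
proof -
  have eq: "H1_norm V (\<lambda>x. w n x - u x) = sqrt ((l2_norm (leb V) (\<lambda>x. w n x - u x))\<^sup>2 +
     (\<Sum>e\<in>Basis. (l2_norm (leb V) (\<lambda>x. g n e x - g' e x))\<^sup>2))" for n
    by (rule H1_norm_eqI[OF grad.D_diff[OF assms(1,2)]
        is_weak_partial_diff[OF assms(3,4) H1D(1)[OF assms(1)] H1D(1)[OF assms(2)]]])
  have "(\<lambda>n. sqrt ((l2_norm (leb V) (\<lambda>x. w n x - u x))\<^sup>2 + (\<Sum>e\<in>Basis. (l2_norm (leb V) (\<lambda>x. g n e x - g' e x))\<^sup>2)))
     \<longlonglongrightarrow> sqrt (0\<^sup>2 + (\<Sum>e\<in>(Basis::(real \<times> real) set). 0\<^sup>2))"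
    by (intro tendsto_real_sqrt tendsto_add tendsto_power tendsto_sum assms(5,6))
  then show ?thesis unfolding eq by simp
qed

lemma mult_test_sq_integrable:
  assumes d: "test_function UNIV d" and f: "sq_integrable (leb V) f"
  shows "sq_integrable (leb V) (\<lambda>x. d x * f x)"
proof -
  obtain B where B: "B > 0" "\<And>x. cmod (d x) \<le> B" using test_function_bounded[OF d] by blast
  have db: "d \<in> borel_measurable (leb V)" by (rule sq_integrableD(1)[OF test_function_sq_integrable_leb[OF open_V d]])
  show ?thesis
  proof (rule sq_integrable_bound)
    show "(\<lambda>x. d x * f x) \<in> borel_measurable (leb V)"
      by (rule borel_measurable_times[OF db sq_integrableD(1)[OF f]])
    show "integrable (leb V) (\<lambda>x. B\<^sup>2 * (cmod (f x))\<^sup>2)" using sq_integrableD(2)[OF f] by simp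
    show "AE x in leb V. (cmod (d x * f x))\<^sup>2 \<le> B\<^sup>2 * (cmod (f x))\<^sup>2"
      using B by (intro AE_I2) (simp add: norm_mult power_mult_distrib mult_right_mono power_mono)
  qed
qed

lemma is_weak_partial_mult_test:
  assumes u: "is_weak_partial V e u g" "sq_integrable (leb V) u" and c: "test_function UNIV c"
  shows "is_weak_partial V e (\<lambda>x. c x * u x) (\<lambda>x. c x * g x + frechet_derivative c (at x) e * u x)"
proof -
  note g = is_weak_partialD[OF u(1)]
  note mult = mult_test_sq_integrable
  note dc = test_function_frechet_derivative[OF c, of e]
  show "is_weak_partial V e (\<lambda>x. c x * u x) (\<lambda>x. c x * g x + frechet_derivative c (at x) e * u x)"
    unfolding is_weak_partial_def
  proof (intro conjI allI impI)
    show "sq_integrable (leb V) (\<lambda>x. c x * g x + frechet_derivative c (at x) e * u x)"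
      by (rule sq_integrable_add[OF mult[OF c g(1)] mult[OF dc u(2)]])
    fix \<phi> assume \<phi>: "test_function V \<phi>"
    have c\<phi>: "test_function V (\<lambda>x. c x * \<phi> x)" by (rule test_function_mult[OF \<phi> test_functionD(1)[OF c]])
    have i1: "integrable (leb V) (\<lambda>x. u x * (c x * frechet_derivative \<phi> (at x) e))"
      by (rule mult_test_integrable[OF u(2) test_function_mult[OF test_function_frechet_derivative[OF \<phi>] test_functionD(1)[OF c]]])
    have i2: "integrable (leb V) (\<lambda>x. u x * (frechet_derivative c (at x) e * \<phi> x))"
      by (rule mult_test_integrable[OF u(2) test_function_mult[OF \<phi> test_functionD(1)[OF dc]]])
    have i3: "integrable (leb V) (\<lambda>x. g x * (c x * \<phi> x))" by (rule mult_test_integrable[OF g(1) c\<phi>])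
    have "(\<integral>x. u x * (c x * frechet_derivative \<phi> (at x) e) + u x * (frechet_derivative c (at x) e * \<phi> x) \<partial>leb V)
        = - (\<integral>x. g x * (c x * \<phi> x) \<partial>leb V)"
      using g(2)[OF c\<phi>] unfolding frechet_derivative_mult[OF test_functionD(1)[OF c] test_functionD(1)[OF \<phi>]] distrib_left .
    then have "(\<integral>x. u x * (c x * frechet_derivative \<phi> (at x) e) \<partial>leb V) =
        - ((\<integral>x. g x * (c x * \<phi> x) \<partial>leb V) + (\<integral>x. u x * (frechet_derivative c (at x) e * \<phi> x) \<partial>leb V))"
      using i1 i2 by (simp add: algebra_simps)
    also have "\<dots> = - (\<integral>x. g x * (c x * \<phi> x) + u x * (frechet_derivative c (at x) e * \<phi> x) \<partial>leb V)"
      using i2 i3 by simp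
    finally show "(\<integral>x. c x * u x * frechet_derivative \<phi> (at x) e \<partial>leb V) =
        - (\<integral>x. (c x * g x + frechet_derivative c (at x) e * u x) * \<phi> x \<partial>leb V)"
      by (simp add: algebra_simps)
  qed
qed

text \<open>A bump stretched by the factor n + 1 has derivative of size O(1 / (n + 1)), so the extra
  term in the product rule tends to 0 in L^2, while dominated convergence handles u and its
  derivatives.\<close>

lemma cutoff_dense:
  assumes u: "u \<in> H1 V" and "\<epsilon> > 0"
  obtains w R where "w \<in> H1 V" "\<And>x. norm x > R \<Longrightarrow> w x = 0" "H1_norm V (\<lambda>x. w x - u x) < \<epsilon>"
proof -
  define s where "s n = 1 / real (Suc n)" for n
  have s: "s n > 0" for n by (simp add: s_def)
  have s0: "s \<longlonglongrightarrow> 0" unfolding s_def by (rule LIMSEQ_Suc[OF lim_1_over_n])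
  define c where "c n x = plane_bump (s n *\<^sub>R x)" for n x
  have ct: "test_function UNIV (c n)" for n
    unfolding c_def[abs_def] by (rule test_function_rescale(1)[OF plane_bump_test s])
  have cd: "frechet_derivative (c n) (at x) e = s n *\<^sub>R frechet_derivative plane_bump (at (s n *\<^sub>R x)) e" for n x e
    unfolding c_def[abs_def] by (rule test_function_rescale(2)[OF plane_bump_test s])
  define g where "g n e x = c n x * weak_partial V e u x + frechet_derivative (c n) (at x) e * u x" for n e x
  define w where "w n x = c n x * u x" for n x
  have us: "sq_integrable (leb V) u" by (rule H1D(1)[OF u])
  have wp: "is_weak_partial V e (w n) (g n e)" if "e \<in> Basis" for n e
    unfolding w_def[abs_def] g_def[abs_def] by (rule is_weak_partial_mult_test[OF H1D(2)[OF u that] us ct])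
  have ws: "sq_integrable (leb V) (w n)" for n
    unfolding w_def[abs_def] by (rule mult_test_sq_integrable[OF ct us])
  have wH: "w n \<in> H1 V" for n by (rule H1I[OF ws wp])
  obtain B where B: "B > 0" "\<And>x. cmod (plane_bump x) \<le> B" using test_function_bounded[OF plane_bump_test] by blast
  have cl: "(\<lambda>n. l2_norm (leb V) (\<lambda>x. c n x * f x - f x)) \<longlonglongrightarrow> 0" if f: "sq_integrable (leb V) f" for f
  proof (rule l2_norm_multiplier_tendsto[OF f])
    show "c n \<in> borel_measurable (leb V)" for n
      by (rule sq_integrableD(1)[OF test_function_sq_integrable_leb[OF open_V ct]])
    show "cmod (c n x) \<le> B" for n x unfolding c_def by (rule B(2))
    show "(\<lambda>n. c n x) \<longlonglongrightarrow> 1" for x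
    proof -
      have "isCont plane_bump 0"
        using smooth_map_continuous[OF test_functionD(1)[OF plane_bump_test]] continuous_on_eq_continuous_at open_UNIV by blast
      moreover have "(\<lambda>n. s n *\<^sub>R x) \<longlonglongrightarrow> 0" using tendsto_scaleR[OF s0 tendsto_const[of x]] by simp
      ultimately have "(\<lambda>n. plane_bump (s n *\<^sub>R x)) \<longlonglongrightarrow> plane_bump 0" by (rule isCont_tendsto_compose)
      then show ?thesis by (simp add: c_def plane_bump_0)
    qed
  qed
  have "(\<lambda>n. H1_norm V (\<lambda>x. w n x - u x)) \<longlonglongrightarrow> 0"
  proof (rule H1_tendstoI[OF wH u wp H1D(2)[OF u]])
    show "(\<lambda>n. l2_norm (leb V) (\<lambda>x. w n x - u x)) \<longlonglongrightarrow> 0" unfolding w_def by (rule cl[OF us])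
    fix e :: "real \<times> real" assume e: "e \<in> Basis"
    obtain C where C: "C > 0" "\<And>x. cmod (frechet_derivative plane_bump (at x) e) \<le> C"
      using test_function_bounded[OF test_function_frechet_derivative[OF plane_bump_test]] by blast
    let ?p = "weak_partial V e u"
    have ps: "sq_integrable (leb V) ?p" by (rule H1D(3)[OF u e])
    have cps: "sq_integrable (leb V) (\<lambda>x. c n x * ?p x)" for n
      by (rule mult_test_sq_integrable[OF ct ps])
    have ds: "sq_integrable (leb V) (\<lambda>x. frechet_derivative (c n) (at x) e * u x)" for n
      using sq_integrable_diff[OF is_weak_partialD(1)[OF wp[OF e, of n]] cps[of n]] by (simp add: g_def)
    have db: "l2_norm (leb V) (\<lambda>x. frechet_derivative (c n) (at x) e * u x) \<le> s n * (C * l2_norm (leb V) u)" for n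
    proof -
      have "l2_norm (leb V) (\<lambda>x. frechet_derivative (c n) (at x) e * u x) \<le> l2_norm (leb V) (\<lambda>x. complex_of_real (s n * C) * u x)"
      proof (rule l2_norm_mono[OF ds sq_integrable_scale[OF us]])
        fix x
        have "cmod (frechet_derivative (c n) (at x) e) \<le> s n * C"
          unfolding cd norm_scaleR using s[of n] C(2) by (simp add: mult_left_mono)
        then show "cmod (frechet_derivative (c n) (at x) e * u x) \<le> cmod (complex_of_real (s n * C) * u x)"
          unfolding norm_mult[of _ "u x"] norm_of_real using s[of n] C(1) by (intro mult_right_mono) auto
      qed
      also have "\<dots> = s n * (C * l2_norm (leb V) u)"
        unfolding l2_norm_scale using s[of n] C(1) by (simp add: norm_mult)
      finally show ?thesis .
    qed
    show "(\<lambda>n. l2_norm (leb V) (\<lambda>x. g n e x - ?p x)) \<longlonglongrightarrow> 0"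
    proof (rule tendsto_sandwich[OF _ _ tendsto_const])
      show "(\<lambda>n. l2_norm (leb V) (\<lambda>x. c n x * ?p x - ?p x) + s n * (C * l2_norm (leb V) u)) \<longlonglongrightarrow> 0"
        using tendsto_add[OF cl[OF ps] tendsto_mult_left_zero[OF s0]] by simp
      show "eventually (\<lambda>n. l2_norm (leb V) (\<lambda>x. g n e x - ?p x) \<le> l2_norm (leb V) (\<lambda>x. c n x * ?p x - ?p x) + s n * (C * l2_norm (leb V) u)) sequentially"
      proof (intro always_eventually allI)
        fix n
        have "(\<lambda>x. g n e x - ?p x) = (\<lambda>x. (c n x * ?p x - ?p x) + frechet_derivative (c n) (at x) e * u x)"
          by (simp add: g_def algebra_simps)
        then have "l2_norm (leb V) (\<lambda>x. g n e x - ?p x) \<le> l2_norm (leb V) (\<lambda>x. c n x * ?p x - ?p x)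
            + l2_norm (leb V) (\<lambda>x. frechet_derivative (c n) (at x) e * u x)"
          using l2_triangle[OF sq_integrable_diff[OF cps ps] ds, of n n] by simp
        then show "l2_norm (leb V) (\<lambda>x. g n e x - ?p x) \<le> l2_norm (leb V) (\<lambda>x. c n x * ?p x - ?p x) + s n * (C * l2_norm (leb V) u)"
          using db[of n] by linarith
      qed
    qed (simp add: l2_norm_nonneg)
  qed
  then have "eventually (\<lambda>n. H1_norm V (\<lambda>x. w n x - u x) < \<epsilon>) sequentially"
    using \<open>\<epsilon> > 0\<close> by (rule order_tendstoD(2))
  then obtain n where n: "H1_norm V (\<lambda>x. w n x - u x) < \<epsilon>" using eventually_happens sequentially_bot by blast
  obtain R where R: "\<And>x. norm x > R \<Longrightarrow> c n x = 0" using test_function_zero_outside[OF ct] by blast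
  show thesis by (rule that[OF wH _ n, of R]) (simp add: w_def R)
qed

text \<open>Vanishing outside a ball makes the extension by zero integrable, so that its convolution
  with a test function is a test function of the whole plane.\<close>

lemma mollify_dense:
  assumes w: "w \<in> H1 V" and z: "\<And>x. norm x > R \<Longrightarrow> w x = 0" and "\<epsilon> > 0"
  shows "\<exists>\<phi>. test_function UNIV \<phi> \<and> H1_norm V (\<lambda>x. \<phi> x - w x) < \<epsilon>"
proof -
  let ?F = "insert w ((\<lambda>e. weak_partial V e w) ` Basis)"
  have F: "finite ?F" "f \<in> ?F \<Longrightarrow> sq_integrable (leb V) f" for f using H1D[OF w] by auto
  have e2: "\<epsilon> / 2 > 0" using \<open>\<epsilon> > 0\<close> by simp
  let ?z = "\<lambda>f z. indicator V z *\<^sub>R f z"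
  show ?thesis
  proof (rule mollifier[OF F e2])
    fix k :: "real \<times> real \<Rightarrow> real"
    assume kt: "test_function UNIV (\<lambda>s. complex_of_real (k s))"
      and kV: "\<And>x. x \<in> V \<Longrightarrow> test_function V (\<lambda>z. complex_of_real (k (x - z)))"
      and cs: "\<And>f. f \<in> ?F \<Longrightarrow> sq_integrable (leb V) (conv (?z f) (\<lambda>s. complex_of_real (k s)))"
      and cl: "\<And>f. f \<in> ?F \<Longrightarrow> l2_norm (leb V) (\<lambda>x. conv (?z f) (\<lambda>s. complex_of_real (k s)) x - f x) \<le> \<epsilon> / 2"
    let ?k = "\<lambda>s. complex_of_real (k s)"
    define \<phi> where "\<phi> = conv (?z w) ?k"
    have zw: "sq_integrable lborel (?z w)" using H1D(1)[OF w] by (simp add: leb_sq_integrable[OF open_V])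
    have zi: "integrable lborel (?z w)" by (rule sq_integrable_integrable_ball[OF zw, of R]) (simp add: z)
    have \<phi>: "test_function UNIV \<phi>"
      unfolding \<phi>_def by (rule test_function_conv[OF zi _ kt, of R]) (simp add: z)
    \<comment> \<open>The derivative is moved onto the kernel and from there, by the weak
      derivative, onto w; the sign from \<open>x - z\<close> cancels the sign of integration by
      parts. This works for x in V, where the reflected kernel is a test function of V.\<close>
    have d\<phi>: "frechet_derivative \<phi> (at x) e = conv (?z (weak_partial V e w)) ?k x" if e: "e \<in> Basis" and x: "x \<in> V" for e x
    proof -
      have dk: "((\<lambda>z. ?k (x - z)) has_derivative (\<lambda>v. frechet_derivative ?k (at (x - z)) (- v))) (at z)" for z
        by (rule has_derivative_compose[OF _ smooth_map_has_derivative[OF test_functionD(1)[OF kt]], of "\<lambda>z. x - z" "\<lambda>v. - v" z UNIV])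
           (auto intro!: derivative_eq_intros)
      have neg: "frechet_derivative ?k (at (x - z)) e = - frechet_derivative (\<lambda>z. ?k (x - z)) (at z) e" for z
        using frechet_derivative_at[OF dk[of z], symmetric]
          linear_neg[OF has_derivative_linear[OF smooth_map_has_derivative[OF test_functionD(1)[OF kt]]], of "x - z" e] by simp
      have "frechet_derivative \<phi> (at x) e = conv (?z w) (\<lambda>y. frechet_derivative ?k (at y) e) x"
        unfolding \<phi>_def frechet_derivative_at[OF conv_has_derivative[OF zi kt, of x], symmetric] ..
      also have "\<dots> = - (\<integral>z. w z * frechet_derivative (\<lambda>z. ?k (x - z)) (at z) e \<partial>leb V)"
        by (simp add: conv_extension neg)
      also have "\<dots> = (\<integral>z. weak_partial V e w z * ?k (x - z) \<partial>leb V)"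
        using is_weak_partialD(2)[OF H1D(2)[OF w e] kV[OF x]] by simp
      finally show ?thesis by (simp add: conv_extension)
    qed
    have g: "l2_norm (leb V) (\<lambda>x. frechet_derivative \<phi> (at x) e - weak_partial V e w x) \<le> \<epsilon> / 2" if e: "e \<in> Basis" for e
    proof -
      have "l2_norm (leb V) (\<lambda>x. frechet_derivative \<phi> (at x) e - weak_partial V e w x)
          = l2_norm (leb V) (\<lambda>x. conv (?z (weak_partial V e w)) ?k x - weak_partial V e w x)"
        unfolding l2_norm_def
        by (intro arg_cong[where f = sqrt] Bochner_Integration.integral_cong) (simp_all add: space_restrict_space d\<phi>[OF e])
      then show ?thesis using cl[of "weak_partial V e w"] e by simp
    qed
    have "H1_norm V (\<lambda>x. \<phi> x - w x) = sqrt ((l2_norm (leb V) (\<lambda>x. \<phi> x - w x))\<^sup>2 +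
        (\<Sum>e\<in>Basis. (l2_norm (leb V) (\<lambda>x. frechet_derivative \<phi> (at x) e - weak_partial V e w x))\<^sup>2))"
      by (rule H1_norm_eqI[OF grad.D_diff[OF test_function_H1[OF \<phi>] w]
          is_weak_partial_diff[OF test_weak_partial[OF \<phi>] H1D(2)[OF w] H1D(1)[OF test_function_H1[OF \<phi>]] H1D(1)[OF w]]])
    also have "\<dots> \<le> sqrt ((\<epsilon> / 2)\<^sup>2 + (\<Sum>e\<in>(Basis :: (real \<times> real) set). (\<epsilon> / 2)\<^sup>2))"
      using cl[of w] g unfolding \<phi>_def
      by (intro real_sqrt_le_mono add_mono sum_mono power_mono) (auto simp: l2_norm_nonneg)
    \<comment> \<open>One term for the function and two for its partial derivatives; the bound works
      because sqrt 3 / 2 < 1.\<close>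
    also have "(\<epsilon> / 2)\<^sup>2 + (\<Sum>e\<in>(Basis :: (real \<times> real) set). (\<epsilon> / 2)\<^sup>2) = 3 * (\<epsilon> / 2)\<^sup>2"
      by simp
    also have "sqrt \<dots> < \<epsilon>" using \<open>\<epsilon> > 0\<close> by (intro real_less_lsqrt) (auto simp: power2_eq_square)
    finally show ?thesis using \<phi> by blast
  qed
qed

theorem test_functions_dense:
  assumes u: "u \<in> H1 V"
  obtains \<phi> where "\<And>n. test_function UNIV (\<phi> n)" "(\<lambda>n. H1_norm V (\<lambda>x. \<phi> n x - u x)) \<longlonglongrightarrow> 0"
proof -
  have "\<exists>\<phi>. test_function UNIV \<phi> \<and> H1_norm V (\<lambda>x. \<phi> x - u x) < 1 / real (Suc n)" for n
  proof -
    have p: "(1 / real (Suc n)) / 2 > 0" by simp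
    obtain w R where w: "w \<in> H1 V" "\<And>x. norm x > R \<Longrightarrow> w x = 0" "H1_norm V (\<lambda>x. w x - u x) < (1 / real (Suc n)) / 2"
      using cutoff_dense[OF u p] by blast
    obtain \<phi> where \<phi>: "test_function UNIV \<phi>" "H1_norm V (\<lambda>x. \<phi> x - w x) < (1 / real (Suc n)) / 2"
      using mollify_dense[OF w(1,2) p] by blast
    have eq: "(\<lambda>x. (\<phi> x - w x) + (w x - u x)) = (\<lambda>x. \<phi> x - u x)" by simp
    have "H1_norm V (\<lambda>x. (\<phi> x - w x) + (w x - u x)) \<le> H1_norm V (\<lambda>x. \<phi> x - w x) + H1_norm V (\<lambda>x. w x - u x)"
      by (intro H1_triangle grad.D_diff test_function_H1 \<phi> w u)
    then have "H1_norm V (\<lambda>x. \<phi> x - u x) < 1 / real (Suc n)"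
      unfolding eq using \<phi>(2) w(3) field_sum_of_halves[of "1 / real (Suc n)"] by linarith
    then show ?thesis using \<phi>(1) by blast
  qed
  then obtain \<phi> where \<phi>: "\<And>n. test_function UNIV (\<phi> n)" "\<And>n. H1_norm V (\<lambda>x. \<phi> n x - u x) < 1 / real (Suc n)" by metis
  have "(\<lambda>n. H1_norm V (\<lambda>x. \<phi> n x - u x)) \<longlonglongrightarrow> 0"
    by (rule tendsto_sandwich[OF _ _ tendsto_const LIMSEQ_Suc[OF lim_1_over_n]])
       (use \<phi>(2) in \<open>auto simp: H1_norm_nonneg intro!: always_eventually less_imp_le\<close>)
  then show thesis using that \<phi>(1) by blast
qed

text \<open>Weak derivatives are characterised by L^2 pairings with test functions, and these pass
  to L^2 limits. The derivatives converge by the Cauchy condition on \<open>grad_form\<close>, the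
  shape in which closedness of the Robin form will supply it.\<close>

lemma H1_closed:
  assumes w: "\<And>n. w n \<in> H1 V" and u: "sq_integrable (leb V) u"
    and lim: "(\<lambda>n. l2_norm (leb V) (\<lambda>x. w n x - u x)) \<longlonglongrightarrow> 0"
    and cauchy: "\<And>\<epsilon>. \<epsilon> > 0 \<Longrightarrow> \<exists>N. \<forall>p\<ge>N. \<forall>q\<ge>N. Re (grad_form (\<lambda>x. w p x - w q x) (\<lambda>x. w p x - w q x)) < \<epsilon>"
  shows "u \<in> H1 V" "(\<lambda>n. H1_norm V (\<lambda>x. w n x - u x)) \<longlonglongrightarrow> 0"
proof -
  have "\<forall>e\<in>Basis. \<exists>g. is_weak_partial V e u g \<and> (\<lambda>n. l2_norm (leb V) (\<lambda>x. weak_partial V e (w n) x - g x)) \<longlonglongrightarrow> 0"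
  proof
    fix e :: "real \<times> real" assume e: "e \<in> Basis"
    let ?p = "\<lambda>n. weak_partial V e (w n)"
    have ps: "sq_integrable (leb V) (?p n)" for n by (rule H1D(3)[OF w e])
    have pd: "(l2_norm (leb V) (\<lambda>x. ?p i x - ?p j x))\<^sup>2 \<le> Re (grad_form (\<lambda>x. w i x - w j x) (\<lambda>x. w i x - w j x))" for i j
    proof -
      have "l2_norm (leb V) (\<lambda>x. ?p i x - ?p j x) = l2_norm (leb V) (weak_partial V e (\<lambda>x. w i x - w j x))"
        by (rule weak_partial_l2_norm[OF grad.D_diff[OF w w] e
            is_weak_partial_diff[OF H1D(2)[OF w e] H1D(2)[OF w e] H1D(1)[OF w] H1D(1)[OF w]], symmetric])
      then show ?thesis unfolding grad_form_self
        using member_le_sum[OF e, of "\<lambda>e. (l2_norm (leb V) (weak_partial V e (\<lambda>x. w i x - w j x)))\<^sup>2"] by simp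
    qed
    have pc: "\<exists>N. \<forall>i\<ge>N. \<forall>j\<ge>N. l2_norm (leb V) (\<lambda>x. ?p i x - ?p j x) < \<epsilon>" if "\<epsilon> > 0" for \<epsilon>
    proof -
      have "\<epsilon>\<^sup>2 > 0" using \<open>\<epsilon> > 0\<close> by simp
      then obtain N where N: "\<forall>i\<ge>N. \<forall>j\<ge>N. Re (grad_form (\<lambda>x. w i x - w j x) (\<lambda>x. w i x - w j x)) < \<epsilon>\<^sup>2"
        using cauchy by blast
      have "l2_norm (leb V) (\<lambda>x. ?p i x - ?p j x) < \<epsilon>" if "i \<ge> N" "j \<ge> N" for i j
        by (rule power2_less_imp_less[of _ \<epsilon>]) (use pd[of i j] N that \<open>\<epsilon> > 0\<close> in fastforce)+
      then show ?thesis by blast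
    qed
    obtain g where g: "sq_integrable (leb V) g" "(\<lambda>n. l2_norm (leb V) (\<lambda>x. ?p n x - g x)) \<longlonglongrightarrow> 0"
      using l2_complete[where f = ?p, OF ps pc] by blast
    have "(\<integral>x. u x * frechet_derivative \<phi> (at x) e \<partial>leb V) = - (\<integral>x. g x * \<phi> x \<partial>leb V)" if \<phi>: "test_function V \<phi>" for \<phi>
    proof -
      \<comment> \<open>\<open>l2_inner\<close> conjugates its second argument, so the bilinear
        pairings are inner products with conjugated test functions.\<close>
      have c: "sq_integrable (leb V) (\<lambda>x. cnj (\<phi> x))" "sq_integrable (leb V) (\<lambda>x. cnj (frechet_derivative \<phi> (at x) e))"
        by (rule sq_integrable_cnj[OF test_function_sq_integrable_leb[OF open_V \<phi>]],
            rule sq_integrable_cnj[OF test_function_sq_integrable_leb[OF open_V test_function_frechet_derivative[OF \<phi>]]])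
      have "(\<lambda>n. \<integral>x. w n x * frechet_derivative \<phi> (at x) e \<partial>leb V) \<longlonglongrightarrow> (\<integral>x. u x * frechet_derivative \<phi> (at x) e \<partial>leb V)"
        using l2_inner_tendsto[OF H1D(1)[OF w] u c(2) lim] by (simp add: l2_inner_def)
      moreover have "(\<lambda>n. - (\<integral>x. ?p n x * \<phi> x \<partial>leb V)) \<longlonglongrightarrow> - (\<integral>x. g x * \<phi> x \<partial>leb V)"
        using tendsto_minus[OF l2_inner_tendsto[OF ps g(1) c(1) g(2)]] by (simp add: l2_inner_def)
      ultimately show ?thesis
        unfolding is_weak_partialD(2)[OF H1D(2)[OF w e] \<phi>] by (rule LIMSEQ_unique)
    qed
    then have "is_weak_partial V e u g" unfolding is_weak_partial_def using g(1) by blast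
    then show "\<exists>g. is_weak_partial V e u g \<and> (\<lambda>n. l2_norm (leb V) (\<lambda>x. weak_partial V e (w n) x - g x)) \<longlonglongrightarrow> 0"
      using g(2) by blast
  qed
  from bchoice[OF this] obtain g where "\<forall>e\<in>Basis. is_weak_partial V e u (g e) \<and>
      (\<lambda>n. l2_norm (leb V) (\<lambda>x. weak_partial V e (w n) x - g e x)) \<longlonglongrightarrow> 0" by blast
  then have g: "\<And>e. e \<in> Basis \<Longrightarrow> is_weak_partial V e u (g e)"
    "\<And>e. e \<in> Basis \<Longrightarrow> (\<lambda>n. l2_norm (leb V) (\<lambda>x. weak_partial V e (w n) x - g e x)) \<longlonglongrightarrow> 0"
    by blast+
  show uH: "u \<in> H1 V" by (rule H1I[OF u g(1)])
  show "(\<lambda>n. H1_norm V (\<lambda>x. w n x - u x)) \<longlonglongrightarrow> 0"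
    by (rule H1_tendstoI[OF w uH H1D(2)[OF w] g(1) lim g(2)])
qed

end

section \<open>Arc length on the graph\<close>

context epigraph
begin

definition speed :: "real \<Rightarrow> real" where "speed x = sqrt (1 + (deriv h x)\<^sup>2)"

definition graph :: "real \<Rightarrow> real \<times> real" where "graph x = (x, h x)"

text \<open>The concrete candidate for arc length: \<open>sqrt (1 + h'^2) dx\<close> carried to the
  graph. It is set up independently of the description in \<open>arc_length_measure\<close> and
  identified with it afterwards.\<close>

definition graph_measure :: "(real \<times> real) measure" where
  "graph_measure = distr (density lborel (\<lambda>x. ennreal (speed x))) borel graph"

lemma h_has_derivative: "(h has_real_derivative deriv h x) (at x)"
  by (rule smooth_map_real_deriv(1)[OF h_smooth])

lemma deriv_h_continuous: "continuous_on S (deriv h)"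
  by (rule smooth_map_continuous[OF smooth_map_real_deriv(2)[OF h_smooth]])

lemma speed_continuous: "continuous_on S speed"
  unfolding speed_def by (intro continuous_intros deriv_h_continuous)

lemma speed_ge_1: "1 \<le> speed x"
  by (simp add: speed_def)

lemma speed_pos: "0 < speed x"
  using speed_ge_1[of x] by linarith

lemma speed_square: "(speed x)\<^sup>2 = 1 + (deriv h x)\<^sup>2"
  unfolding speed_def by (rule real_sqrt_pow2) simp

lemma speed_square_le: "(speed x)\<^sup>2 \<le> 1 + m\<^sup>2"
  unfolding speed_square using h_deriv_le[of x] m_nonneg by (simp add: abs_le_square_iff[symmetric])

lemma graph_continuous: "continuous_on S graph"
  unfolding graph_def by (intro continuous_intros h_continuous)

lemma graph_measurable [measurable]: "graph \<in> borel_measurable borel"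
  by (rule borel_measurable_continuous_onI[OF graph_continuous])

lemma speed_measurable [measurable]: "speed \<in> borel_measurable borel"
  by (rule borel_measurable_continuous_onI[OF speed_continuous])

lemma fst_graph [simp]: "fst (graph x) = x"
  by (simp add: graph_def)

lemma frontier_V: "frontier V = range graph"
proof -
  have cl: "closure V = {q. h (fst q) \<le> snd q}"
  proof (rule antisym)
    have "closed {q::real\<times>real. h (fst q) \<le> snd q}"
      by (intro closed_Collect_le continuous_on_compose2[OF h_continuous[of UNIV]] continuous_on_fst continuous_on_snd continuous_on_id) auto
    then show "closure V \<subseteq> {q. h (fst q) \<le> snd q}"
      by (intro closure_minimal) (auto simp: V_def)
    show "{q. h (fst q) \<le> snd q} \<subseteq> closure V"
    proof
      fix q assume "q \<in> {q. h (fst q) \<le> snd q}"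
      then have q: "h (fst q) \<le> snd q" by simp
      have "(\<lambda>n. q + (0, 1 / real (Suc n))) \<longlonglongrightarrow> q + (0, 0)"
        by (intro tendsto_add tendsto_Pair tendsto_const LIMSEQ_Suc[OF lim_1_over_n])
      moreover have "q + (0, 1 / real (Suc n)) \<in> V" for n
        using q by (simp add: V_def) (smt (verit) divide_pos_pos of_nat_0_less_iff zero_less_Suc of_nat_Suc)
      ultimately show "q \<in> closure V" unfolding closure_sequential by (intro exI[of _ "\<lambda>n. q + (0, 1 / real (Suc n))"]) (simp add: zero_prod_def[symmetric])
    qed
  qed
  have "frontier V = {q. h (fst q) \<le> snd q} - V"
    unfolding frontier_def cl interior_open[OF open_V] ..
  also have "\<dots> = range graph" by (auto simp: V_def graph_def image_iff prod_eq_iff)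
  finally show ?thesis .
qed

lemma frontier_V_borel: "frontier V \<in> sets borel"
  by simp

lemma sets_graph_measure [simp]: "sets graph_measure = sets borel"
  and space_graph_measure [simp]: "space graph_measure = UNIV"
  by (simp_all add: graph_measure_def)

lemma measurable_graph_measure [simp]: "borel_measurable graph_measure = borel_measurable borel"
  by (intro measurable_cong_sets) simp_all

lemma nn_integral_graph_measure:
  assumes [measurable]: "f \<in> borel_measurable borel"
  shows "(\<integral>\<^sup>+x. f x \<partial>graph_measure) = (\<integral>\<^sup>+x. ennreal (speed x) * f (graph x) \<partial>lborel)"
  unfolding graph_measure_def by (simp add: nn_integral_distr nn_integral_density)

lemma integral_graph_measure:
  fixes f :: "real \<times> real \<Rightarrow> 'b::{banach, second_countable_topology}"
  assumes [measurable]: "f \<in> borel_measurable borel"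
  shows "(\<integral>x. f x \<partial>graph_measure) = (\<integral>x. speed x *\<^sub>R f (graph x) \<partial>lborel)"
    "integrable graph_measure f \<longleftrightarrow> integrable lborel (\<lambda>x. speed x *\<^sub>R f (graph x))"
  unfolding graph_measure_def using less_imp_le[OF speed_pos]
  by (simp_all add: integral_distr integral_density integrable_distr_eq integrable_density)

lemma emeasure_graph_measure:
  assumes A: "A \<in> sets borel"
  shows "emeasure graph_measure A = (\<integral>\<^sup>+x. ennreal (speed x) * indicator {x. graph x \<in> A} x \<partial>lborel)"
proof -
  have "emeasure graph_measure A = (\<integral>\<^sup>+q. indicator A q \<partial>graph_measure)" using A by simp
  also have "\<dots> = (\<integral>\<^sup>+x. ennreal (speed x) * indicator A (graph x) \<partial>lborel)"
    using A by (intro nn_integral_graph_measure) simp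
  finally show ?thesis by (simp add: indicator_def)
qed

lemma graph_measure_segment:
  assumes "a \<le> b" and S: "\<And>x. x \<in> {a..b} \<Longrightarrow> (S has_real_derivative speed x) (at x within {a..b})"
    and A: "A \<in> sets borel" "{x. graph x \<in> A} = {a..b}"
  shows "emeasure graph_measure A = ennreal (S b - S a)"
proof -
  have i: "(\<integral>x. indicator {a..b} x *\<^sub>R speed x \<partial>lborel) = S b - S a"
    by (rule integral_FTC_atLeastAtMost[OF assms(1) _ speed_continuous])
       (use S in \<open>auto simp: has_real_derivative_iff_has_vector_derivative\<close>)
  have ii: "integrable lborel (\<lambda>x. indicator {a..b} x *\<^sub>R speed x)"
    by (rule borel_integrable_compact[OF compact_Icc speed_continuous])
  have "emeasure graph_measure A = (\<integral>\<^sup>+x. ennreal (speed x) * indicator {a..b} x \<partial>lborel)"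
    unfolding emeasure_graph_measure[OF A(1)] A(2) ..
  also have "\<dots> = (\<integral>\<^sup>+x. ennreal (indicator {a..b} x *\<^sub>R speed x) \<partial>lborel)"
    by (intro nn_integral_cong) (simp add: indicator_def)
  also have "\<dots> = ennreal (S b - S a)"
    using nn_integral_eq_integral[OF ii] less_imp_le[OF speed_pos] i by simp
  finally show ?thesis .
qed

lemma speed_antiderivative:
  obtains S where "\<And>x. x \<in> {a..b} \<Longrightarrow> (S has_real_derivative speed x) (at x within {a..b})"
  using antiderivative_continuous[OF speed_continuous[of "{a..b}"]]
  by (metis has_real_derivative_iff_has_vector_derivative)

text \<open>On the graph a velocity has the form (d, h' d), so a regular arc has nonvanishing
  horizontal speed, moves in one direction and covers the graph over an interval exactly once. Its
  length is then a substitution in the integral of \<open>speed\<close>.\<close>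

lemma arc_length_of_arc:
  assumes arc: "arc \<gamma>" and C1: "\<gamma> C1_differentiable_on {0..1}"
    and nz: "\<And>t. t \<in> {0..1} \<Longrightarrow> vector_derivative \<gamma> (at t) \<noteq> 0" and im: "path_image \<gamma> \<subseteq> frontier V"
  shows "emeasure graph_measure (path_image \<gamma>) = ennreal (integral {0..1} (\<lambda>t. norm (vector_derivative \<gamma> (at t))))"
proof -
  obtain D where D: "\<And>t. t \<in> {0..1} \<Longrightarrow> (\<gamma> has_vector_derivative D t) (at t)" "continuous_on {0..1} D"
    using C1 unfolding C1_differentiable_on_def by blast
  have vd: "vector_derivative \<gamma> (at t) = D t" if "t \<in> {0..1}" for t
    by (rule vector_derivative_at[OF D(1)[OF that]])
  define x where "x t = fst (\<gamma> t)" for t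
  define d where "d t = fst (D t)" for t
  have \<gamma>: "\<gamma> t = graph (x t)" if "t \<in> {0..1}" for t
  proof -
    have "\<gamma> t \<in> range graph" using im that unfolding frontier_V path_image_def by blast
    then show ?thesis by (auto simp: x_def)
  qed
  have xd: "(x has_real_derivative d t) (at t)" if "t \<in> {0..1}" for t
    unfolding has_real_derivative_iff_has_vector_derivative has_vector_derivative_def x_def d_def
    using has_derivative_fst[OF D(1)[OF that, unfolded has_vector_derivative_def]] by simp
  have dc: "continuous_on {0..1} d" unfolding d_def by (intro continuous_on_fst D(2))
  \<comment> \<open>The arc is known to lie on the graph for parameters in {0..1} only, so the two
    derivatives are compared within that interval, one-sidedly at its end points.\<close>
  have snd: "snd (D t) = deriv h (x t) * d t" if t: "t \<in> {0..1}" for t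
  proof -
    have 1: "((\<lambda>t. snd (\<gamma> t)) has_vector_derivative snd (D t)) (at t within {0..1})"
      unfolding has_vector_derivative_def
      using has_derivative_at_withinI[OF has_derivative_snd[OF D(1)[OF t, unfolded has_vector_derivative_def]]] by simp
    have "((\<lambda>t. h (x t)) has_real_derivative deriv h (x t) * d t) (at t)"
      by (rule DERIV_chain2[OF h_has_derivative xd[OF t]])
    then have "((\<lambda>t. h (x t)) has_vector_derivative deriv h (x t) * d t) (at t within {0..1})"
      unfolding has_real_derivative_iff_has_vector_derivative[symmetric] by (rule has_field_derivative_at_within)
    then have 2: "((\<lambda>t. snd (\<gamma> t)) has_vector_derivative deriv h (x t) * d t) (at t within {0..1})"
      by (rule has_vector_derivative_transform[OF t, rotated]) (simp add: \<gamma> graph_def)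
    show ?thesis
      using vector_derivative_unique_within_closed_interval[of 0 1 t "\<lambda>t. snd (\<gamma> t)"] 1 2 t by (simp add: box_real)
  qed
  have nrm: "norm (D t) = speed (x t) * \<bar>d t\<bar>" if t: "t \<in> {0..1}" for t
  proof -
    have "norm (D t) = sqrt ((d t)\<^sup>2 + (deriv h (x t) * d t)\<^sup>2)"
      using snd[OF t] by (cases "D t") (simp add: d_def norm_Pair)
    also have "(d t)\<^sup>2 + (deriv h (x t) * d t)\<^sup>2 = (1 + (deriv h (x t))\<^sup>2) * (d t)\<^sup>2"
      by (simp add: power_mult_distrib algebra_simps)
    finally show ?thesis by (simp add: real_sqrt_mult speed_def)
  qed
  have dnz: "d t \<noteq> 0" if "t \<in> {0..1}" for t
    using nz[OF that] nrm[OF that] unfolding vd[OF that] by auto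
  have xc: "continuous_on {0..1} x"
    using xd DERIV_isCont by (intro continuous_at_imp_continuous_on) blast
  \<comment> \<open>s is the sign of the horizontal speed, so that both orientations are treated at
    once.\<close>
  have main: ?thesis if s: "s = 1 \<or> s = -1" and pos: "\<And>t. t \<in> {0..1} \<Longrightarrow> 0 < s * d t" for s :: real
  proof -
    have mono: "s * x t \<le> s * x t'" if "t \<in> {0..1}" "t' \<in> {0..1}" "t \<le> t'" for t t'
    proof (rule DERIV_nonneg_imp_nondecreasing[OF that(3), of "\<lambda>t. s * x t"])
      fix z assume "t \<le> z" "z \<le> t'"
      then have z: "z \<in> {0..1}" using that by auto
      show "\<exists>y. ((\<lambda>t. s * x t) has_real_derivative y) (at z) \<and> 0 \<le> y"
        using DERIV_cmult[OF xd[OF z], of s] pos[OF z] less_imp_le by blast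
    qed
    define lo where "lo = min (x 0) (x 1)"
    define hi where "hi = max (x 0) (x 1)"
    have xin: "x t \<in> {lo..hi}" if t: "t \<in> {0..1}" for t
      using mono[of 0 t] mono[of t 1] t s by (auto simp: lo_def hi_def)
    have ximg: "x ` {0..1} = {lo..hi}"
    proof
      show "x ` {0..1} \<subseteq> {lo..hi}" using xin by blast
      have conn: "connected (x ` {0..1})" by (intro connected_continuous_image xc connected_Icc)
      have l: "lo \<in> x ` {0..1}" and u: "hi \<in> x ` {0..1}" by (auto simp: lo_def hi_def min_def max_def)
      show "{lo..hi} \<subseteq> x ` {0..1}"
      proof
        fix y assume "y \<in> {lo..hi}"
        then show "y \<in> x ` {0..1}" by (intro connectedD_interval[OF conn l u]) simp_all
      qed
    qed
    have pi: "path_image \<gamma> = graph ` {lo..hi}"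
      unfolding ximg[symmetric] path_image_def image_image using \<gamma> by (intro image_cong) auto
    have pre: "{y. graph y \<in> path_image \<gamma>} = {lo..hi}" unfolding pi by (auto simp: graph_def)
    have "compact (path_image \<gamma>)" using arc arc_imp_path compact_path_image by blast
    then have pb: "path_image \<gamma> \<in> sets borel" using borel_compact by blast
    obtain S where S: "\<And>y. y \<in> {lo..hi} \<Longrightarrow> (S has_real_derivative speed y) (at y within {lo..hi})"
      by (rule speed_antiderivative[of lo hi]) (rule that)
    have lohi: "lo \<le> hi" by (simp add: lo_def hi_def)
    have e: "emeasure graph_measure (path_image \<gamma>) = ennreal (S hi - S lo)"
      by (rule graph_measure_segment[OF lohi S pb pre])
    have "((\<lambda>t. norm (vector_derivative \<gamma> (at t))) has_integral (s * S (x 1) - s * S (x 0))) {0..1}"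
    proof (rule fundamental_theorem_of_calculus)
      fix t :: real assume t: "t \<in> {0..1}"
      have "((\<lambda>t. S (x t)) has_real_derivative speed (x t) * d t) (at t within {0..1})"
        using DERIV_image_chain[of S "speed (x t)" x t "{0..1}" "d t"] S[OF xin[OF t]] ximg
          has_field_derivative_at_within[OF xd[OF t]] by (simp add: comp_def)
      then have "((\<lambda>t. s * S (x t)) has_real_derivative s * (speed (x t) * d t)) (at t within {0..1})"
        by (rule DERIV_cmult)
      moreover have "s * (speed (x t) * d t) = norm (vector_derivative \<gamma> (at t))"
        unfolding vd[OF t] nrm[OF t] using s pos[OF t] by auto
      ultimately show "((\<lambda>t. s * S (x t)) has_vector_derivative norm (vector_derivative \<gamma> (at t))) (at t within {0..1})"
        by (simp add: has_real_derivative_iff_has_vector_derivative)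
    qed simp
    then have "integral {0..1} (\<lambda>t. norm (vector_derivative \<gamma> (at t))) = s * S (x 1) - s * S (x 0)"
      by (rule integral_unique)
    also have "\<dots> = S hi - S lo"
      using s mono[of 0 1] by (auto simp: lo_def hi_def min_def max_def)
    finally show ?thesis using e by simp
  qed
  show ?thesis
  proof (cases "d 0 > 0")
    case True
    have "0 < d t" if "t \<in> {0..1}" for t
    proof (rule ccontr)
      assume "\<not> 0 < d t"
      have "connected (d ` {0..1})" by (intro connected_continuous_image dc connected_Icc)
      then have "0 \<in> d ` {0..1}"
        by (rule connectedD_interval[of _ "d t" "d 0"]) (use that True \<open>\<not> 0 < d t\<close> in auto)
      then show False using dnz by auto
    qed
    then show ?thesis using main[of 1] by simp
  next
    case False
    have "d t < 0" if "t \<in> {0..1}" for t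
    proof (rule ccontr)
      assume "\<not> d t < 0"
      have "connected (d ` {0..1})" by (intro connected_continuous_image dc connected_Icc)
      then have "0 \<in> d ` {0..1}"
        by (rule connectedD_interval[of _ "d 0" "d t"]) (use that False \<open>\<not> d t < 0\<close> in auto)
      then show False using dnz by auto
    qed
    then show ?thesis using main[of "-1"] by simp
  qed
qed

lemma graph_measure_is_arc_length: "is_arc_length_measure V graph_measure"
  unfolding is_arc_length_measure_def
proof (intro conjI allI impI)
  have "{x. graph x \<in> - frontier V} = {}" by (auto simp: frontier_V)
  then show "emeasure graph_measure (- frontier V) = 0"
    using frontier_V_borel by (subst emeasure_graph_measure) simp_all
qed (use arc_length_of_arc in auto)

text \<open>The defining property is about arcs only. A piece of the graph over a nondegenerate
  interval is one, and as the measure is carried by the frontier, this fixes its value on a whole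
  vertical slab.\<close>

lemma arc_length_segment:
  assumes \<sigma>: "is_arc_length_measure V \<sigma>" and ab: "a < b"
  shows "emeasure \<sigma> {q. fst q \<in> {a..b}} = emeasure graph_measure {q. fst q \<in> {a..b}}"
    "emeasure \<sigma> {q. fst q \<in> {a..b}} < \<infinity>"
proof -
  define \<gamma> where "\<gamma> t = graph (a + t * (b - a))" for t
  have vd: "(\<gamma> has_vector_derivative (b - a, deriv h (a + t * (b - a)) * (b - a))) (at t)" for t
  proof -
    have "((\<lambda>t. h (a + t * (b - a))) has_real_derivative deriv h (a + t * (b - a)) * (b - a)) (at t)"
      by (rule DERIV_chain2[OF h_has_derivative]) (auto intro!: derivative_eq_intros)
    moreover have "((\<lambda>t. a + t * (b - a)) has_real_derivative (b - a)) (at t)" by (auto intro!: derivative_eq_intros)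
    ultimately show ?thesis
      unfolding \<gamma>_def[abs_def] graph_def has_real_derivative_iff_has_vector_derivative
      by (intro has_vector_derivative_Pair)
  qed
  have C1: "\<gamma> C1_differentiable_on {0..1}"
    unfolding C1_differentiable_on_def
    by (intro exI[of _ "\<lambda>t. (b - a, deriv h (a + t * (b - a)) * (b - a))"] conjI ballI vd continuous_intros
        continuous_on_compose2[OF deriv_h_continuous[of UNIV]]) auto
  have arc: "arc \<gamma>"
    unfolding arc_def
  proof
    show "path \<gamma>" unfolding path_def using C1 C1_differentiable_imp_continuous_on by blast
    show "inj_on \<gamma> {0..1}" using ab by (auto simp: inj_on_def \<gamma>_def graph_def)
  qed
  have nz: "vector_derivative \<gamma> (at t) \<noteq> 0" for t
    using vector_derivative_at[OF vd[of t]] ab by (simp add: zero_prod_def)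
  have "(\<lambda>t. a + t * (b - a)) ` {0..1} = {a..b}"
    using ab image_affinity_atLeastAtMost[of "b - a" a 0 1] by (simp add: mult.commute add.commute)
  then have pi: "path_image \<gamma> = graph ` {a..b}"
    unfolding path_image_def \<gamma>_def by (metis image_image)
  have im: "path_image \<gamma> \<subseteq> frontier V" unfolding pi frontier_V by blast
  have cb: "path_image \<gamma> \<in> sets borel"
    using arc arc_imp_path compact_path_image borel_compact by blast
  have slab: "emeasure \<tau> {q. fst q \<in> {a..b}} = ennreal (integral {0..1} (\<lambda>t. norm (vector_derivative \<gamma> (at t))))"
    if \<tau>: "is_arc_length_measure V \<tau>" for \<tau>
  proof -
    have sets: "sets \<tau> = sets borel" and null: "emeasure \<tau> (- frontier V) = 0"
      using \<tau> by (auto simp: is_arc_length_measure_def)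
    have sb: "{q::real \<times> real. fst q \<in> {a..b}} \<in> sets borel"
    proof -
      have "closed (fst -` {a..b} :: (real \<times> real) set)" by (intro closed_vimage) (auto intro: continuous_intros)
      then show ?thesis by (simp add: vimage_def)
    qed
    have "emeasure \<tau> {q. fst q \<in> {a..b}} = emeasure \<tau> (path_image \<gamma>)"
    proof (rule emeasure_eq_AE)
      have "AE q in \<tau>. q \<in> frontier V"
        using null sets frontier_V_borel by (intro AE_I[of _ _ "- frontier V"]) (auto simp: sets_eq_imp_space_eq[OF sets])
      then show "AE q in \<tau>. q \<in> {q. fst q \<in> {a..b}} \<longleftrightarrow> q \<in> path_image \<gamma>"
        by eventually_elim (auto simp: frontier_V pi image_iff graph_def)
    qed (use cb sb sets in auto)
    also have "\<dots> = ennreal (integral {0..1} (\<lambda>t. norm (vector_derivative \<gamma> (at t))))"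
      using \<tau> arc C1 nz im by (auto simp: is_arc_length_measure_def)
    finally show ?thesis .
  qed
  show "emeasure \<sigma> {q. fst q \<in> {a..b}} = emeasure graph_measure {q. fst q \<in> {a..b}}"
    using slab[OF \<sigma>] slab[OF graph_measure_is_arc_length] by simp
  show "emeasure \<sigma> {q. fst q \<in> {a..b}} < \<infinity>" using slab[OF \<sigma>] by simp
qed

text \<open>A measure carried by the graph is determined by its projection to the first axis, so
  uniqueness becomes a pi-system argument on the line.\<close>

lemma arc_length_unique:
  assumes \<sigma>: "is_arc_length_measure V \<sigma>"
  shows "\<sigma> = graph_measure"
proof -
  have sets: "sets \<sigma> = sets borel" and null: "emeasure \<sigma> (- frontier V) = 0"
    using \<sigma> by (auto simp: is_arc_length_measure_def)
  have fm: "fst \<in> measurable \<tau> borel" if "sets \<tau> = sets borel" for \<tau> :: "(real \<times> real) measure"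
    using measurable_cong_sets[OF that refl] borel_measurable_continuous_onI[OF continuous_on_fst[OF continuous_on_id]] by blast
  have space: "space \<tau> = UNIV" if "sets \<tau> = sets borel" for \<tau> :: "(real \<times> real) measure"
    using sets_eq_imp_space_eq[OF that] by simp
  have slab: "emeasure (distr \<tau> borel fst) A = emeasure \<tau> {q. fst q \<in> A}" if "sets \<tau> = sets borel" "A \<in> sets borel"
    for \<tau> :: "(real \<times> real) measure" and A
    using emeasure_distr[OF fm[OF that(1)] that(2)] space[OF that(1)] by (simp add: vimage_def)
  have icc: "emeasure (distr \<sigma> borel fst) {a..b} = emeasure (distr graph_measure borel fst) {a..b}"
    "emeasure (distr \<sigma> borel fst) {a..b} < \<infinity>" if "a < b" for a b
    using arc_length_segment[OF \<sigma> that] by (simp_all add: slab[OF sets] slab[OF sets_graph_measure])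
  \<comment> \<open>Closed intervals with a < b are not stable under intersection, open intervals
    (including the empty one) are; hence the exhaustion from inside.\<close>
  have ioo: "emeasure (distr \<sigma> borel fst) {a<..<b} = emeasure (distr graph_measure borel fst) {a<..<b}" for a b :: real
  proof (cases "a < b")
    case True
    \<comment> \<open>With n + 3 in the denominator even the first interval is nondegenerate, as
      \<open>arc_length_segment\<close> demands.\<close>
    define I where "I n = {a + (b - a) / (real n + 3) .. b - (b - a) / (real n + 3)}" for n
    have r: "(b - a) / (real n + 3) < (b - a) / 2" for n using True by (intro divide_strict_left_mono) auto
    have lt: "a + (b - a) / (real n + 3) < b - (b - a) / (real n + 3)" for n 
    proof -
      define d where "d = (b - a) / (real n + 3)"
      show ?thesis using r[of n] unfolding d_def[symmetric] by simp
    qed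
    have inc: "incseq I"
    proof (rule incseq_SucI)
      fix n
      have "(b - a) / (real (Suc n) + 3) \<le> (b - a) / (real n + 3)" using True by (intro divide_left_mono) auto
      then show "I n \<subseteq> I (Suc n)" unfolding I_def by auto
    qed
    have un: "(\<Union>n. I n) = {a<..<b}"
    proof
      show "(\<Union>n. I n) \<subseteq> {a<..<b}"
      proof
        fix x assume "x \<in> (\<Union>n. I n)"
        then obtain n where n: "x \<in> I n" by blast
        have "(b - a) / (real n + 3) > 0" using True by simp
        then show "x \<in> {a<..<b}" using n by (auto simp: I_def)
      qed
      show "{a<..<b} \<subseteq> (\<Union>n. I n)"
      proof
        fix x assume x: "x \<in> {a<..<b}"
        define e where "e = min (x - a) (b - x)"
        have e: "e > 0" using x by (simp add: e_def)
        obtain n :: nat where n: "(b - a) / e < real n" using reals_Archimedean2 by blast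
        have "(b - a) < real n * e" using n e by (simp add: pos_divide_less_eq)
        also have "\<dots> \<le> e * (real n + 3)" using e by (simp add: algebra_simps)
        finally have "(b - a) / (real n + 3) < e" by (simp add: pos_divide_less_eq)
        then have "x \<in> I n" by (simp add: I_def e_def)
        then show "x \<in> (\<Union>n. I n)" by blast
      qed
    qed
    have "emeasure (distr \<tau> borel fst) {a<..<b} = (SUP n. emeasure (distr \<tau> borel fst) (I n))" for \<tau> :: "(real \<times> real) measure"
      unfolding un[symmetric] 
    proof (rule SUP_emeasure_incseq[symmetric])
      show "range I \<subseteq> sets (distr \<tau> borel fst)" by (auto simp: I_def)
    qed (rule inc)
    moreover have "emeasure (distr \<sigma> borel fst) (I n) = emeasure (distr graph_measure borel fst) (I n)" for n
      unfolding I_def by (rule icc(1)[OF lt])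
    ultimately show ?thesis by simp
  qed simp
  have b: "sets (borel :: real measure) = sigma_sets UNIV (range (\<lambda>(a, b). {a<..<b}))"
  proof -
    have eq: "(\<lambda>(a, b). {a<..<b::real}) = (\<lambda>(a, b). box a b)" by (auto simp: fun_eq_iff box_real)
    show ?thesis unfolding eq by (subst borel_eq_box, subst sets_measure_of) simp_all
  qed
  have eq: "distr \<sigma> borel fst = distr graph_measure borel fst"
  proof (rule measure_eqI_generator_eq[where E = "range (\<lambda>(a, b). {a<..<b::real})" and \<Omega> = UNIV
        and A = "\<lambda>n. {- (real n + 1)<..<real n + 1}"])
    show "Int_stable (range (\<lambda>(a, b). {a<..<b::real}))"
      unfolding Int_stable_def by force
    show "sets (distr \<sigma> borel fst) = sigma_sets UNIV (range (\<lambda>(a, b). {a<..<b::real}))"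
      "sets (distr graph_measure borel fst) = sigma_sets UNIV (range (\<lambda>(a, b). {a<..<b::real}))"
      using b by simp_all
    show "(\<Union>n. {- (real n + 1)<..<real n + 1}) = UNIV"
    proof -
      have "\<exists>n. x \<in> {- (real n + 1)<..<real n + 1}" for x :: real
      proof -
        obtain n :: nat where "\<bar>x\<bar> < real n" using reals_Archimedean2 by blast
        then show ?thesis by (intro exI[of _ n]) auto
      qed
      then show ?thesis by blast
    qed
    show "emeasure (distr \<sigma> borel fst) {- (real n + 1)<..<real n + 1} \<noteq> \<infinity>" for n
    proof -
      have "emeasure (distr \<sigma> borel fst) {- (real n + 1)<..<real n + 1} \<le> emeasure (distr \<sigma> borel fst) {- (real n + 1)..real n + 1}"
        by (intro emeasure_mono) auto
      also have "\<dots> < \<infinity>" by (rule icc(2)) simp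
      finally show ?thesis by simp
    qed
  qed (use ioo in \<open>auto simp: range_subsetD\<close>)
  \<comment> \<open>Up to the null set off the graph, A equals the cylinder over the set of
    abscissas whose graph point lies in A.\<close>
  have red: "emeasure \<tau> A = emeasure (distr \<tau> borel fst) {x. graph x \<in> A}"
    if \<tau>: "is_arc_length_measure V \<tau>" and A: "A \<in> sets borel" for \<tau> A
  proof -
    have sets: "sets \<tau> = sets borel" and null: "emeasure \<tau> (- frontier V) = 0"
      using \<tau> by (auto simp: is_arc_length_measure_def)
    have gA: "{x. graph x \<in> A} \<in> sets borel" using measurable_sets[OF graph_measurable A] by (simp add: vimage_def)
    have "{q. fst q \<in> {x. graph x \<in> A}} \<in> sets \<tau>"
      using measurable_sets[OF fm[OF sets] gA] by (simp add: vimage_def space[OF sets])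
    moreover have "AE q in \<tau>. q \<in> frontier V"
      using null sets frontier_V_borel by (intro AE_I[of _ _ "- frontier V"]) (auto simp: space[OF sets])
    then have "AE q in \<tau>. q \<in> A \<longleftrightarrow> q \<in> {q. fst q \<in> {x. graph x \<in> A}}"
      by eventually_elim (auto simp: frontier_V)
    ultimately have "emeasure \<tau> A = emeasure \<tau> {q. fst q \<in> {x. graph x \<in> A}}"
      using A sets by (intro emeasure_eq_AE) auto
    then show ?thesis by (simp add: slab[OF sets gA])
  qed
  show ?thesis
  proof (rule measure_eqI)
    show "emeasure \<sigma> A = emeasure graph_measure A" if "A \<in> sets \<sigma>" for A
      using red[OF \<sigma>] red[OF graph_measure_is_arc_length] that unfolding sets eq by simp
  qed (simp add: sets)
qed

theorem arc_length_measure_V: "arc_length_measure V = graph_measure"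
  unfolding arc_length_measure_def
proof (rule the_equality)
  show "is_arc_length_measure V graph_measure" by (rule graph_measure_is_arc_length)
  show "\<sigma> = graph_measure" if "is_arc_length_measure V \<sigma>" for \<sigma> by (rule arc_length_unique[OF that])
qed

lemma smooth_boundary_V: "smooth_boundary V"
  unfolding smooth_boundary_def
proof
  fix p assume "p \<in> frontier V"
  then have p: "snd p = h (fst p)" by (auto simp: frontier_V graph_def)
  show "\<exists>(A :: real \<times> real \<Rightarrow> real \<times> real) (h :: real \<Rightarrow> real) r. orthogonal_transformation A \<and> smooth_map h \<and> r > 0 \<and>
      (\<forall>q\<in>ball p r. q \<in> V \<longleftrightarrow> h (fst (A (q - p))) < snd (A (q - p)))"
  proof (rule exI[of _ "\<lambda>x. x"], rule exI[of _ "\<lambda>x. h (fst p + x) - h (fst p)"], rule exI[of _ 1], intro conjI ballI)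
    show "orthogonal_transformation (\<lambda>x::real\<times>real. x)"
      by (rule orthogonal_transformation_id)
    show "smooth_map (\<lambda>x. h (fst p + x) - h (fst p))"
      by (rule smooth_map_diff[OF smooth_map_affine[OF bounded_linear_ident h_smooth] smooth_map_const])
    show "q \<in> V \<longleftrightarrow> h (fst p + fst (q - p)) - h (fst p) < snd (q - p)" for q
      unfolding V_def mem_Collect_eq fst_diff snd_diff p by simp
  qed (rule zero_less_one)
qed

text \<open>A continuous vertical shear maps the convex upper half-plane onto V.\<close>

lemma connected_V: "connected V"
proof -
  have "V = (\<lambda>q. (fst q, h (fst q) + snd q)) ` {q. 0 < snd q}"
  proof (intro set_eqI iffI)
    fix q assume "q \<in> V"
    then show "q \<in> (\<lambda>q. (fst q, h (fst q) + snd q)) ` {q. 0 < snd q}"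
      by (intro image_eqI[of _ _ "(fst q, snd q - h (fst q))"]) (auto simp: V_def)
  qed (auto simp: V_def)
  moreover have "convex {q::real\<times>real. 0 < snd q}"
    using convex_halfspace_gt[of 0 "(0, 1) :: real \<times> real"] by (simp add: inner_prod_def)
  then have "connected ((\<lambda>q. (fst q, h (fst q) + snd q)) ` {q::real\<times>real. 0 < snd q})"
    by (intro connected_continuous_image convex_connected continuous_on_Pair continuous_on_add
        continuous_on_compose2[OF h_continuous[of UNIV]] continuous_on_fst continuous_on_snd continuous_on_id) auto
  ultimately show ?thesis by simp
qed

lemma unbounded_V: "V \<noteq> {}" "\<not> bounded V" "\<not> compact (frontier V)"
proof -
  have inV: "(0, h 0 + t) \<in> V" if "t > 0" for t using that by (simp add: V_def)
  show "V \<noteq> {}" using inV[of 1] by auto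
  show "\<not> bounded V"
  proof
    assume "bounded V"
    then obtain B where B: "\<And>q. q \<in> V \<Longrightarrow> norm q \<le> B" unfolding bounded_iff by blast
    have "norm (0::real, h 0 + (\<bar>B\<bar> + \<bar>h 0\<bar> + 1)) \<le> B" by (intro B inV) simp
    moreover have "norm (h 0 + (\<bar>B\<bar> + \<bar>h 0\<bar> + 1)) \<le> norm (0::real, h 0 + (\<bar>B\<bar> + \<bar>h 0\<bar> + 1))" by (rule norm_snd_le)
    ultimately show False unfolding real_norm_def by linarith
  qed
  show "\<not> compact (frontier V)"
  proof
    assume "compact (frontier V)"
    then obtain B where B: "\<And>q. q \<in> frontier V \<Longrightarrow> norm q \<le> B" using compact_imp_bounded[of "frontier V"] unfolding bounded_iff by blast
    have "graph (\<bar>B\<bar> + 1) \<in> frontier V" by (simp add: frontier_V)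
    then have "norm (graph (\<bar>B\<bar> + 1)) \<le> B" by (rule B)
    moreover have "norm (\<bar>B\<bar> + 1) \<le> norm (graph (\<bar>B\<bar> + 1))" unfolding graph_def by (rule norm_fst_le)
    ultimately show False unfolding real_norm_def by linarith
  qed
qed

end

section \<open>The divergence theorem on the epigraph and the vector field bound\<close>

lemma Fubini_plane:
  fixes f :: "real \<times> real \<Rightarrow> 'b::{banach, second_countable_topology}"
  assumes "integrable lborel f"
  shows "(\<integral>z. f z \<partial>lborel) = (\<integral>x. \<integral>y. f (x, y) \<partial>lborel \<partial>lborel)"
    "(\<integral>z. f z \<partial>lborel) = (\<integral>y. \<integral>x. f (x, y) \<partial>lborel \<partial>lborel)"
proof -
  have i: "integrable (lborel \<Otimes>\<^sub>M lborel) f" using assms by (simp add: lborel_prod)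
  show "(\<integral>z. f z \<partial>lborel) = (\<integral>x. \<integral>y. f (x, y) \<partial>lborel \<partial>lborel)"
    using lborel_pair.integral_fst'[OF i] by (simp add: lborel_prod)
  have i2: "integrable (lborel \<Otimes>\<^sub>M lborel) (\<lambda>(x, y). f (x, y))" using i by (simp add: case_prod_unfold)
  show "(\<integral>z. f z \<partial>lborel) = (\<integral>y. \<integral>x. f (x, y) \<partial>lborel \<partial>lborel)"
    using lborel_pair.integral_snd[OF i2] by (simp add: lborel_prod case_prod_unfold)
qed

context epigraph
begin

text \<open>For a compactly supported \<open>C\<^sup>1\<close> function \<open>w\<close> (with partial derivatives \<open>w1\<close>, \<open>w2\<close>) the divergence
  theorem on \<open>V\<close> for the field \<open>w (p, -q)\<close>, where \<open>p\<close> and \<open>q\<close> depend on the first coordinate only.\<close>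

context
  fixes w w1 w2 :: "real \<times> real \<Rightarrow> real" and R :: real
  assumes w_deriv: "\<And>z. (w has_derivative (\<lambda>v. fst v * w1 z + snd v * w2 z)) (at z)"
    and w_cont: "continuous_on UNIV w1" "continuous_on UNIV w2"
    and w_supp: "\<And>z. norm z > R \<Longrightarrow> w z = 0" "\<And>z. norm z > R \<Longrightarrow> w1 z = 0" "\<And>z. norm z > R \<Longrightarrow> w2 z = 0"
begin

lemma w_continuous: "continuous_on UNIV w"
  using w_deriv has_derivative_continuous by (intro continuous_at_imp_continuous_on) blast

lemma integrable_V:
  fixes f :: "real \<times> real \<Rightarrow> real"
  assumes "continuous_on UNIV f" "\<And>z. norm z > S \<Longrightarrow> f z = 0"
  shows "integrable lborel (\<lambda>z. indicator V z * f z)"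
proof (rule Bochner_Integration.integrable_bound[OF integrable_continuous_compact_support[OF assms(1), of S]])
  have Vb: "V \<in> sets borel" using open_V by simp
  have "f \<in> borel_measurable borel" by (rule borel_measurable_continuous_onI[OF assms(1)])
  then show "(\<lambda>z. indicator V z * f z) \<in> borel_measurable lborel" using Vb by simp
qed (simp_all add: indicator_def assms(2))

text \<open>Each vertical line enters V at the graph and ends where w vanishes, so the fundamental
  theorem leaves minus the value of w on the graph. The weight r is constant along the line.\<close>

lemma vertical_FTC:
  assumes r: "continuous_on UNIV r"
  shows "(\<integral>x. r x * w (graph x) \<partial>lborel) = - (\<integral>z. indicator V z * (r (fst z) * w2 z) \<partial>lborel)"
proof -
  have c: "continuous_on UNIV (\<lambda>z. r (fst z) * w2 z)"
    by (intro continuous_on_mult w_cont continuous_on_compose2[OF r] continuous_on_fst continuous_on_id) auto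
  have i: "integrable lborel (\<lambda>z. indicator V z * (r (fst z) * w2 z))"
    by (rule integrable_V[OF c, of R]) (simp add: w_supp)
  have inner: "(\<integral>y. indicator V (x, y) * (r (fst (x, y)) * w2 (x, y)) \<partial>lborel) = - (r x * w (graph x))" for x
  proof -
    \<comment> \<open>From height T on, the line is outside the support of w; T is at least h x so
      that the interval of integration is not reversed.\<close>
    define T where "T = max (h x) (\<bar>R\<bar> + 1)"
    have T: "h x \<le> T" "\<bar>R\<bar> < T" by (auto simp: T_def)
    have out: "norm (x, y) > R" if "y \<ge> T" for y
      using norm_snd_le[of y x] that T(2) by simp
    have d: "((\<lambda>y. w (x, y)) has_vector_derivative w2 (x, y)) (at y within {h x..T})" for y
    proof -
      have "((\<lambda>y. (x, y)) has_derivative (\<lambda>t. (0, t))) (at y)" by (auto intro!: derivative_eq_intros)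
      from has_derivative_compose[OF this w_deriv[of "(x, y)"]]
      have "((\<lambda>y. w (x, y)) has_vector_derivative w2 (x, y)) (at y)" by (simp add: has_vector_derivative_def)
      then show ?thesis by (rule has_vector_derivative_at_within)
    qed
    have c2: "continuous_on {h x..T} (\<lambda>y. w2 (x, y))"
      by (intro continuous_on_compose2[OF w_cont(2)] continuous_on_Pair continuous_on_const continuous_on_id) auto
    \<comment> \<open>V is open while the fundamental theorem uses a closed interval; the integrands
      differ at most at the height y = h x.\<close>
    have "AE y in lborel. indicator V (x, y) * w2 (x, y) = indicator {h x..T} y *\<^sub>R w2 (x, y)"
      using AE_lborel_singleton[of "h x"]
    proof eventually_elim
      fix y assume "y \<noteq> h x"
      show "indicator V (x, y) * w2 (x, y) = indicator {h x..T} y *\<^sub>R w2 (x, y)"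
      proof (cases "y \<ge> T")
        case True
        then show ?thesis using w_supp(3)[OF out[OF True]] by simp
      next
        case False
        then show ?thesis using \<open>y \<noteq> h x\<close> by (simp add: V_def indicator_def)
      qed
    qed
    moreover have "(\<lambda>y. indicator V (x, y) * w2 (x, y)) \<in> borel_measurable lborel"
    proof -
      have "(\<lambda>z. indicator V z * w2 z) \<in> borel_measurable borel"
        using borel_measurable_integrable[OF integrable_V[OF w_cont(2) w_supp(3)]] by simp
      then show ?thesis by (rule measurable_compose[rotated]) simp
    qed
    moreover have "(\<lambda>y. indicator {h x..T} y *\<^sub>R w2 (x, y)) \<in> borel_measurable lborel"
      using borel_measurable_integrable[OF borel_integrable_compact[OF compact_Icc c2]] .
    ultimately have "(\<integral>y. indicator V (x, y) * w2 (x, y) \<partial>lborel) = (\<integral>y. indicator {h x..T} y *\<^sub>R w2 (x, y) \<partial>lborel)"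
      by (intro integral_cong_AE)
    also have "\<dots> = w (x, T) - w (x, h x)"
      by (rule integral_FTC_atLeastAtMost[OF T(1) d c2])
    also have "w (x, T) = 0" by (rule w_supp(1)[OF out]) simp
    finally have e: "(\<integral>y. indicator V (x, y) * w2 (x, y) \<partial>lborel) = - w (graph x)" by (simp add: graph_def)
    have "(\<integral>y. indicator V (x, y) * (r (fst (x, y)) * w2 (x, y)) \<partial>lborel) = (\<integral>y. r x * (indicator V (x, y) * w2 (x, y)) \<partial>lborel)"
      by (intro Bochner_Integration.integral_cong) auto
    also have "\<dots> = r x * (\<integral>y. indicator V (x, y) * w2 (x, y) \<partial>lborel)" by simp
    finally show ?thesis unfolding e by simp
  qed
  show ?thesis unfolding Fubini_plane(1)[OF i] inner by simp
qed

text \<open>In the coordinates \<open>(x, y - h x)\<close> the integrand is an \<open>x\<close>-derivative.\<close>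

lemma horizontal_FTC:
  assumes p: "\<And>x. (p has_real_derivative p' x) (at x)" "continuous_on UNIV p'"
  shows "(\<integral>z. indicator V z * (p' (fst z) * w z + p (fst z) * (w1 z + deriv h (fst z) * w2 z)) \<partial>lborel) = 0"
proof -
  define G where "G z = p' (fst z) * w z + p (fst z) * (w1 z + deriv h (fst z) * w2 z)" for z
  have pc: "continuous_on UNIV p" using p(1) DERIV_isCont by (intro continuous_at_imp_continuous_on) blast
  have Gc: "continuous_on UNIV G"
    unfolding G_def
    by (intro continuous_on_add continuous_on_mult w_cont w_continuous continuous_on_compose2[OF p(2)] continuous_on_compose2[OF pc]
        continuous_on_compose2[OF deriv_h_continuous[of UNIV]] continuous_on_fst continuous_on_id) auto
  have G0: "G z = 0" if "norm z > R" for z using w_supp that by (simp add: G_def)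
  have i: "integrable lborel (\<lambda>z. indicator V z * G z)" by (rule integrable_V[OF Gc G0])
  define F where "F z = indicator {0<..} (snd z) * G (fst z, h (fst z) + snd z)" for z
  have shift: "(\<integral>y. indicator V (x, y) * G (x, y) \<partial>lborel) = (\<integral>t. F (x, t) \<partial>lborel)" for x
  proof -
    have "(\<lambda>z. indicator V z * G z) \<in> borel_measurable borel" using borel_measurable_integrable[OF i] by simp
    then have "(\<lambda>y. indicator V (x, y) * G (x, y)) \<in> borel_measurable borel"
      by (rule measurable_compose[rotated]) simp
    from lborel_translation(2)[OF this, of "h x"]
    have "(\<integral>y. indicator V (x, y) * G (x, y) \<partial>lborel) = (\<integral>t. indicator V (x, t + h x) * G (x, t + h x) \<partial>lborel)" by simp
    also have "\<dots> = (\<integral>t. F (x, t) \<partial>lborel)"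
      by (intro Bochner_Integration.integral_cong) (auto simp: F_def V_def indicator_def add.commute)
    finally show ?thesis .
  qed
  \<comment> \<open>h is bounded over the horizontal extent of the support, so the sheared integrand
    is compactly supported again and the order of integration may be exchanged.\<close>
  have "compact (h ` {- R..R})" by (intro compact_continuous_image h_continuous compact_Icc)
  then obtain B where "\<forall>y\<in>h ` {- R..R}. norm y \<le> B"
    using compact_imp_bounded[of "h ` {- R..R}"] unfolding bounded_iff by blast
  then have B: "\<bar>h x\<bar> \<le> B" if "x \<in> {- R..R}" for x using that by simp
  have F_int: "integrable lborel F"
  proof (rule Bochner_Integration.integrable_bound)
    show "integrable lborel (\<lambda>z. G (fst z, h (fst z) + snd z))"
    proof (rule integrable_continuous_compact_support)
      show "continuous_on UNIV (\<lambda>z. G (fst z, h (fst z) + snd z))"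
        by (intro continuous_on_compose2[OF Gc] continuous_on_Pair continuous_on_add continuous_on_compose2[OF h_continuous[of UNIV]]
            continuous_on_fst continuous_on_snd continuous_on_id) auto
      fix z :: "real \<times> real" assume z: "norm z > R + (R + B)"
      show "G (fst z, h (fst z) + snd z) = 0"
      proof (rule G0, rule ccontr)
        assume "\<not> norm (fst z, h (fst z) + snd z) > R"
        then have n: "norm (fst z, h (fst z) + snd z) \<le> R" by simp
        have 1: "\<bar>fst z\<bar> \<le> R" using norm_fst_le[of "fst z" "h (fst z) + snd z"] n by simp
        have 2: "\<bar>h (fst z) + snd z\<bar> \<le> R" using norm_snd_le[of "h (fst z) + snd z" "fst z"] n by simp
        have 3: "\<bar>h (fst z)\<bar> \<le> B" using 1 by (intro B) auto
        have "norm z \<le> \<bar>fst z\<bar> + \<bar>snd z\<bar>" using norm_Pair_le[of "fst z" "snd z"] by simp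
        then show False using 1 2 3 z by linarith
      qed
    qed
    then have "(\<lambda>z. G (fst z, h (fst z) + snd z)) \<in> borel_measurable borel" by simp
    moreover have "(\<lambda>z. indicator {0<..} (snd z) :: real) \<in> borel_measurable (borel :: (real \<times> real) measure)"
      by (rule measurable_compose[of snd borel borel]) (auto intro!: borel_measurable_continuous_onI continuous_intros)
    ultimately show "F \<in> borel_measurable lborel" unfolding F_def[abs_def] by simp
  qed (simp add: F_def indicator_def)
  have inner: "(\<integral>x. F (x, t) \<partial>lborel) = 0" for t
  proof -
    define W where "W x = p x * w (x, h x + t)" for x
    define S where "S = \<bar>R\<bar> + 1"
    have S: "- S \<le> S" "R < S" by (auto simp: S_def)
    have out: "norm (x, h x + t) > R" if "\<bar>x\<bar> \<ge> S" for x
      using norm_fst_le[of x "h x + t"] that S by simp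
    have d: "(W has_vector_derivative G (x, h x + t)) (at x within {-S..S})" for x
    proof -
      have "((\<lambda>x. (x, h x + t)) has_derivative (\<lambda>v. (v, v * deriv h x))) (at x)"
        using h_has_derivative[of x] by (auto intro!: derivative_eq_intros simp: has_field_derivative_def mult.commute)
      from has_derivative_compose[OF this w_deriv[of "(x, h x + t)"]]
      have "((\<lambda>x. w (x, h x + t)) has_real_derivative (w1 (x, h x + t) + deriv h x * w2 (x, h x + t))) (at x)"
        unfolding has_field_derivative_def by (rule has_derivative_eq_rhs) (simp add: fun_eq_iff algebra_simps)
      from DERIV_mult[OF p(1)[of x] this]
      have "(W has_real_derivative G (x, h x + t)) (at x)"
        unfolding W_def[abs_def] by (rule DERIV_cong) (simp add: G_def algebra_simps)
      then show ?thesis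
        unfolding has_real_derivative_iff_has_vector_derivative by (rule has_vector_derivative_at_within)
    qed
    have Gtc: "continuous_on {-S..S} (\<lambda>x. G (x, h x + t))"
      by (intro continuous_on_compose2[OF Gc] continuous_on_Pair continuous_on_add h_continuous continuous_on_const continuous_on_id) auto
    have "(\<integral>x. F (x, t) \<partial>lborel) = (\<integral>x. indicator {0<..} t * (indicator {-S..S} x *\<^sub>R G (x, h x + t)) \<partial>lborel)"
    proof (intro Bochner_Integration.integral_cong)
      fix x
      show "F (x, t) = indicator {0<..} t * (indicator {-S..S} x *\<^sub>R G (x, h x + t))"
      proof (cases "x \<in> {-S..S}")
        case False
        then have "S \<le> \<bar>x\<bar>" unfolding atLeastAtMost_iff by linarith
        then show ?thesis using G0[OF out[of x]] by (simp add: F_def)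
      qed (simp add: F_def)
    qed simp
    also have "\<dots> = indicator {0<..} t * (\<integral>x. indicator {-S..S} x *\<^sub>R G (x, h x + t) \<partial>lborel)" by (rule integral_mult_right_zero)
    also have "(\<integral>x. indicator {-S..S} x *\<^sub>R G (x, h x + t) \<partial>lborel) = W S - W (- S)"
      by (rule integral_FTC_atLeastAtMost[OF S(1) d Gtc])
    also have "\<dots> = 0" using w_supp(1)[OF out[of S]] w_supp(1)[OF out[of "- S"]] by (simp add: W_def S_def)
    finally show ?thesis by simp
  qed
  have "(\<integral>z. indicator V z * G z \<partial>lborel) = (\<integral>x. \<integral>t. F (x, t) \<partial>lborel \<partial>lborel)"
    unfolding Fubini_plane(1)[OF i] shift ..
  also have "\<dots> = (\<integral>t. \<integral>x. F (x, t) \<partial>lborel \<partial>lborel)" using Fubini_plane[OF F_int] by simp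
  also have "\<dots> = 0" unfolding inner by simp
  finally show ?thesis by (simp add: G_def)
qed

text \<open>The outer normal is (h', -1) / \<open>speed\<close>, so the flux density of w (p, -q)
  with respect to dx is (p h' + q) w. The vertical formula with r = p h' + q produces it, and adding
  the vanishing horizontal integral cancels the terms p h' w2.\<close>

lemma boundary_divergence:
  assumes p: "\<And>x. (p has_real_derivative p' x) (at x)" "continuous_on UNIV p'" and q: "continuous_on UNIV q"
  shows "(\<integral>x. (p x * deriv h x + q x) * w (graph x) \<partial>lborel) =
    (\<integral>z. indicator V z * (p' (fst z) * w z + p (fst z) * w1 z - q (fst z) * w2 z) \<partial>lborel)"
proof -
  have pc: "continuous_on UNIV p" using p(1) DERIV_isCont by (intro continuous_at_imp_continuous_on) blast
  have rc: "continuous_on UNIV (\<lambda>x. p x * deriv h x + q x)"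
    by (intro continuous_on_add continuous_on_mult pc deriv_h_continuous q)
  have c1: "continuous_on UNIV (\<lambda>z. (p (fst z) * deriv h (fst z) + q (fst z)) * w2 z)"
    by (intro continuous_on_mult w_cont continuous_on_compose2[OF rc] continuous_on_fst continuous_on_id) auto
  have c2: "continuous_on UNIV (\<lambda>z. p' (fst z) * w z + p (fst z) * (w1 z + deriv h (fst z) * w2 z))"
    by (intro continuous_on_add continuous_on_mult w_cont w_continuous continuous_on_compose2[OF p(2)] continuous_on_compose2[OF pc]
        continuous_on_compose2[OF deriv_h_continuous[of UNIV]] continuous_on_fst continuous_on_id) auto
  have i1: "integrable lborel (\<lambda>z. indicator V z * ((p (fst z) * deriv h (fst z) + q (fst z)) * w2 z))"
    by (rule integrable_V[OF c1, of R]) (simp add: w_supp)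
  have i2: "integrable lborel (\<lambda>z. indicator V z * (p' (fst z) * w z + p (fst z) * (w1 z + deriv h (fst z) * w2 z)))"
    by (rule integrable_V[OF c2, of R]) (simp add: w_supp)
  have "(\<integral>x. (p x * deriv h x + q x) * w (graph x) \<partial>lborel) =
      (\<integral>z. indicator V z * (p' (fst z) * w z + p (fst z) * (w1 z + deriv h (fst z) * w2 z)) \<partial>lborel)
      - (\<integral>z. indicator V z * ((p (fst z) * deriv h (fst z) + q (fst z)) * w2 z) \<partial>lborel)"
    unfolding vertical_FTC[OF rc] horizontal_FTC[OF p] by simp
  also have "\<dots> = (\<integral>z. indicator V z * (p' (fst z) * w z + p (fst z) * (w1 z + deriv h (fst z) * w2 z))
      - indicator V z * ((p (fst z) * deriv h (fst z) + q (fst z)) * w2 z) \<partial>lborel)"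
    by (rule Bochner_Integration.integral_diff[OF i2 i1, symmetric])
  also have "\<dots> = (\<integral>z. indicator V z * (p' (fst z) * w z + p (fst z) * w1 z - q (fst z) * w2 z) \<partial>lborel)"
    by (intro Bochner_Integration.integral_cong) (simp_all add: algebra_simps)
  finally show ?thesis .
qed

end

lemma grad_form_test:
  assumes \<phi>: "test_function UNIV \<phi>"
  shows "Re (grad_form \<phi> \<phi>) = (\<integral>z. indicator V z * (cmod (frechet_derivative \<phi> (at z) (1, 0)))\<^sup>2 \<partial>lborel)
    + (\<integral>z. indicator V z * (cmod (frechet_derivative \<phi> (at z) (0, 1)))\<^sup>2 \<partial>lborel)"
proof -
  have e: "l2_norm (leb V) (weak_partial V e \<phi>) = l2_norm (leb V) (\<lambda>z. frechet_derivative \<phi> (at z) e)" if "e \<in> Basis" for e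
    by (rule weak_partial_l2_norm[OF test_function_H1[OF \<phi>] that test_weak_partial[OF \<phi>]])
  have "(1, 0) \<in> (Basis :: (real \<times> real) set)" "(0, 1) \<in> (Basis :: (real \<times> real) set)" by (simp_all add: Basis_prod_def)
  moreover have "Re (grad_form \<phi> \<phi>) = (l2_norm (leb V) (weak_partial V (1, 0) \<phi>))\<^sup>2 + (l2_norm (leb V) (weak_partial V (0, 1) \<phi>))\<^sup>2"
    unfolding grad_form_self by (simp add: Basis_prod_def image_Un sum.union_disjoint zero_prod_def)
  ultimately show ?thesis using e by (simp add: l2_norm_square leb_integral[OF open_V])
qed

text \<open>With \<open>q = a speed - p h'\<close> the field \<open>(p, -q)\<close> has normal component \<open>a\<close> on the boundary.\<close>

lemma vector_field_bound:
  assumes \<phi>: "test_function UNIV \<phi>"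
    and p: "\<And>x. (p has_real_derivative p' x) (at x)" "continuous_on UNIV p'"
    and K: "\<And>x. p' x + (p x)\<^sup>2 + (a * speed x - p x * deriv h x)\<^sup>2 \<le> K"
  shows "a * (\<integral>x. speed x * (cmod (\<phi> (graph x)))\<^sup>2 \<partial>lborel) \<le> Re (grad_form \<phi> \<phi>) + K * (l2_norm (leb V) \<phi>)\<^sup>2"
proof -
  note sm = test_functionD(1)[OF \<phi>]
  define d1 where "d1 z = frechet_derivative \<phi> (at z) (1, 0)" for z
  define d2 where "d2 z = frechet_derivative \<phi> (at z) (0, 1)" for z
  define w where "w z = (cmod (\<phi> z))\<^sup>2" for z
  define w1 where "w1 z = 2 * Re (cnj (\<phi> z) * d1 z)" for z
  define w2 where "w2 z = 2 * Re (cnj (\<phi> z) * d2 z)" for z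
  define q where "q x = a * speed x - p x * deriv h x" for x
  have t1: "test_function UNIV d1" and t2: "test_function UNIV d2"
    unfolding d1_def[abs_def] d2_def[abs_def] by (rule test_function_frechet_derivative[OF \<phi>])+
  have \<phi>c: "continuous_on UNIV \<phi>" "continuous_on UNIV d1" "continuous_on UNIV d2"
    by (rule smooth_map_continuous[OF test_functionD(1)], fact)+
  have Dv: "frechet_derivative \<phi> (at z) v = fst v *\<^sub>R d1 z + snd v *\<^sub>R d2 z" for z v
    unfolding frechet_derivative_basis[OF sm, of z v] d1_def d2_def
    by (simp add: Basis_prod_def inner_prod_def image_Un sum.union_disjoint zero_prod_def)
  have wd: "(w has_derivative (\<lambda>v. fst v * w1 z + snd v * w2 z)) (at z)" for z
  proof -
    have "w = (\<lambda>z. \<phi> z \<bullet> \<phi> z)" by (simp add: w_def fun_eq_iff dot_square_norm)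
    moreover have "((\<lambda>z. \<phi> z \<bullet> \<phi> z) has_derivative (\<lambda>v. \<phi> z \<bullet> frechet_derivative \<phi> (at z) v + frechet_derivative \<phi> (at z) v \<bullet> \<phi> z)) (at z)"
      by (intro has_derivative_inner smooth_map_has_derivative sm)
    moreover have "\<phi> z \<bullet> frechet_derivative \<phi> (at z) v + frechet_derivative \<phi> (at z) v \<bullet> \<phi> z = fst v * w1 z + snd v * w2 z" for v
      unfolding Dv w1_def w2_def by (simp add: inner_complex_def algebra_simps)
    ultimately show ?thesis by simp
  qed
  have wc: "continuous_on UNIV w1" "continuous_on UNIV w2"
    unfolding w1_def w2_def by (intro continuous_on_mult continuous_on_const continuous_on_Re continuous_on_cnj \<phi>c)+
  obtain R where R: "\<And>z. norm z > R \<Longrightarrow> \<phi> z = 0" using test_function_zero_outside[OF \<phi>] by blast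
  have ws: "w z = 0" "w1 z = 0" "w2 z = 0" if "norm z > R" for z
    using R[OF that] by (simp_all add: w_def w1_def w2_def)
  have pc: "continuous_on UNIV p" using p(1) DERIV_isCont by (intro continuous_at_imp_continuous_on) blast
  have qc: "continuous_on UNIV q" unfolding q_def
    by (intro continuous_on_diff continuous_on_mult continuous_on_const speed_continuous pc deriv_h_continuous)
  have wcont: "continuous_on UNIV w" unfolding w_def by (intro continuous_on_power continuous_on_norm \<phi>c)
  define N1 where "N1 z = (cmod (d1 z))\<^sup>2" for z
  define N2 where "N2 z = (cmod (d2 z))\<^sup>2" for z
  have Nw: "integrable lborel (\<lambda>z. indicator V z * w z)" "integrable lborel (\<lambda>z. indicator V z * N1 z)" "integrable lborel (\<lambda>z. indicator V z * N2 z)"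
    using sq_integrableD(2)[OF test_function_sq_integrable_leb[OF open_V \<phi>]] sq_integrableD(2)[OF test_function_sq_integrable_leb[OF open_V t1]]
      sq_integrableD(2)[OF test_function_sq_integrable_leb[OF open_V t2]]
    unfolding leb_integrable[OF open_V] w_def N1_def N2_def by simp_all
  have fc: "continuous_on UNIV (\<lambda>z. p' (fst z) * w z + p (fst z) * w1 z - q (fst z) * w2 z)"
    by (intro continuous_on_diff continuous_on_add continuous_on_mult wc wcont continuous_on_compose2[OF p(2)] continuous_on_compose2[OF pc]
        continuous_on_compose2[OF qc] continuous_on_fst continuous_on_id) auto
  have fi: "integrable lborel (\<lambda>z. indicator V z * (p' (fst z) * w z + p (fst z) * w1 z - q (fst z) * w2 z))"
  proof (rule Bochner_Integration.integrable_bound[OF integrable_continuous_compact_support[OF fc, of R]])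
    have Vb: "V \<in> sets borel" using open_V by simp
    show "(\<lambda>z. indicator V z * (p' (fst z) * w z + p (fst z) * w1 z - q (fst z) * w2 z)) \<in> borel_measurable lborel"
      using borel_measurable_continuous_onI[OF fc] Vb by simp
  qed (simp_all add: indicator_def ws)
  \<comment> \<open>The inequality 2 Re (conj u v) <= |u|^2 + |v|^2, once with u = p \<phi> and once
    with u = -q \<phi>, trades the first-order terms for |F|^2 |\<phi>|^2 plus the squared
    gradient.\<close>
  have pt: "p' x * w z + p x * w1 z - q x * w2 z \<le> K * w z + (N1 z + N2 z)" for x z
  proof -
    have sq: "2 * Re (cnj u * v) \<le> (cmod u)\<^sup>2 + (cmod v)\<^sup>2" for u v :: complex
    proof -
      have "Re (cnj u * v) \<le> cmod u * cmod v" using complex_Re_le_cmod[of "cnj u * v"] by (simp add: norm_mult)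
      then show ?thesis using sum_squares_bound[of "cmod u" "cmod v"] by linarith
    qed
    have 1: "p x * w1 z \<le> (p x)\<^sup>2 * w z + N1 z"
    proof -
      have "p x * w1 z = 2 * Re (cnj (of_real (p x) * \<phi> z) * d1 z)" by (simp add: w1_def algebra_simps)
      then show ?thesis
        using sq[of "of_real (p x) * \<phi> z" "d1 z"] by (simp add: w_def N1_def norm_mult power_mult_distrib del: complex_cnj_mult times_complex.sel)
    qed
    have 2: "- q x * w2 z \<le> (q x)\<^sup>2 * w z + N2 z"
    proof -
      have "- q x * w2 z = 2 * Re (cnj (of_real (- q x) * \<phi> z) * d2 z)" by (simp add: w2_def algebra_simps)
      then show ?thesis
        using sq[of "of_real (- q x) * \<phi> z" "d2 z"] by (simp add: w_def N2_def norm_mult power_mult_distrib del: complex_cnj_mult times_complex.sel of_real_minus)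
    qed
    have "(p' x + (p x)\<^sup>2 + (q x)\<^sup>2) * w z \<le> K * w z"
      using K[of x] by (intro mult_right_mono) (simp_all add: q_def w_def)
    then show ?thesis using 1 2 by (simp add: distrib_right)
  qed
  have "a * (\<integral>x. speed x * (cmod (\<phi> (graph x)))\<^sup>2 \<partial>lborel) = (\<integral>x. a * (speed x * (cmod (\<phi> (graph x)))\<^sup>2) \<partial>lborel)"
    by (rule integral_mult_right_zero[symmetric])
  also have "\<dots> = (\<integral>x. (p x * deriv h x + q x) * w (graph x) \<partial>lborel)"
    by (intro Bochner_Integration.integral_cong) (simp_all add: q_def w_def)
  also have "\<dots> = (\<integral>z. indicator V z * (p' (fst z) * w z + p (fst z) * w1 z - q (fst z) * w2 z) \<partial>lborel)"
    by (rule boundary_divergence[OF wd wc ws p qc])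
  also have "\<dots> \<le> (\<integral>z. K * (indicator V z * w z) + (indicator V z * N1 z + indicator V z * N2 z) \<partial>lborel)"
  proof (rule integral_mono[OF fi])
    show "indicator V z * (p' (fst z) * w z + p (fst z) * w1 z - q (fst z) * w2 z)
        \<le> K * (indicator V z * w z) + (indicator V z * N1 z + indicator V z * N2 z)" for z
      using pt[where x = "fst z" and z = z] by (simp add: indicator_def)
  qed (intro Bochner_Integration.integrable_add integrable_mult_right Nw)
  also have "\<dots> = K * (\<integral>z. indicator V z * w z \<partial>lborel) + ((\<integral>z. indicator V z * N1 z \<partial>lborel) + (\<integral>z. indicator V z * N2 z \<partial>lborel))"
    using Nw by simp
  also have "(\<integral>z. indicator V z * w z \<partial>lborel) = (l2_norm (leb V) \<phi>)\<^sup>2"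
    unfolding l2_norm_square leb_integral[OF open_V] w_def by simp
  also have "(\<integral>z. indicator V z * N1 z \<partial>lborel) + (\<integral>z. indicator V z * N2 z \<partial>lborel) = Re (grad_form \<phi> \<phi>)"
    unfolding grad_form_test[OF \<phi>] N1_def N2_def d1_def d2_def ..
  finally show ?thesis by simp
qed

end

section \<open>Traces and the Robin form\<close>

lemma test_function_scale: "test_function V \<phi> \<Longrightarrow> test_function V (\<lambda>x. c * \<phi> x)"
  by (rule test_function_mult[OF _ smooth_map_const])

lemma test_function_add:
  assumes "test_function V \<phi>" "test_function V \<psi>" shows "test_function V (\<lambda>x. \<phi> x + \<psi> x)"
  using test_function_diff[OF assms(1) test_function_scale[OF assms(2), of "-1"]] by simp

lemma closed_formI:
  assumes "\<And>w u. (\<And>n. w n \<in> D) \<Longrightarrow> sq_integrable M u \<Longrightarrow> (\<lambda>n. l2_norm M (\<lambda>x. w n x - u x)) \<longlonglongrightarrow> 0 \<Longrightarrow>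
    (\<And>e. e > 0 \<Longrightarrow> \<exists>N. \<forall>m\<ge>N. \<forall>n\<ge>N. cmod (t (\<lambda>x. w m x - w n x) (\<lambda>x. w m x - w n x)) < e) \<Longrightarrow>
    u \<in> D \<and> (\<lambda>n. t (\<lambda>x. w n x - u x) (\<lambda>x. w n x - u x)) \<longlonglongrightarrow> 0"
  shows "closed_form M D t"
  unfolding closed_form_def using assms by blast

context epigraph
begin

abbreviation bdry :: "(real \<times> real) measure" where "bdry \<equiv> graph_measure"

lemma test_sq_integrable_bdry:
  assumes \<phi>: "test_function UNIV \<phi>"
  shows "sq_integrable bdry \<phi>" "(l2_norm bdry \<phi>)\<^sup>2 = (\<integral>x. speed x * (cmod (\<phi> (graph x)))\<^sup>2 \<partial>lborel)"
proof -
  have [measurable]: "\<phi> \<in> borel_measurable borel" by (rule test_function_measurable[OF \<phi>])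
  obtain R where R: "\<And>z. norm z > R \<Longrightarrow> \<phi> z = 0" using test_function_zero_outside[OF \<phi>] by blast
  have c: "continuous_on {-R..R} (\<lambda>x. speed x * (cmod (\<phi> (graph x)))\<^sup>2)"
    by (intro continuous_on_mult continuous_on_power continuous_on_norm speed_continuous
        continuous_on_compose2[OF smooth_map_continuous[OF test_functionD(1)[OF \<phi>], of UNIV] graph_continuous]) auto
  have e: "indicator {-R..R} x *\<^sub>R (speed x * (cmod (\<phi> (graph x)))\<^sup>2) = speed x * (cmod (\<phi> (graph x)))\<^sup>2" for x
  proof (cases "x \<in> {-R..R}")
    case False
    then have "\<bar>x\<bar> > R" unfolding atLeastAtMost_iff by linarith
    then have "norm (graph x) > R" using norm_fst_le[of x "h x"] by (simp add: graph_def)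
    then show ?thesis using R by simp
  qed simp
  have "integrable lborel (\<lambda>x. speed x * (cmod (\<phi> (graph x)))\<^sup>2)"
    using borel_integrable_compact[OF compact_Icc c] unfolding e .
  then have "integrable bdry (\<lambda>x. (cmod (\<phi> x))\<^sup>2)"
    using integral_graph_measure(2)[of "\<lambda>x. (cmod (\<phi> x))\<^sup>2"] by simp
  then show "sq_integrable bdry \<phi>" by (simp add: sq_integrable_def)
  show "(l2_norm bdry \<phi>)\<^sup>2 = (\<integral>x. speed x * (cmod (\<phi> (graph x)))\<^sup>2 \<partial>lborel)"
    unfolding l2_norm_square using integral_graph_measure(1)[of "\<lambda>x. (cmod (\<phi> x))\<^sup>2"] by simp
qed

text \<open>Certifies the lower bound -K for the energy at \<alpha> = -a. The last square is that of
  the vertical component, which is forced once p and the normal component a are prescribed.\<close>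

definition admissible :: "real \<Rightarrow> real \<Rightarrow> bool" where
  "admissible a K \<longleftrightarrow> (\<exists>p p'. (\<forall>x. (p has_real_derivative p' x) (at x)) \<and> continuous_on UNIV p' \<and>
     (\<forall>x. p' x + (p x)\<^sup>2 + (a * speed x - p x * deriv h x)\<^sup>2 \<le> K))"

text \<open>The vertical field, p = 0 and q = a \<open>speed\<close>. It is far from optimal but
  works for every real a, and it already yields continuity of traces, semiboundedness and
  closedness.\<close>

lemma admissible_crude: "admissible a (a\<^sup>2 * (1 + m\<^sup>2))"
  unfolding admissible_def
  by (intro exI[of _ "\<lambda>x. 0"]) (simp add: power_mult_distrib speed_square_le mult_left_mono)

lemma test_admissible:
  assumes "test_function UNIV \<phi>" "admissible a K"
  shows "a * (l2_norm bdry \<phi>)\<^sup>2 \<le> Re (grad_form \<phi> \<phi>) + K * (l2_norm (leb V) \<phi>)\<^sup>2"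
  using assms(2) vector_field_bound[OF assms(1)] unfolding admissible_def test_sq_integrable_bdry(2)[OF assms(1)] by blast

lemma test_bdry_le_H1:
  assumes "test_function UNIV \<phi>"
  shows "l2_norm bdry \<phi> \<le> (2 + m\<^sup>2) * H1_norm V \<phi>"
proof (rule power2_le_imp_le)
  have "(l2_norm bdry \<phi>)\<^sup>2 \<le> Re (grad_form \<phi> \<phi>) + (1 + m\<^sup>2) * (l2_norm (leb V) \<phi>)\<^sup>2"
    using test_admissible[OF assms admissible_crude[of 1]] by simp
  also have "\<dots> \<le> (H1_norm V \<phi>)\<^sup>2 + (1 + m\<^sup>2) * (H1_norm V \<phi>)\<^sup>2"
    by (intro add_mono mult_left_mono power_mono H1_norm_ge_grad H1_norm_ge_l2) (simp_all add: l2_norm_nonneg)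
  also have "\<dots> = (2 + m\<^sup>2) * (H1_norm V \<phi>)\<^sup>2" by (simp add: algebra_simps)
  \<comment> \<open>The constant is at least 1 and may be enlarged to its square, which keeps roots
    out of the statement.\<close>
  also have "\<dots> \<le> (2 + m\<^sup>2)\<^sup>2 * (H1_norm V \<phi>)\<^sup>2"
    by (intro mult_right_mono self_le_power) (simp_all add: add_increasing2)
  finally show "(l2_norm bdry \<phi>)\<^sup>2 \<le> ((2 + m\<^sup>2) * H1_norm V \<phi>)\<^sup>2" by (simp only: power_mult_distrib)
qed (simp add: H1_norm_nonneg)

text \<open>Convergence on the boundary is asked in the global L^2 norm, whereas
  \<open>is_trace\<close> asks for it on compact sets only. For u in H^1 the two requirements on g
  turn out to be equivalent.\<close>

definition trace_limit :: "(nat \<Rightarrow> real \<times> real \<Rightarrow> complex) \<Rightarrow> (real \<times> real \<Rightarrow> complex) \<Rightarrow> (real \<times> real \<Rightarrow> complex) \<Rightarrow> bool" where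
  "trace_limit \<phi> u g \<longleftrightarrow> u \<in> H1 V \<and> (\<forall>n. test_function UNIV (\<phi> n)) \<and> (\<lambda>n. H1_norm V (\<lambda>x. \<phi> n x - u x)) \<longlonglongrightarrow> 0 \<and>
     sq_integrable bdry g \<and> (\<lambda>n. l2_norm bdry (\<lambda>x. \<phi> n x - g x)) \<longlonglongrightarrow> 0"

lemma trace_limitD:
  assumes "trace_limit \<phi> u g"
  shows "u \<in> H1 V" "\<And>n. test_function UNIV (\<phi> n)" "(\<lambda>n. H1_norm V (\<lambda>x. \<phi> n x - u x)) \<longlonglongrightarrow> 0"
    "sq_integrable bdry g" "(\<lambda>n. l2_norm bdry (\<lambda>x. \<phi> n x - g x)) \<longlonglongrightarrow> 0"
  using assms by (auto simp: trace_limit_def)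

lemma tendsto_0_le:
  fixes f g :: "nat \<Rightarrow> real"
  assumes "g \<longlonglongrightarrow> 0" "\<And>n. 0 \<le> f n" "\<And>n. f n \<le> g n" shows "f \<longlonglongrightarrow> 0"
  by (rule tendsto_sandwich[OF _ _ tendsto_const assms(1)]) (simp_all add: assms(2,3))

text \<open>By \<open>test_bdry_le_H1\<close> a sequence that converges in H^1 has boundary values
  that are Cauchy in L^2, and \<open>l2_complete\<close> supplies the limit.\<close>

lemma trace_limit_exists:
  assumes u: "u \<in> H1 V" and \<phi>: "\<And>n. test_function UNIV (\<phi> n)" and lim: "(\<lambda>n. H1_norm V (\<lambda>x. \<phi> n x - u x)) \<longlonglongrightarrow> 0"
  shows "\<exists>g. trace_limit \<phi> u g"
proof -
  note \<phi>H = test_function_H1[OF \<phi>]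
  have cauchy: "\<exists>N. \<forall>i\<ge>N. \<forall>j\<ge>N. l2_norm bdry (\<lambda>x. \<phi> i x - \<phi> j x) < e" if "e > 0" for e
  proof -
    define C where "C = 2 + m\<^sup>2"
    have C: "C > 0" by (simp add: C_def add_pos_nonneg)
    have "eventually (\<lambda>n. H1_norm V (\<lambda>x. \<phi> n x - u x) < e / (2 * C)) sequentially"
      using \<open>e > 0\<close> C by (intro order_tendstoD(2)[OF lim]) simp
    then obtain N where N: "\<And>n. n \<ge> N \<Longrightarrow> H1_norm V (\<lambda>x. \<phi> n x - u x) < e / (2 * C)"
      unfolding eventually_sequentially by blast
    have "l2_norm bdry (\<lambda>x. \<phi> i x - \<phi> j x) < e" if ij: "i \<ge> N" "j \<ge> N" for i j
    proof -
      have eq: "(\<lambda>x. (\<phi> i x - u x) + (u x - \<phi> j x)) = (\<lambda>x. \<phi> i x - \<phi> j x)" by simp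
      have "H1_norm V (\<lambda>x. \<phi> i x - \<phi> j x) \<le> H1_norm V (\<lambda>x. \<phi> i x - u x) + H1_norm V (\<lambda>x. u x - \<phi> j x)"
        using H1_triangle[OF grad.D_diff[OF \<phi>H[of i] u] grad.D_diff[OF u \<phi>H[of j]]] unfolding eq .
      also have "\<dots> < e / (2 * C) + e / (2 * C)"
        using N[OF ij(1)] N[OF ij(2)] H1_norm_minus_commute[OF u \<phi>H[of j]] by linarith
      also have "e / (2 * C) + e / (2 * C) = e / C" using C by (simp add: field_simps)
      finally have "C * H1_norm V (\<lambda>x. \<phi> i x - \<phi> j x) < C * (e / C)" using C by (rule mult_strict_left_mono)
      then show ?thesis using test_bdry_le_H1[OF test_function_diff[OF \<phi>[of i] \<phi>[of j]]] C unfolding C_def[symmetric] by simp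
    qed
    then show ?thesis by blast
  qed
  obtain g where "sq_integrable bdry g" "(\<lambda>n. l2_norm bdry (\<lambda>x. \<phi> n x - g x)) \<longlonglongrightarrow> 0"
    using l2_complete[where f = \<phi>, OF test_sq_integrable_bdry(1)[OF \<phi>] cauchy] by blast
  then show ?thesis unfolding trace_limit_def using u \<phi> lim by blast
qed

text \<open>Two approximating sequences of the same u come close to each other in H^1, hence also on
  the boundary.\<close>

lemma trace_limit_unique:
  assumes "trace_limit \<phi> u g" "trace_limit \<phi>' u g'"
  shows "AE x in bdry. g x = g' x"
proof -
  note t = trace_limitD[OF assms(1)] and t' = trace_limitD[OF assms(2)]
  note s = test_sq_integrable_bdry(1)[OF t(2)] and s' = test_sq_integrable_bdry(1)[OF t'(2)]
  have "l2_norm bdry (\<lambda>x. g x - g' x) \<le> l2_norm bdry (\<lambda>x. \<phi> n x - g x) +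
      ((2 + m\<^sup>2) * (H1_norm V (\<lambda>x. \<phi> n x - u x) + H1_norm V (\<lambda>x. \<phi>' n x - u x)) + l2_norm bdry (\<lambda>x. \<phi>' n x - g' x))" for n
  proof -
    have "l2_norm bdry (\<lambda>x. g x - g' x) \<le> l2_norm bdry (\<lambda>x. g x - \<phi> n x) + l2_norm bdry (\<lambda>x. \<phi> n x - g' x)"
      by (rule l2_triangle_diff[OF t(4) s t'(4)])
    moreover have "l2_norm bdry (\<lambda>x. \<phi> n x - g' x) \<le> l2_norm bdry (\<lambda>x. \<phi> n x - \<phi>' n x) + l2_norm bdry (\<lambda>x. \<phi>' n x - g' x)"
      by (rule l2_triangle_diff[OF s s' t'(4)])
    moreover have "l2_norm bdry (\<lambda>x. \<phi> n x - \<phi>' n x) \<le> (2 + m\<^sup>2) * H1_norm V (\<lambda>x. \<phi> n x - \<phi>' n x)"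
      by (rule test_bdry_le_H1[OF test_function_diff[OF t(2) t'(2)]])
    moreover have "H1_norm V (\<lambda>x. \<phi> n x - \<phi>' n x) \<le> H1_norm V (\<lambda>x. \<phi> n x - u x) + H1_norm V (\<lambda>x. \<phi>' n x - u x)"
    proof -
      have eq: "(\<lambda>x. (\<phi> n x - u x) + (u x - \<phi>' n x)) = (\<lambda>x. \<phi> n x - \<phi>' n x)" by simp
      show ?thesis
        using H1_triangle[OF grad.D_diff[OF test_function_H1[OF t(2)] t(1)] grad.D_diff[OF t(1) test_function_H1[OF t'(2)]], of n n]
          H1_norm_minus_commute[OF t(1) test_function_H1[OF t'(2)], of n] unfolding eq by linarith
    qed
    then have "(2 + m\<^sup>2) * H1_norm V (\<lambda>x. \<phi> n x - \<phi>' n x) \<le> (2 + m\<^sup>2) * (H1_norm V (\<lambda>x. \<phi> n x - u x) + H1_norm V (\<lambda>x. \<phi>' n x - u x))"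
      by (intro mult_left_mono) simp_all
    ultimately show ?thesis using l2_norm_minus_commute[of bdry g "\<phi> n"] by linarith
  qed
  moreover have "(\<lambda>n. l2_norm bdry (\<lambda>x. \<phi> n x - g x) +
      ((2 + m\<^sup>2) * (H1_norm V (\<lambda>x. \<phi> n x - u x) + H1_norm V (\<lambda>x. \<phi>' n x - u x)) + l2_norm bdry (\<lambda>x. \<phi>' n x - g' x)))
      \<longlonglongrightarrow> 0 + ((2 + m\<^sup>2) * (0 + 0) + 0)"
    by (intro tendsto_add tendsto_mult tendsto_const t t')
  ultimately have "l2_norm bdry (\<lambda>x. g x - g' x) \<le> 0"
    using LIMSEQ_le_const[of _ 0 "l2_norm bdry (\<lambda>x. g x - g' x)"] by simp
  then have "l2_norm bdry (\<lambda>x. g x - g' x) = 0" using l2_norm_nonneg[of bdry "\<lambda>x. g x - g' x"] by linarith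
  then have "AE x in bdry. g x - g' x = 0" by (rule l2_norm_zero_AE[OF sq_integrable_diff[OF t(4) t'(4)]])
  then show ?thesis by simp
qed

lemma trace_limit_is_trace:
  assumes "trace_limit \<phi> u g"
  shows "is_trace V u g"
proof -
  note t = trace_limitD[OF assms]
  have "(\<lambda>n. \<integral>\<^sup>+x\<in>K. ennreal ((cmod (\<phi> n x - g x))\<^sup>2) \<partial>bdry) \<longlonglongrightarrow> 0" for K
  proof (rule tendsto_sandwich[OF _ _ tendsto_const])
    have "(\<lambda>n. ennreal ((l2_norm bdry (\<lambda>x. \<phi> n x - g x))\<^sup>2)) \<longlonglongrightarrow> ennreal (0\<^sup>2)"
      by (intro tendsto_ennrealI tendsto_power t)
    then show "(\<lambda>n. ennreal ((l2_norm bdry (\<lambda>x. \<phi> n x - g x))\<^sup>2)) \<longlonglongrightarrow> 0" by simp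
    show "eventually (\<lambda>n. (\<integral>\<^sup>+x\<in>K. ennreal ((cmod (\<phi> n x - g x))\<^sup>2) \<partial>bdry) \<le> ennreal ((l2_norm bdry (\<lambda>x. \<phi> n x - g x))\<^sup>2)) sequentially"
    proof (intro always_eventually allI)
      fix n
      have d: "sq_integrable bdry (\<lambda>x. \<phi> n x - g x)" by (rule sq_integrable_diff[OF test_sq_integrable_bdry(1)[OF t(2)] t(4)])
      have "(\<integral>\<^sup>+x\<in>K. ennreal ((cmod (\<phi> n x - g x))\<^sup>2) \<partial>bdry) \<le> (\<integral>\<^sup>+x. ennreal ((cmod (\<phi> n x - g x))\<^sup>2) \<partial>bdry)"
        by (intro nn_integral_mono) (simp add: indicator_def)
      also have "\<dots> = ennreal ((l2_norm bdry (\<lambda>x. \<phi> n x - g x))\<^sup>2)"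
        unfolding l2_norm_square by (rule nn_integral_eq_integral[OF sq_integrableD(2)[OF d]]) simp
      finally show "(\<integral>\<^sup>+x\<in>K. ennreal ((cmod (\<phi> n x - g x))\<^sup>2) \<partial>bdry) \<le> ennreal ((l2_norm bdry (\<lambda>x. \<phi> n x - g x))\<^sup>2)" .
    qed
  qed simp
  then show ?thesis
    unfolding is_trace_def arc_length_measure_V using t(2,3) sq_integrableD(1)[OF t(4)] by blast
qed

text \<open>\<open>sobolev_trace\<close> is an arbitrary choice among functions that satisfy the
  local condition. So any such function has to be identified, almost everywhere, with the global
  limit along its own approximating sequence.\<close>

lemma is_trace_trace_limit:
  assumes u: "u \<in> H1 V" and tr: "is_trace V u g"
  shows "\<exists>\<phi>. trace_limit \<phi> u g"
proof -
  obtain \<phi> where \<phi>: "\<And>n. test_function UNIV (\<phi> n)" "(\<lambda>n. H1_norm V (\<lambda>x. \<phi> n x - u x)) \<longlonglongrightarrow> 0"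
    and loc: "\<And>K. compact K \<Longrightarrow> (\<lambda>n. \<integral>\<^sup>+x\<in>K. ennreal ((cmod (\<phi> n x - g x))\<^sup>2) \<partial>bdry) \<longlonglongrightarrow> 0"
    and gm: "g \<in> borel_measurable bdry"
    using tr unfolding is_trace_def arc_length_measure_V by blast
  obtain g' where g': "trace_limit \<phi> u g'" using trace_limit_exists[OF u \<phi>] by blast
  note t = trace_limitD[OF g']
  have [measurable]: "g \<in> borel_measurable borel" "g' \<in> borel_measurable borel" "\<phi> n \<in> borel_measurable borel" for n
    using gm sq_integrableD(1)[OF t(4)] test_function_measurable[OF \<phi>(1)] by simp_all
  \<comment> \<open>Local and global convergence are compared on balls of integer radius; countably
    many of them exhaust the plane.\<close>
  have "AE x in bdry. x \<in> cball 0 (real k) \<longrightarrow> g' x = g x" for k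
  proof -
    let ?K = "cball 0 (real k) :: (real \<times> real) set"
    let ?I = "\<integral>\<^sup>+x\<in>?K. ennreal ((cmod (g' x - g x))\<^sup>2) \<partial>bdry"
    have Kb [measurable]: "?K \<in> sets borel" by simp
    have le: "?I \<le> 2 * ennreal ((l2_norm bdry (\<lambda>x. \<phi> n x - g' x))\<^sup>2) + 2 * (\<integral>\<^sup>+x\<in>?K. ennreal ((cmod (\<phi> n x - g x))\<^sup>2) \<partial>bdry)" for n
    proof -
      have d: "sq_integrable bdry (\<lambda>x. \<phi> n x - g' x)" by (rule sq_integrable_diff[OF test_sq_integrable_bdry(1)[OF t(2)] t(4)])
      have "(cmod (g' x - g x))\<^sup>2 \<le> 2 * (cmod (\<phi> n x - g' x))\<^sup>2 + 2 * (cmod (\<phi> n x - g x))\<^sup>2" for x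
      proof -
        have "g' x - g x = (\<phi> n x - g x) - (\<phi> n x - g' x)" by simp
        then have "cmod (g' x - g x) \<le> cmod (\<phi> n x - g x) + cmod (\<phi> n x - g' x)" using norm_triangle_ineq4 by metis
        then have "(cmod (g' x - g x))\<^sup>2 \<le> (cmod (\<phi> n x - g x) + cmod (\<phi> n x - g' x))\<^sup>2" by (intro power_mono) auto
        then show ?thesis
          using sum_squares_bound[of "cmod (\<phi> n x - g x)" "cmod (\<phi> n x - g' x)"] by (simp add: power2_sum)
      qed
      then have "ennreal ((cmod (g' x - g x))\<^sup>2) \<le> 2 * ennreal ((cmod (\<phi> n x - g' x))\<^sup>2) + 2 * ennreal ((cmod (\<phi> n x - g x))\<^sup>2)" for x
        using ennreal_leI[of "(cmod (g' x - g x))\<^sup>2" "2 * (cmod (\<phi> n x - g' x))\<^sup>2 + 2 * (cmod (\<phi> n x - g x))\<^sup>2"]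
        by (simp add: ennreal_plus ennreal_mult)
      then have "?I \<le> (\<integral>\<^sup>+x. 2 * ennreal ((cmod (\<phi> n x - g' x))\<^sup>2) + 2 * (ennreal ((cmod (\<phi> n x - g x))\<^sup>2) * indicator ?K x) \<partial>bdry)"
        by (intro nn_integral_mono) (simp add: indicator_def)
      also have "\<dots> = 2 * (\<integral>\<^sup>+x. ennreal ((cmod (\<phi> n x - g' x))\<^sup>2) \<partial>bdry) + 2 * (\<integral>\<^sup>+x\<in>?K. ennreal ((cmod (\<phi> n x - g x))\<^sup>2) \<partial>bdry)"
      proof -
        have m1: "(\<lambda>x. ennreal ((cmod (\<phi> n x - g' x))\<^sup>2)) \<in> borel_measurable bdry"
          and m2: "(\<lambda>x. ennreal ((cmod (\<phi> n x - g x))\<^sup>2) * indicator ?K x) \<in> borel_measurable bdry"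
          unfolding measurable_graph_measure by measurable
        have m1': "(\<lambda>x. 2 * ennreal ((cmod (\<phi> n x - g' x))\<^sup>2)) \<in> borel_measurable bdry"
          and m2': "(\<lambda>x. 2 * (ennreal ((cmod (\<phi> n x - g x))\<^sup>2) * indicator ?K x)) \<in> borel_measurable bdry"
          unfolding measurable_graph_measure by measurable
        show ?thesis
          unfolding nn_integral_cmult[OF m1, symmetric] nn_integral_cmult[OF m2, symmetric]
          by (rule nn_integral_add[OF m1' m2'])
      qed
      also have "(\<integral>\<^sup>+x. ennreal ((cmod (\<phi> n x - g' x))\<^sup>2) \<partial>bdry) = ennreal ((l2_norm bdry (\<lambda>x. \<phi> n x - g' x))\<^sup>2)"
        unfolding l2_norm_square by (rule nn_integral_eq_integral[OF sq_integrableD(2)[OF d]]) simp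
      finally show ?thesis .
    qed
    have e1: "(\<lambda>n. ennreal ((l2_norm bdry (\<lambda>x. \<phi> n x - g' x))\<^sup>2)) \<longlonglongrightarrow> 0"
      using tendsto_ennrealI[OF tendsto_power[OF t(5), of 2]] by simp
    have "(\<lambda>n. 2 * ennreal ((l2_norm bdry (\<lambda>x. \<phi> n x - g' x))\<^sup>2) + 2 * (\<integral>\<^sup>+x\<in>?K. ennreal ((cmod (\<phi> n x - g x))\<^sup>2) \<partial>bdry)) \<longlonglongrightarrow> 2 * 0 + 2 * 0"
      by (intro tendsto_add ennreal_tendsto_cmult e1 loc) simp_all
    then have "?I \<le> 0" using le by (intro LIMSEQ_le_const[of _ _ ?I]) auto
    then have "AE x in bdry. ennreal ((cmod (g' x - g x))\<^sup>2) * indicator ?K x = 0"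
    proof -
      have m: "(\<lambda>x. ennreal ((cmod (g' x - g x))\<^sup>2) * indicator ?K x) \<in> borel_measurable bdry"
        unfolding measurable_graph_measure by measurable
      show ?thesis using \<open>?I \<le> 0\<close> nn_integral_0_iff_AE[OF m] by simp
    qed
    then show ?thesis by eventually_elim (auto simp: indicator_def)
  qed
  then have "AE x in bdry. \<forall>k. x \<in> cball 0 (real k) \<longrightarrow> g' x = g x" unfolding AE_all_countable by blast
  then have ae: "AE x in bdry. g' x = g x"
  proof eventually_elim
    fix x assume a: "\<forall>k. x \<in> cball 0 (real k) \<longrightarrow> g' x = g x"
    obtain k :: nat where "norm x \<le> real k" using real_arch_simple by blast
    then show "g' x = g x" using a by auto
  qed
  have gs: "sq_integrable bdry g" by (rule sq_integrable_AE_cong[OF t(4) gm ae])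
  have "l2_norm bdry (\<lambda>x. \<phi> n x - g x) = l2_norm bdry (\<lambda>x. \<phi> n x - g' x)" for n
    by (rule l2_norm_AE_cong[OF sq_integrableD(1)[OF sq_integrable_diff[OF test_sq_integrable_bdry(1)[OF t(2)] gs]]
        sq_integrableD(1)[OF sq_integrable_diff[OF test_sq_integrable_bdry(1)[OF t(2)] t(4)]]]) (use ae in eventually_elim, simp)
  then have "trace_limit \<phi> u g" unfolding trace_limit_def using t gs by simp
  then show ?thesis by blast
qed

abbreviation tr :: "(real \<times> real \<Rightarrow> complex) \<Rightarrow> real \<times> real \<Rightarrow> complex" where "tr \<equiv> sobolev_trace V"

lemma trace_exists:
  assumes "u \<in> H1 V" shows "\<exists>\<phi> g. trace_limit \<phi> u g"
proof -
  obtain \<phi> where "\<And>n. test_function UNIV (\<phi> n)" "(\<lambda>n. H1_norm V (\<lambda>x. \<phi> n x - u x)) \<longlonglongrightarrow> 0"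
    by (rule test_functions_dense[OF assms]) (rule that)
  then show ?thesis using trace_limit_exists[OF assms] by blast
qed

lemma trace_limit_tr:
  assumes "u \<in> H1 V" obtains \<phi> where "trace_limit \<phi> u (tr u)"
proof -
  have "\<exists>g. is_trace V u g" using trace_exists[OF assms] trace_limit_is_trace by blast
  then have "is_trace V u (tr u)" unfolding sobolev_trace_def by (rule someI_ex)
  then show thesis using is_trace_trace_limit[OF assms] that by blast
qed

lemma tr_sq_integrable: "u \<in> H1 V \<Longrightarrow> sq_integrable bdry (tr u)"
  using trace_limit_tr[of u] trace_limitD(4)[of _ u "tr u"] by blast

lemma tr_eq:
  assumes "trace_limit \<phi> u g" shows "AE x in bdry. tr u x = g x"
  by (rule trace_limit_tr[OF trace_limitD(1)[OF assms]]) (rule trace_limit_unique[OF _ assms])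

text \<open>The constant sequence approximates a test function, so its trace is plain
  restriction.\<close>

lemma tr_test:
  assumes \<phi>: "test_function UNIV \<phi>" shows "AE x in bdry. tr \<phi> x = \<phi> x"
proof (rule tr_eq)
  show "trace_limit (\<lambda>n. \<phi>) \<phi> \<phi>"
    unfolding trace_limit_def using \<phi> test_sq_integrable_bdry(1)[OF \<phi>] test_function_H1[OF \<phi>] H1_norm_scale[OF test_function_H1[OF \<phi>], of 0]
    by (simp add: l2_norm_def)
qed

lemma tr_add:
  assumes u: "u \<in> H1 V" and v: "v \<in> H1 V"
  shows "AE x in bdry. tr (\<lambda>x. u x + v x) x = tr u x + tr v x"
proof -
  obtain \<phi> where \<phi>: "trace_limit \<phi> u (tr u)" by (rule trace_limit_tr[OF u])
  obtain \<psi> where \<psi>: "trace_limit \<psi> v (tr v)" by (rule trace_limit_tr[OF v])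
  note a = trace_limitD[OF \<phi>] and b = trace_limitD[OF \<psi>]
  have "trace_limit (\<lambda>n x. \<phi> n x + \<psi> n x) (\<lambda>x. u x + v x) (\<lambda>x. tr u x + tr v x)"
    unfolding trace_limit_def
  proof (intro conjI allI)
    show "(\<lambda>n. H1_norm V (\<lambda>x. \<phi> n x + \<psi> n x - (u x + v x))) \<longlonglongrightarrow> 0"
    proof (rule tendsto_0_le)
      show "(\<lambda>n. H1_norm V (\<lambda>x. \<phi> n x - u x) + H1_norm V (\<lambda>x. \<psi> n x - v x)) \<longlonglongrightarrow> 0"
        using tendsto_add[OF a(3) b(3)] by simp
      have eq: "(\<lambda>x. (\<phi> n x - u x) + (\<psi> n x - v x)) = (\<lambda>x. \<phi> n x + \<psi> n x - (u x + v x))" for n by (simp add: algebra_simps)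
      show "H1_norm V (\<lambda>x. \<phi> n x + \<psi> n x - (u x + v x)) \<le> H1_norm V (\<lambda>x. \<phi> n x - u x) + H1_norm V (\<lambda>x. \<psi> n x - v x)" for n
        using H1_triangle[OF grad.D_diff[OF test_function_H1[OF a(2)] u] grad.D_diff[OF test_function_H1[OF b(2)] v], of n n] unfolding eq .
    qed (rule H1_norm_nonneg)
    show "(\<lambda>n. l2_norm bdry (\<lambda>x. \<phi> n x + \<psi> n x - (tr u x + tr v x))) \<longlonglongrightarrow> 0"
    proof (rule tendsto_0_le)
      show "(\<lambda>n. l2_norm bdry (\<lambda>x. \<phi> n x - tr u x) + l2_norm bdry (\<lambda>x. \<psi> n x - tr v x)) \<longlonglongrightarrow> 0"
        using tendsto_add[OF a(5) b(5)] by simp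
      have eq: "(\<lambda>x. (\<phi> n x - tr u x) + (\<psi> n x - tr v x)) = (\<lambda>x. \<phi> n x + \<psi> n x - (tr u x + tr v x))" for n by (simp add: algebra_simps)
      show "l2_norm bdry (\<lambda>x. \<phi> n x + \<psi> n x - (tr u x + tr v x)) \<le> l2_norm bdry (\<lambda>x. \<phi> n x - tr u x) + l2_norm bdry (\<lambda>x. \<psi> n x - tr v x)" for n
        using l2_triangle[OF sq_integrable_diff[OF test_sq_integrable_bdry(1)[OF a(2)] a(4)] sq_integrable_diff[OF test_sq_integrable_bdry(1)[OF b(2)] b(4)], of n n] unfolding eq .
    qed (rule l2_norm_nonneg)
  qed (rule H1_add[OF u v], rule test_function_add[OF a(2) b(2)], rule sq_integrable_add[OF a(4) b(4)])
  then show ?thesis by (rule tr_eq)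
qed

lemma tr_scale:
  assumes u: "u \<in> H1 V"
  shows "AE x in bdry. tr (\<lambda>x. c * u x) x = c * tr u x"
proof -
  obtain \<phi> where \<phi>: "trace_limit \<phi> u (tr u)" by (rule trace_limit_tr[OF u])
  note a = trace_limitD[OF \<phi>]
  have "trace_limit (\<lambda>n x. c * \<phi> n x) (\<lambda>x. c * u x) (\<lambda>x. c * tr u x)"
    unfolding trace_limit_def right_diff_distrib[symmetric] l2_norm_scale
  proof (intro conjI allI)
    show "(\<lambda>n. H1_norm V (\<lambda>x. c * (\<phi> n x - u x))) \<longlonglongrightarrow> 0"
      using tendsto_mult[OF tendsto_const a(3), of "cmod c"] H1_norm_scale[OF grad.D_diff[OF test_function_H1[OF a(2)] u]] by simp
    show "(\<lambda>n. cmod c * l2_norm bdry (\<lambda>x. \<phi> n x - tr u x)) \<longlonglongrightarrow> 0"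
      using tendsto_mult[OF tendsto_const a(5), of "cmod c"] by simp
  qed (rule H1_scale[OF u], rule test_function_scale[OF a(2)], rule sq_integrable_scale[OF a(4)])
  then show ?thesis by (rule tr_eq)
qed

text \<open>Density transfers the bound from test functions: all three norms are continuous along
  the approximating sequence, the gradient part because it is a seminorm dominated by the H^1
  norm.\<close>

theorem trace_inequality:
  assumes u: "u \<in> H1 V" and ad: "admissible a K"
  shows "a * (l2_norm bdry (tr u))\<^sup>2 \<le> Re (grad_form u u) + K * (l2_norm (leb V) u)\<^sup>2"
proof -
  obtain \<phi> where \<phi>: "trace_limit \<phi> u (tr u)" by (rule trace_limit_tr[OF u])
  note t = trace_limitD[OF \<phi>]
  note \<phi>H = test_function_H1[OF t(2)]
  have b: "(\<lambda>n. l2_norm bdry (\<phi> n)) \<longlonglongrightarrow> l2_norm bdry (tr u)"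
    by (rule l2_norm_tendsto[OF test_sq_integrable_bdry(1)[OF t(2)] t(4,5)])
  have "(\<lambda>n. l2_norm (leb V) (\<lambda>x. \<phi> n x - u x)) \<longlonglongrightarrow> 0"
    by (rule tendsto_0_le[OF t(3) l2_norm_nonneg H1_norm_ge_l2])
  then have l: "(\<lambda>n. l2_norm (leb V) (\<phi> n)) \<longlonglongrightarrow> l2_norm (leb V) u"
    by (rule l2_norm_tendsto[OF H1D(1)[OF \<phi>H] H1D(1)[OF u]])
  define G where "G v = sqrt (Re (grad_form v v))" for v
  have Gd: "G v \<le> H1_norm V v" for v unfolding G_def using H1_norm_ge_grad[of v] H1_norm_nonneg[of v] by (intro real_le_lsqrt) auto
  have "\<bar>G (\<phi> n) - G u\<bar> \<le> H1_norm V (\<lambda>x. \<phi> n x - u x)" for n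
  proof -
    have 1: "G (\<phi> n) \<le> G (\<lambda>x. \<phi> n x - u x) + G u"
      using grad.sqrt_triangle[OF grad.D_diff[OF \<phi>H u] u, of n] by (simp add: G_def)
    have 2: "G u \<le> G (\<lambda>x. u x - \<phi> n x) + G (\<phi> n)"
      using grad.sqrt_triangle[OF grad.D_diff[OF u \<phi>H] \<phi>H, of n n] by (simp add: G_def)
    have 3: "G (\<lambda>x. \<phi> n x - u x) \<le> H1_norm V (\<lambda>x. \<phi> n x - u x)" by (rule Gd)
    have 4: "G (\<lambda>x. u x - \<phi> n x) \<le> H1_norm V (\<lambda>x. \<phi> n x - u x)"
      using Gd[of "\<lambda>x. u x - \<phi> n x"] H1_norm_minus_commute[OF u \<phi>H, of n] by linarith
    show ?thesis using 1 2 3 4 by linarith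
  qed
  then have "(\<lambda>n. \<bar>G (\<phi> n) - G u\<bar>) \<longlonglongrightarrow> 0" by (intro tendsto_0_le[OF t(3)]) auto
  then have "(\<lambda>n. G (\<phi> n) - G u) \<longlonglongrightarrow> 0" by (rule tendsto_rabs_zero_cancel)
  then have g: "(\<lambda>n. G (\<phi> n)) \<longlonglongrightarrow> G u" by (rule LIM_zero_cancel)
  have Gsq: "(G v)\<^sup>2 = Re (grad_form v v)" if "v \<in> H1 V" for v
    unfolding G_def using grad.nonneg[OF that] by (rule real_sqrt_pow2)
  have "a * (l2_norm bdry (tr u))\<^sup>2 \<le> (G u)\<^sup>2 + K * (l2_norm (leb V) u)\<^sup>2"
  proof (rule LIMSEQ_le)
    show "(\<lambda>n. a * (l2_norm bdry (\<phi> n))\<^sup>2) \<longlonglongrightarrow> a * (l2_norm bdry (tr u))\<^sup>2"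
      by (intro tendsto_mult tendsto_power tendsto_const b)
    show "(\<lambda>n. (G (\<phi> n))\<^sup>2 + K * (l2_norm (leb V) (\<phi> n))\<^sup>2) \<longlonglongrightarrow> (G u)\<^sup>2 + K * (l2_norm (leb V) u)\<^sup>2"
      by (intro tendsto_add tendsto_mult tendsto_power tendsto_const g l)
    show "\<exists>N. \<forall>n\<ge>N. a * (l2_norm bdry (\<phi> n))\<^sup>2 \<le> (G (\<phi> n))\<^sup>2 + K * (l2_norm (leb V) (\<phi> n))\<^sup>2"
      unfolding Gsq[OF \<phi>H] using test_admissible[OF t(2) ad] by blast
  qed
  then show ?thesis unfolding Gsq[OF u] .
qed

section \<open>The Robin form and the bottom of its spectrum\<close>

lemma robin_form_eq: "robin_form V \<alpha> u v = grad_form u v + of_real \<alpha> * l2_inner bdry (tr u) (tr v)"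
  by (simp add: robin_form_def grad_form_def arc_length_measure_V)

lemma robin_self: "Re (robin_form V \<alpha> u u) = Re (grad_form u u) + \<alpha> * (l2_norm bdry (tr u))\<^sup>2"
  unfolding robin_form_eq l2_inner_self by simp

lemma robin_well_defined: "robin_form_well_defined V"
  unfolding robin_form_well_defined_def arc_length_measure_V
  using trace_exists trace_limit_is_trace trace_limitD(4) by blast

lemma hermitian_robin: "hermitian_form (H1 V) (robin_form V \<alpha>)"
proof unfold_locales
  fix u v w assume H: "u \<in> H1 V" "v \<in> H1 V" "w \<in> H1 V"
  note s = tr_sq_integrable[OF H(1)] tr_sq_integrable[OF H(2)] tr_sq_integrable[OF H(3)] tr_sq_integrable[OF H1_add[OF H(1,2)]]
  have "l2_inner bdry (tr (\<lambda>x. u x + v x)) (tr w) = l2_inner bdry (\<lambda>x. tr u x + tr v x) (tr w)"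
    by (rule l2_inner_AE_cong[OF sq_integrableD(1)[OF s(4)] sq_integrableD(1)[OF sq_integrable_add[OF s(1,2)]]
        tr_add[OF H(1,2)] sq_integrableD(1)[OF s(3)] sq_integrableD(1)[OF s(3)]]) simp
  also have "\<dots> = l2_inner bdry (tr u) (tr w) + l2_inner bdry (tr v) (tr w)"
    using l2.add_left[of "tr u" bdry "tr v" "tr w"] s by simp
  finally show "robin_form V \<alpha> (\<lambda>x. u x + v x) w = robin_form V \<alpha> u w + robin_form V \<alpha> v w"
    unfolding robin_form_eq grad.add_left[OF H] by (simp add: algebra_simps)
next
  fix u w c assume H: "u \<in> H1 V" "w \<in> H1 V"
  note s = tr_sq_integrable[OF H(1)] tr_sq_integrable[OF H(2)] tr_sq_integrable[OF H1_scale[OF H(1)]]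
  have "l2_inner bdry (tr (\<lambda>x. c * u x)) (tr w) = l2_inner bdry (\<lambda>x. c * tr u x) (tr w)"
    by (rule l2_inner_AE_cong[OF sq_integrableD(1)[OF s(3)] sq_integrableD(1)[OF sq_integrable_scale[OF s(1)]]
        tr_scale[OF H(1)] sq_integrableD(1)[OF s(2)] sq_integrableD(1)[OF s(2)]]) simp
  also have "\<dots> = c * l2_inner bdry (tr u) (tr w)"
    using l2.scale_left[of "tr u" bdry "tr w" c] s by simp
  finally show "robin_form V \<alpha> (\<lambda>x. c * u x) w = c * robin_form V \<alpha> u w"
    unfolding robin_form_eq grad.scale_left[OF H] by (simp add: algebra_simps)
next
  fix u v assume H: "u \<in> H1 V" "v \<in> H1 V"
  show "robin_form V \<alpha> v u = cnj (robin_form V \<alpha> u v)"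
    unfolding robin_form_eq grad.herm[OF H] using l2.herm[of "tr u" bdry "tr v"] tr_sq_integrable[OF H(1)] tr_sq_integrable[OF H(2)] by simp
qed (auto intro: H1_add H1_scale grad.D_nonempty)

lemma robin_lower:
  assumes "admissible (- \<alpha>) K" "u \<in> H1 V"
  shows "- K * (l2_norm (leb V) u)\<^sup>2 \<le> Re (robin_form V \<alpha> u u)"
  using trace_inequality[OF assms(2,1)] unfolding robin_self by simp

lemma robin_semibounded: "lower_semibounded_form (leb V) (H1 V) (robin_form V \<alpha>)"
  unfolding lower_semibounded_form_def
proof (intro exI[of _ "- ((- \<alpha>)\<^sup>2 * (1 + m\<^sup>2))"] ballI conjI)
  fix u assume u: "u \<in> H1 V"
  show "- ((- \<alpha>)\<^sup>2 * (1 + m\<^sup>2)) * (l2_norm (leb V) u)\<^sup>2 \<le> Re (robin_form V \<alpha> u u)"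
    by (rule robin_lower[OF admissible_crude u])
  show "Im (robin_form V \<alpha> u u) = 0"
    using hermitian_form.diag_real[OF hermitian_robin u] by (metis Im_complex_of_real)
qed

lemma robin_closed: "closed_form (leb V) (H1 V) (robin_form V \<alpha>)"
proof (rule closed_formI)
  fix w u
  assume w: "\<And>n. w n \<in> H1 V" and u: "sq_integrable (leb V) u" and lim: "(\<lambda>n. l2_norm (leb V) (\<lambda>x. w n x - u x)) \<longlonglongrightarrow> 0"
    and cauchy: "\<And>e. e > 0 \<Longrightarrow> \<exists>N. \<forall>m\<ge>N. \<forall>n\<ge>N. cmod (robin_form V \<alpha> (\<lambda>x. w m x - w n x) (\<lambda>x. w m x - w n x)) < e"
  \<comment> \<open>With a = 2 |\<alpha>| in the trace inequality the boundary term absorbs at most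
    half of the squared gradient, up to an L^2 term, so the Robin form and the L^2 norm together
    control the H^1 norm.\<close>
  define K where "K = (2 * \<bar>\<alpha>\<bar>)\<^sup>2 * (1 + m\<^sup>2)"
  have K: "K \<ge> 0" by (simp add: K_def)
  have coercive: "Re (grad_form v v) \<le> 2 * Re (robin_form V \<alpha> v v) + K * (l2_norm (leb V) v)\<^sup>2" if v: "v \<in> H1 V" for v
  proof -
    have "2 * \<bar>\<alpha>\<bar> * (l2_norm bdry (tr v))\<^sup>2 \<le> Re (grad_form v v) + K * (l2_norm (leb V) v)\<^sup>2"
      unfolding K_def by (rule trace_inequality[OF v admissible_crude])
    moreover have "- \<bar>\<alpha>\<bar> * (l2_norm bdry (tr v))\<^sup>2 \<le> \<alpha> * (l2_norm bdry (tr v))\<^sup>2" by (intro mult_right_mono) auto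
    ultimately show ?thesis unfolding robin_self by (simp add: algebra_simps)
  qed
  have l2c: "\<exists>N. \<forall>p\<ge>N. \<forall>q\<ge>N. l2_norm (leb V) (\<lambda>x. w p x - w q x) < e" if "e > 0" for e
  proof -
    have "eventually (\<lambda>n. l2_norm (leb V) (\<lambda>x. w n x - u x) < e / 2) sequentially"
      using \<open>e > 0\<close> by (intro order_tendstoD(2)[OF lim]) simp
    then obtain N where N: "\<And>n. n \<ge> N \<Longrightarrow> l2_norm (leb V) (\<lambda>x. w n x - u x) < e / 2"
      unfolding eventually_sequentially by blast
    have "l2_norm (leb V) (\<lambda>x. w p x - w q x) < e" if "p \<ge> N" "q \<ge> N" for p q
      using l2_triangle_diff[OF H1D(1)[OF w[of p]] u H1D(1)[OF w[of q]]] N[OF that(1)] N[OF that(2)]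
        l2_norm_minus_commute[of "leb V" u "w q"] by linarith
    then show ?thesis by blast
  qed
  have gc: "\<exists>N. \<forall>p\<ge>N. \<forall>q\<ge>N. Re (grad_form (\<lambda>x. w p x - w q x) (\<lambda>x. w p x - w q x)) < e" if "e > 0" for e
  proof -
    obtain N1 where N1: "\<forall>p\<ge>N1. \<forall>q\<ge>N1. cmod (robin_form V \<alpha> (\<lambda>x. w p x - w q x) (\<lambda>x. w p x - w q x)) < e / 4"
      using cauchy[of "e / 4"] \<open>e > 0\<close> by auto
    obtain N2 where N2: "\<forall>p\<ge>N2. \<forall>q\<ge>N2. l2_norm (leb V) (\<lambda>x. w p x - w q x) < sqrt (e / (2 * (K + 1)))"
      using l2c[of "sqrt (e / (2 * (K + 1)))"] \<open>e > 0\<close> K by auto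
    have "Re (grad_form (\<lambda>x. w p x - w q x) (\<lambda>x. w p x - w q x)) < e" if pq: "p \<ge> max N1 N2" "q \<ge> max N1 N2" for p q
    proof -
      define z where "z = (\<lambda>x. w p x - w q x)"
      have zH: "z \<in> H1 V" unfolding z_def by (rule grad.D_diff[OF w w])
      have 1: "Re (robin_form V \<alpha> z z) < e / 4"
        using N1 pq complex_Re_le_cmod[of "robin_form V \<alpha> z z"] unfolding z_def by fastforce
      have "l2_norm (leb V) z < sqrt (e / (2 * (K + 1)))" using N2 pq unfolding z_def by simp
      then have "(l2_norm (leb V) z)\<^sup>2 \<le> (sqrt (e / (2 * (K + 1))))\<^sup>2" by (intro power_mono) (simp_all add: l2_norm_nonneg)
      also have "\<dots> = e / (2 * (K + 1))" using \<open>e > 0\<close> K by simp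
      finally have "K * (l2_norm (leb V) z)\<^sup>2 \<le> K * (e / (2 * (K + 1)))" using K by (intro mult_left_mono)
      also have "\<dots> \<le> e / 2" using K \<open>e > 0\<close> by (simp add: field_simps)
      finally show ?thesis using coercive[OF zH] 1 unfolding z_def by linarith
    qed
    then show ?thesis by blast
  qed
  have uH: "u \<in> H1 V" and conv: "(\<lambda>n. H1_norm V (\<lambda>x. w n x - u x)) \<longlonglongrightarrow> 0"
    using H1_closed[OF w u lim gc] by blast+
  define C where "C = 1 + \<bar>\<alpha>\<bar> * (2 + m\<^sup>2)"
  have bd: "cmod (robin_form V \<alpha> v v) \<le> C * (H1_norm V v)\<^sup>2" if v: "v \<in> H1 V" for v
  proof -
    have g0: "0 \<le> Re (grad_form v v)" by (rule grad.nonneg[OF v])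
    have t: "(l2_norm bdry (tr v))\<^sup>2 \<le> (2 + m\<^sup>2) * (H1_norm V v)\<^sup>2"
    proof -
      have "(l2_norm bdry (tr v))\<^sup>2 \<le> Re (grad_form v v) + (1 + m\<^sup>2) * (l2_norm (leb V) v)\<^sup>2"
        using trace_inequality[OF v admissible_crude[of 1]] by simp
      also have "\<dots> \<le> (H1_norm V v)\<^sup>2 + (1 + m\<^sup>2) * (H1_norm V v)\<^sup>2"
        by (intro add_mono mult_left_mono power_mono H1_norm_ge_grad H1_norm_ge_l2) (simp_all add: l2_norm_nonneg)
      finally show ?thesis by (simp add: algebra_simps)
    qed
    have "cmod (robin_form V \<alpha> v v) = \<bar>Re (robin_form V \<alpha> v v)\<bar>"
      using hermitian_form.diag_real[OF hermitian_robin v] by (metis norm_of_real)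
    also have "\<dots> \<le> \<bar>Re (grad_form v v)\<bar> + \<bar>\<alpha> * (l2_norm bdry (tr v))\<^sup>2\<bar>" unfolding robin_self by (rule abs_triangle_ineq)
    also have "\<dots> = Re (grad_form v v) + \<bar>\<alpha>\<bar> * (l2_norm bdry (tr v))\<^sup>2" using g0 by (simp add: abs_mult)
    also have "\<dots> \<le> (H1_norm V v)\<^sup>2 + \<bar>\<alpha>\<bar> * ((2 + m\<^sup>2) * (H1_norm V v)\<^sup>2)"
      by (intro add_mono mult_left_mono H1_norm_ge_grad t) simp
    finally show ?thesis by (simp add: C_def algebra_simps)
  qed
  have "(\<lambda>n. cmod (robin_form V \<alpha> (\<lambda>x. w n x - u x) (\<lambda>x. w n x - u x))) \<longlonglongrightarrow> 0"
  proof (rule tendsto_0_le)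
    show "(\<lambda>n. C * (H1_norm V (\<lambda>x. w n x - u x))\<^sup>2) \<longlonglongrightarrow> 0"
      using tendsto_mult[OF tendsto_const tendsto_power[OF conv, of 2], of C] by simp
    show "cmod (robin_form V \<alpha> (\<lambda>x. w n x - u x) (\<lambda>x. w n x - u x)) \<le> C * (H1_norm V (\<lambda>x. w n x - u x))\<^sup>2" for n
      by (rule bd[OF grad.D_diff[OF w uH]])
  qed simp
  then have "(\<lambda>n. robin_form V \<alpha> (\<lambda>x. w n x - u x) (\<lambda>x. w n x - u x)) \<longlonglongrightarrow> 0"
    by (rule tendsto_norm_zero_cancel)
  with uH show "u \<in> H1 V \<and> (\<lambda>n. robin_form V \<alpha> (\<lambda>x. w n x - u x) (\<lambda>x. w n x - u x)) \<longlonglongrightarrow> 0" ..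
qed

lemma semibounded_closed_robin: "semibounded_closed_form (H1 V) (robin_form V \<alpha>) (leb V)"
  by (intro semibounded_closed_form.intro hermitian_robin semibounded_closed_form_axioms.intro H1D(1) robin_closed)

text \<open>If all H^1 functions were null, so would be all test functions of V. The indicator of a
  ball in V would then be orthogonal to them and vanish almost everywhere.\<close>

lemma H1_nontrivial: "\<exists>u\<in>H1 V. l2_norm (leb V) u > 0"
proof (rule ccontr)
  assume "\<not> ?thesis"
  then have z: "l2_norm (leb V) u = 0" if "u \<in> H1 V" for u
    using that l2_norm_nonneg[of "leb V" u] by fastforce
  have "(0, h 0 + 1) \<in> V" by (simp add: V_def)
  then obtain r where r: "r > 0" "ball (0, h 0 + 1) r \<subseteq> V" by (rule openE[OF open_V])
  let ?B = "ball (0 :: real, h 0 + 1) r"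
  let ?f = "\<lambda>x. complex_of_real (indicator ?B x)"
  have fl: "sq_integrable lborel ?f"
  proof -
    have eq: "(cmod (?f x))\<^sup>2 = indicator ?B x" for x by (simp add: indicator_def)
    have i: "integrable lborel (\<lambda>x. indicator ?B x :: real)"
      using emeasure_lborel_ball_finite[of "(0, h 0 + 1)" r] by (simp add: integrable_indicator_iff)
    have [measurable]: "?B \<in> sets borel" by simp
    have m: "?f \<in> borel_measurable lborel" by measurable
    show ?thesis unfolding sq_integrable_def eq using i m by blast
  qed
  have "AE x in leb V. ?f x = 0"
  proof (rule orthogonal_to_test_functions)
    show "sq_integrable (leb V) ?f" by (rule leb_sq_integrable_restrict(1)[OF open_V fl])
    fix \<phi> assume \<phi>: "test_function V \<phi>"
    have "\<phi> \<in> H1 V" by (rule test_function_H1[OF test_function_mono[OF \<phi> subset_UNIV]])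
    then have "AE x in leb V. \<phi> x = 0" by (intro l2_norm_zero_AE H1D(1) z)
    then show "(\<integral>x. ?f x * \<phi> x \<partial>leb V) = 0"
      by (intro integral_eq_zero_AE) (auto elim!: eventually_mono)
  qed
  then have "AE x in lborel. x \<notin> ?B" 
    unfolding leb_AE[OF open_V] by (rule eventually_mono) (use r(2) in \<open>auto simp: indicator_def\<close>)
  then have "?B \<in> null_sets lborel" by (simp add: AE_iff_null_sets)
  then have "?B = {}" using open_not_negligible[of ?B] negligible_iff_null_sets null_sets_completionI by blast
  then show False using r(1) by simp
qed

theorem robin_E_lower:
  assumes "admissible (- \<alpha>) K"
  shows "- K \<le> robin_E V \<alpha>"
proof -
  interpret R: semibounded_closed_form "H1 V" "robin_form V \<alpha>" "leb V" by (rule semibounded_closed_robin)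
  have "robin_E V \<alpha> = R.rayleigh_inf"
    unfolding robin_E_def robin_laplacian_def by (rule R.Inf_spectrum[OF robin_lower[OF assms] H1_nontrivial])
  then show ?thesis using R.rayleigh_inf(1)[OF robin_lower[OF assms] H1_nontrivial] by simp
qed

text \<open>Competitors are taken among test functions, where the trace is restriction and the
  boundary term can be computed.\<close>

theorem robin_E_upper:
  assumes \<phi>: "test_function UNIV \<phi>" and pos: "l2_norm (leb V) \<phi> > 0"
    and le: "Re (grad_form \<phi> \<phi>) + \<alpha> * (l2_norm bdry \<phi>)\<^sup>2 \<le> c * (l2_norm (leb V) \<phi>)\<^sup>2"
  shows "robin_E V \<alpha> \<le> c"
proof -
  interpret R: semibounded_closed_form "H1 V" "robin_form V \<alpha>" "leb V" by (rule semibounded_closed_robin)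
  have E: "robin_E V \<alpha> = R.rayleigh_inf"
    unfolding robin_E_def robin_laplacian_def by (rule R.Inf_spectrum[OF robin_lower[OF admissible_crude] H1_nontrivial])
  have \<phi>H: "\<phi> \<in> H1 V" by (rule test_function_H1[OF \<phi>])
  have "l2_norm bdry (tr \<phi>) = l2_norm bdry \<phi>"
    by (rule l2_norm_AE_cong[OF sq_integrableD(1)[OF tr_sq_integrable[OF \<phi>H]] sq_integrableD(1)[OF test_sq_integrable_bdry(1)[OF \<phi>]] tr_test[OF \<phi>]])
  then have "R.rayleigh_inf * (l2_norm (leb V) \<phi>)\<^sup>2 \<le> c * (l2_norm (leb V) \<phi>)\<^sup>2"
    using R.rayleigh_inf(2)[OF robin_lower[OF admissible_crude] H1_nontrivial \<phi>H] le unfolding robin_self by simp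
  then show ?thesis unfolding E using pos by (simp add: mult_le_cancel_right)
qed

end

section \<open>Separated test functions\<close>

lemma smooth_map_fst_snd:
  fixes \<xi> f :: "real \<Rightarrow> real"
  assumes "smooth_map \<xi>" "smooth_map f"
  shows "smooth_map (\<lambda>z::real \<times> real. complex_of_real (\<xi> (fst z) * f (snd z)))"
proof -
  have "smooth_map (\<lambda>z::real\<times>real. \<xi> (0 + fst z) * f (0 + snd z))"
    by (rule smooth_map_mult[OF smooth_map_affine[OF bounded_linear_fst assms(1)] smooth_map_affine[OF bounded_linear_snd assms(2)]])
  then have "smooth_map (\<lambda>z::real\<times>real. \<xi> (fst z) * f (snd z))" by simp
  then show ?thesis by (rule smooth_map_linear[OF bounded_linear_of_real])
qed

context epigraph
begin

context
  fixes \<xi> f :: "real \<Rightarrow> real" and R :: real and \<phi> :: "real \<times> real \<Rightarrow> complex"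
  assumes smooth: "smooth_map \<xi>" "smooth_map f"
    and supp: "\<And>x. \<bar>x\<bar> > R \<Longrightarrow> \<xi> x = 0" "\<And>y. \<bar>y\<bar> > R \<Longrightarrow> f y = 0"
    and \<phi>_eq: "\<phi> = (\<lambda>z. complex_of_real (\<xi> (fst z) * f (snd z)))"
begin

lemma separated_test: "test_function UNIV \<phi>"
proof (rule test_functionI)
  show "smooth_map \<phi>" unfolding \<phi>_eq by (rule smooth_map_fst_snd[OF smooth])
  show "compact (cbox (-R, -R) (R, R))" by (rule compact_cbox)
  show "z \<in> cbox (-R, -R) (R, R)" if "\<phi> z \<noteq> 0" for z
  proof -
    have "\<not> \<bar>fst z\<bar> > R" "\<not> \<bar>snd z\<bar> > R" using that supp unfolding \<phi>_eq by auto
    then show ?thesis by (cases z) (auto simp: cbox_Pair_eq abs_le_iff)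
  qed
qed simp

lemma separated_deriv:
  "frechet_derivative \<phi> (at z) v =
    complex_of_real (fst v * (deriv \<xi> (fst z) * f (snd z)) + snd v * (\<xi> (fst z) * deriv f (snd z)))"
proof -
  have 1: "((\<lambda>z. \<xi> (fst z)) has_derivative (\<lambda>v. fst v * deriv \<xi> (fst z))) (at z)"
    using has_derivative_compose[OF has_derivative_fst[OF has_derivative_ident] smooth_map_real_deriv(1)[OF smooth(1), unfolded has_field_derivative_def]]
    by (simp add: mult.commute)
  have 2: "((\<lambda>z. f (snd z)) has_derivative (\<lambda>v. snd v * deriv f (snd z))) (at z)"
    using has_derivative_compose[OF has_derivative_snd[OF has_derivative_ident] smooth_map_real_deriv(1)[OF smooth(2), unfolded has_field_derivative_def]]
    by (simp add: mult.commute)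
  have "(\<phi> has_derivative (\<lambda>v. complex_of_real (\<xi> (fst z) * (snd v * deriv f (snd z)) + (fst v * deriv \<xi> (fst z)) * f (snd z)))) (at z)"
    unfolding \<phi>_eq by (rule has_derivative_of_real[OF has_derivative_mult[OF 1 2]])
  from frechet_derivative_at[OF this, symmetric] show ?thesis by (simp add: algebra_simps)
qed

lemma separated_l2: "(l2_norm (leb V) \<phi>)\<^sup>2 = (\<integral>z. indicator V z * ((\<xi> (fst z))\<^sup>2 * (f (snd z))\<^sup>2) \<partial>lborel)"
  unfolding l2_norm_square leb_integral[OF open_V] \<phi>_eq by (simp add: norm_mult power_mult_distrib del: of_real_mult)

text \<open>Completing the square: \<open>f' + a f\<close> vanishes for the exponential decaying at rate \<open>a\<close>.\<close>

lemma separated_energy: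
  "Re (grad_form \<phi> \<phi>) - a * (l2_norm bdry \<phi>)\<^sup>2 + a\<^sup>2 * (l2_norm (leb V) \<phi>)\<^sup>2 =
    (\<integral>z. indicator V z * ((deriv \<xi> (fst z))\<^sup>2 * (f (snd z))\<^sup>2 + (\<xi> (fst z))\<^sup>2 * (deriv f (snd z) + a * f (snd z))\<^sup>2) \<partial>lborel)
    - a * (\<integral>x. (speed x - 1) * ((\<xi> x)\<^sup>2 * (f (h x))\<^sup>2) \<partial>lborel)"
  "integrable lborel (\<lambda>z. indicator V z * ((deriv \<xi> (fst z))\<^sup>2 * (f (snd z))\<^sup>2 + (\<xi> (fst z))\<^sup>2 * (deriv f (snd z) + a * f (snd z))\<^sup>2))"
  "integrable lborel (\<lambda>x. (speed x - 1) * ((\<xi> x)\<^sup>2 * (f (h x))\<^sup>2))"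
  "integrable lborel (\<lambda>z. indicator V z * ((\<xi> (fst z))\<^sup>2 * (f (snd z))\<^sup>2))"
proof -
  define c where "c z = \<xi> (fst z)" for z :: "real \<times> real"
  define c' where "c' z = deriv \<xi> (fst z)" for z :: "real \<times> real"
  define g where "g z = f (snd z)" for z :: "real \<times> real"
  define g' where "g' z = deriv f (snd z)" for z :: "real \<times> real"
  note defs = c_def c'_def g_def g'_def
  have cont: "continuous_on UNIV c" "continuous_on UNIV c'" "continuous_on UNIV g" "continuous_on UNIV g'"
    unfolding defs
    by (rule continuous_on_compose2[OF smooth_map_continuous[OF smooth(1), of UNIV] continuous_on_fst[OF continuous_on_id]], simp,
        rule continuous_on_compose2[OF smooth_map_continuous[OF smooth_map_real_deriv(2)[OF smooth(1)], of UNIV] continuous_on_fst[OF continuous_on_id]], simp,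
        rule continuous_on_compose2[OF smooth_map_continuous[OF smooth(2), of UNIV] continuous_on_snd[OF continuous_on_id]], simp,
        rule continuous_on_compose2[OF smooth_map_continuous[OF smooth_map_real_deriv(2)[OF smooth(2)], of UNIV] continuous_on_snd[OF continuous_on_id]], simp)
  have dz: "deriv k x = 0" if k: "smooth_map k" "\<And>x. \<bar>x\<bar> > R \<Longrightarrow> k x = 0" and x: "\<bar>x\<bar> > R" for k :: "real \<Rightarrow> real" and x
  proof -
    have o: "open {y::real. R < \<bar>y\<bar>}"
      by (intro open_Collect_less continuous_on_const continuous_on_rabs continuous_on_id)
    have "(k has_real_derivative 0) (at x)"
    proof (rule has_field_derivative_transform_within_open[OF _ o])
      show "((\<lambda>x. 0) has_real_derivative 0) (at x)" by simp
      show "x \<in> {y. R < \<bar>y\<bar>}" using x by simp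
    qed (simp add: k(2))
    then show ?thesis by (rule DERIV_imp_deriv)
  qed
  have z: "c z * g z = 0" "c' z * g z = 0" "c z * g' z = 0" if n: "norm z > 2 * \<bar>R\<bar>" for z
  proof -
    have "norm z \<le> \<bar>fst z\<bar> + \<bar>snd z\<bar>" using norm_Pair_le[of "fst z" "snd z"] by simp
    then have "\<bar>fst z\<bar> > R \<or> \<bar>snd z\<bar> > R" using n by linarith
    then show "c z * g z = 0" "c' z * g z = 0" "c z * g' z = 0"
      unfolding defs using supp dz[OF smooth(1) supp(1)] dz[OF smooth(2) supp(2)] by auto
  qed
  have int: "integrable lborel (\<lambda>z. indicator V z * k z)"
    if k: "continuous_on UNIV k" "\<And>z. norm z > 2 * \<bar>R\<bar> \<Longrightarrow> k z = 0" for k :: "real \<times> real \<Rightarrow> real"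
  proof (rule Bochner_Integration.integrable_bound[OF integrable_continuous_compact_support[OF k(1), of "2 * \<bar>R\<bar>"]])
    have Vb: "V \<in> sets borel" using open_V by simp
    show "(\<lambda>z. indicator V z * k z) \<in> borel_measurable lborel"
      using borel_measurable_continuous_onI[OF k(1)] Vb by simp
  qed (simp_all add: k(2) indicator_def)
  define w where "w z = (c z * g z)\<^sup>2" for z
  define w1 where "w1 z = 2 * (c z * g z) * (c' z * g z)" for z
  define w2 where "w2 z = 2 * (c z * g z) * (c z * g' z)" for z
  have wd: "(w has_derivative (\<lambda>v. fst v * w1 z + snd v * w2 z)) (at z)" for z
  proof -
    have 1: "((\<lambda>z. \<xi> (fst z)) has_derivative (\<lambda>v. fst v * deriv \<xi> (fst z))) (at z)"
      using has_derivative_compose[OF has_derivative_fst[OF has_derivative_ident] smooth_map_real_deriv(1)[OF smooth(1), unfolded has_field_derivative_def]]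
      by (simp add: mult.commute)
    have 2: "((\<lambda>z. f (snd z)) has_derivative (\<lambda>v. snd v * deriv f (snd z))) (at z)"
      using has_derivative_compose[OF has_derivative_snd[OF has_derivative_ident] smooth_map_real_deriv(1)[OF smooth(2), unfolded has_field_derivative_def]]
      by (simp add: mult.commute)
    show ?thesis
      unfolding w_def power2_eq_square defs
      by (rule has_derivative_eq_rhs[OF has_derivative_mult[OF has_derivative_mult[OF 1 2] has_derivative_mult[OF 1 2]]])
         (simp add: w1_def w2_def defs fun_eq_iff algebra_simps)
  qed
  have wc: "continuous_on UNIV w1" "continuous_on UNIV w2"
    unfolding w1_def w2_def by (intro continuous_on_mult continuous_on_const cont)+
  have ws: "w z = 0" "w1 z = 0" "w2 z = 0" if "norm z > 2 * \<bar>R\<bar>" for z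
    using z[OF that] by (simp_all add: w_def w1_def w2_def)
  \<comment> \<open>The cross term 2 a f f' of the completed square integrates to the boundary
    integral with respect to dx. The form measures the boundary in arc length, and the difference,
    with density \<open>speed\<close> - 1, is the only negative contribution for a > 0.\<close>
  have flux: "(\<integral>x. a * w (graph x) \<partial>lborel) = - (\<integral>z. indicator V z * (a * w2 z) \<partial>lborel)"
    using vertical_FTC[OF wd wc ws continuous_on_const] .
  have i1: "integrable lborel (\<lambda>z. indicator V z * (c' z * g z)\<^sup>2)"
    by (rule int) (intro continuous_on_power continuous_on_mult cont, simp add: z)
  have i2: "integrable lborel (\<lambda>z. indicator V z * (c z * g' z)\<^sup>2)"
    by (rule int) (intro continuous_on_power continuous_on_mult cont, simp add: z)
  have i3: "integrable lborel (\<lambda>z. indicator V z * (c z * g z)\<^sup>2)"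
    by (rule int) (intro continuous_on_power continuous_on_mult cont, simp add: z)
  have i4: "integrable lborel (\<lambda>z. indicator V z * w2 z)" by (rule int[OF wc(2) ws(3)])
  have i5: "integrable lborel (\<lambda>z. indicator V z * ((c' z * g z)\<^sup>2 + (c z * g' z + a * (c z * g z))\<^sup>2))"
    by (rule int) (intro continuous_on_power continuous_on_add continuous_on_mult continuous_on_const cont, simp add: z)
  have bdry_int: "integrable lborel (\<lambda>x. k x * w (graph x))" if k: "continuous_on UNIV k" for k
  proof -
    have wcont: "continuous_on UNIV w" unfolding w_def by (intro continuous_on_power continuous_on_mult cont)
    have "continuous_on {-R..R} (\<lambda>x. k x * w (graph x))"
      by (intro continuous_on_mult continuous_on_subset[OF k] continuous_on_compose2[OF wcont graph_continuous]) auto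
    from borel_integrable_compact[OF compact_Icc this]
    have "integrable lborel (\<lambda>x. indicator {-R..R} x *\<^sub>R (k x * w (graph x)))" .
    moreover have e: "indicator {-R..R} x *\<^sub>R (k x * w (graph x)) = k x * w (graph x)" for x
    proof (cases "x \<in> {-R..R}")
      case False
      then have "\<bar>x\<bar> > R" unfolding atLeastAtMost_iff by linarith
      then show ?thesis by (simp add: w_def c_def supp(1))
    qed simp
    ultimately show ?thesis unfolding e by simp
  qed
  have b1: "integrable lborel (\<lambda>x. (speed x - 1) * w (graph x))"
    by (rule bdry_int) (intro continuous_on_diff continuous_on_const speed_continuous)
  have b2: "integrable lborel (\<lambda>x. w (graph x))"
    using bdry_int[OF continuous_on_const, of 1] by simp
  show "integrable lborel (\<lambda>x. (speed x - 1) * ((\<xi> x)\<^sup>2 * (f (h x))\<^sup>2))"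
    using b1 by (simp add: w_def defs graph_def power_mult_distrib)
  show "integrable lborel (\<lambda>z. indicator V z * ((\<xi> (fst z))\<^sup>2 * (f (snd z))\<^sup>2))"
    using i3 by (simp add: defs power_mult_distrib)
  have e5: "(c' z * g z)\<^sup>2 + (c z * g' z + a * (c z * g z))\<^sup>2 =
      (deriv \<xi> (fst z))\<^sup>2 * (f (snd z))\<^sup>2 + (\<xi> (fst z))\<^sup>2 * (deriv f (snd z) + a * f (snd z))\<^sup>2" for z
    by (simp add: defs power2_eq_square algebra_simps)
  show "integrable lborel (\<lambda>z. indicator V z * ((deriv \<xi> (fst z))\<^sup>2 * (f (snd z))\<^sup>2 + (\<xi> (fst z))\<^sup>2 * (deriv f (snd z) + a * f (snd z))\<^sup>2))"
    using i5 unfolding e5 .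
  have g: "Re (grad_form \<phi> \<phi>) = (\<integral>z. indicator V z * (c' z * g z)\<^sup>2 \<partial>lborel) + (\<integral>z. indicator V z * (c z * g' z)\<^sup>2 \<partial>lborel)"
    unfolding grad_form_test[OF separated_test] separated_deriv by (simp add: defs norm_mult power_mult_distrib del: of_real_mult)
  have b: "(l2_norm bdry \<phi>)\<^sup>2 = (\<integral>x. (speed x - 1) * w (graph x) \<partial>lborel) + (\<integral>x. w (graph x) \<partial>lborel)"
  proof -
    have "(l2_norm bdry \<phi>)\<^sup>2 = (\<integral>x. (speed x - 1) * w (graph x) + w (graph x) \<partial>lborel)"
      unfolding test_sq_integrable_bdry(2)[OF separated_test] unfolding \<phi>_eq
      by (intro Bochner_Integration.integral_cong) (simp_all add: w_def defs algebra_simps norm_mult power_mult_distrib del: of_real_mult)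
    then show ?thesis using b1 b2 by simp
  qed
  have l: "(l2_norm (leb V) \<phi>)\<^sup>2 = (\<integral>z. indicator V z * (c z * g z)\<^sup>2 \<partial>lborel)"
    unfolding separated_l2 by (simp add: defs power_mult_distrib)
  have "(\<integral>z. indicator V z * ((c' z * g z)\<^sup>2 + (c z * g' z + a * (c z * g z))\<^sup>2) \<partial>lborel)
      = (\<integral>z. indicator V z * (c' z * g z)\<^sup>2 + (indicator V z * (c z * g' z)\<^sup>2
          + (a * (indicator V z * w2 z) + a\<^sup>2 * (indicator V z * (c z * g z)\<^sup>2))) \<partial>lborel)"
    by (intro Bochner_Integration.integral_cong) (simp_all add: w2_def power2_eq_square algebra_simps)
  also have "\<dots> = (\<integral>z. indicator V z * (c' z * g z)\<^sup>2 \<partial>lborel) + ((\<integral>z. indicator V z * (c z * g' z)\<^sup>2 \<partial>lborel)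
      + (a * (\<integral>z. indicator V z * w2 z \<partial>lborel) + a\<^sup>2 * (\<integral>z. indicator V z * (c z * g z)\<^sup>2 \<partial>lborel)))"
    using i1 i2 i3 i4 by simp
  also have "a * (\<integral>z. indicator V z * w2 z \<partial>lborel) = - (a * (\<integral>x. w (graph x) \<partial>lborel))"
    using flux by (simp add: mult.left_commute[of _ a])
  finally have main: "(\<integral>z. indicator V z * ((c' z * g z)\<^sup>2 + (c z * g' z + a * (c z * g z))\<^sup>2) \<partial>lborel) =
      Re (grad_form \<phi> \<phi>) - a * (\<integral>x. w (graph x) \<partial>lborel) + a\<^sup>2 * (l2_norm (leb V) \<phi>)\<^sup>2"
    unfolding g l by simp
  have wg: "(speed x - 1) * w (graph x) = (speed x - 1) * ((\<xi> x)\<^sup>2 * (f (h x))\<^sup>2)" for x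
    by (simp add: w_def defs graph_def power_mult_distrib)
  show "Re (grad_form \<phi> \<phi>) - a * (l2_norm bdry \<phi>)\<^sup>2 + a\<^sup>2 * (l2_norm (leb V) \<phi>)\<^sup>2 =
    (\<integral>z. indicator V z * ((deriv \<xi> (fst z))\<^sup>2 * (f (snd z))\<^sup>2 + (\<xi> (fst z))\<^sup>2 * (deriv f (snd z) + a * f (snd z))\<^sup>2) \<partial>lborel)
    - a * (\<integral>x. (speed x - 1) * ((\<xi> x)\<^sup>2 * (f (h x))\<^sup>2) \<partial>lborel)"
    using main unfolding b e5 wg by (simp add: algebra_simps)
qed

end

end

section \<open>A half-plane with bumps on all scales\<close>

text \<open>Cell n consists of the points that round to n. When each F n vanishes outside (-1/4,
  1/4), the convention of \<open>round\<close> at half-integers has no effect.\<close>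

definition glue :: "(int \<Rightarrow> real \<Rightarrow> real) \<Rightarrow> real \<Rightarrow> real" where
  "glue F x = F (round x) (x - of_int (round x))"

text \<open>If y rounds to another integer than the nearby x, then y is at least 1/4 away from both
  integers, and both sides are 0. So near x a single cell function describes everything, even at the
  edge of a cell.\<close>

lemma glue_local:
  assumes zero: "\<And>n s. 1/4 \<le> \<bar>s\<bar> \<Longrightarrow> F n s = 0" and y: "\<bar>y - x\<bar> < 1/4"
  shows "glue F y = F (round x) (y - of_int (round x))"
proof (cases "round y = round x")
  case False
  have d: "\<bar>real_of_int (round y) - real_of_int (round x)\<bar> \<ge> 1"
    using False by linarith
  have ry: "\<bar>real_of_int (round y) - y\<bar> \<le> 1/2" and rx: "\<bar>real_of_int (round x) - x\<bar> \<le> 1/2"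
    by (rule of_int_round_abs_le)+
  have "\<bar>y - of_int (round x)\<bar> \<ge> 1/4" "\<bar>y - of_int (round y)\<bar> \<ge> 1/4"
    using d ry rx y by linarith+
  then show ?thesis by (simp add: glue_def zero)
qed (simp add: glue_def)

lemma glue_has_derivative:
  assumes zero: "\<And>n s. 1/4 \<le> \<bar>s\<bar> \<Longrightarrow> F n s = 0" and d: "\<And>n s. (F n has_real_derivative F' n s) (at s)"
  shows "(glue F has_real_derivative glue F' x) (at x)"
proof (rule has_field_derivative_transform_within_open[of _ _ _ "ball x (1/4)"])
  have "((\<lambda>y. F (round x) (y - of_int (round x))) has_real_derivative F' (round x) (x - of_int (round x)) * 1) (at x)"
    by (rule DERIV_chain2[OF d]) (auto intro!: derivative_eq_intros)
  then show "((\<lambda>y. F (round x) (y - of_int (round x))) has_real_derivative glue F' x) (at x)"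
    by (simp add: glue_def)
  show "F (round x) (y - of_int (round x)) = glue F y" if "y \<in> ball x (1/4)" for y
    using that by (intro glue_local[OF zero, symmetric]) (simp_all add: dist_real_def abs_minus_commute)
qed simp_all

lemma glue_continuous:
  assumes zero: "\<And>n s. 1/4 \<le> \<bar>s\<bar> \<Longrightarrow> F n s = 0" and c: "\<And>n. continuous_on UNIV (F n)"
  shows "continuous_on UNIV (glue F)"
proof (rule continuous_at_imp_continuous_on, rule ballI)
  fix x :: real
  have "isCont (\<lambda>y. F (round x) (y - of_int (round x))) x"
  proof (rule isCont_o2[where g = "F (round x)"])
    show "isCont (F (round x)) (x - of_int (round x))" using c continuous_on_eq_continuous_at[OF open_UNIV] by blast
  qed simp
  moreover have "eventually (\<lambda>y. y \<in> ball x (1/4)) (nhds x)" by (rule eventually_nhds_in_open) simp_all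
  then have "eventually (\<lambda>y. F (round x) (y - of_int (round x)) = glue F y) (nhds x)"
  proof (rule eventually_mono)
    fix y assume "y \<in> ball x (1/4)"
    then show "F (round x) (y - of_int (round x)) = glue F y"
      by (intro glue_local[OF zero, symmetric]) (simp_all add: dist_real_def abs_minus_commute)
  qed
  ultimately show "isCont (glue F) x" by (simp only: isCont_cong)
qed

lemma glue_smooth:
  assumes zero: "\<And>n s. 1/4 \<le> \<bar>s\<bar> \<Longrightarrow> F n s = 0" and c: "\<And>n. smooth_map (F n)"
  shows "smooth_map (glue F)"
proof (rule smooth_map_local)
  fix x :: real
  show "\<exists>g S. open S \<and> x \<in> S \<and> smooth_map g \<and> (\<forall>y\<in>S. glue F y = g y)"
  proof (intro exI conjI ballI)
    show "smooth_map (\<lambda>y. F (round x) (- of_int (round x) + y))"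
      by (rule smooth_map_affine[OF bounded_linear_ident c])
    show "open (ball x (1/4))" "x \<in> ball x (1/4)" by simp_all
    fix y assume "y \<in> ball x (1/4)"
    then have "glue F y = F (round x) (y - of_int (round x))"
      by (intro glue_local[OF zero]) (simp_all add: dist_real_def abs_minus_commute)
    then show "glue F y = F (round x) (- of_int (round x) + y)" by simp
  qed
qed

text \<open>The factor 8 gives \<open>2 * scale n \<le> 1/4\<close>, so the bump and the falling
  part of the vector field, twice as wide, both fit into the region where glued functions may be
  nonzero.\<close>

definition scale :: "nat \<Rightarrow> real" where
  "scale n = 1 / (8 * (fact n)\<^sup>2)"

lemma scale_pos: "scale n > 0"
  by (simp add: scale_def)

lemma scale_Suc: "scale (Suc n) = scale n / (real (Suc n))\<^sup>2"
  unfolding scale_def fact_Suc power_mult_distrib by simp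

lemma scale_mono: "k \<le> n \<Longrightarrow> scale n \<le> scale k"
  unfolding scale_def by (intro divide_left_mono mult_left_mono power_mono fact_mono) simp_all

lemma scale_le: "scale n \<le> 1/8"
  using scale_mono[of 0 n] by (simp add: scale_def)

lemma scale_le_inverse: "scale n \<le> 1 / real (Suc n)"
proof -
  have "real n < 8 * fact n * fact n"
  proof -
    have "n \<le> fact n" by (rule fact_ge_self)
    then have "real n \<le> fact n" by (metis of_nat_fact of_nat_le_iff)
    also have "\<dots> < 8 * fact n" by simp
    also have "\<dots> \<le> 8 * fact n * fact n" by (simp add: fact_ge_1)
    finally show ?thesis .
  qed
  moreover have "1 \<le> (fact n :: real) * fact n" using mult_mono[of 1 "fact n" 1 "fact n :: real"] by (simp add: fact_ge_1)
  moreover have "real n \<le> fact n * fact n"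
  proof -
    have "n \<le> fact n" by (rule fact_ge_self)
    then have "real n \<le> fact n" by (metis of_nat_fact of_nat_le_iff)
    also have "\<dots> \<le> fact n * fact n" by (simp add: fact_ge_1)
    finally show ?thesis .
  qed
  ultimately have "real (Suc n) \<le> 8 * (fact n)\<^sup>2" by (simp add: power2_eq_square)
  then show ?thesis unfolding scale_def by (intro divide_left_mono) simp_all
qed

text \<open>Height and width share one factor, so slopes are those of \<open>bump\<close> at every
  scale, while second derivatives grow like 1 / \<open>scale\<close>.\<close>

definition cell_bump :: "int \<Rightarrow> real \<Rightarrow> real" where
  "cell_bump n s = scale (nat n) * bump (s / scale (nat n))"

definition profile :: "real \<Rightarrow> real" where "profile = glue cell_bump"

lemma scaled_outside:
  assumes "1/4 \<le> \<bar>s\<bar>" shows "2 \<le> \<bar>s / scale n\<bar>" "1 \<le> \<bar>s / (2 * scale n)\<bar>"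
proof -
  have "2 * scale n \<le> \<bar>s\<bar>" using assms scale_le[of n] by linarith
  then show "2 \<le> \<bar>s / scale n\<bar>" "1 \<le> \<bar>s / (2 * scale n)\<bar>"
    using scale_pos[of n] by (simp_all add: abs_divide le_divide_eq)
qed

lemma cell_bump_outside: "1/4 \<le> \<bar>s\<bar> \<Longrightarrow> cell_bump n s = 0"
  using scaled_outside(1)[of s "nat n"] by (simp add: cell_bump_def bump_outside)

lemma deriv_bump_outside: "1 \<le> \<bar>x\<bar> \<Longrightarrow> deriv bump x = 0"
  by (rule deriv_zero_outside[OF smooth_map_bump bump_outside])

lemma deriv2_bump_outside: "1 \<le> \<bar>x\<bar> \<Longrightarrow> deriv (deriv bump) x = 0"
  by (rule deriv_zero_outside[OF smooth_map_real_deriv(2)[OF smooth_map_bump] deriv_bump_outside])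

lemma bump_has_derivative: "(bump has_real_derivative deriv bump x) (at x)"
  by (rule smooth_map_real_deriv(1)[OF smooth_map_bump])

lemma deriv_bump_has_derivative: "(deriv bump has_real_derivative deriv (deriv bump) x) (at x)"
  by (rule smooth_map_real_deriv(1)[OF smooth_map_real_deriv(2)[OF smooth_map_bump]])

lemma smooth_map_profile: "smooth_map profile"
  unfolding profile_def
proof (rule glue_smooth[OF cell_bump_outside])
  fix n
  have "bounded_linear (\<lambda>s::real. s / scale (nat n))" by (rule bounded_linear_divide)
  from smooth_map_linear[OF bounded_linear_mult_right smooth_map_affine[OF this smooth_map_bump, of 0]]
  have "smooth_map (\<lambda>s. scale (nat n) * bump (0 + s / scale (nat n)))" .
  then show "smooth_map (cell_bump n)" by (simp add: cell_bump_def[abs_def])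
qed

lemma deriv_profile: "deriv profile x = glue (\<lambda>n s. deriv bump (s / scale (nat n))) x"
proof (rule DERIV_imp_deriv, unfold profile_def, rule glue_has_derivative[OF cell_bump_outside])
  fix n s
  have "((\<lambda>s. bump (s / scale (nat n))) has_real_derivative deriv bump (s / scale (nat n)) * (1 / scale (nat n))) (at s)"
    using scale_pos[of "nat n"] by (intro DERIV_chain2[OF bump_has_derivative]) (auto intro!: derivative_eq_intros)
  from DERIV_cmult[OF this, of "scale (nat n)"]
  show "(cell_bump n has_real_derivative deriv bump (s / scale (nat n))) (at s)"
    unfolding cell_bump_def[abs_def] using scale_pos[of "nat n"] by simp
qed

lemma profile_cell:
  assumes "\<bar>x - real n\<bar> < 1/2"
  shows "profile x = scale n * bump ((x - real n) / scale n)" "deriv profile x = deriv bump ((x - real n) / scale n)"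
proof -
  have "round x = int n" using assms by (intro round_unique') simp
  then show "profile x = scale n * bump ((x - real n) / scale n)" "deriv profile x = deriv bump ((x - real n) / scale n)"
    unfolding deriv_profile by (simp_all add: profile_def glue_def cell_bump_def)
qed

lemma profile_nonneg: "0 \<le> profile x"
  unfolding profile_def glue_def cell_bump_def using bump_nonneg scale_pos by (simp add: less_imp_le)

text \<open>A smooth step. Stretched copies of it build the horizontal field component on fine
  bumps: their derivatives are rescaled bumps, and the total rise J does not depend on the
  stretching.\<close>

lemma bump_primitive:
  obtains \<Theta> J where "J > 0" "\<And>s. (\<Theta> has_real_derivative bump s) (at s)" "\<And>s. s \<le> -1 \<Longrightarrow> \<Theta> s = 0"
    "\<And>s. 1 \<le> s \<Longrightarrow> \<Theta> s = J" "\<And>s. 0 \<le> \<Theta> s" "\<And>s. \<Theta> s \<le> J"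
proof -
  have c: "isCont bump x" for x using bump_has_derivative DERIV_isCont by blast
  obtain F where F: "\<And>x. (F has_vector_derivative bump x) (at x)"
    using einterval_antiderivative[of "-\<infinity>" \<infinity> bump] c by auto
  then have Fd: "(F has_real_derivative bump x) (at x)" for x by (simp add: has_real_derivative_iff_has_vector_derivative)
  have mono: "F x \<le> F y" if "x \<le> y" for x y
    by (rule DERIV_nonneg_imp_nondecreasing[OF that]) (use Fd bump_nonneg in blast)
  have const: "F x = F y" if "x \<le> y" "\<And>z. x \<le> z \<Longrightarrow> z \<le> y \<Longrightarrow> bump z = 0" for x y
  proof -
    have "F y \<le> F x"
    proof (rule DERIV_nonpos_imp_nonincreasing[OF that(1)])
      fix z assume "x \<le> z" "z \<le> y"
      then show "\<exists>d. (F has_real_derivative d) (at z) \<and> d \<le> 0" using Fd[of z] that(2) by (intro exI[of _ "bump z"]) simp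
    qed
    then show ?thesis using mono[OF that(1)] by simp
  qed
  have lt: "F (-1) < F 1"
  proof (rule DERIV_pos_imp_increasing_open[of "-1" 1 F])
    show "\<exists>y. (F has_real_derivative y) (at x) \<and> 0 < y" if "-1 < x" "x < 1" for x
      using Fd[of x] bump_pos[of x] that by (intro exI[of _ "bump x"]) (simp add: abs_less_iff)
    show "continuous_on {-1..1} F" using Fd DERIV_isCont by (intro continuous_at_imp_continuous_on) blast
  qed simp
  have left: "F s = F (-1)" if "s \<le> -1" for s by (rule const[OF that]) (simp add: bump_outside)
  have right: "F s = F 1" if "1 \<le> s" for s by (rule const[OF that, symmetric]) (simp add: bump_outside)
  show thesis
  proof (rule that[of "F 1 - F (-1)" "\<lambda>s. F s - F (-1)"])
    show "((\<lambda>s. F s - F (-1)) has_real_derivative bump s) (at s)" for s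
      using DERIV_diff[OF Fd[of s] DERIV_const[of "F (-1)"]] by simp
    show "0 \<le> F s - F (-1)" for s
    proof (cases "s \<le> -1")
      case False
      then have "F (-1) \<le> F s" by (intro mono) linarith
      then show ?thesis by linarith
    next
      case True
      have "F s = F (-1)" by (rule left[OF True])
      then show ?thesis by linarith
    qed
    show "F s - F (-1) \<le> F 1 - F (-1)" for s
    proof (cases "1 \<le> s")
      case False
      then have "F s \<le> F 1" by (intro mono) linarith
      then show ?thesis by linarith
    next
      case True
      have "F s = F 1" by (rule right[OF True])
      then show ?thesis by linarith
    qed
    show "F s - F (-1) = 0" if "s \<le> -1" for s using left[OF that] by linarith
    show "F s - F (-1) = F 1 - F (-1)" if "1 \<le> s" for s using right[OF that] by linarith
    show "0 < F 1 - F (-1)" using lt by linarith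
  qed
qed

text \<open>The range 1/2 is where arguments land after a division by at least 2:
  \<open>s / (2 * e)\<close> on a bump of scale e, and \<open>X / L\<close> in the trial
  function.\<close>

lemma bump_lower:
  obtains \<beta> where "0 < \<beta>" "\<beta> \<le> 1" "\<And>s. \<bar>s\<bar> \<le> 1/2 \<Longrightarrow> \<beta> \<le> bump s"
proof -
  have "compact {-1/2..1/2::real}" "{-1/2..1/2::real} \<noteq> {}" "continuous_on {-1/2..1/2} bump"
    by (simp_all add: smooth_map_continuous[OF smooth_map_bump])
  then obtain x where x: "x \<in> {-1/2..1/2}" "\<And>y. y \<in> {-1/2..1/2} \<Longrightarrow> bump x \<le> bump y"
    using continuous_attains_inf by metis
  show thesis
  proof (rule that[of "bump x"])
    show "bump x \<le> bump s" if "\<bar>s\<bar> \<le> 1/2" for s using that by (intro x(2)) (auto simp: abs_le_iff)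
  qed (use x(1) in \<open>auto intro!: bump_pos bump_le_1\<close>)
qed

section \<open>Vector fields for the lower bound\<close>

locale bumpy =
  fixes m C :: real
  assumes deriv_bump_le: "\<And>x. \<bar>deriv bump x\<bar> \<le> m" and deriv2_bump_le: "\<And>x. \<bar>deriv (deriv bump) x\<bar> \<le> C"
begin

sublocale epigraph profile m
proof
  show "smooth_map profile" by (rule smooth_map_profile)
  show "\<bar>deriv profile x\<bar> \<le> m" for x unfolding deriv_profile glue_def by (rule deriv_bump_le)
qed

text \<open>On the coarse bumps the vector field is \<open>a\<close> times the unit normal, with divergence \<open>a\<close> times
  the curvature. On the fine bumps its horizontal component falls steeply across the bump and
  recovers slowly over the whole cell; the steep fall absorbs the effect of the larger slope.\<close>

lemma admissible_two_scales:
  assumes \<Theta>: "J > 0" "\<And>s. (\<Theta> has_real_derivative bump s) (at s)" "\<And>s. s \<le> -1 \<Longrightarrow> \<Theta> s = 0"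
      "\<And>s. 1 \<le> s \<Longrightarrow> \<Theta> s = J" "\<And>s. 0 \<le> \<Theta> s" "\<And>s. \<Theta> s \<le> J"
    and \<beta>: "0 < \<beta>" "\<And>s. \<bar>s\<bar> \<le> 1/2 \<Longrightarrow> \<beta> \<le> bump s"
    and a: "a > 0" and d: "d > 0"
    and fine: "\<And>n. n > N \<Longrightarrow> scale n * a * (2 * (sqrt (1 + m\<^sup>2) + d * J * m)\<^sup>2) \<le> d * \<beta>"
  shows "admissible a (a\<^sup>2 * (1 + d\<^sup>2 * J\<^sup>2) + 4 * a * d + a * C / scale N)"
proof -
  let ?e = "\<lambda>n. scale (nat n)"
  \<comment> \<open>The first step rises slowly over the cell, the subtracted one steeply around the
    bump. Both are 0 far to the left and J far to the right, so S vanishes near the ends of the cell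
    and can be glued.\<close>
  define S where "S n s = \<Theta> (4 * s) - \<Theta> (s / (2 * ?e n))" for n s
  define S' where "S' n s = 4 * bump (4 * s) - bump (s / (2 * ?e n)) / (2 * ?e n)" for n s
  define z where "z n s = deriv bump (s / ?e n)" for n s
  define z' where "z' n s = deriv (deriv bump) (s / ?e n) / ?e n" for n s
  \<comment> \<open>First branch: a h' / \<open>speed\<close>, the horizontal part of a times the
    outer unit normal, extended constantly in the vertical direction. Second branch: the step S with
    an amplitude d that is chosen small later.\<close>
  define P where "P n s = (if nat n \<le> N then a * (z n s / sqrt (1 + (z n s)\<^sup>2)) else a * d * S n s)" for n s
  define P' where "P' n s = (if nat n \<le> N then a * (z' n s / (sqrt (1 + (z n s)\<^sup>2) * (1 + (z n s)\<^sup>2))) else a * d * S' n s)" for n s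
  have C0: "0 \<le> C" using deriv2_bump_le[of 0] by linarith
  have s4: "S n s = 0" "S' n s = 0" if "1/4 \<le> \<bar>s\<bar>" for n s
  proof -
    have 1: "1 \<le> \<bar>4 * s\<bar>" using that by simp
    have 2: "1 \<le> \<bar>s / (2 * ?e n)\<bar>" by (rule scaled_outside(2)[OF that])
    show "S' n s = 0" unfolding S'_def bump_outside[OF 1] bump_outside[OF 2] by simp
    have pos: "0 < 2 * ?e n" using scale_pos[of "nat n"] by simp
    show "S n s = 0"
    proof (cases "s \<ge> 0")
      case True
      then have "1 \<le> 4 * s" "1 \<le> s / (2 * ?e n)" using 1 2 pos by (simp_all add: abs_divide)
      then show ?thesis by (simp add: S_def \<Theta>(4))
    next
      case False
      then have "4 * s \<le> -1" using 1 by simp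
      moreover have "\<bar>s / (2 * ?e n)\<bar> = - (s / (2 * ?e n))" using False pos by (simp add: abs_divide)
      then have "s / (2 * ?e n) \<le> -1" using 2 by linarith
      ultimately show ?thesis by (simp add: S_def \<Theta>(3))
    qed
  qed
  have z4: "z n s = 0" "z' n s = 0" if "1/4 \<le> \<bar>s\<bar>" for n s
  proof -
    have "1 \<le> \<bar>s / ?e n\<bar>" using scaled_outside(1)[OF that, of "nat n"] by linarith
    then show "z n s = 0" "z' n s = 0" by (simp_all only: z_def z'_def deriv_bump_outside deriv2_bump_outside div_0)
  qed
  have P0: "P n s = 0" "P' n s = 0" if "1/4 \<le> \<bar>s\<bar>" for n s
    unfolding P_def P'_def using s4[OF that] z4[OF that] by simp_all
  have zd: "(z n has_real_derivative z' n s) (at s)" for n s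
  proof -
    have "((\<lambda>s. deriv bump (s / ?e n)) has_real_derivative deriv (deriv bump) (s / ?e n) * (1 / ?e n)) (at s)"
      using scale_pos[of "nat n"] by (intro DERIV_chain2[OF deriv_bump_has_derivative]) (auto intro!: derivative_eq_intros)
    then show ?thesis by (simp add: z_def[abs_def] z'_def)
  qed
  have Sd: "(S n has_real_derivative S' n s) (at s)" for n s
  proof -
    have 1: "((\<lambda>s. \<Theta> (4 * s)) has_real_derivative bump (4 * s) * 4) (at s)"
      by (intro DERIV_chain2[OF \<Theta>(2)]) (auto intro!: derivative_eq_intros)
    have 2: "((\<lambda>s. \<Theta> (s / (2 * ?e n))) has_real_derivative bump (s / (2 * ?e n)) * (1 / (2 * ?e n))) (at s)"
      using scale_pos[of "nat n"] by (intro DERIV_chain2[OF \<Theta>(2)]) (auto intro!: derivative_eq_intros)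
    from DERIV_diff[OF 1 2] show ?thesis by (simp add: S_def[abs_def] S'_def mult.commute)
  qed
  have quot: "((\<lambda>s. z n s / sqrt (1 + (z n s)\<^sup>2)) has_real_derivative z' n s / (sqrt (1 + (z n s)\<^sup>2) * (1 + (z n s)\<^sup>2))) (at s)" for n s
  proof -
    define \<sigma> where "\<sigma> = sqrt (1 + (z n s)\<^sup>2)"
    have \<sigma>: "\<sigma> > 0" "\<sigma>\<^sup>2 = 1 + (z n s)\<^sup>2" by (simp_all add: \<sigma>_def add_pos_nonneg)
    have "((\<lambda>s. 1 + (z n s)\<^sup>2) has_real_derivative 2 * z n s * z' n s) (at s)"
      by (rule derivative_eq_intros zd refl)+ simp
    then have 1: "((\<lambda>s. sqrt (1 + (z n s)\<^sup>2)) has_real_derivative inverse \<sigma> / 2 * (2 * z n s * z' n s)) (at s)"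
      unfolding \<sigma>_def by (rule DERIV_chain2[OF DERIV_real_sqrt, rotated]) (simp add: add_pos_nonneg)
    have 2: "((\<lambda>s. z n s / sqrt (1 + (z n s)\<^sup>2)) has_real_derivative
        (z' n s * \<sigma> - z n s * (inverse \<sigma> / 2 * (2 * z n s * z' n s))) / (\<sigma> * \<sigma>)) (at s)"
      using DERIV_divide[OF zd 1] \<sigma>(1) by (simp add: \<sigma>_def)
    have "(z' n s * \<sigma> - z n s * (inverse \<sigma> / 2 * (2 * z n s * z' n s))) / (\<sigma> * \<sigma>) = z' n s * (\<sigma>\<^sup>2 - (z n s)\<^sup>2) / (\<sigma> * \<sigma>\<^sup>2)"
      using \<sigma>(1) by (simp add: field_simps power2_eq_square)
    also have "\<dots> = z' n s / (\<sigma> * (1 + (z n s)\<^sup>2))" by (simp add: \<sigma>(2))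
    finally show ?thesis using 2 by (simp add: \<sigma>_def)
  qed
  have Pd: "(P n has_real_derivative P' n s) (at s)" for n s
    unfolding P_def[abs_def] P'_def using DERIV_cmult[OF quot[of n s], of a] DERIV_cmult[OF Sd[of n s], of "a * d"]
    by (cases "nat n \<le> N") simp_all
  have bc: "continuous_on UNIV (\<lambda>s. bump (s / c))" "continuous_on UNIV (\<lambda>s. deriv bump (s / c))"
    "continuous_on UNIV (\<lambda>s. deriv (deriv bump) (s / c))" "continuous_on UNIV (\<lambda>s. bump (c * s))" if "c \<noteq> 0" for c
  proof -
    have l: "continuous_on UNIV (\<lambda>s::real. s / c)" "continuous_on UNIV (\<lambda>s::real. c * s)"
      using that by (auto intro!: continuous_intros)
    note sm = smooth_map_bump smooth_map_real_deriv(2)[OF smooth_map_bump] smooth_map_real_deriv(2)[OF smooth_map_real_deriv(2)[OF smooth_map_bump]]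
    show "continuous_on UNIV (\<lambda>s. bump (s / c))" "continuous_on UNIV (\<lambda>s. deriv bump (s / c))"
      "continuous_on UNIV (\<lambda>s. deriv (deriv bump) (s / c))" "continuous_on UNIV (\<lambda>s. bump (c * s))"
      by (rule continuous_on_compose2[OF smooth_map_continuous[OF sm(1), of UNIV] l(1)], simp,
          rule continuous_on_compose2[OF smooth_map_continuous[OF sm(2), of UNIV] l(1)], simp,
          rule continuous_on_compose2[OF smooth_map_continuous[OF sm(3), of UNIV] l(1)], simp,
          rule continuous_on_compose2[OF smooth_map_continuous[OF sm(1), of UNIV] l(2)], simp)
  qed
  have P'c: "continuous_on UNIV (P' n)" for n
  proof -
    have e: "?e n \<noteq> 0" "2 * ?e n \<noteq> 0" using scale_pos[of "nat n"] by simp_all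
    have zc: "continuous_on UNIV (z n)" "continuous_on UNIV (z' n)"
      unfolding z_def[abs_def] z'_def[abs_def] using e(1) by (simp_all add: bc continuous_on_divide)
    have ne: "sqrt (1 + (z n s)\<^sup>2) * (1 + (z n s)\<^sup>2) \<noteq> 0" for s
    proof -
      have "0 < 1 + (z n s)\<^sup>2" by (simp add: add_pos_nonneg)
      then show ?thesis by simp
    qed
    have "continuous_on UNIV (\<lambda>s. a * (z' n s / (sqrt (1 + (z n s)\<^sup>2) * (1 + (z n s)\<^sup>2))))"
      using ne by (intro continuous_on_mult continuous_on_divide continuous_on_const continuous_on_real_sqrt continuous_on_add
          continuous_on_power zc) simp
    moreover have "continuous_on UNIV (\<lambda>s. a * d * S' n s)"
      unfolding S'_def using e by (intro continuous_on_mult continuous_on_diff continuous_on_divide continuous_on_const bc) simp_all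
    ultimately show ?thesis unfolding P'_def[abs_def] by (cases "nat n \<le> N") simp_all
  qed
  \<comment> \<open>The sum dominates the requirements of both branches: \<open>K1\<close> for
    coarse cells, \<open>K2\<close> for fine ones.\<close>
  define K where "K = a\<^sup>2 * (1 + d\<^sup>2 * J\<^sup>2) + 4 * a * d + a * C / scale N"
  have K1: "a\<^sup>2 + a * C / scale N \<le> K" and K2: "a\<^sup>2 * (1 + d\<^sup>2 * J\<^sup>2) + 4 * a * d \<le> K"
    unfolding K_def using a d C0 scale_pos[of N] by (simp_all add: algebra_simps add_nonneg_nonneg)
  have cell: "P' n s + (P n s)\<^sup>2 + (a * sqrt (1 + (z n s)\<^sup>2) - P n s * z n s)\<^sup>2 \<le> K" for n s
  proof (cases "nat n \<le> N")
    case True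
    define \<sigma> where "\<sigma> = sqrt (1 + (z n s)\<^sup>2)"
    have \<sigma>: "1 \<le> \<sigma>" "\<sigma>\<^sup>2 = 1 + (z n s)\<^sup>2" by (simp_all add: \<sigma>_def add_pos_nonneg)
    have Pe: "P n s = a * (z n s / \<sigma>)" using True by (simp add: P_def \<sigma>_def)
    \<comment> \<open>The vertical part is a / \<open>speed\<close>, so the field has length exactly
      a, and only its divergence can exceed a^2.\<close>
    have q: "a * \<sigma> - P n s * z n s = a / \<sigma>"
    proof -
      have "a * \<sigma> - P n s * z n s = a * (\<sigma>\<^sup>2 - (z n s)\<^sup>2) / \<sigma>"
        using \<sigma>(1) by (simp add: Pe field_simps power2_eq_square)
      then show ?thesis by (simp add: \<sigma>(2))
    qed
    have "(P n s)\<^sup>2 + (a * \<sigma> - P n s * z n s)\<^sup>2 = a\<^sup>2 * (1 + (z n s)\<^sup>2) / \<sigma>\<^sup>2"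
      unfolding q unfolding Pe by (simp add: power_mult_distrib power_divide add_divide_distrib algebra_simps)
    also have "\<dots> = a\<^sup>2" unfolding \<sigma>(2)[symmetric] using \<sigma>(1) by simp
    finally have 1: "(P n s)\<^sup>2 + (a * \<sigma> - P n s * z n s)\<^sup>2 = a\<^sup>2" .
    have "\<bar>z' n s\<bar> \<le> C / scale N"
    proof -
      have "\<bar>z' n s\<bar> = \<bar>deriv (deriv bump) (s / ?e n)\<bar> / ?e n" using scale_pos[of "nat n"] by (simp add: z'_def abs_divide)
      also have "\<dots> \<le> C / ?e n" using scale_pos[of "nat n"] by (intro divide_right_mono deriv2_bump_le) simp
      also have "\<dots> \<le> C / scale N" using scale_mono[OF True] scale_pos C0 by (intro divide_left_mono) simp_all
      finally show ?thesis .
    qed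
    moreover have "1 \<le> \<sigma> * (1 + (z n s)\<^sup>2)" using mult_mono[of 1 \<sigma> 1 "1 + (z n s)\<^sup>2"] \<sigma>(1) by simp
    then have "z' n s / (\<sigma> * (1 + (z n s)\<^sup>2)) \<le> \<bar>z' n s\<bar> / 1" by (intro frac_le) simp_all
    ultimately have "a * (z' n s / (\<sigma> * (1 + (z n s)\<^sup>2))) \<le> a * (C / scale N)" using a by (intro mult_left_mono) simp_all
    moreover have "P' n s = a * (z' n s / (\<sigma> * (1 + (z n s)\<^sup>2)))" using True by (simp add: P'_def \<sigma>_def)
    ultimately have "P' n s \<le> a * C / scale N" by simp
    then show ?thesis using 1 K1 unfolding \<sigma>_def[symmetric] by linarith
  next
    case False
    have Pe: "P n s = a * d * S n s" "P' n s = a * d * S' n s" using False by (simp_all add: P_def P'_def)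
    have SJ: "\<bar>S n s\<bar> \<le> J" unfolding S_def using \<Theta>(5,6)[of "4 * s"] \<Theta>(5,6)[of "s / (2 * ?e n)"] by (simp add: abs_le_iff)
    have "(P n s)\<^sup>2 = a\<^sup>2 * d\<^sup>2 * \<bar>S n s\<bar>\<^sup>2" by (simp add: Pe power_mult_distrib)
    also have "\<dots> \<le> a\<^sup>2 * d\<^sup>2 * J\<^sup>2" using SJ by (intro mult_left_mono power_mono) simp_all
    finally have P2: "(P n s)\<^sup>2 \<le> a\<^sup>2 * d\<^sup>2 * J\<^sup>2" .
    have e: "?e n > 0" by (rule scale_pos)
    have S'4: "S' n s \<le> 4 - bump (s / (2 * ?e n)) / (2 * ?e n)" unfolding S'_def using bump_le_1[of "4 * s"] by simp
    have K3: "a\<^sup>2 + a\<^sup>2 * d\<^sup>2 * J\<^sup>2 + 4 * a * d \<le> K" using K2 by (simp add: algebra_simps)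
    have ad: "a * d > 0" using a d by simp
    show ?thesis
    proof (cases "\<bar>s\<bar> < ?e n")
      \<comment> \<open>On the bump the vertical part is bounded only crudely, by a Q. The steep
        fall of P contributes at most -a d \<beta> / (2 e), and this outweighs a^2 Q^2 by the
        hypothesis \<open>fine\<close>.\<close>
      case True
      have "\<bar>s / (2 * ?e n)\<bar> \<le> 1/2" using True e by (simp add: abs_divide field_simps)
      then have "\<beta> / (2 * ?e n) \<le> bump (s / (2 * ?e n)) / (2 * ?e n)" using e by (intro divide_right_mono \<beta>(2)) simp_all
      then have "S' n s \<le> 4 - \<beta> / (2 * ?e n)" using S'4 by linarith
      then have "a * d * S' n s \<le> a * d * (4 - \<beta> / (2 * ?e n))" using ad by (intro mult_left_mono) simp_all
      then have P'1: "P' n s \<le> 4 * a * d - a * (d * \<beta> / (2 * ?e n))" by (simp add: Pe algebra_simps)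
      define Q where "Q = sqrt (1 + m\<^sup>2) + d * J * m"
      have zm: "\<bar>z n s\<bar> \<le> m" unfolding z_def by (rule deriv_bump_le)
      then have "(z n s)\<^sup>2 \<le> m\<^sup>2" using abs_le_square_iff[of "z n s" m] by simp
      then have s1: "sqrt (1 + (z n s)\<^sup>2) \<le> sqrt (1 + m\<^sup>2)" by simp
      have "\<bar>P n s * z n s\<bar> \<le> (a * d * J) * m"
        unfolding abs_mult Pe using SJ zm a d by (intro mult_mono) (simp_all add: abs_mult)
      moreover have "\<bar>a * sqrt (1 + (z n s)\<^sup>2)\<bar> \<le> a * sqrt (1 + m\<^sup>2)"
        using a s1 by (simp add: abs_mult mult_left_mono)
      ultimately have "\<bar>a * sqrt (1 + (z n s)\<^sup>2) - P n s * z n s\<bar> \<le> a * Q"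
        using abs_triangle_ineq4[of "a * sqrt (1 + (z n s)\<^sup>2)" "P n s * z n s"] by (simp add: Q_def algebra_simps)
      then have "\<bar>a * sqrt (1 + (z n s)\<^sup>2) - P n s * z n s\<bar>\<^sup>2 \<le> (a * Q)\<^sup>2" by (intro power_mono) simp_all
      then have q: "(a * sqrt (1 + (z n s)\<^sup>2) - P n s * z n s)\<^sup>2 \<le> a * (a * Q\<^sup>2)" by (simp add: power2_eq_square algebra_simps)
      have "?e n * a * (2 * Q\<^sup>2) \<le> d * \<beta>" unfolding Q_def using False by (intro fine) simp
      then have "a * Q\<^sup>2 \<le> d * \<beta> / (2 * ?e n)" using e by (simp add: field_simps)
      then have "a * (a * Q\<^sup>2) \<le> a * (d * \<beta> / (2 * ?e n))" using a by (intro mult_left_mono) simp_all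
      moreover have "0 \<le> a\<^sup>2" by simp
      ultimately show ?thesis using P'1 P2 q K3 by linarith
    next
      \<comment> \<open>Off the bump the boundary is flat: the vertical part is exactly a, and the
        slow recovery costs at most 4 a d.\<close>
      case F: False
      have "1 \<le> \<bar>s / ?e n\<bar>" using F e by (simp add: abs_divide)
      then have z0: "z n s = 0" by (simp only: z_def deriv_bump_outside)
      have "S' n s \<le> 4" using S'4 bump_nonneg[of "s / (2 * ?e n)"] e
        by (smt (verit) divide_nonneg_pos mult_pos_pos)
      then have "a * d * S' n s \<le> a * d * 4" using ad by (intro mult_left_mono) simp_all
      then have "P' n s \<le> 4 * a * d" by (simp add: Pe)
      then show ?thesis using P2 K3 by (simp add: z0)
    qed
  qed
  show ?thesis
    unfolding admissible_def K_def[symmetric]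
  proof (intro exI conjI allI)
    show "(glue P has_real_derivative glue P' x) (at x)" for x by (rule glue_has_derivative[OF P0(1) Pd])
    show "continuous_on UNIV (glue P')" by (rule glue_continuous[OF P0(2) P'c])
    show "glue P' x + (glue P x)\<^sup>2 + (a * speed x - glue P x * deriv profile x)\<^sup>2 \<le> K" for x
    proof -
      have "deriv profile x = z (round x) (x - of_int (round x))" by (simp add: deriv_profile glue_def z_def)
      then show ?thesis using cell[of "round x" "x - of_int (round x)"] by (simp add: speed_def glue_def)
    qed
  qed
qed

end

section \<open>The upper bound from a trial function\<close>

lemma exponential_strip_bound:
  fixes G :: "real \<times> real \<Rightarrow> real"
  assumes c: "c > 0" and r: "r \<ge> 0" and B: "B \<ge> 0"
    and G: "\<And>z. G z \<le> B * indicator {x0 - r..x0 + r} (fst z) * (indicator {0..} (snd z) * exp (- c * snd z))"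
  shows "(\<integral>z. G z \<partial>lborel) \<le> B * (2 * r) / c"
proof (rule integral_real_bounded)
  show "0 \<le> B * (2 * r) / c" using assms by simp
  \<comment> \<open>The majorant is a product, so Tonelli gives B times the width 2 r times 1 / c,
    the integral of the exponential over the half-line.\<close>
  define u where "u x = ennreal (B * indicator {x0 - r..x0 + r} x)" for x
  define v where "v y = ennreal (exp (- c * y)) * indicator {0..} y" for y
  have um [measurable]: "u \<in> borel_measurable borel" unfolding u_def[abs_def] by measurable
  have vm [measurable]: "v \<in> borel_measurable borel" unfolding v_def[abs_def] by measurable
  have v: "(\<integral>\<^sup>+y. v y \<partial>lborel) = ennreal (1 / c)"
  proof -
    have "((\<lambda>y. - exp (- c * y) / c) \<longlongrightarrow> - 0 / c) at_top"
    proof (intro tendsto_divide tendsto_minus tendsto_const)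
      have "filterlim (\<lambda>y. - c * y) at_bot at_top"
        using c by (intro filterlim_tendsto_neg_mult_at_bot[OF tendsto_const _ filterlim_ident]) simp
      then show "((\<lambda>y. exp (- c * y)) \<longlongrightarrow> 0) at_top" by (rule filterlim_compose[OF exp_at_bot])
    qed (use c in simp)
    then have l: "((\<lambda>y. - exp (- c * y) / c) \<longlongrightarrow> 0) at_top" by simp
    have d: "((\<lambda>y. - exp (- c * y) / c) has_real_derivative exp (- c * y)) (at y)" for y
      using c by (auto intro!: derivative_eq_intros)
    show ?thesis
      unfolding v_def using nn_integral_FTC_atLeast[OF _ d _ l, of 0] c by simp
  qed
  have u: "(\<integral>\<^sup>+x. u x \<partial>lborel) = ennreal (B * (2 * r))"
  proof -
    have "(\<integral>\<^sup>+x. u x \<partial>lborel) = (\<integral>\<^sup>+x. ennreal B * indicator {x0 - r..x0 + r} x \<partial>lborel)"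
      by (intro nn_integral_cong) (simp add: u_def indicator_def)
    also have "\<dots> = ennreal B * emeasure lborel {x0 - r..x0 + r}" by (rule nn_integral_cmult_indicator) simp
    also have "\<dots> = ennreal (B * (2 * r))" using r B by (simp add: ennreal_mult)
    finally show ?thesis .
  qed
  have m: "(\<lambda>z. u (fst z) * v (snd z)) \<in> borel_measurable (lborel \<Otimes>\<^sub>M lborel)" by measurable
  have "(\<integral>\<^sup>+z. ennreal (G z) \<partial>lborel) \<le> (\<integral>\<^sup>+z. u (fst z) * v (snd z) \<partial>lborel)"
  proof (rule nn_integral_mono)
    fix z
    have "ennreal (G z) \<le> ennreal (B * indicator {x0 - r..x0 + r} (fst z) * (indicator {0..} (snd z) * exp (- c * snd z)))"
      by (rule ennreal_leI[OF G])
    also have "\<dots> = u (fst z) * v (snd z)" using B by (simp add: u_def v_def indicator_def ennreal_mult)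
    finally show "ennreal (G z) \<le> u (fst z) * v (snd z)" .
  qed
  also have "\<dots> = (\<integral>\<^sup>+x. \<integral>\<^sup>+y. u x * v y \<partial>lborel \<partial>lborel)"
    using lborel.nn_integral_fst[OF m] by (simp add: lborel_prod)
  also have "\<dots> = (\<integral>\<^sup>+x. u x * ennreal (1 / c) \<partial>lborel)"
    by (intro nn_integral_cong) (simp add: nn_integral_cmult v)
  also have "\<dots> = ennreal (B * (2 * r)) * ennreal (1 / c)" by (simp add: nn_integral_multc u)
  also have "\<dots> = ennreal (B * (2 * r) / c)" using assms by (simp add: ennreal_mult[symmetric])
  finally show "(\<integral>\<^sup>+z. ennreal (G z) \<partial>lborel) \<le> ennreal (B * (2 * r) / c)" .
qed

text \<open>A vanishing excess would force the continuous derivative of \<open>bump\<close> to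
  vanish almost everywhere, hence everywhere, although \<open>bump\<close> is not constant.\<close>

lemma bump_excess_length: "0 < (\<integral>x. indicator {-1..1} x *\<^sub>R (sqrt (1 + (deriv bump x)\<^sup>2) - 1) \<partial>lborel)"
  (is "0 < integral\<^sup>L _ ?g")
proof -
  have bc: "continuous_on S (deriv bump)" for S
    by (rule smooth_map_continuous[OF smooth_map_real_deriv(2)[OF smooth_map_bump]])
  have c: "continuous_on {-1..1} (\<lambda>x. sqrt (1 + (deriv bump x)\<^sup>2) - 1)"
    by (intro continuous_on_diff continuous_on_real_sqrt continuous_on_add continuous_on_power continuous_on_const bc)
  have i: "integrable lborel ?g" by (rule borel_integrable_compact[OF compact_Icc c])
  have nn: "0 \<le> ?g x" for x by (simp add: indicator_def)
  have "integral\<^sup>L lborel ?g \<noteq> 0"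
  proof
    assume "integral\<^sup>L lborel ?g = 0"
    then have ae: "AE x in lborel. ?g x = 0" using integral_nonneg_eq_0_iff_AE[OF i] nn by simp
    let ?U = "{x. deriv bump x \<noteq> 0}"
    have "AE x in lborel. x \<notin> ?U"
      using ae
    proof eventually_elim
      fix x assume g: "?g x = 0"
      show "x \<notin> ?U"
      proof (cases "x \<in> {-1..1}")
        case True
        then have "sqrt (1 + (deriv bump x)\<^sup>2) = 1" using g by simp
        then show ?thesis by simp
      next
        case False
        then have "1 \<le> \<bar>x\<bar>" unfolding atLeastAtMost_iff by linarith
        then show ?thesis by (simp add: deriv_bump_outside)
      qed
    qed
    moreover have o: "open ?U" by (rule open_Collect_neq[OF bc continuous_on_const])
    then have "?U \<in> sets lborel" by simp
    ultimately have "?U \<in> null_sets lborel" by (simp add: AE_iff_null_sets)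
    with o have "?U = {}" using open_not_negligible negligible_iff_null_sets null_sets_completionI by blast
    then have z: "deriv bump x = 0" for x by blast
    have "bump 0 = bump 1"
      by (rule DERIV_isconst_all[OF allI]) (use bump_has_derivative z in metis)
    then show False using bump_pos[of 0] bump_outside[of 1] by simp
  qed
  then show ?thesis using Bochner_Integration.integral_nonneg[of lborel ?g] nn by (simp add: order.strict_iff_order)
qed

context bumpy
begin

text \<open>The trial function is \<open>b((x - N)/(L e)) b(y/(L e)) exp(-y/e)\<close> for \<open>a = 1/e\<close>, concentrated at the bump of
  scale \<open>e\<close>: the energy gained from the excess length of the bump beats the cost \<open>O(1/L)\<close> of the cut-offs.\<close>

lemma upper_bound:
  obtains c N0 where "c > 0" "\<And>N. N \<ge> N0 \<Longrightarrow> robin_E V (- (1 / scale N)) \<le> - (1 + c) * (1 / scale N)\<^sup>2"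
proof -
  obtain \<beta> where \<beta>: "0 < \<beta>" "\<beta> \<le> 1" "\<And>s. \<bar>s\<bar> \<le> 1/2 \<Longrightarrow> \<beta> \<le> bump s" by (rule bump_lower) (rule that)
  define \<kappa>0 where "\<kappa>0 = (\<integral>x. indicator {-1..1} x *\<^sub>R (sqrt (1 + (deriv bump x)\<^sup>2) - 1) \<partial>lborel)"
  \<comment> \<open>Lower bound for the squared trial function on the bump: the horizontal cut-off
    is at least \<beta>, and as the bump is at most e high, the vertical factor is at least exp(-1)
    \<beta>.\<close>
  define \<gamma> where "\<gamma> = \<beta>\<^sup>2 * (exp (-1) * \<beta>)\<^sup>2"
  define \<kappa> where "\<kappa> = \<gamma> * \<kappa>0"
  have \<gamma>: "\<gamma> > 0" using \<beta>(1) by (simp add: \<gamma>_def)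
  have \<kappa>: "\<kappa> > 0" unfolding \<kappa>_def \<kappa>0_def by (rule mult_pos_pos[OF \<gamma> bump_excess_length])
  \<comment> \<open>Long enough for the cut-off cost 2 m^2 / L to eat at most half of the gain
    \<kappa>; at least 2 so that both cut-offs stay above \<beta> on the bump.\<close>
  define L where "L = max 2 (4 * m\<^sup>2 / \<kappa>)"
  have L2: "L \<ge> 2" and L4: "4 * m\<^sup>2 / \<kappa> \<le> L" by (simp_all add: L_def)
  have Lm: "2 * m\<^sup>2 / L \<le> \<kappa> / 2"
    using L4 L2 \<kappa> by (simp add: field_simps)
  \<comment> \<open>The squared L^2 norm of the trial function is at most L / a^2, so a net gain of
    \<kappa> / 2 lowers the Rayleigh quotient by at least c a^2.\<close>
  define c where "c = \<kappa> / (2 * L)"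
  have c: "c > 0" "c * L = \<kappa> / 2" using \<kappa> L2 by (simp_all add: c_def)
  obtain N0 :: nat where N0: "4 * L \<le> real N0" using real_arch_simple by blast
  have "robin_E V (- (1 / scale N)) \<le> - (1 + c) * (1 / scale N)\<^sup>2" if N: "N \<ge> N0" for N
  proof -
    define e where "e = scale N"
    define a where "a = 1 / e"
    have e: "e > 0" "e \<le> 1/8" unfolding e_def by (rule scale_pos, rule scale_le)
    have Le: "L * e \<le> 1/4"
    proof -
      have "4 * L \<le> real (Suc N)" using N0 N by linarith
      then have "(4 * L) * e \<le> real (Suc N) * (1 / real (Suc N))"
        unfolding e_def using scale_le_inverse[of N] scale_pos[of N] by (intro mult_mono) simp_all
      then show ?thesis by simp
    qed
    have Lpos: "L * e > 0" using L2 e(1) by simp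
    have a: "a > 0" using e by (simp add: a_def)
    define \<xi> where "\<xi> x = bump (- (real N / (L * e)) + x / (L * e))" for x
    define f where "f y = exp (0 + - (y / e)) * bump (0 + y / (L * e))" for y
    define \<phi> where "\<phi> = (\<lambda>z. complex_of_real (\<xi> (fst z) * f (snd z)))"
    have \<xi>e: "\<xi> x = bump ((x - real N) / (L * e))" for x by (simp add: \<xi>_def diff_divide_distrib)
    have fe: "f y = exp (- (y / e)) * bump (y / (L * e))" for y by (simp add: f_def)
    have sm: "smooth_map \<xi>" "smooth_map f"
    proof -
      show "smooth_map \<xi>" unfolding \<xi>_def by (rule smooth_map_affine[OF bounded_linear_divide smooth_map_bump])
      show "smooth_map f" unfolding f_def
        by (rule smooth_map_mult[OF smooth_map_affine[OF bounded_linear_minus[OF bounded_linear_divide] smooth_map_exp]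
              smooth_map_affine[OF bounded_linear_divide smooth_map_bump]])
    qed
    have \<xi>d: "deriv \<xi> x = deriv bump ((x - real N) / (L * e)) * (1 / (L * e))" for x
    proof (rule DERIV_imp_deriv)
      show "(\<xi> has_real_derivative deriv bump ((x - real N) / (L * e)) * (1 / (L * e))) (at x)"
        unfolding \<xi>e[abs_def] using Lpos by (intro DERIV_chain2[OF bump_has_derivative]) (auto intro!: derivative_eq_intros)
    qed
    \<comment> \<open>The exponential solves f' + a f = 0, so only the derivative of the cut-off
      survives.\<close>
    have fd: "deriv f y + a * f y = exp (- (y / e)) * (deriv bump (y / (L * e)) * (1 / (L * e)))" for y
    proof -
      have 1: "((\<lambda>y. exp (- (y / e))) has_real_derivative exp (- (y / e)) * (- (1 / e))) (at y)"
        using e by (auto intro!: derivative_eq_intros)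
      have 2: "((\<lambda>y. bump (y / (L * e))) has_real_derivative deriv bump (y / (L * e)) * (1 / (L * e))) (at y)"
        using Lpos by (intro DERIV_chain2[OF bump_has_derivative]) (auto intro!: derivative_eq_intros)
      have "(f has_real_derivative exp (- (y / e)) * (- (1 / e)) * bump (y / (L * e))
          + deriv bump (y / (L * e)) * (1 / (L * e)) * exp (- (y / e))) (at y)"
        unfolding fe[abs_def] by (rule DERIV_mult[OF 1 2])
      then have "deriv f y = exp (- (y / e)) * (- (1 / e)) * bump (y / (L * e))
          + deriv bump (y / (L * e)) * (1 / (L * e)) * exp (- (y / e))" by (rule DERIV_imp_deriv)
      then show ?thesis by (simp add: fe a_def)
    qed
    have out: "1 \<le> \<bar>t / (L * e)\<bar>" if "\<bar>t\<bar> > L * e" for t using that Lpos by (simp add: abs_divide)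
    have supp: "\<xi> x = 0" "f x = 0" if x: "\<bar>x\<bar> > real N + L * e" for x
    proof -
      have "\<bar>x - real N\<bar> > L * e" "\<bar>x\<bar> > L * e" using x by linarith+
      then show "\<xi> x = 0" "f x = 0" unfolding \<xi>e fe by (simp_all only: bump_outside[OF out] mult_zero_right)
    qed
    note energy = separated_energy[OF sm supp \<phi>_def]
    have \<phi>t: "test_function UNIV \<phi>" by (rule separated_test[OF sm supp \<phi>_def])
    define B where "B = (m / (L * e))\<^sup>2"
    have B: "B \<ge> 0" by (simp add: B_def)
    have db: "(deriv bump t * (1 / (L * e)))\<^sup>2 \<le> B" for t
    proof -
      have "\<bar>deriv bump t * (1 / (L * e))\<bar> \<le> m * (1 / (L * e))"
        unfolding abs_mult using deriv_bump_le[of t] Lpos m_nonneg by (intro mult_mono) simp_all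
      then have "\<bar>deriv bump t * (1 / (L * e))\<bar>\<^sup>2 \<le> (m * (1 / (L * e)))\<^sup>2" by (intro power_mono) simp_all
      then show ?thesis unfolding power2_abs B_def by simp
    qed
    have exp2: "(exp (- (y / e)))\<^sup>2 = exp (- (2 / e) * y)" for y
      by (simp add: power2_eq_square exp_add[symmetric])
    have b1: "(bump t)\<^sup>2 \<le> 1" for t using bump_nonneg[of t] bump_le_1[of t] by (simp add: power_le_one)
    have f2: "(f y)\<^sup>2 \<le> exp (- (2 / e) * y)" for y
      unfolding fe power_mult_distrib exp2 using mult_left_mono[OF b1[of "y / (L * e)"], of "exp (- (2 / e) * y)"] by simp
    have fd2: "(deriv f y + a * f y)\<^sup>2 \<le> B * exp (- (2 / e) * y)" for y
      unfolding fd power_mult_distrib[of "exp _"] exp2 using mult_left_mono[OF db, of "exp (- (2 / e) * y)"] by (simp add: mult.commute)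
    let ?I = "\<lambda>x. indicator {real N - L * e..real N + L * e} x :: real"
    have loc: "\<xi> x = 0" "deriv \<xi> x = 0" if "x \<notin> {real N - L * e..real N + L * e}" for x
    proof -
      have "\<bar>x - real N\<bar> > L * e" using that unfolding atLeastAtMost_iff by linarith
      from out[OF this] show "\<xi> x = 0" "deriv \<xi> x = 0"
        unfolding \<xi>e \<xi>d by (simp_all only: bump_outside deriv_bump_outside mult_zero_left)
    qed
    \<comment> \<open>The bumps point upwards, so V lies in the upper half-plane and integrals over
      V are covered by the strip bound.\<close>
    have Vpos: "0 \<le> snd z" if "z \<in> V" for z
      using that profile_nonneg[of "fst z"] unfolding V_def by simp
    have G1: "indicator V z * ((deriv \<xi> (fst z))\<^sup>2 * (f (snd z))\<^sup>2 + (\<xi> (fst z))\<^sup>2 * (deriv f (snd z) + a * f (snd z))\<^sup>2)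
        \<le> (2 * B) * ?I (fst z) * (indicator {0..} (snd z) * exp (- (2 / e) * snd z))" for z
    proof (cases "z \<in> V \<and> fst z \<in> {real N - L * e..real N + L * e}")
      case True
      have "(deriv \<xi> (fst z))\<^sup>2 * (f (snd z))\<^sup>2 \<le> B * exp (- (2 / e) * snd z)"
        unfolding \<xi>d using db f2 B by (intro mult_mono) simp_all
      moreover have "(\<xi> (fst z))\<^sup>2 * (deriv f (snd z) + a * f (snd z))\<^sup>2 \<le> 1 * (B * exp (- (2 / e) * snd z))"
        unfolding \<xi>e using b1 fd2 by (intro mult_mono) simp_all
      ultimately show ?thesis using True Vpos[of z] by simp
    next
      case False
      then have "indicator V z * ((deriv \<xi> (fst z))\<^sup>2 * (f (snd z))\<^sup>2 + (\<xi> (fst z))\<^sup>2 * (deriv f (snd z) + a * f (snd z))\<^sup>2) = 0"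
        using loc[of "fst z"] by (cases "z \<in> V") simp_all
      moreover have "0 \<le> (2 * B) * ?I (fst z) * (indicator {0..} (snd z) * exp (- (2 / e) * snd z))" using B by simp
      ultimately show ?thesis by linarith
    qed
    have "2 / e > 0" "L * e \<ge> 0" "2 * B \<ge> 0" using e Lpos B by simp_all
    from exponential_strip_bound[OF this G1]
    have T1: "(\<integral>z. indicator V z * ((deriv \<xi> (fst z))\<^sup>2 * (f (snd z))\<^sup>2 + (\<xi> (fst z))\<^sup>2 * (deriv f (snd z) + a * f (snd z))\<^sup>2) \<partial>lborel) \<le> 2 * m\<^sup>2 / L"
    proof (rule order_trans)
      \<comment> \<open>Width 2 L e, effective height e / 2 and integrand at most 2 m^2 / (L e)^2:
        the scale e cancels.\<close>
      show "2 * B * (2 * (L * e)) / (2 / e) \<le> 2 * m\<^sup>2 / L"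
        using e L2 by (simp add: B_def power_divide power_mult_distrib field_simps power2_eq_square)
    qed
    have G2: "indicator V z * ((\<xi> (fst z))\<^sup>2 * (f (snd z))\<^sup>2)
        \<le> 1 * ?I (fst z) * (indicator {0..} (snd z) * exp (- (2 / e) * snd z))" for z
    proof (cases "z \<in> V \<and> fst z \<in> {real N - L * e..real N + L * e}")
      case True
      have "(\<xi> (fst z))\<^sup>2 * (f (snd z))\<^sup>2 \<le> 1 * exp (- (2 / e) * snd z)"
        unfolding \<xi>e using b1 f2 by (intro mult_mono) simp_all
      then show ?thesis using True Vpos[of z] by simp
    next
      case False
      then have "indicator V z * ((\<xi> (fst z))\<^sup>2 * (f (snd z))\<^sup>2) = 0"
        using loc[of "fst z"] by (cases "z \<in> V") simp_all
      moreover have "0 \<le> 1 * ?I (fst z) * (indicator {0..} (snd z) * exp (- (2 / e) * snd z))" by simp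
      ultimately show ?thesis by linarith
    qed
    define l where "l = (l2_norm (leb V) \<phi>)\<^sup>2"
    have "2 / e > 0" "L * e \<ge> 0" "(1::real) \<ge> 0" using e Lpos by simp_all
    note strip = exponential_strip_bound[OF this G2]
    have "l = (\<integral>z. indicator V z * ((\<xi> (fst z))\<^sup>2 * (f (snd z))\<^sup>2) \<partial>lborel)"
      unfolding l_def by (rule separated_l2[OF sm supp \<phi>_def])
    then have "l \<le> L * e\<^sup>2" using strip by (simp add: power2_eq_square)
    then have al: "a\<^sup>2 * l \<le> L"
      using e by (simp add: a_def power_divide divide_le_eq mult.commute)
    have bd: "e * \<kappa> \<le> (\<integral>x. (speed x - 1) * ((\<xi> x)\<^sup>2 * (f (profile x))\<^sup>2) \<partial>lborel)"
    proof -
      \<comment> \<open>The excess length in the rescaled variable X = (x - N) / e. Away from this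
        bump the excess is estimated below by 0, so other bumps inside the support cause no
        loss.\<close>
      define g where "g X = \<gamma> * (indicator {-1..1} X *\<^sub>R (sqrt (1 + (deriv bump X)\<^sup>2) - 1))" for X
      have bc: "continuous_on {-1..1} (\<lambda>x. sqrt (1 + (deriv bump x)\<^sup>2) - 1)"
        by (intro continuous_on_diff continuous_on_real_sqrt continuous_on_add continuous_on_power continuous_on_const
            smooth_map_continuous[OF smooth_map_real_deriv(2)[OF smooth_map_bump]])
      have gi: "integrable lborel g" unfolding g_def[abs_def]
        by (intro integrable_mult_right borel_integrable_compact[OF compact_Icc bc])
      have gint: "(\<integral>X. g X \<partial>lborel) = \<kappa>" unfolding g_def \<kappa>_def \<kappa>0_def by (rule integral_mult_right_zero)
      have e0: "1 / e \<noteq> 0" using e by simp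
      have gs: "(\<integral>x. g (- (real N / e) + 1 / e * x) \<partial>lborel) = e * \<kappa>"
        using lborel_integral_real_affine[OF e0, of g "- (real N / e)"] gint e by (simp add: field_simps)
      have gsi: "integrable lborel (\<lambda>x. g (- (real N / e) + 1 / e * x))"
        by (rule lborel_integrable_real_affine[OF gi e0])
      have "(\<integral>x. g (- (real N / e) + 1 / e * x) \<partial>lborel) \<le> (\<integral>x. (speed x - 1) * ((\<xi> x)\<^sup>2 * (f (profile x))\<^sup>2) \<partial>lborel)"
      proof (rule integral_mono[OF gsi energy(3)])
        fix x
        define X where "X = (x - real N) / e"
        have Xe: "- (real N / e) + 1 / e * x = X" by (simp add: X_def diff_divide_distrib)
        have s1: "0 \<le> speed x - 1" using speed_ge_1[of x] by simp
        show "g (- (real N / e) + 1 / e * x) \<le> (speed x - 1) * ((\<xi> x)\<^sup>2 * (f (profile x))\<^sup>2)"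
        proof (cases "X \<in> {-1..1}")
          case True
          have X1: "\<bar>X\<bar> \<le> 1" using True by (simp add: abs_le_iff)
          then have "\<bar>x - real N\<bar> \<le> e" using e by (simp add: X_def abs_divide)
          then have cell: "\<bar>x - real N\<bar> < 1/2" using e by linarith
          have h: "profile x = e * bump X" and h': "deriv profile x = deriv bump X"
            using profile_cell[OF cell] by (simp_all add: X_def e_def)
          have sp: "speed x - 1 = sqrt (1 + (deriv bump X)\<^sup>2) - 1" by (simp add: speed_def h')
          have "\<xi> x = bump (X / L)" by (simp add: \<xi>e X_def mult.commute)
          moreover have "\<bar>X / L\<bar> \<le> 1/2" using X1 L2 by (simp add: abs_divide divide_le_eq)
          ultimately have 1: "\<beta> \<le> \<xi> x" using \<beta>(3) by simp
          have "f (profile x) = exp (- bump X) * bump (bump X / L)" using e by (simp add: fe h)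
          moreover have "\<beta> \<le> bump (bump X / L)"
            using bump_nonneg[of X] bump_le_1[of X] L2 by (intro \<beta>(3)) (simp add: abs_divide divide_le_eq)
          moreover have "exp (-1) \<le> exp (- bump X)" using bump_le_1[of X] by simp
          ultimately have 2: "exp (-1) * \<beta> \<le> f (profile x)" using \<beta>(1) by (simp add: mult_mono)
          have "\<gamma> \<le> (\<xi> x)\<^sup>2 * (f (profile x))\<^sup>2"
            unfolding \<gamma>_def using 1 2 \<beta>(1) by (intro mult_mono power_mono) simp_all
          then have "(speed x - 1) * \<gamma> \<le> (speed x - 1) * ((\<xi> x)\<^sup>2 * (f (profile x))\<^sup>2)" using s1 by (rule mult_left_mono)
          then show ?thesis unfolding Xe g_def using True by (simp add: sp mult.commute)
        next
          case False
          then have "g X = 0" by (simp add: g_def)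
          then show ?thesis unfolding Xe using s1 by simp
        qed
      qed
      then show ?thesis unfolding gs .
    qed
    define T where "T = Re (grad_form \<phi> \<phi>) - a * (l2_norm bdry \<phi>)\<^sup>2 + a\<^sup>2 * l"
    have "T = (\<integral>z. indicator V z * ((deriv \<xi> (fst z))\<^sup>2 * (f (snd z))\<^sup>2 + (\<xi> (fst z))\<^sup>2 * (deriv f (snd z) + a * f (snd z))\<^sup>2) \<partial>lborel)
        - a * (\<integral>x. (speed x - 1) * ((\<xi> x)\<^sup>2 * (f (profile x))\<^sup>2) \<partial>lborel)"
      unfolding T_def l_def by (rule energy(1))
    then have "T \<le> 2 * m\<^sup>2 / L - a * (e * \<kappa>)"
      using T1 mult_left_mono[OF bd, of a] a by linarith
    also have "a * (e * \<kappa>) = \<kappa>" using e by (simp add: a_def)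
    finally have T: "T \<le> - (\<kappa> / 2)" using Lm by linarith
    \<comment> \<open>A trial function of norm zero would have T >= 0 by the crude vector field
      bound, against T < 0. This spares a direct computation of the norm.\<close>
    have lpos: "l2_norm (leb V) \<phi> > 0"
    proof (rule ccontr)
      assume "\<not> ?thesis"
      then have z: "l2_norm (leb V) \<phi> = 0" using l2_norm_nonneg[of "leb V" \<phi>] by linarith
      have "a * (l2_norm bdry \<phi>)\<^sup>2 \<le> Re (grad_form \<phi> \<phi>)"
        using test_admissible[OF \<phi>t admissible_crude[of a]] z by simp
      then have "0 \<le> T" by (simp add: T_def l_def z)
      then show False using T \<kappa> by linarith
    qed
    have "c * (a\<^sup>2 * l) \<le> c * L" using al c(1) by (intro mult_left_mono) simp_all
    then have "T \<le> - (c * (a\<^sup>2 * l))" using T c(2) by linarith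
    then have "Re (grad_form \<phi> \<phi>) + (- a) * (l2_norm bdry \<phi>)\<^sup>2 \<le> (- (1 + c) * a\<^sup>2) * l"
      by (simp add: T_def algebra_simps)
    then have "robin_E V (- a) \<le> - (1 + c) * a\<^sup>2" unfolding l_def by (rule robin_E_upper[OF \<phi>t lpos])
    then show ?thesis by (simp only: a_def e_def)
  qed
  then show thesis using that c(1) by blast
qed

text \<open>Divided by a^2, the bound of \<open>admissible_two_scales\<close> is 1 + d^2 J^2 + 4 d /
  a + C / (a \<open>scale N\<close>), where a \<open>scale N\<close> = N + 1 and a >= N + 1. The
  finer bumps satisfy a \<open>scale n\<close> <= 1 / (N + 1).\<close>

lemma lower_bound:
  assumes \<eta>: "\<eta> > 0"
  obtains N0 where "\<And>N. N \<ge> N0 \<Longrightarrow> - (1 + \<eta>) * (real (Suc N) / scale N)\<^sup>2 \<le> robin_E V (- (real (Suc N) / scale N))"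
proof -
  obtain \<Theta> J where \<Theta>: "J > 0" "\<And>s. (\<Theta> has_real_derivative bump s) (at s)" "\<And>s. s \<le> -1 \<Longrightarrow> \<Theta> s = 0"
    "\<And>s. 1 \<le> s \<Longrightarrow> \<Theta> s = J" "\<And>s. 0 \<le> \<Theta> s" "\<And>s. \<Theta> s \<le> J" by (rule bump_primitive) (rule that)
  obtain \<beta> where \<beta>: "0 < \<beta>" "\<beta> \<le> 1" "\<And>s. \<bar>s\<bar> \<le> 1/2 \<Longrightarrow> \<beta> \<le> bump s" by (rule bump_lower) (rule that)
  \<comment> \<open>d is fixed first and makes the quadratic term exactly \<eta> / 2; large N then
    handles the remaining terms and the condition on the fine bumps.\<close>
  define d where "d = sqrt (\<eta> / 2) / J"
  have d: "d > 0" "d\<^sup>2 * J\<^sup>2 = \<eta> / 2" using \<eta> \<Theta>(1) by (simp_all add: d_def power_divide)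
  have C0: "0 \<le> C" using deriv2_bump_le[of 0] by linarith
  define Q where "Q = 2 * (sqrt (1 + m\<^sup>2) + d * J * m)\<^sup>2"
  have Q: "0 \<le> Q" by (simp add: Q_def)
  obtain N1 :: nat where N1: "(4 * d + C) / (\<eta> / 2) \<le> real N1" using real_arch_simple by blast
  obtain N2 :: nat where N2: "Q / (d * \<beta>) \<le> real N2" using real_arch_simple by blast
  have "- (1 + \<eta>) * (real (Suc N) / scale N)\<^sup>2 \<le> robin_E V (- (real (Suc N) / scale N))" if N: "N \<ge> max N1 N2" for N
  proof -
    define a where "a = real (Suc N) / scale N"
    have a: "a > 0" using scale_pos[of N] by (simp add: a_def)
    have as: "a * scale N = real (Suc N)" using scale_pos[of N] by (simp add: a_def)
    have aN: "real (Suc N) \<le> a"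
    proof -
      have "a * scale N \<le> a * 1" using a scale_le[of N] by (intro mult_left_mono) linarith+
      then show ?thesis by (simp add: as)
    qed
    have fine: "scale n * a * (2 * (sqrt (1 + m\<^sup>2) + d * J * m)\<^sup>2) \<le> d * \<beta>" if n: "n > N" for n
    proof -
      have "scale n * a \<le> scale (Suc N) * a" using n a by (intro mult_right_mono scale_mono) simp_all
      also have "\<dots> = 1 / real (Suc N)" using scale_pos[of N] by (simp add: scale_Suc a_def power2_eq_square)
      finally have 1: "scale n * a \<le> 1 / real (Suc N)" .
      have "Q \<le> real N2 * (d * \<beta>)" using N2 d(1) \<beta>(1) by (simp add: pos_divide_le_eq)
      also have "\<dots> \<le> real (Suc N) * (d * \<beta>)" using N d(1) \<beta>(1) by (intro mult_right_mono) simp_all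
      finally have 2: "1 / real (Suc N) * Q \<le> d * \<beta>" by (simp add: pos_divide_le_eq mult.commute)
      have "scale n * a * Q \<le> 1 / real (Suc N) * Q" using 1 Q by (rule mult_right_mono)
      then show ?thesis using 2 unfolding Q_def by linarith
    qed
    define K where "K = a\<^sup>2 * (1 + d\<^sup>2 * J\<^sup>2) + 4 * a * d + a * C / scale N"
    have "admissible (- (- a)) K"
      unfolding K_def minus_minus by (rule admissible_two_scales[OF \<Theta> \<beta>(1,3) a d(1) fine])
    then have E: "- K \<le> robin_E V (- a)" by (rule robin_E_lower)
    have "a * C / scale N = a\<^sup>2 * (C / real (Suc N))"
      using as a scale_pos[of N] by (simp add: a_def power2_eq_square)
    moreover have "4 * a * d \<le> a\<^sup>2 * (4 * d / real (Suc N))"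
    proof -
      have "a * (4 * d) * real (Suc N) \<le> a * (4 * d) * a" using a d(1) aN by (intro mult_left_mono) simp_all
      then show ?thesis by (simp add: power2_eq_square pos_le_divide_eq ac_simps)
    qed
    ultimately have "K \<le> a\<^sup>2 * (1 + \<eta> / 2 + (4 * d + C) / real (Suc N))"
      unfolding K_def d(2) by (simp add: algebra_simps add_divide_distrib)
    also have "\<dots> \<le> a\<^sup>2 * (1 + \<eta> / 2 + \<eta> / 2)"
    proof (intro mult_left_mono add_left_mono)
      have "4 * d + C \<le> real N1 * (\<eta> / 2)" using N1 \<eta> by (simp only: pos_divide_le_eq half_gt_zero)
      also have "\<dots> \<le> real (Suc N) * (\<eta> / 2)" using N \<eta> by (intro mult_right_mono) simp_all
      finally show "(4 * d + C) / real (Suc N) \<le> \<eta> / 2" by (simp add: pos_divide_le_eq mult.commute)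
    qed simp
    finally have "K \<le> (1 + \<eta>) * a\<^sup>2" by (simp add: algebra_simps)
    then show ?thesis using E unfolding a_def by linarith
  qed
  then show thesis using that by blast
qed

text \<open>Along a = 1 / \<open>scale n\<close> the quotient is eventually at most -(1 + c), along
  a = (n + 1) / \<open>scale n\<close> at least -(1 + c / 2). Working in \<open>ereal\<close> rules
  out infinite limits as well.\<close>

theorem no_limit: "\<not> (\<exists>L::ereal. ((\<lambda>\<alpha>. ereal (robin_E V \<alpha> / \<alpha>\<^sup>2)) \<longlongrightarrow> L) at_bot)"
proof
  assume "\<exists>L::ereal. ((\<lambda>\<alpha>. ereal (robin_E V \<alpha> / \<alpha>\<^sup>2)) \<longlongrightarrow> L) at_bot"
  then obtain L where L: "((\<lambda>\<alpha>. ereal (robin_E V \<alpha> / \<alpha>\<^sup>2)) \<longlongrightarrow> L) at_bot" by blast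
  obtain c N0 where c: "c > 0" and up: "\<And>N. N \<ge> N0 \<Longrightarrow> robin_E V (- (1 / scale N)) \<le> - (1 + c) * (1 / scale N)\<^sup>2"
    by (rule upper_bound) (rule that)
  have c2: "c / 2 > 0" using c by simp
  obtain N1 where lo: "\<And>N. N \<ge> N1 \<Longrightarrow> - (1 + c / 2) * (real (Suc N) / scale N)\<^sup>2 \<le> robin_E V (- (real (Suc N) / scale N))"
    by (rule lower_bound[OF c2]) (rule that)
  have ge: "real n \<le> 1 / scale n" "real n \<le> real (Suc n) / scale n" for n
  proof -
    have "real (Suc n) * scale n \<le> 1"
      using scale_le_inverse[of n] by (simp add: pos_le_divide_eq mult.commute)
    then have 1: "real (Suc n) \<le> 1 / scale n" using scale_pos[of n] by (simp add: pos_le_divide_eq)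
    then show "real n \<le> 1 / scale n" by linarith
    have "1 / scale n \<le> real (Suc n) / scale n" using scale_pos[of n] by (intro divide_right_mono) simp_all
    then show "real n \<le> real (Suc n) / scale n" using 1 by linarith
  qed
  have bot: "filterlim (\<lambda>n. - X n) at_bot sequentially" if "\<And>n. real n \<le> X n" for X :: "nat \<Rightarrow> real"
  proof -
    have "filterlim X at_top sequentially"
      by (rule filterlim_at_top_mono[OF filterlim_real_sequentially]) (simp add: that)
    then show ?thesis by (simp add: filterlim_uminus_at_top)
  qed
  have 1: "(\<lambda>n. ereal (robin_E V (- (1 / scale n)) / (- (1 / scale n))\<^sup>2)) \<longlonglongrightarrow> L"
    by (rule filterlim_compose[OF L bot[OF ge(1)]])
  have 2: "(\<lambda>n. ereal (robin_E V (- (real (Suc n) / scale n)) / (- (real (Suc n) / scale n))\<^sup>2)) \<longlonglongrightarrow> L"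
    by (rule filterlim_compose[OF L bot[OF ge(2)]])
  have "L \<le> ereal (- (1 + c))"
  proof (rule tendsto_upperbound[OF 1])
    show "eventually (\<lambda>n. ereal (robin_E V (- (1 / scale n)) / (- (1 / scale n))\<^sup>2) \<le> ereal (- (1 + c))) sequentially"
      unfolding eventually_sequentially
    proof (intro exI allI impI)
      fix n assume "N0 \<le> n"
      have "(1 / scale n)\<^sup>2 > 0" using scale_pos[of n] by simp
      then show "ereal (robin_E V (- (1 / scale n)) / (- (1 / scale n))\<^sup>2) \<le> ereal (- (1 + c))"
        using up[OF \<open>N0 \<le> n\<close>] by (simp only: ereal_less_eq power2_minus pos_divide_le_eq)
    qed
  qed simp
  moreover have "ereal (- (1 + c / 2)) \<le> L"
  proof (rule tendsto_lowerbound[OF 2])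
    show "eventually (\<lambda>n. ereal (- (1 + c / 2)) \<le> ereal (robin_E V (- (real (Suc n) / scale n)) / (- (real (Suc n) / scale n))\<^sup>2)) sequentially"
      unfolding eventually_sequentially
    proof (intro exI allI impI)
      fix n assume "N1 \<le> n"
      have "(real (Suc n) / scale n)\<^sup>2 > 0" using scale_pos[of n] by simp
      then show "ereal (- (1 + c / 2)) \<le> ereal (robin_E V (- (real (Suc n) / scale n)) / (- (real (Suc n) / scale n))\<^sup>2)"
        using lo[OF \<open>N1 \<le> n\<close>] by (simp only: ereal_less_eq power2_minus pos_le_divide_eq)
    qed
  qed simp
  ultimately have "ereal (- (1 + c / 2)) \<le> ereal (- (1 + c))" by (rule order_trans[rotated])
  then show False using c by simp
qed

end

theorem mainTheorem2:
  shows "\<exists>V :: (real \<times> real) set.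
    open V \<and> connected V \<and> V \<noteq> {} \<and> \<not> bounded V \<and>
    smooth_boundary V \<and> \<not> compact (frontier V) \<and>
    robin_form_well_defined V \<and>
    (\<forall>\<alpha>::real. closed_form (leb V) (H1 V) (robin_form V \<alpha>) \<and>
               lower_semibounded_form (leb V) (H1 V) (robin_form V \<alpha>)) \<and>
    \<not> (\<exists>L::ereal. ((\<lambda>\<alpha>. ereal (robin_E V \<alpha> / \<alpha>\<^sup>2)) \<longlongrightarrow> L) at_bot)"
proof -
  obtain m where m: "\<And>x. \<bar>deriv bump x\<bar> \<le> m"
    by (rule continuous_bounded_outside[OF smooth_map_continuous[OF smooth_map_real_deriv(2)[OF smooth_map_bump]]])
      (rule deriv_bump_outside, assumption, rule that)
  obtain C where C: "\<And>x. \<bar>deriv (deriv bump) x\<bar> \<le> C"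
    by (rule continuous_bounded_outside[OF smooth_map_continuous[OF smooth_map_real_deriv(2)[OF smooth_map_real_deriv(2)[OF smooth_map_bump]]]])
      (rule deriv2_bump_outside, assumption, rule that)
  interpret bumpy m C by unfold_locales (rule m, rule C)
  show ?thesis
    by (rule exI[of _ V])
       (intro conjI allI open_V connected_V unbounded_V smooth_boundary_V robin_well_defined robin_closed robin_semibounded no_limit)
qed

end
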